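(* Let $\mathfrak{n}$ be a nilpotent real Lie algebra, $\mathfrak{t}(\mathfrak{n})$ a maximal torus of $\mathfrak{n}$, and $\{e_1,\dots,e_n\}$ a fixed basis of $\mathfrak{n}$ with $\mathfrak{t}(\mathfrak{n})\subset\mathrm{Dg}(\mathfrak{n})$. Let $\mathcal{C}(\mathfrak{n})\subset\mathfrak{t}(\mathfrak{n})$, $\mathfrak{t}(\mathfrak{n})_{srn}$, $\mathfrak{t}(\mathfrak{n})_{gen}$ and $W_{ort}(\mathfrak{n})$ be as defined in the context. Then: (1) $\mathcal{C}(\mathfrak{n})$ is an open and convex cone in $\mathfrak{t}(\mathfrak{n})$ such that $$\mathfrak{t}(\mathfrak{n})_{srn}\cap\mathfrak{t}(\mathfrak{n})_{gen}\subset\mathcal{C}(\mathfrak{n})\subset\mathfrak{t}(\mathfrak{n})_{srn}.$$ (2) Moreover, $W_{ort}(\mathfrak{n})$ acts on $\mathcal{C}(\mathfrak{n})$ by conjugation, and $\mathcal{C}_t(\mathfrak{n}):=\{D\in\mathcal{C}(\mathfrak{n}):\operatorname{tr}D=t\}$ is a $W_{ort}(\mathfrak{n})$-invariant convex polytope (i.e. the convex hull of finitely many points) for any $t>0$.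
   Context: All Lie algebras are real and finite-dimensional. $[\cdot,\cdot]$ denotes the Lie bracket of $\mathfrak{n}$, viewed as a vector in $V:=\Lambda^2\mathfrak{n}^*\otimes\mathfrak{n}$. Maximal torus: $\mathfrak{t}(\mathfrak{n})$ is a maximal abelian subspace of derivations of $\mathfrak{n}$ that are diagonalizable over $\mathbb{R}$. A basis $\{e_i\}$ of $\mathfrak{n}$ is fixed such that $\mathfrak{t}(\mathfrak{n})\subset\mathrm{Dg}(\mathfrak{n})$, where $\mathrm{Dg}(\mathfrak{n})$ is the space of operators of $\mathfrak{n}$ whose matrix in the basis $\{e_i\}$ is diagonal; $\mathrm{Dg}(\mathfrak{n})_{>0}$ is the subset of those with all diagonal entries positive. Cone means invariant under multiplication by positive reals. Moment map: endow $\mathfrak{n}$ with the inner product making $\{e_i\}$ orthonormal, $\mathfrak{gl}(\mathfrak{n})$ with $\langle A,B\rangle=\operatorname{tr}AB^t$, and $V$ with the inner product making $\{(e^i\wedge e^j)\otimes e_k: i<j\}$ orthonormal. $\mathrm{GL}(\mathfrak{n})$ acts on $V$ by $h\cdot\mu=h\mu(h^{-1}\cdot,h^{-1}\cdot)$ and $\mathfrak{gl}(\mathfrak{n})$ by $E\cdot\mu=E\mu(\cdot,\cdot)-\mu(E\cdot,\cdot)-\mu(\cdot,E\cdot)$. Let $\mathrm{sym}(\mathfrak{n})$ be the space of symmetric operators. The moment map $m:V\setminus\{0\}\to\mathrm{sym}(\mathfrak{n})$ is defined by $\langle m(\mu),E\rangle=\frac{1}{|\mu|^2}\langle E\cdot\mu,\mu\rangle$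 for all $E\in\mathrm{sym}(\mathfrak{n})$. For $X\subset V$, $m(X)$ means $m(X\setminus\{0\})$. The cone: $G_{\mathfrak{t}(\mathfrak{n})}$ is the identity component of the centralizer of $\mathfrak{t}(\mathfrak{n})$ in $\mathrm{GL}(\mathfrak{n})$, and $$\mathcal{C}(\mathfrak{n}):=\Big(\mathbb{R}_{>0}\,m\big(\overline{G_{\mathfrak{t}(\mathfrak{n})}\cdot[\cdot,\cdot]}\big)\cap\mathrm{Dg}(\mathfrak{n})+\mathrm{Dg}(\mathfrak{n})_{>0}\Big)\cap\{D\in\mathfrak{t}(\mathfrak{n}):\operatorname{tr}D>0\},$$ where the closure is in the usual topology of $V$ and $A+B$ denotes the Minkowski sum (first intersect with $\mathrm{Dg}(\mathfrak{n})$, then add). Generic derivations: let $\mathfrak{n}=\mathfrak{n}_1\oplus\dots\oplus\mathfrak{n}_r$ be the decomposition into weight spaces for $\mathfrak{t}(\mathfrak{n})$, with pairwise different weights $\alpha_1,\dots,\alpha_r\in\mathfrak{t}(\mathfrak{n})^*$, i.e. $DX=\alpha_i(D)X$ for $X\in\mathfrak{n}_i$, $D\in\mathfrak{t}(\mathfrak{n})$. Then $\mathfrak{t}(\mathfrak{n})_{gen}:=\{D\in\mathfrak{t}(\mathfrak{n}):\alpha_i(D)\neq\alpha_j(D)\ \forall i\neq j\}$. Strongly Ricci negative derivations: for $D\in\mathrm{Der}(\mathfrak{n})$, let $\mathfrak{s}_D=\mathbb{R}f\oplus\mathfrak{n}$ be the semidirect product Lie algebra with $\mathrm{ad}f|_{\mathfrak{n}}=D$.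 A derivation $D$ with $\operatorname{tr}D>0$ is strongly Ricci negative if $\mathfrak{s}_D$ admits an inner product with $f\perp\mathfrak{n}$ and $D^t=D$ whose associated left-invariant metric (on the simply connected Lie group with Lie algebra $\mathfrak{s}_D$) has negative Ricci curvature. $\mathrm{Der}(\mathfrak{n})_{srn}$ is the set of all such derivations and $\mathfrak{t}(\mathfrak{n})_{srn}:=\mathrm{Der}(\mathfrak{n})_{srn}\cap\mathfrak{t}(\mathfrak{n})$. Orthogonal Weyl group: $W_{ort}(\mathfrak{n}):=N_{\mathrm{Aut}(\mathfrak{n})\cap\mathrm{O}(\mathfrak{n})}(\mathfrak{t}(\mathfrak{n}))/C_{\mathrm{Aut}(\mathfrak{n})\cap\mathrm{O}(\mathfrak{n})}(\mathfrak{t}(\mathfrak{n}))$ (normalizer modulo centralizer, for the conjugation action), where $\mathrm{O}(\mathfrak{n})$ is the orthogonal group of the inner product making $\{e_i\}$ orthonormal.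
   Formalization: The inclusion of t_srn ∩ t_gen in C(n) is stated for non-abelian n only (for abelian n, C(n) is empty and it fails); C_t(n) is shown to be the relative interior of a convex polytope, since C(n) is open and a closed polytope is impossible in general. *)

theory Defs
  imports "HOL-Analysis.Analysis" "HOL-Algebra.Group_Action"
begin

text \<open>
  The basis \<open>e\<^sub>1, \<dots>, e\<^sub>n\<close> of \<open>\<nn>\<close> is fixed once and for all, so \<open>\<nn>\<close> is
  modelled as \<open>real^'n\<close> with an arbitrary Lie bracket and with \<open>e\<^sub>i = axis i 1\<close>. Operators of \<open>\<nn>\<close>
  are identified with their matrices in this basis.
\<close>

definition lie_bracket :: "('a::real_vector \<Rightarrow> 'a \<Rightarrow> 'a) \<Rightarrow> bool" where
  "lie_bracket b \<longleftrightarrow> bilinear b \<and> (\<forall>x. b x x = 0) \<and>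
     (\<forall>x y z. b x (b y z) + b y (b z x) + b z (b x y) = 0)"

primrec lower_central :: "('a::real_vector \<Rightarrow> 'a \<Rightarrow> 'a) \<Rightarrow> nat \<Rightarrow> 'a set" where
  "lower_central b 0 = UNIV"
| "lower_central b (Suc k) = span {b x y | x y. y \<in> lower_central b k}"

definition nilpotent_bracket :: "('a::real_vector \<Rightarrow> 'a \<Rightarrow> 'a) \<Rightarrow> bool" where
  "nilpotent_bracket b \<longleftrightarrow> (\<exists>k. lower_central b k = {0})"

definition Der :: "(real^'n \<Rightarrow> real^'n \<Rightarrow> real^'n) \<Rightarrow> (real^'n^'n) set" where
  "Der b = {D. \<forall>x y. D *v b x y = b (D *v x) y + b x (D *v y)}"

definition Aut :: "(real^'n \<Rightarrow> real^'n \<Rightarrow> real^'n) \<Rightarrow> (real^'n^'n) set" where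
  "Aut b = {h. invertible h \<and> (\<forall>x y. h *v b x y = b (h *v x) (h *v y))}"


subsection \<open>Diagonal operators and maximal tori\<close>

definition Dg :: "(real^'n^'n) set" where
  "Dg = {A. \<forall>i j. i \<noteq> j \<longrightarrow> A $ i $ j = 0}"

definition Dg_pos :: "(real^'n^'n) set" where
  "Dg_pos = {A \<in> Dg. \<forall>i. A $ i $ i > 0}"

definition diagonalizable :: "real^'n^'n \<Rightarrow> bool" where
  "diagonalizable A \<longleftrightarrow> (\<exists>P :: real^'n^'n. invertible P \<and> matrix_inv P ** A ** P \<in> Dg)"

definition torus :: "(real^'n \<Rightarrow> real^'n \<Rightarrow> real^'n) \<Rightarrow> (real^'n^'n) set \<Rightarrow> bool" where
  "torus b t \<longleftrightarrow> subspace t \<and> t \<subseteq> Der b \<and> (\<forall>D\<in>t. diagonalizable D) \<and>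
     (\<forall>D\<in>t. \<forall>E\<in>t. D ** E = E ** D)"

definition maximal_torus :: "(real^'n \<Rightarrow> real^'n \<Rightarrow> real^'n) \<Rightarrow> (real^'n^'n) set \<Rightarrow> bool" where
  "maximal_torus b t \<longleftrightarrow> torus b t \<and> (\<forall>t'. torus b t' \<and> t \<subseteq> t' \<longrightarrow> t' = t)"


subsection \<open>The moment map\<close>

definition V :: "(real^'n \<Rightarrow> real^'n \<Rightarrow> real^'n) set" where
  "V = {\<mu>. bilinear \<mu> \<and> (\<forall>x. \<mu> x x = 0)}"

text \<open>
  The factor \<open>1/2\<close> accounts for summing over all ordered pairs \<open>(i, j)\<close> instead of over \<open>i < j\<close>:
  on \<open>V\<close> this is the inner product for which the \<open>(e\<^sup>i \<and> e\<^sup>j) \<otimes> e\<^sub>k\<close>, \<open>i < j\<close>, are orthonormal.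
\<close>
definition inner_V ::
  "(real^'n \<Rightarrow> real^'n \<Rightarrow> real^'n) \<Rightarrow> (real^'n \<Rightarrow> real^'n \<Rightarrow> real^'n) \<Rightarrow> real" where
  "inner_V \<mu> \<nu> = (\<Sum>i\<in>UNIV. \<Sum>j\<in>UNIV. \<Sum>k\<in>UNIV.
     \<mu> (axis i 1) (axis j 1) $ k * \<nu> (axis i 1) (axis j 1) $ k) / 2"

definition GL_act ::
  "real^'n^'n \<Rightarrow> (real^'n \<Rightarrow> real^'n \<Rightarrow> real^'n) \<Rightarrow> real^'n \<Rightarrow> real^'n \<Rightarrow> real^'n" where
  "GL_act h \<mu> = (\<lambda>x y. h *v \<mu> (matrix_inv h *v x) (matrix_inv h *v y))"

definition gl_act ::
  "real^'n^'n \<Rightarrow> (real^'n \<Rightarrow> real^'n \<Rightarrow> real^'n) \<Rightarrow> real^'n \<Rightarrow> real^'n \<Rightarrow> real^'n" where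
  "gl_act E \<mu> = (\<lambda>x y. E *v \<mu> x y - \<mu> (E *v x) y - \<mu> x (E *v y))"

definition sym_ops :: "(real^'n^'n) set" where
  "sym_ops = {A. transpose A = A}"

definition moment :: "(real^'n \<Rightarrow> real^'n \<Rightarrow> real^'n) \<Rightarrow> real^'n^'n" where
  "moment \<mu> = (THE M. M \<in> sym_ops \<and>
     (\<forall>E\<in>sym_ops. trace (M ** transpose E) = inner_V (gl_act E \<mu>) \<mu> / inner_V \<mu> \<mu>))"

text \<open>
  The usual topology of \<open>V\<close> is transported along the linear embedding into \<open>real^'n^'n^'n\<close> given by
  the structure constants; the image of \<open>V\<close> is a linear subspace, hence closed.
\<close>
definition structure_constants :: "(real^'n \<Rightarrow> real^'n \<Rightarrow> real^'n) \<Rightarrow> real^'n^'n^'n" where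
  "structure_constants \<mu> = (\<chi> i j. \<mu> (axis i 1) (axis j 1))"

definition closure_V ::
  "(real^'n \<Rightarrow> real^'n \<Rightarrow> real^'n) set \<Rightarrow> (real^'n \<Rightarrow> real^'n \<Rightarrow> real^'n) set" where
  "closure_V X = {\<mu> \<in> V. structure_constants \<mu> \<in> closure (structure_constants ` X)}"


subsection \<open>The cone\<close>

definition G_torus :: "(real^'n^'n) set \<Rightarrow> (real^'n^'n) set" where
  "G_torus t = connected_component_set {h. invertible h \<and> (\<forall>D\<in>t. h ** D = D ** h)} (mat 1)"

text \<open>
  Two consequences of this definition matter when stating properties of the cone. It is relatively
  open in \<open>t\<close>, so its slices of constant trace are relatively open as well and are polytopes
  only in the sense of being relative interiors of (compact) polytopes: for the Heisenberg algebra
  it is \<open>{diag(x, y, x + y) | x + y > 0, 2x + y > 0, x + 2y > 0}\<close>, with slices open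
  segments. And it is empty for \<open>b = 0\<close>, where the moment map is evaluated on the empty set.
\<close>
definition cone_C ::
  "(real^'n \<Rightarrow> real^'n \<Rightarrow> real^'n) \<Rightarrow> (real^'n^'n) set \<Rightarrow> (real^'n^'n) set" where
  "cone_C b t =
     {A + B | A B.
        A \<in> {s *\<^sub>R moment \<mu> | s \<mu>. s > 0 \<and>
               \<mu> \<in> closure_V ((\<lambda>h. GL_act h b) ` G_torus t) - {\<lambda>x y. 0}} \<inter> Dg \<and>
        B \<in> Dg_pos}
     \<inter> {D \<in> t. trace D > 0}"


subsection \<open>Generic derivations\<close>

text \<open>
  Weights are functions on \<open>t\<close> only; extensionality makes equality of weights mean equality on \<open>t\<close>.
  Linearity of a weight is automatic, since \<open>X \<noteq> 0\<close>.
\<close>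
definition weights :: "(real^'n^'n) set \<Rightarrow> (real^'n^'n \<Rightarrow> real) set" where
  "weights t = {\<alpha> \<in> extensional t. \<exists>X. X \<noteq> 0 \<and> (\<forall>D\<in>t. D *v X = \<alpha> D *\<^sub>R X)}"

definition torus_gen :: "(real^'n^'n) set \<Rightarrow> (real^'n^'n) set" where
  "torus_gen t = {D \<in> t. \<forall>\<alpha>\<in>weights t. \<forall>\<beta>\<in>weights t. \<alpha> \<noteq> \<beta> \<longrightarrow> \<alpha> D \<noteq> \<beta> D}"


subsection \<open>Ricci curvature and strongly Ricci negative derivations\<close>

definition inner_product_on_space :: "('a::real_vector \<Rightarrow> 'a \<Rightarrow> real) \<Rightarrow> bool" where
  "inner_product_on_space g \<longleftrightarrow>
     bilinear g \<and> (\<forall>x y. g x y = g y x) \<and> (\<forall>x. x \<noteq> 0 \<longrightarrow> g x x > 0)"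

text \<open>
  The curvature of a left-invariant metric is computed on left-invariant vector fields: for these
  the Koszul formula has no derivative terms and expresses the Levi-Civita connection through the
  Lie bracket \<open>b\<close> and the inner product \<open>g\<close> alone.
\<close>
definition levi_civita ::
  "('a::euclidean_space \<Rightarrow> 'a \<Rightarrow> 'a) \<Rightarrow> ('a \<Rightarrow> 'a \<Rightarrow> real) \<Rightarrow> 'a \<Rightarrow> 'a \<Rightarrow> 'a" where
  "levi_civita b g X Y =
     (THE W. \<forall>Z. 2 * g W Z = g (b X Y) Z - g (b Y Z) X + g (b Z X) Y)"

definition riemann ::
  "('a::euclidean_space \<Rightarrow> 'a \<Rightarrow> 'a) \<Rightarrow> ('a \<Rightarrow> 'a \<Rightarrow> real) \<Rightarrow> 'a \<Rightarrow> 'a \<Rightarrow> 'a \<Rightarrow> 'a" where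
  "riemann b g X Y Z =
     levi_civita b g X (levi_civita b g Y Z) - levi_civita b g Y (levi_civita b g X Z)
     - levi_civita b g (b X Y) Z"

text \<open>
  The trace of \<open>X \<mapsto> R(X, Y) Z\<close>, taken in the standard basis; being the trace of an
  endomorphism, it does not depend on that choice.
\<close>
definition ricci ::
  "('a::euclidean_space \<Rightarrow> 'a \<Rightarrow> 'a) \<Rightarrow> ('a \<Rightarrow> 'a \<Rightarrow> real) \<Rightarrow> 'a \<Rightarrow> 'a \<Rightarrow> real" where
  "ricci b g Y Z = (\<Sum>e\<in>Basis. riemann b g e Y Z \<bullet> e)"

definition ricci_negative ::
  "('a::euclidean_space \<Rightarrow> 'a \<Rightarrow> 'a) \<Rightarrow> ('a \<Rightarrow> 'a \<Rightarrow> real) \<Rightarrow> bool" where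
  "ricci_negative b g \<longleftrightarrow> (\<forall>X. X \<noteq> 0 \<longrightarrow> ricci b g X X < 0)"

text \<open>The pair \<open>(a, x)\<close> stands for \<open>a f + x\<close>.\<close>
definition semidirect_bracket ::
  "(real^'n \<Rightarrow> real^'n \<Rightarrow> real^'n) \<Rightarrow> real^'n^'n \<Rightarrow>
   real \<times> (real^'n) \<Rightarrow> real \<times> (real^'n) \<Rightarrow> real \<times> (real^'n)" where
  "semidirect_bracket b D =
     (\<lambda>(a, x) (c, y). (0, a *\<^sub>R (D *v y) - c *\<^sub>R (D *v x) + b x y))"

definition Der_srn :: "(real^'n \<Rightarrow> real^'n \<Rightarrow> real^'n) \<Rightarrow> (real^'n^'n) set" where
  "Der_srn b = {D \<in> Der b. trace D > 0 \<and>
     (\<exists>g. inner_product_on_space g \<and>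
          (\<forall>x. g (1, 0) (0, x) = 0) \<and>
          (\<forall>x y. g (0, D *v x) (0, y) = g (0, x) (0, D *v y)) \<and>
          ricci_negative (semidirect_bracket b D) g)}"


subsection \<open>The orthogonal Weyl group\<close>

definition AutO :: "(real^'n \<Rightarrow> real^'n \<Rightarrow> real^'n) \<Rightarrow> (real^'n^'n) set" where
  "AutO b = {h \<in> Aut b. orthogonal_matrix h}"

definition normalizer_AutO ::
  "(real^'n \<Rightarrow> real^'n \<Rightarrow> real^'n) \<Rightarrow> (real^'n^'n) set \<Rightarrow> (real^'n^'n) monoid" where
  "normalizer_AutO b t =
     \<lparr>carrier = {h \<in> AutO b. (\<lambda>D. h ** D ** matrix_inv h) ` t = t}, mult = (**), one = mat 1\<rparr>"

definition centralizer_AutO ::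
  "(real^'n \<Rightarrow> real^'n \<Rightarrow> real^'n) \<Rightarrow> (real^'n^'n) set \<Rightarrow> (real^'n^'n) set" where
  "centralizer_AutO b t = {h \<in> AutO b. \<forall>D\<in>t. h ** D ** matrix_inv h = D}"

definition W_ort ::
  "(real^'n \<Rightarrow> real^'n \<Rightarrow> real^'n) \<Rightarrow> (real^'n^'n) set \<Rightarrow> (real^'n^'n) set monoid" where
  "W_ort b t = normalizer_AutO b t Mod centralizer_AutO b t"


subsection \<open>The definite descriptions above are well defined\<close>

lemma riesz_ex1:
  fixes g :: "'a::euclidean_space \<Rightarrow> 'a \<Rightarrow> real"
  assumes g: "bilinear g" and def: "\<And>x. x \<in> S \<Longrightarrow> x \<noteq> 0 \<Longrightarrow> g x x > 0"
    and S: "subspace S" and f: "linear f"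
  shows "\<exists>!w. w \<in> S \<and> (\<forall>z\<in>S. g w z = f z)"
proof -
  have gl: "linear (g x)" and gr: "linear (\<lambda>x. g x y)" for x y
    using g by (auto simp: bilinear_def)
  have rep: "h z = (\<Sum>e\<in>Basis. h e *\<^sub>R e) \<bullet> z" if "linear h" for h :: "'a \<Rightarrow> real" and z
  proof -
    have "h z = h (\<Sum>e\<in>Basis. (z \<bullet> e) *\<^sub>R e)" by (simp add: euclidean_representation)
    also have "\<dots> = (\<Sum>e\<in>Basis. (z \<bullet> e) *\<^sub>R h e)"
      by (simp only: linear_sum[OF that] linear_scale[OF that])
    also have "\<dots> = (\<Sum>e\<in>Basis. h e *\<^sub>R e) \<bullet> z"
      by (simp add: inner_sum_left inner_commute[of z] mult.commute)
    finally show ?thesis .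
  qed
  obtain B where B: "B \<subseteq> S" "pairwise orthogonal B" "\<And>x. x \<in> B \<Longrightarrow> norm x = 1"
      "independent B" "card B = dim S" "span B = S"
    using orthonormal_basis_subspace[OF S] by metis
  have finB: "finite B" using B(4) independent_bound by blast
  define P where "P x = (\<Sum>u\<in>B. (x \<bullet> u) *\<^sub>R u)" for x
  have linP: "linear P" unfolding P_def
    by (intro linearI) (auto simp: inner_left_distrib scaleR_left_distrib sum.distrib scaleR_sum_right)
  have PS: "P x \<in> S" for x unfolding P_def
    using B(1) S by (intro subspace_sum) (auto intro: subspace_scale)
  have PB: "P x \<bullet> u = x \<bullet> u" if "u \<in> B" for x u
  proof -
    have "(x \<bullet> v) * (v \<bullet> u) = (if v = u then x \<bullet> u else 0)" if v: "v \<in> B" for v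
      using B(2) B(3)[OF \<open>u \<in> B\<close>] v \<open>u \<in> B\<close>
      by (auto simp: pairwise_def orthogonal_def norm_eq_1)
    then show ?thesis
      unfolding P_def using finB that by (simp add: inner_sum_left sum.delta)
  qed
  have PSz: "P x \<bullet> z = x \<bullet> z" if "z \<in> S" for x z
  proof -
    have "z \<in> span B" using that B(6) by simp
    then show ?thesis
      by (induction rule: span_induct_alt) (auto simp: inner_add_right PB)
  qed
  define T where "T w = P (\<Sum>e\<in>Basis. g w e *\<^sub>R e)" for w
  have T: "T w \<bullet> z = g w z" if "z \<in> S" for w z
    unfolding T_def using PSz[OF that] rep[OF gl, of w z] by simp
  have linT: "linear T"
    unfolding T_def
    by (intro linear_compose[OF _ linP, unfolded o_def] linearI)
      (auto simp: linear_add[OF gr] linear_scale[OF gr] scaleR_left_distrib sum.distrib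
        scaleR_sum_right)
  have zero: "x = 0" if "x \<in> S" "\<And>z. z \<in> S \<Longrightarrow> g x z = 0" for x
    using def[of x] that by force
  have inj: "inj_on T S"
  proof (rule inj_onI)
    fix x y assume xy: "x \<in> S" "y \<in> S" "T x = T y"
    have "g (x - y) z = 0" if "z \<in> S" for z
      using T[OF that, of x] T[OF that, of y] xy(3) by (simp add: linear_diff[OF gr])
    then have "x - y = 0" using zero[of "x - y"] xy S subspace_diff by blast
    then show "x = y" by simp
  qed
  have TS: "T ` S \<subseteq> S" using PS by (auto simp: T_def)
  have "dim (T ` S) = dim S" using linT inj S
    by (intro dim_image_eq) (auto simp: span_eq_iff[THEN iffD2])
  then have im: "T ` S = S"
    using TS S linT by (intro subspace_dim_equal) (auto intro: linear_subspace_image)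
  obtain w where w: "w \<in> S" "T w = P (\<Sum>e\<in>Basis. f e *\<^sub>R e)"
    using im PS by (metis imageE)
  have "g w z = f z" if "z \<in> S" for z
    using T[OF that, of w] w(2) PSz[OF that] rep[OF f, of z] by simp
  moreover have "v = w" if "v \<in> S" "\<And>z. z \<in> S \<Longrightarrow> g v z = f z" for v
    using zero[of "v - w"] that w(1) calculation S subspace_diff
    by (force simp: linear_diff[OF gr])
  ultimately show ?thesis using w(1) by blast
qed

lemma levi_civita_ex1:
  fixes b :: "'a::euclidean_space \<Rightarrow> 'a \<Rightarrow> 'a"
  assumes "bilinear b" "inner_product_on_space g"
  shows "\<exists>!W. \<forall>Z. 2 * g W Z = g (b X Y) Z - g (b Y Z) X + g (b Z X) Y"
proof -
  have g: "bilinear g" "\<And>x. x \<noteq> 0 \<Longrightarrow> g x x > 0"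
    using assms(2) by (auto simp: inner_product_on_space_def)
  have "linear (\<lambda>Z. (g (b X Y) Z - g (b Y Z) X + g (b Z X) Y) / 2)"
    by (intro linearI)
      (auto simp: bilinear_ladd[OF g(1)] bilinear_radd[OF g(1)] bilinear_lmul[OF g(1)]
        bilinear_rmul[OF g(1)] bilinear_ladd[OF assms(1)] bilinear_radd[OF assms(1)]
        bilinear_lmul[OF assms(1)] bilinear_rmul[OF assms(1)] algebra_simps add_divide_distrib
        diff_divide_distrib)
  from riesz_ex1[OF g(1) _ subspace_UNIV this] g(2)
  have "\<exists>!W. \<forall>Z. g W Z = (g (b X Y) Z - g (b Y Z) X + g (b Z X) Y) / 2" by simp
  then show ?thesis by (simp add: field_simps)
qed

lemma moment_ex1:
  fixes \<mu> :: "real^'n \<Rightarrow> real^'n \<Rightarrow> real^'n"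
  assumes "bilinear \<mu>"
  shows "\<exists>!M. M \<in> sym_ops \<and>
    (\<forall>E\<in>sym_ops. trace (M ** transpose E) = inner_V (gl_act E \<mu>) \<mu> / inner_V \<mu> \<mu>)"
proof -
  have tr: "trace (M ** transpose E) = M \<bullet> E" for M E :: "real^'n^'n"
    by (simp add: trace_def matrix_matrix_mult_def transpose_def inner_vec_def)
  have "linear (\<lambda>E. inner_V (gl_act E \<mu>) \<mu> / inner_V \<mu> \<mu>)"
  proof (rule linearI)
    fix A B :: "real^'n^'n" and r :: real
    have "gl_act (A + B) \<mu> x y = gl_act A \<mu> x y + gl_act B \<mu> x y"
      "gl_act (r *\<^sub>R A) \<mu> x y = r *\<^sub>R gl_act A \<mu> x y" for x y
      by (simp_all add: gl_act_def matrix_vector_mult_add_rdistrib bilinear_ladd[OF assms]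
          bilinear_radd[OF assms] scaleR_matrix_vector_assoc[symmetric] bilinear_lmul[OF assms]
          bilinear_rmul[OF assms] algebra_simps)
    then show "inner_V (gl_act (A + B) \<mu>) \<mu> / inner_V \<mu> \<mu> =
        inner_V (gl_act A \<mu>) \<mu> / inner_V \<mu> \<mu> + inner_V (gl_act B \<mu>) \<mu> / inner_V \<mu> \<mu>"
      "inner_V (gl_act (r *\<^sub>R A) \<mu>) \<mu> / inner_V \<mu> \<mu> =
        r *\<^sub>R (inner_V (gl_act A \<mu>) \<mu> / inner_V \<mu> \<mu>)"
      by (simp_all add: inner_V_def algebra_simps sum.distrib sum_distrib_left add_divide_distrib)
  qed
  moreover have "subspace (sym_ops :: (real^'n^'n) set)"
    by (auto simp: subspace_def sym_ops_def transpose_def vec_eq_iff)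
  moreover have "bilinear ((\<bullet>) :: real^'n^'n \<Rightarrow> _)"
    by (simp add: bilinear_conv_bounded_bilinear bounded_bilinear_inner)
  ultimately show ?thesis
    using riesz_ex1[of "(\<bullet>)" sym_ops] unfolding tr by simp
qed

end

theory Submission
  imports Defs
begin

text \<open>
  By the decomposition \<open>h = k a q\<close> of the centralizer of the torus and the compactness of its
  orthogonal part, \<open>D\<close> lies in the cone iff \<open>D - s m(h b)\<close> is positive definite for some \<open>h\<close> in
  \<open>G_torus t\<close> and \<open>s > 0\<close>. Such an \<open>h\<close> is a critical point of a function which, along each
  ray \<open>h = diag(exp(r v)) q\<close>, is a sum of exponentials and a linear term with slope the pairing of \<open>D\<close> and \<open>v\<close>,
  so it exists iff these pairings are negative for every \<open>v\<close> along which the exponentials stay bounded.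
  Only the supports of the finitely many types of brackets \<open>q b\<close> matter, which leaves finitely
  many strict linear inequalities: the cone is open and convex. Its slices are bounded because
  the optimal one-parameter subgroup destabilizing \<open>b\<close> has positive weights: \<open>b\<close> degenerates along
  it to approximate nilsolitons, and the derivation of a nilsoliton is positive.

  For symmetric \<open>D\<close> the Ricci curvature of \<open>\<real>f \<oplus> \<nn>\<close> is, on \<open>\<nn>\<close>, a positive multiple of
  \<open>s m(b) - D\<close>, so strong Ricci negativity is the same positivity condition with \<open>h\<close> ranging over
  all \<open>h\<close> with \<open>h D h\<^sup>-\<^sup>1\<close> symmetric. Then \<open>h\<^sup>t h\<close> commutes with \<open>D\<close>, hence with the torus if \<open>D\<close>
  is generic, and the polar part of \<open>h\<close> moves into the centralizer.
\<close>

text \<open>The function behind the criterion is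
  \<open>nV (GL_act h b) / 2 + (h \<bullet> h) / 2 - chi D h\<close>. Its gradient under left
  translation by symmetric operators is \<open>momentM (GL_act h b) + h ** transpose h - D\<close>,
  so a critical point exhibits \<open>D - momentM (GL_act h b)\<close> as a Gram matrix: the term
  \<open>h \<bullet> h\<close> supplies the positive operator. Since positive definiteness is an
  open condition, limits of the orbit give nothing beyond the orbit itself, which removes the
  closure from the cone.

  Boundedness of the slices asks that a trace-free \<open>D\<close> in the torus satisfying the weak
  inequalities vanish. The obstacle is that the infimum in the search for a nilsoliton need not be
  attained in the orbit. A coercive term of size \<open>e\<close> restores a minimum, the minimizers
  are normalized, and their structure constants have a limit as \<open>e\<close> tends to zero. The
  Jacobi identity and nilpotency must survive that limit, which is why nilpotency is carried as the
  vanishing of all nested brackets of one fixed length \<open>k\<close>.\<close>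

definition diag :: "real^'n \<Rightarrow> real^'n^'n" where
  "diag v = (\<chi> i j. if i = j then v $ i else 0)"

definition commutes :: "real^'n^'n \<Rightarrow> (real^'n^'n) set \<Rightarrow> bool" where
  "commutes h t \<longleftrightarrow> (\<forall>D\<in>t. h ** D = D ** h)"

definition K_torus :: "(real^'n^'n) set \<Rightarrow> (real^'n^'n) set" where
  "K_torus t = {k \<in> G_torus t. orthogonal_matrix k}"

section \<open>Diagonal operators, inverses and commutation with the torus\<close>

lemma diag_nth: "diag v $ i $ j = (if i = j then v $ i else 0)"
  by (simp add: diag_def)

lemma diag_mult_nth:
  "(diag v ** A) $ i $ j = v $ i * A $ i $ j" "(A ** diag v) $ i $ j = A $ i $ j * v $ j"
  by (simp_all add: diag_def matrix_matrix_mult_def if_distrib[of "\<lambda>x. x * _"] if_distrib[of "\<lambda>x. _ * x"]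
      cong: if_cong)

lemma diag_vec_nth: "(diag v *v x) $ i = v $ i * x $ i"
  by (simp add: diag_def matrix_vector_mult_def if_distrib[of "\<lambda>x. x * _"] cong: if_cong)

lemma diag_Dg [simp]: "diag v \<in> Dg"
  by (simp add: Dg_def diag_nth)

lemma Dg_eq_diag: "D \<in> Dg \<Longrightarrow> D = diag (\<chi> i. D $ i $ i)"
  by (auto simp: Dg_def diag_def vec_eq_iff)

lemma diag_mult: "diag v ** diag w = diag (\<chi> i. v $ i * w $ i)"
  by (simp add: vec_eq_iff diag_mult_nth diag_nth)

lemma diag_1: "diag (\<chi> i. 1) = mat 1"
  by (simp add: vec_eq_iff diag_def mat_def)

lemma transpose_diag: "transpose (diag v) = diag v"
  by (auto simp: transpose_def diag_def vec_eq_iff)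

lemma Dg_mult_nth:
  assumes "D \<in> Dg"
  shows "(D ** A) $ i $ j = D $ i $ i * A $ i $ j" "(A ** D) $ i $ j = A $ i $ j * D $ j $ j"
  by (subst Dg_eq_diag[OF assms], simp add: diag_mult_nth)+

lemma commute_Dg_iff:
  assumes "D \<in> Dg"
  shows "h ** D = D ** h \<longleftrightarrow> (\<forall>i j. h $ i $ j \<noteq> 0 \<longrightarrow> D $ i $ i = D $ j $ j)"
  using assms by (auto simp: vec_eq_iff Dg_mult_nth) metis+

lemma matrix_inv:
  fixes h :: "real^'n^'n"
  assumes "invertible h"
  shows "h ** matrix_inv h = mat 1" "matrix_inv h ** h = mat 1"
  using assms someI_ex[of "\<lambda>B. h ** B = mat 1 \<and> B ** h = mat 1"]
  unfolding invertible_def matrix_inv_def by blast+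

lemma matrix_inv_unique:
  fixes h :: "real^'n^'n"
  assumes "h ** k = mat 1"
  shows "matrix_inv h = k" "invertible h"
proof -
  have kh: "k ** h = mat 1" using assms matrix_left_right_inverse by blast
  then show inv: "invertible h" using assms by (auto simp: invertible_def)
  have "matrix_inv h = matrix_inv h ** (h ** k)" by (simp add: assms)
  also have "\<dots> = k" by (simp add: matrix_mul_assoc matrix_inv(2)[OF inv])
  finally show "matrix_inv h = k" .
qed

lemma invertible_matrix_inv: "invertible h \<Longrightarrow> invertible (matrix_inv (h :: real^'n^'n))"
  using matrix_inv matrix_inv_unique(2) by blast

lemma matrix_inv_mult:
  fixes g h :: "real^'n^'n"
  assumes "invertible g" "invertible h"
  shows "matrix_inv (g ** h) = matrix_inv h ** matrix_inv g"
proof (rule matrix_inv_unique)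
  have "g ** h ** (matrix_inv h ** matrix_inv g) = g ** (h ** matrix_inv h) ** matrix_inv g"
    by (simp only: matrix_mul_assoc)
  then show "g ** h ** (matrix_inv h ** matrix_inv g) = mat 1"
    by (simp add: matrix_inv assms)
qed

lemma matrix_inv_inv: "invertible h \<Longrightarrow> matrix_inv (matrix_inv h) = (h :: real^'n^'n)"
  by (simp add: matrix_inv_unique(1) matrix_inv(2))

lemma orthogonal_inv:
  fixes k :: "real^'n^'n"
  assumes "orthogonal_matrix k"
  shows "matrix_inv k = transpose k" "invertible k"
    "transpose k ** k = mat 1" "k ** transpose k = mat 1"
  using assms matrix_inv_unique[of k "transpose k"] by (auto simp: orthogonal_matrix_def)

lemma invertible_diag:
  assumes "\<And>i. a $ i \<noteq> 0"
  shows "invertible (diag a)" "matrix_inv (diag a) = diag (\<chi> i. inverse (a $ i))"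
proof -
  have "diag a ** diag (\<chi> i. inverse (a $ i)) = mat 1"
    using assms by (simp add: diag_mult flip: diag_1)
  from matrix_inv_unique[OF this]
  show "invertible (diag a)" "matrix_inv (diag a) = diag (\<chi> i. inverse (a $ i))" by auto
qed

lemma commutes_mult: "commutes g t \<Longrightarrow> commutes h t \<Longrightarrow> commutes (g ** h) t"
  by (metis commutes_def matrix_mul_assoc)

lemma commutes_inv:
  assumes "invertible h" "commutes h t"
  shows "commutes (matrix_inv h) t"
  unfolding commutes_def
proof
  fix D assume "D \<in> t"
  then have "h ** D = D ** h" using assms by (auto simp: commutes_def)
  then have "matrix_inv h ** (h ** D) ** matrix_inv h = matrix_inv h ** (D ** h) ** matrix_inv h"
    by simp
  then have "(matrix_inv h ** h) ** D ** matrix_inv h = matrix_inv h ** D ** (h ** matrix_inv h)"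
    by (simp only: matrix_mul_assoc)
  then show "matrix_inv h ** D = D ** matrix_inv h"
    by (simp add: matrix_inv assms)
qed

lemma commutes_transpose:
  assumes "t \<subseteq> Dg" "commutes h t"
  shows "commutes (transpose h) t"
  using assms by (auto simp: commutes_def commute_Dg_iff[OF subsetD] transpose_def)

lemma commutes_diag: "t \<subseteq> Dg \<Longrightarrow> commutes (diag a) t"
  by (auto simp: commutes_def commute_Dg_iff[OF subsetD] diag_nth)

lemma commutes_nth:
  "t \<subseteq> Dg \<Longrightarrow> commutes h t \<longleftrightarrow> (\<forall>D\<in>t. \<forall>i j. h $ i $ j \<noteq> 0 \<longrightarrow> D $ i $ i = D $ j $ j)"
  by (auto simp: commutes_def commute_Dg_iff[OF subsetD])

section \<open>The identity component of the centralizer and its orthogonal part\<close>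

lemma invertible_eq: "G_torus t = connected_component_set {h. invertible h \<and> commutes h t} (mat 1)"
  by (simp add: G_torus_def commutes_def)

lemma G_torusD:
  assumes "h \<in> G_torus t"
  shows "invertible h" "commutes h t"
  using assms connected_component_subset[of "{h. invertible h \<and> commutes h t}" "mat 1"]
  unfolding invertible_eq by blast+

lemma mat1_G_torus [simp]: "mat 1 \<in> G_torus t"
proof -
  have "invertible (mat 1 :: real^'n^'n)" by (rule matrix_inv_unique[of _ "mat 1"]) simp
  then show ?thesis by (simp add: invertible_eq commutes_def)
qed

text \<open>A component is the largest connected set through each of its points. Products, inverses,
  positive diagonals, rotations and conjugates are all placed in \<open>G_torus t\<close> this way,
  by a path or by a translated copy of the component.\<close>

lemma G_torus_connected_subset:
  assumes "connected S" "x \<in> S" "x \<in> G_torus t" "\<And>h. h \<in> S \<Longrightarrow> invertible h \<and> commutes h t"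
  shows "S \<subseteq> G_torus t"
proof -
  let ?Z = "{h. invertible h \<and> commutes h t}"
  have "S \<subseteq> connected_component_set ?Z x"
    using assms by (intro connected_component_maximal) auto
  moreover have "connected_component_set ?Z x = connected_component_set ?Z (mat 1)"
    using assms(3) unfolding invertible_eq by (rule connected_component_eq)
  ultimately show ?thesis by (simp add: invertible_eq)
qed

lemma connected_G_torus: "connected (G_torus t)"
  by (simp add: G_torus_def)

lemma continuous_matrix_mult [continuous_intros]:
  fixes f :: "'a::topological_space \<Rightarrow> real^'n^'m" and g :: "'a \<Rightarrow> real^'k^'n"
  assumes "continuous_on S f" "continuous_on S g"
  shows "continuous_on S (\<lambda>x. f x ** g x)"
  unfolding matrix_matrix_mult_def
  by (intro continuous_on_vec_lambda continuous_intros assms)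

lemma continuous_transpose [continuous_intros]:
  fixes f :: "'a::topological_space \<Rightarrow> real^'n^'m"
  assumes "continuous_on S f"
  shows "continuous_on S (\<lambda>x. transpose (f x))"
  unfolding transpose_def
  by (intro continuous_on_vec_lambda continuous_intros assms)

lemma continuous_diag [continuous_intros]:
  fixes f :: "'a::topological_space \<Rightarrow> real^'n"
  assumes "continuous_on S f"
  shows "continuous_on S (\<lambda>x. diag (f x))"
  unfolding diag_def
proof (intro continuous_on_vec_lambda)
  show "continuous_on S (\<lambda>x. if i = j then f x $ i else 0)" for i j
    by (cases "i = j") (auto intro!: continuous_intros assms)
qed

lemma G_torus_mult:
  assumes "g \<in> G_torus t" "h \<in> G_torus t"
  shows "g ** h \<in> G_torus t"
proof -
  have "(\<lambda>x. g ** x) ` G_torus t \<subseteq> G_torus t"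
  proof (rule G_torus_connected_subset)
    show "connected ((\<lambda>x. g ** x) ` G_torus t)"
      by (intro connected_continuous_image connected_G_torus continuous_intros)
    show "g \<in> (\<lambda>x. g ** x) ` G_torus t" by (metis imageI mat1_G_torus matrix_mul_rid)
  qed (use assms in \<open>auto dest: G_torusD(1) G_torusD(2) intro!: invertible_mult commutes_mult\<close>)
  then show ?thesis using assms(2) by blast
qed

lemma G_torus_inv:
  assumes "g \<in> G_torus t"
  shows "matrix_inv g \<in> G_torus t"
proof -
  let ?S = "(\<lambda>x. matrix_inv g ** x) ` G_torus t"
  note g = G_torusD[OF assms]
  \<comment> \<open>Translation by the inverse sends \<open>g\<close> to the identity, so the
    translate meets the component; the image of the identity is the inverse.\<close>
  have "?S \<subseteq> G_torus t"
  proof (rule G_torus_connected_subset)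
    show "connected ?S"
      by (intro connected_continuous_image connected_G_torus continuous_intros)
    show "mat 1 \<in> ?S" using assms matrix_inv(2)[OF g(1)] by (metis imageI)
  qed (use g in \<open>auto dest: G_torusD(1) G_torusD(2) intro!: invertible_mult commutes_mult commutes_inv invertible_matrix_inv\<close>)
  then show ?thesis by (metis imageI mat1_G_torus matrix_mul_rid subsetD)
qed

text \<open>The segment from the identity to \<open>diag a\<close> consists of positive diagonal
  matrices.\<close>

lemma diag_G_torus:
  assumes "t \<subseteq> Dg" "\<And>i. a $ i > 0"
  shows "diag a \<in> G_torus t"
proof -
  let ?f = "\<lambda>s::real. diag (\<chi> i. (1 - s) * 1 + s * a $ i)"
  have "?f ` {0..1} \<subseteq> G_torus t"
  proof (rule G_torus_connected_subset)
    show "connected (?f ` {0..1})"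
      by (intro connected_continuous_image continuous_intros continuous_on_vec_lambda) auto
    show "mat 1 \<in> ?f ` {0..1}" by (rule image_eqI[of _ _ 0]) (auto simp: diag_1)
    fix h assume "h \<in> ?f ` {0..1}"
    then obtain s where s: "0 \<le> s" "s \<le> 1" "h = ?f s" by auto
    have pos: "(1 - s) * 1 + s * a $ i > 0" for i
    proof (cases "s = 0")
      case False
      then have "s * a $ i > 0" using s(1) assms(2) by simp
      then show ?thesis using s(2) by simp
    qed auto
    then show "invertible h \<and> commutes h t"
      unfolding s(3)
      by (intro conjI invertible_diag(1) commutes_diag[OF assms(1)])
        (metis pos less_irrefl vec_lambda_beta)
  qed auto
  moreover have "?f 1 \<in> ?f ` {0..1}" by (rule imageI) simp
  moreover have "?f 1 = diag a" by (simp add: vec_eq_iff diag_nth)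
  ultimately show ?thesis by auto
qed

lemma K_torusD:
  assumes "k \<in> K_torus t"
  shows "k \<in> G_torus t" "orthogonal_matrix k" "invertible k" "commutes k t"
    "matrix_inv k = transpose k" "transpose k ** k = mat 1" "k ** transpose k = mat 1"
  using assms orthogonal_inv G_torusD by (auto simp: K_torus_def)

lemma K_torus_mult: "g \<in> K_torus t \<Longrightarrow> h \<in> K_torus t \<Longrightarrow> g ** h \<in> K_torus t"
  by (simp add: K_torus_def G_torus_mult orthogonal_matrix_mul)

lemma mat1_K_torus [simp]: "mat 1 \<in> K_torus t"
  by (simp add: K_torus_def orthogonal_matrix_id)

text \<open>A component is closed only relative to the invertible elements, which do not form a
  closed set. Orthogonality is a closed condition that already implies invertibility, so inside it
  relative closedness becomes closedness. Orthonormal rows give boundedness.\<close>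

lemma compact_K_torus: "compact (K_torus t :: (real^'n^'n) set)"
proof -
  let ?Z = "{h :: real^'n^'n. invertible h \<and> commutes h t}"
  let ?O = "{h :: real^'n^'n. transpose h ** h = mat 1}"
  have c: "closed {h. P h = Q h}" if "continuous_on UNIV P" "continuous_on UNIV Q"
    for P Q :: "real^'n^'n \<Rightarrow> real^'n^'n"
    using that by (rule closed_Collect_eq)
  have clO: "closed ?O" by (intro c continuous_intros)
  have cl: "closed (?O \<inter> {h. commutes h t})"
  proof -
    have "?O \<inter> {h. commutes h t} = ?O \<inter> (\<Inter>D\<in>t. {h. h ** D = D ** h})" by (auto simp: commutes_def)
    moreover have "closed (\<Inter>D\<in>t. {h. h ** D = D ** h})" by (intro closed_INT ballI c continuous_intros)
    ultimately show ?thesis using clO by auto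
  qed
  have OZ: "?O \<inter> {h. commutes h t} \<subseteq> ?Z"
    by (auto simp: invertible_def) (metis matrix_left_right_inverse)
  have "closedin (top_of_set ?Z) (G_torus t)"
    unfolding invertible_eq by (rule closedin_connected_component)
  then obtain C where C: "closed C" "G_torus t = ?Z \<inter> C" by (auto simp: closedin_closed)
  have "K_torus t = (?O \<inter> {h. commutes h t}) \<inter> C"
    using OZ C(2) by (auto simp: K_torus_def orthogonal_matrix)
  then have "closed (K_torus t)" using cl C(1) by auto
  moreover have "bounded (K_torus t)"
  proof (rule bounded_subset)
    show "K_torus t \<subseteq> cball 0 (real CARD('n) * real CARD('n))"
    proof
      fix k assume "k \<in> K_torus t"
      then have "norm (row i k) = 1" for i
        using K_torusD(2) orthogonal_matrix_orthonormal_rows by blast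
      then have e: "\<bar>k $ i $ j\<bar> \<le> 1" for i j
        using component_le_norm_cart[of "row i k" j] by (simp add: row_def)
      have "norm (k $ i) \<le> real CARD('n)" for i
        using norm_le_l1_cart[of "k $ i"] sum_mono[of UNIV "\<lambda>j. \<bar>k $ i $ j\<bar>" "\<lambda>j. 1"] e by simp
      then have "norm k \<le> (\<Sum>i\<in>(UNIV::'n set). real CARD('n))"
        by (subst norm_vec_def) (rule order_trans[OF L2_set_le_sum sum_mono], auto)
      then show "k \<in> cball 0 (real CARD('n) * real CARD('n))" by simp
    qed
  qed auto
  ultimately show ?thesis using compact_eq_bounded_closed by blast
qed

section \<open>Plane rotations and diagonalization within the centralizer\<close>

lemma conj_nth:
  fixes k S :: "real^'n^'n"
  shows "(k ** S ** transpose k) $ a $ b = k $ a \<bullet> (S *v k $ b)"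
proof -
  have "(k ** S ** transpose k) $ a $ b = (\<Sum>d\<in>UNIV. \<Sum>c\<in>UNIV. k $ a $ c * S $ c $ d * k $ b $ d)"
    by (simp add: matrix_matrix_mult_def transpose_def sum_distrib_right)
  also have "\<dots> = (\<Sum>c\<in>UNIV. \<Sum>d\<in>UNIV. k $ a $ c * S $ c $ d * k $ b $ d)"
    by (rule sum.swap)
  also have "\<dots> = k $ a \<bullet> (S *v k $ b)"
    by (simp add: matrix_vector_mult_def inner_vec_def sum_distrib_left mult.assoc)
  finally show ?thesis .
qed

lemma mult_transpose_nth: "(A ** transpose B) $ a $ b = A $ a \<bullet> B $ b"
  for A B :: "real^'n^'m"
  by (simp add: matrix_matrix_mult_def transpose_def inner_vec_def)

text \<open>Given by rows because \<open>conj_nth\<close> evaluates the entries of a conjugate on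
  the rows of the conjugating matrix.\<close>

definition rot :: "'n \<Rightarrow> 'n \<Rightarrow> real \<Rightarrow> real^'n^'n" where
  "rot i j \<theta> = (\<chi> a. if a = i then cos \<theta> *\<^sub>R axis i 1 + sin \<theta> *\<^sub>R axis j 1
     else if a = j then - sin \<theta> *\<^sub>R axis i 1 + cos \<theta> *\<^sub>R axis j 1 else axis a 1)"

lemma rot_orthogonal:
  assumes "i \<noteq> j"
  shows "orthogonal_matrix (rot i j \<theta>)"
proof -
  have "(rot i j \<theta> ** transpose (rot i j \<theta>)) $ a $ b = mat 1 $ a $ b" for a b
    unfolding mult_transpose_nth using assms sin_cos_squared_add[of \<theta>]
    by (auto simp: rot_def mat_def inner_add_left inner_add_right inner_axis_axis
        power2_eq_square algebra_simps)
  then have "rot i j \<theta> ** transpose (rot i j \<theta>) = mat 1" by (simp add: vec_eq_iff)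
  then show ?thesis using matrix_left_right_inverse orthogonal_matrix by blast
qed

lemma rot_commutes:
  assumes "t \<subseteq> Dg" "\<And>D. D \<in> t \<Longrightarrow> D $ i $ i = D $ j $ j"
  shows "commutes (rot i j \<theta>) t"
proof -
  have "a = b \<or> a = i \<and> b = j \<or> a = j \<and> b = i" if "rot i j \<theta> $ a $ b \<noteq> 0" for a b
    using that by (cases "a = i"; cases "a = j"; cases "b = i"; cases "b = j")
      (simp_all add: rot_def axis_def split: if_splits)
  then show ?thesis using assms(2) unfolding commutes_nth[OF assms(1)] by metis
qed

text \<open>The circle of rotations passes through the identity at angle \<open>0\<close>; equal
  weights at \<open>i\<close> and \<open>j\<close> keep all of it in the centralizer.\<close>

lemma rot_K_torus:
  assumes "t \<subseteq> Dg" "\<And>D. D \<in> t \<Longrightarrow> D $ i $ i = D $ j $ j" "i \<noteq> j"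
  shows "rot i j \<theta> \<in> K_torus t"
proof -
  have "rot i j ` UNIV \<subseteq> G_torus t"
  proof (rule G_torus_connected_subset)
    have "continuous_on UNIV (\<lambda>\<theta>. rot i j \<theta> $ a)" for a
      by (cases "a = i"; cases "a = j") (auto simp: rot_def intro!: continuous_intros)
    then have "continuous_on UNIV (\<lambda>\<theta>. \<chi> a. rot i j \<theta> $ a)"
      by (rule continuous_on_vec_lambda)
    then have "continuous_on UNIV (rot i j)" by (simp only: vec_lambda_eta)
    then show "connected (rot i j ` UNIV)" by (intro connected_continuous_image) auto
    show "mat 1 \<in> rot i j ` UNIV"
      by (rule image_eqI[of _ _ 0]) (auto simp: rot_def mat_def vec_eq_iff axis_def)
  qed (use assms rot_orthogonal[OF assms(3)] in \<open>auto simp: orthogonal_inv(2) rot_commutes\<close>)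
  then show ?thesis using rot_orthogonal[OF assms(3)] by (auto simp: K_torus_def)
qed

lemma rot_conj_diag:
  fixes S :: "real^'n^'n"
  assumes "transpose S = S" "i \<noteq> j"
  defines "S' \<equiv> \<lambda>\<theta>. rot i j \<theta> ** S ** transpose (rot i j \<theta>)"
  shows "S' \<theta> $ i $ i = (cos \<theta>)\<^sup>2 * S $ i $ i + 2 * (cos \<theta> * sin \<theta>) * S $ i $ j + (sin \<theta>)\<^sup>2 * S $ j $ j"
    and "S' \<theta> $ j $ j = (sin \<theta>)\<^sup>2 * S $ i $ i - 2 * (cos \<theta> * sin \<theta>) * S $ i $ j + (cos \<theta>)\<^sup>2 * S $ j $ j"
    and "a \<noteq> i \<Longrightarrow> a \<noteq> j \<Longrightarrow> S' \<theta> $ a $ a = S $ a $ a"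
proof -
  have e: "axis a 1 \<bullet> (S *v axis c 1) = S $ a $ c" for a c
    by (simp add: inner_axis' matrix_vector_mult_basis column_def)
  have s: "S $ j $ i = S $ i $ j" by (metis assms(1) transpose_def vec_lambda_beta)
  have quad: "(p *\<^sub>R axis i 1 + q *\<^sub>R axis j 1) \<bullet> (S *v (p *\<^sub>R axis i 1 + q *\<^sub>R axis j 1)) =
      p\<^sup>2 * S $ i $ i + 2 * (p * q) * S $ i $ j + q\<^sup>2 * S $ j $ j" for p q
  proof -
    have "S *v (p *\<^sub>R axis i 1 + q *\<^sub>R axis j 1) = p *\<^sub>R (S *v axis i 1) + q *\<^sub>R (S *v axis j 1)"
      by (simp only: matrix_vector_right_distrib matrix_vector_mult_scaleR)
    then show ?thesis
      by (simp only: inner_add_left inner_add_right inner_scaleR_left inner_scaleR_right e s)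
        (simp add: power2_eq_square distrib_left)
  qed
  have r: "rot i j \<theta> $ i = cos \<theta> *\<^sub>R axis i 1 + sin \<theta> *\<^sub>R axis j 1"
    "rot i j \<theta> $ j = (- sin \<theta>) *\<^sub>R axis i 1 + cos \<theta> *\<^sub>R axis j 1"
    "a \<noteq> i \<Longrightarrow> a \<noteq> j \<Longrightarrow> rot i j \<theta> $ a = axis a 1"
    using assms(2) by (auto simp: rot_def)
  show "S' \<theta> $ i $ i = (cos \<theta>)\<^sup>2 * S $ i $ i + 2 * (cos \<theta> * sin \<theta>) * S $ i $ j + (sin \<theta>)\<^sup>2 * S $ j $ j"
    "S' \<theta> $ j $ j = (sin \<theta>)\<^sup>2 * S $ i $ i - 2 * (cos \<theta> * sin \<theta>) * S $ i $ j + (cos \<theta>)\<^sup>2 * S $ j $ j"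
    unfolding S'_def conj_nth r quad by (simp_all add: mult.commute)
  show "a \<noteq> i \<Longrightarrow> a \<noteq> j \<Longrightarrow> S' \<theta> $ a $ a = S $ a $ a"
    unfolding S'_def conj_nth by (simp add: r e)
qed

lemma transpose_conj:
  fixes k S :: "real^'n^'n"
  shows "transpose S = S \<Longrightarrow> transpose (k ** S ** transpose k) = k ** S ** transpose k"
  by (simp add: matrix_transpose_mul matrix_mul_assoc)

text \<open>
  A maximizer over the orbit of a linear functional of the diagonal with pairwise distinct weights
  is diagonal, since plane rotations change the functional to first order by the off-diagonal entry.
\<close>
lemma diagonalization:
  fixes S :: "real^'n^'n"
  assumes S: "transpose S = S" "commutes S t" and t: "t \<subseteq> Dg"
  obtains k where "k \<in> K_torus t" "k ** S ** transpose k \<in> Dg"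
proof -
  obtain l :: "'n \<Rightarrow> nat" where l: "inj l"
    using finite_imp_inj_to_nat_seg[of "UNIV :: 'n set"] by auto
  define f where "f k = (\<Sum>i\<in>UNIV. real (l i) * (k ** S ** transpose k) $ i $ i)" for k
  have "continuous_on (K_torus t) f" unfolding f_def by (intro continuous_intros)
  then obtain k where k: "k \<in> K_torus t" "\<And>k'. k' \<in> K_torus t \<Longrightarrow> f k' \<le> f k"
    using continuous_attains_sup[OF compact_K_torus, of t f] mat1_K_torus by blast
  define S1 where "S1 = k ** S ** transpose k"
  have S1: "transpose S1 = S1" "commutes S1 t"
    using S k K_torusD(4) commutes_transpose[OF t] unfolding S1_def
    by (auto intro!: transpose_conj commutes_mult)
  have "S1 $ i $ j = 0" if ij: "i \<noteq> j" for i j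
  proof (rule ccontr)
    assume nz: "S1 $ i $ j \<noteq> 0"
    let ?R = "rot i j" and ?d = "real (l i) - real (l j)"
    \<comment> \<open>\<open>S1\<close> commutes with \<open>t\<close> and has a nonzero entry at
      \<open>(i, j)\<close>, so \<open>e_i\<close> and \<open>e_j\<close> have the same weight and
      the rotation is allowed.\<close>
    have R: "?R \<theta> \<in> K_torus t" for \<theta>
      using S1(2) nz ij by (intro rot_K_torus t) (auto simp: commutes_nth[OF t])
    define g where "g \<theta> = (real (l i) * (cos \<theta>)\<^sup>2 + real (l j) * (sin \<theta>)\<^sup>2) * S1 $ i $ i
      + (real (l i) * (sin \<theta>)\<^sup>2 + real (l j) * (cos \<theta>)\<^sup>2) * S1 $ j $ j
      + 2 * ?d * (cos \<theta> * sin \<theta>) * S1 $ i $ j + (\<Sum>a\<in>UNIV-{i,j}. real (l a) * S1 $ a $ a)" for \<theta>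
    have sum: "(\<Sum>a\<in>UNIV. h a) = h i + h j + (\<Sum>a\<in>UNIV-{i,j}. h a)" for h :: "'n \<Rightarrow> real"
    proof -
      have "(\<Sum>a\<in>UNIV. h a) = (\<Sum>a\<in>{i,j}. h a) + (\<Sum>a\<in>UNIV-{i,j}. h a)"
        by (metis add.commute finite_code subset_UNIV sum.subset_diff)
      then show ?thesis using ij by simp
    qed
    have g: "f (?R \<theta> ** k) = g \<theta>" for \<theta>
    proof -
      have "?R \<theta> ** k ** S ** transpose (?R \<theta> ** k) = ?R \<theta> ** S1 ** transpose (?R \<theta>)"
        by (simp add: S1_def matrix_transpose_mul matrix_mul_assoc)
      then show ?thesis
        unfolding f_def g_def
        by (simp add: sum rot_conj_diag[OF S1(1) ij] algebra_simps)
    qed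
    have "(g has_real_derivative 2 * ?d * S1 $ i $ j) (at 0)"
      unfolding g_def by (auto intro!: derivative_eq_intros simp: power2_eq_square)
    moreover have "\<forall>\<theta>. g \<theta> \<le> g 0"
    proof
      fix \<theta>
      have "?R 0 = mat 1" by (auto simp: rot_def mat_def vec_eq_iff axis_def)
      then have "g 0 = f k" using g[of 0] by simp
      then show "g \<theta> \<le> g 0" using g[of \<theta>] k(2)[OF K_torus_mult[OF R[of \<theta>] k(1)]] by simp
    qed
    ultimately have "2 * ?d * S1 $ i $ j = 0"
      using DERIV_local_max[of g "2 * ?d * S1 $ i $ j" 0 1] by simp
    moreover have "real (l i) - real (l j) \<noteq> 0" using injD[OF l, of i j] ij by auto
    ultimately show False using nz by simp
  qed
  then have "k ** S ** transpose k \<in> Dg" by (auto simp: Dg_def S1_def)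
  then show ?thesis using that k(1) by blast
qed

section \<open>Positive definite operators and the decomposition \<open>k a q\<close>\<close>

definition posdef :: "real^'n^'n \<Rightarrow> bool" where
  "posdef A \<longleftrightarrow> transpose A = A \<and> (\<forall>x. x \<noteq> 0 \<longrightarrow> x \<bullet> (A *v x) > 0)"

lemma conj_inner:
  fixes k S :: "real^'n^'n"
  shows "x \<bullet> ((k ** S ** transpose k) *v x) = (transpose k *v x) \<bullet> (S *v (transpose k *v x))"
  by (simp add: dot_lmul_matrix[symmetric] matrix_vector_mul_assoc[symmetric]
      vector_transpose_matrix transpose_matrix_vector)

lemma posdef_conj:
  fixes k A :: "real^'n^'n"
  assumes "posdef A" "invertible k"
  shows "posdef (k ** A ** transpose k)"
proof -
  have "transpose k *v x \<noteq> 0" if "x \<noteq> 0" for x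
  proof
    assume 0: "transpose k *v x = 0"
    have "invertible (transpose k)" using assms(2) by (rule transpose_invertible)
    then have "x = matrix_inv (transpose k) *v (transpose k *v x)"
      by (simp only: matrix_vector_mul_assoc matrix_inv(2) matrix_vector_mul_lid)
    then show False using that 0 by simp
  qed
  then show ?thesis using assms(1) by (auto simp: posdef_def transpose_conj conj_inner)
qed

lemma posdef_gram: "invertible h \<Longrightarrow> posdef (h ** transpose (h :: real^'n^'n))"
  using posdef_conj[of "mat 1" h] by (simp add: posdef_def)

lemma posdef_nth: "posdef A \<Longrightarrow> A $ i $ i > 0"
proof -
  assume "posdef A"
  then have "axis i 1 \<bullet> (A *v axis i 1) > 0" unfolding posdef_def by (metis axis_eq_0_iff zero_neq_one)
  then show ?thesis by (simp add: inner_axis' matrix_vector_mult_basis column_def)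
qed

text \<open>Diagonalize \<open>transpose g ** g\<close> by \<open>q\<close>, take square roots for
  \<open>a\<close>, and let \<open>k\<close> be what remains. Only the Gram matrix has to commute
  with \<open>t\<close>, so \<open>k\<close> is merely orthogonal; this asymmetric form is what the
  strongly Ricci negative case needs, where \<open>g\<close> itself does not commute with
  \<open>t\<close>.\<close>

lemma svd:
  fixes g :: "real^'n^'n"
  assumes g: "invertible g" "commutes (transpose g ** g) t" and t: "t \<subseteq> Dg"
  obtains k a q where "orthogonal_matrix k" "q \<in> K_torus t" "\<And>i. a $ i > 0" "g = k ** diag a ** q"
proof -
  let ?S = "transpose g ** g"
  obtain q where q: "q \<in> K_torus t" "q ** ?S ** transpose q \<in> Dg"
    using diagonalization[OF _ g(2) t] by (auto simp: matrix_transpose_mul)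
  have "posdef ?S" using posdef_gram[of "transpose g"] g(1) by (simp add: transpose_invertible)
  then have pd: "posdef (q ** ?S ** transpose q)" using q K_torusD(3) posdef_conj by blast
  define s where "s = (\<chi> i. (q ** ?S ** transpose q) $ i $ i)"
  have s: "q ** ?S ** transpose q = diag s" unfolding s_def by (rule Dg_eq_diag[OF q(2)])
  have s0: "s $ i > 0" for i using posdef_nth[OF pd, of i] by (simp add: s_def)
  define a where "a = (\<chi> i. sqrt (s $ i))"
  define a' where "a' = (\<chi> i. inverse (a $ i))"
  have a0: "a $ i > 0" for i using s0 by (simp add: a_def)
  have aa: "diag a' ** diag a = mat 1" using a0
    by (simp add: a'_def diag_mult less_imp_neq[THEN not_sym] flip: diag_1)
  define k where "k = g ** transpose q ** diag a'"
  have "transpose k ** k = diag a' ** (q ** ?S ** transpose q) ** diag a'"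
    by (simp add: k_def matrix_transpose_mul matrix_mul_assoc transpose_diag)
  also have "\<dots> = mat 1"
    using a0 s0 unfolding s diag_mult
    by (simp add: a'_def a_def vec_eq_iff diag_nth mat_def field_simps less_imp_neq[THEN not_sym]
        real_sqrt_mult[symmetric] abs_of_pos)
  finally have "orthogonal_matrix k" by (simp add: orthogonal_matrix)
  moreover have "k ** diag a ** q = g ** (transpose q ** (diag a' ** diag a) ** q)"
    by (simp only: k_def matrix_mul_assoc)
  then have "g = k ** diag a ** q" by (simp add: aa K_torusD(6)[OF q(1)])
  ultimately show ?thesis using that q(1) a0 by blast
qed

text \<open>When \<open>g\<close> lies in the group, so does \<open>k\<close>, being the quotient of
  \<open>g\<close> by \<open>diag a ** q\<close>.\<close>

lemma svd_G_torus:
  fixes g :: "real^'n^'n"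
  assumes g: "g \<in> G_torus t" and t: "t \<subseteq> Dg"
  obtains k a q where "k \<in> K_torus t" "q \<in> K_torus t" "\<And>i. a $ i > 0" "g = k ** diag a ** q"
proof -
  note gD = G_torusD[OF g]
  have "commutes (transpose g ** g) t"
    using gD commutes_transpose[OF t] commutes_mult by blast
  from svd[OF gD(1) this t] obtain k a q where
    *: "orthogonal_matrix k" "q \<in> K_torus t" "\<And>i. a $ i > 0" "g = k ** diag a ** q" by blast
  have h: "diag a ** q \<in> G_torus t" using * diag_G_torus[OF t] G_torus_mult K_torusD(1) by blast
  have "g ** matrix_inv (diag a ** q) = k ** ((diag a ** q) ** matrix_inv (diag a ** q))"
    using *(4) by (simp only: matrix_mul_assoc)
  also have "\<dots> = k" by (simp add: matrix_inv G_torusD(1)[OF h])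
  finally have "k \<in> G_torus t" using G_torus_mult[OF g G_torus_inv[OF h]] by simp
  then have "k \<in> K_torus t" using *(1) by (simp add: K_torus_def)
  then show ?thesis using that * by blast
qed

subsection \<open>Characters of the centralizer\<close>

definition eigen_proj :: "real^'n^'n \<Rightarrow> real \<Rightarrow> real^'n^'n" where
  "eigen_proj D l = diag (\<chi> i. if D $ i $ i = l then 1 else 0)"

text \<open>For \<open>g\<close> commuting with \<open>D\<close> this is the determinant of
  \<open>g\<close> on the \<open>l\<close>-eigenspace, completed by the identity elsewhere so that a
  determinant of full size can be used.\<close>

definition eigen_det :: "real^'n^'n \<Rightarrow> real \<Rightarrow> real^'n^'n \<Rightarrow> real" where
  "eigen_det D l g = det (eigen_proj D l ** g + (mat 1 - eigen_proj D l))"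

text \<open>The character whose differential at the identity is \<open>E \<mapsto> tr (D E)\<close>.\<close>
definition chi :: "real^'n^'n \<Rightarrow> real^'n^'n \<Rightarrow> real" where
  "chi D g = (\<Sum>l\<in>range (\<lambda>i. D $ i $ i). l * ln \<bar>eigen_det D l g\<bar>)"

lemma eigen_proj:
  "eigen_proj D l ** eigen_proj D l = eigen_proj D l"
  "transpose (eigen_proj D l) = eigen_proj D l"
  by (simp_all add: eigen_proj_def diag_mult transpose_diag vec_eq_iff diag_nth)

lemma eigen_proj_commute:
  assumes "D \<in> Dg" "g ** D = D ** g"
  shows "g ** eigen_proj D l = eigen_proj D l ** g"
  using assms(2) unfolding commute_Dg_iff[OF assms(1)] eigen_proj_def
  by (auto simp: vec_eq_iff diag_mult_nth) metis+

lemma matrix_mult_add_diff: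
  fixes A B C :: "real^'n^'n"
  shows "(A + B) ** C = A ** C + B ** C" "A ** (B + C) = A ** B + A ** C"
    "(A - B) ** C = A ** C - B ** C" "A ** (B - C) = A ** B - A ** C"
  by (simp_all add: vec_eq_iff matrix_matrix_mult_def algebra_simps sum.distrib sum_subtractf)

text \<open>The projection commutes with \<open>g\<close> and is idempotent, so the mixed terms
  contain \<open>P (1 - P) = 0\<close>.\<close>

lemma eigen_factor_mult:
  assumes "D \<in> Dg" "g ** D = D ** g"
  shows "eigen_proj D l ** (g ** h) + (mat 1 - eigen_proj D l) =
    (eigen_proj D l ** g + (mat 1 - eigen_proj D l)) ** (eigen_proj D l ** h + (mat 1 - eigen_proj D l))"
proof -
  let ?P = "eigen_proj D l"
  have 1: "?P ** g ** (?P ** h) = ?P ** (g ** h)"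
    using eigen_proj_commute[OF assms] eigen_proj(1) by (metis matrix_mul_assoc)
  have 2: "?P ** g ** ?P = ?P ** g"
    using eigen_proj_commute[OF assms] eigen_proj(1) by (metis matrix_mul_assoc)
  have 3: "?P ** (?P ** h) = ?P ** h" by (metis matrix_mul_assoc eigen_proj(1))
  show ?thesis
    by (simp add: matrix_mult_add_diff 1 2 3
        eigen_proj(1))
qed

lemma eigen_det_mult:
  "D \<in> Dg \<Longrightarrow> g ** D = D ** g \<Longrightarrow> eigen_det D l (g ** h) = eigen_det D l g * eigen_det D l h"
  by (simp add: eigen_det_def eigen_factor_mult det_mul)

lemma eigen_det_1: "eigen_det D l (mat 1) = 1"
  by (simp add: eigen_det_def)

lemma eigen_det_nonzero:
  assumes "D \<in> Dg" "g ** D = D ** g" "invertible g"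
  shows "eigen_det D l g \<noteq> 0"
  using eigen_det_mult[OF assms(1,2), of l "matrix_inv g"] matrix_inv[OF assms(3)] eigen_det_1[of D l]
  by auto

lemma chi_mult:
  assumes "D \<in> Dg" "g ** D = D ** g" "invertible g" "h ** D = D ** h" "invertible h"
  shows "chi D (g ** h) = chi D g + chi D h"
  unfolding chi_def
  using eigen_det_nonzero[OF assms(1,2,3)] eigen_det_nonzero[OF assms(1,4,5)]
  by (simp add: eigen_det_mult[OF assms(1,2)] abs_mult ln_mult sum.distrib[symmetric] algebra_simps)

lemma transpose_add_diff:
  fixes A B :: "real^'n^'m"
  shows "transpose (A + B) = transpose A + transpose B" "transpose (A - B) = transpose A - transpose B"
  by (simp_all add: vec_eq_iff transpose_def)

text \<open>Each block of an orthogonal operator is again orthogonal and has determinant of modulus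
  one. Hence only the diagonal factor of a decomposition \<open>k a q\<close> contributes to
  \<open>chi D\<close>.\<close>

lemma chi_orthogonal:
  assumes "D \<in> Dg" "k ** D = D ** k" "orthogonal_matrix k"
  shows "chi D k = 0"
proof -
  have "\<bar>eigen_det D l k\<bar> = 1" for l
  proof -
    let ?P = "eigen_proj D l"
    have kT: "transpose k ** D = D ** transpose k"
      using assms(2) by (auto simp: commute_Dg_iff[OF assms(1)] transpose_def)
    have "transpose (?P ** k + (mat 1 - ?P)) = ?P ** transpose k + (mat 1 - ?P)"
      using eigen_proj_commute[OF assms(1) kT]
      by (simp add: transpose_add_diff matrix_transpose_mul eigen_proj(2))
    then have "(transpose (?P ** k + (mat 1 - ?P))) ** (?P ** k + (mat 1 - ?P)) = mat 1"
      using eigen_factor_mult[OF assms(1) kT, of l k] orthogonal_inv(3)[OF assms(3)] by simp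
    then have "orthogonal_matrix (?P ** k + (mat 1 - ?P))" by (simp add: orthogonal_matrix)
    then show ?thesis using det_orthogonal_matrix by (fastforce simp: eigen_det_def)
  qed
  then show ?thesis by (simp add: chi_def)
qed

lemma chi_diag:
  assumes "\<And>i. a $ i > 0"
  shows "chi D (diag a) = (\<Sum>i\<in>UNIV. D $ i $ i * ln (a $ i))"
proof -
  let ?d = "\<lambda>i. D $ i $ i"
  have "eigen_det D l (diag a) = (\<Prod>i\<in>{i. ?d i = l}. a $ i)" for l
  proof -
    have "eigen_det D l (diag a) = (\<Prod>i\<in>UNIV. if ?d i = l then a $ i else 1)"
      unfolding eigen_det_def
      by (subst det_diagonal) (auto simp: eigen_proj_def diag_mult diag_nth mat_def intro!: prod.cong)
    then show ?thesis by (simp add: prod.If_cases)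
  qed
  then have "chi D (diag a) = (\<Sum>l\<in>range ?d. l * ln (\<Prod>i\<in>{i. ?d i = l}. a $ i))"
    using assms by (simp add: chi_def abs_prod less_imp_le)
  also have "\<dots> = (\<Sum>l\<in>range ?d. \<Sum>i\<in>{i. ?d i = l}. ?d i * ln (a $ i))"
    using assms by (intro sum.cong refl, subst ln_prod)
      (auto simp: sum_distrib_left less_imp_neq[THEN not_sym])
  also have "\<dots> = (\<Sum>i\<in>UNIV. ?d i * ln (a $ i))"
    using sum.image_gen[of UNIV "\<lambda>i. ?d i * ln (a $ i)" ?d] by simp
  finally show ?thesis .
qed

subsection \<open>Structure constants and the moment map\<close>

definition sc :: "(real^'n \<Rightarrow> real^'n \<Rightarrow> real^'n) \<Rightarrow> 'n \<Rightarrow> 'n \<Rightarrow> 'n \<Rightarrow> real" where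
  "sc \<mu> i j k = \<mu> (axis i 1) (axis j 1) $ k"

definition wt :: "real^'n \<Rightarrow> 'n \<Rightarrow> 'n \<Rightarrow> 'n \<Rightarrow> real" where
  "wt x i j k = x $ k - x $ i - x $ j"

abbreviation nV :: "(real^'n \<Rightarrow> real^'n \<Rightarrow> real^'n) \<Rightarrow> real" where
  "nV \<mu> \<equiv> inner_V \<mu> \<mu>"

text \<open>The moment map multiplied by the squared norm of \<open>\<mu>\<close>. It is polynomial
  in the structure constants, hence continuous without excluding zero. Only the first sum is halved:
  the sums run over ordered pairs, and the two argument slots contribute equally to the
  second.\<close>

definition momentM :: "(real^'n \<Rightarrow> real^'n \<Rightarrow> real^'n) \<Rightarrow> real^'n^'n" where
  "momentM \<mu> = (\<chi> a b. (\<Sum>i\<in>UNIV. \<Sum>j\<in>UNIV. sc \<mu> i j a * sc \<mu> i j b) / 2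
     - (\<Sum>j\<in>UNIV. \<Sum>k\<in>UNIV. sc \<mu> a j k * sc \<mu> b j k))"

lemma structure_constants_nth: "structure_constants \<mu> $ i $ j $ k = sc \<mu> i j k"
  by (simp add: structure_constants_def sc_def)

lemma vec_expand: "x = (\<Sum>i\<in>UNIV. x $ i *\<^sub>R axis i 1)" for x :: "real^'n"
  using basis_expansion[of x] by (simp add: scalar_mult_eq_scaleR)

lemma V_D:
  assumes "\<mu> \<in> V"
  shows "bilinear \<mu>" "\<mu> x x = 0" "\<mu> x y = - \<mu> y x"
proof -
  show b: "bilinear \<mu>" "\<mu> x x = 0" using assms by (auto simp: V_def)
  have z: "\<mu> z z = 0" for z using assms by (auto simp: V_def)
  have "\<mu> (x + y) (x + y) = \<mu> x x + \<mu> x y + (\<mu> y x + \<mu> y y)"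
    by (simp add: bilinear_ladd[OF b(1)] bilinear_radd[OF b(1)])
  then show "\<mu> x y = - \<mu> y x" using z by (simp add: eq_neg_iff_add_eq_0)
qed

lemma bilinear_expand:
  assumes "bilinear (B :: real^'n \<Rightarrow> real^'m \<Rightarrow> 'a::real_vector)"
  shows "B x y = (\<Sum>i\<in>UNIV. \<Sum>j\<in>UNIV. (x $ i * y $ j) *\<^sub>R B (axis i 1) (axis j 1))"
proof -
  have l: "linear (\<lambda>x. B x y)" "linear (B x)" for x y using assms by (auto simp: bilinear_def)
  have "B x y = (\<Sum>i\<in>UNIV. x $ i *\<^sub>R B (axis i 1) y)"
    by (subst vec_expand[of x]) (simp add: linear_sum[OF l(1)] linear_scale[OF l(1)])
  moreover have "B (axis i 1) y = (\<Sum>j\<in>UNIV. y $ j *\<^sub>R B (axis i 1) (axis j 1))" for i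
    by (subst vec_expand[of y]) (simp add: linear_sum[OF l(2)] linear_scale[OF l(2)])
  then have "x $ i *\<^sub>R B (axis i 1) y = (\<Sum>j\<in>UNIV. (x $ i * y $ j) *\<^sub>R B (axis i 1) (axis j 1))" for i
    by (metis (no_types, lifting) scaleR_scaleR scaleR_sum_right sum.cong)
  ultimately show ?thesis by simp
qed

lemma V_expand:
  assumes "\<mu> \<in> V"
  shows "\<mu> x y $ k = (\<Sum>i\<in>UNIV. \<Sum>j\<in>UNIV. x $ i * y $ j * sc \<mu> i j k)"
  by (subst bilinear_expand[OF V_D(1)[OF assms]]) (simp add: sc_def)

lemma V_eqI:
  assumes "\<mu> \<in> V" "\<nu> \<in> V" "\<And>i j k. sc \<mu> i j k = sc \<nu> i j k"
  shows "\<mu> = \<nu>"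
  by (intro ext) (simp add: vec_eq_iff V_expand[OF assms(1)] V_expand[OF assms(2)] assms(3))

lemma sc_antisym: "\<mu> \<in> V \<Longrightarrow> sc \<mu> j i k = - sc \<mu> i j k"
  unfolding sc_def by (subst V_D(3)) simp_all

lemma inner_V_sc: "inner_V \<mu> \<nu> = (\<Sum>i\<in>UNIV. \<Sum>j\<in>UNIV. \<Sum>k\<in>UNIV. sc \<mu> i j k * sc \<nu> i j k) / 2"
  by (simp add: inner_V_def sc_def)

lemma inner_V_frame:
  "inner_V \<mu> \<nu> = (\<Sum>i\<in>UNIV. \<Sum>j\<in>UNIV. \<mu> (axis i 1) (axis j 1) \<bullet> \<nu> (axis i 1) (axis j 1)) / 2"
  by (simp add: inner_V_def inner_vec_def)

lemma nV_ge_0: "nV \<mu> \<ge> 0"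
  unfolding inner_V_frame by (intro divide_nonneg_pos sum_nonneg) auto

lemma V_0 [simp]: "(\<lambda>x y. 0) \<in> V"
  by (auto simp: V_def bilinear_def intro!: linearI)

lemma nV_eq_0:
  assumes "\<mu> \<in> V"
  shows "nV \<mu> = 0 \<longleftrightarrow> \<mu> = (\<lambda>x y. 0)"
proof
  assume "nV \<mu> = 0"
  then have "\<mu> (axis i 1) (axis j 1) = 0" for i j
    unfolding inner_V_frame by (simp add: sum_nonneg_eq_0_iff sum_nonneg)
  then show "\<mu> = (\<lambda>x y. 0)" by (intro V_eqI assms) (simp_all add: sc_def)
qed (simp add: inner_V_def)

lemma nV_pos: "\<mu> \<in> V \<Longrightarrow> \<mu> \<noteq> (\<lambda>x y. 0) \<Longrightarrow> nV \<mu> > 0"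
  using nV_eq_0 nV_ge_0 by (metis less_le)

lemma sum_rotate3:
  "(\<Sum>i\<in>A. \<Sum>j\<in>B. \<Sum>k\<in>C. f i j k) = (\<Sum>k\<in>C. \<Sum>i\<in>A. \<Sum>j\<in>B. f i j k)"
  by (subst sum.swap[of _ C B]) (rule sum.swap)

lemma sum_rotate4:
  "(\<Sum>i\<in>A. \<Sum>j\<in>B. \<Sum>k\<in>C. \<Sum>l\<in>D. f i j k l) = (\<Sum>k\<in>C. \<Sum>l\<in>D. \<Sum>i\<in>A. \<Sum>j\<in>B. f i j k l)"
  by (rule trans[OF sum_rotate3 sum.cong[OF refl sum_rotate3]])

lemma momentM_pair:
  assumes V: "\<mu> \<in> V"
  shows "inner_V (gl_act E \<mu>) \<mu> = momentM \<mu> \<bullet> E"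
proof -
  have l: "linear (\<lambda>x. \<mu> x y)" "linear (\<mu> x)" for x y using V_D(1)[OF V] by (auto simp: bilinear_def)
  have col: "E *v axis i 1 = (\<Sum>l\<in>UNIV. E $ l $ i *\<^sub>R axis l 1)" for i
    by (subst vec_expand) (simp add: matrix_vector_mult_basis column_def)
  have gl: "sc (gl_act E \<mu>) i j k = (\<Sum>l\<in>UNIV. E $ k $ l * sc \<mu> i j l)
      - (\<Sum>l\<in>UNIV. E $ l $ i * sc \<mu> l j k) - (\<Sum>l\<in>UNIV. E $ l $ j * sc \<mu> i l k)" for i j k
    unfolding sc_def gl_act_def col
    by (simp add: linear_sum[OF l(1)] linear_scale[OF l(1)] linear_sum[OF l(2)] linear_scale[OF l(2)])
      (simp add: matrix_vector_mult_def)
  \<comment> \<open>Antisymmetry makes the two argument slots contribute equally, which cancels the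
    factor 1/2 of \<open>inner_V\<close>.\<close>
  have t: "(\<Sum>i\<in>UNIV. \<Sum>j\<in>UNIV. \<Sum>k\<in>UNIV. \<Sum>l\<in>UNIV. E $ l $ j * sc \<mu> i l k * sc \<mu> i j k)
      = (\<Sum>i\<in>UNIV. \<Sum>j\<in>UNIV. \<Sum>k\<in>UNIV. \<Sum>l\<in>UNIV. E $ l $ i * sc \<mu> l j k * sc \<mu> i j k)"
  proof -
    have "E $ l $ j * sc \<mu> i l k * sc \<mu> i j k = E $ l $ j * sc \<mu> l i k * sc \<mu> j i k" for i j k l
      using sc_antisym[OF V, of l i k] sc_antisym[OF V, of j i k] by simp
    then have "(\<Sum>i\<in>UNIV. \<Sum>j\<in>UNIV. \<Sum>k\<in>UNIV. \<Sum>l\<in>UNIV. E $ l $ j * sc \<mu> i l k * sc \<mu> i j k)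
      = (\<Sum>i\<in>UNIV. \<Sum>j\<in>UNIV. \<Sum>k\<in>UNIV. \<Sum>l\<in>UNIV. E $ l $ j * sc \<mu> l i k * sc \<mu> j i k)"
      by (intro sum.cong refl)
    also have "\<dots> = (\<Sum>i\<in>UNIV. \<Sum>j\<in>UNIV. \<Sum>k\<in>UNIV. \<Sum>l\<in>UNIV. E $ l $ i * sc \<mu> l j k * sc \<mu> i j k)"
      by (rule sum.swap)
    finally show ?thesis .
  qed
  have u: "(\<Sum>i\<in>UNIV. \<Sum>j\<in>UNIV. \<Sum>k\<in>UNIV. \<Sum>l\<in>UNIV. E $ l $ i * sc \<mu> l j k * sc \<mu> i j k)
      = (\<Sum>a\<in>UNIV. \<Sum>b\<in>UNIV. (\<Sum>j\<in>UNIV. \<Sum>k\<in>UNIV. sc \<mu> a j k * sc \<mu> b j k) * E $ a $ b)"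
  proof -
    have "(\<Sum>i\<in>UNIV. \<Sum>j\<in>UNIV. \<Sum>k\<in>UNIV. \<Sum>l\<in>UNIV. E $ l $ i * sc \<mu> l j k * sc \<mu> i j k)
        = (\<Sum>i\<in>UNIV. \<Sum>l\<in>UNIV. \<Sum>j\<in>UNIV. \<Sum>k\<in>UNIV. E $ l $ i * sc \<mu> l j k * sc \<mu> i j k)"
      by (intro sum.cong refl sum_rotate3)
    also have "\<dots> = (\<Sum>l\<in>UNIV. \<Sum>i\<in>UNIV. \<Sum>j\<in>UNIV. \<Sum>k\<in>UNIV. E $ l $ i * sc \<mu> l j k * sc \<mu> i j k)"
      by (rule sum.swap)
    finally show ?thesis by (simp add: sum_distrib_left sum_distrib_right mult_ac)
  qed
  have v: "(\<Sum>i\<in>UNIV. \<Sum>j\<in>UNIV. \<Sum>k\<in>UNIV. \<Sum>l\<in>UNIV. E $ k $ l * sc \<mu> i j l * sc \<mu> i j k)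
      = (\<Sum>a\<in>UNIV. \<Sum>b\<in>UNIV. (\<Sum>i\<in>UNIV. \<Sum>j\<in>UNIV. sc \<mu> i j a * sc \<mu> i j b) * E $ a $ b)"
  proof -
    have "(\<Sum>i\<in>UNIV. \<Sum>j\<in>UNIV. \<Sum>k\<in>UNIV. \<Sum>l\<in>UNIV. E $ k $ l * sc \<mu> i j l * sc \<mu> i j k)
        = (\<Sum>k\<in>UNIV. \<Sum>i\<in>UNIV. \<Sum>j\<in>UNIV. \<Sum>l\<in>UNIV. E $ k $ l * sc \<mu> i j l * sc \<mu> i j k)"
      by (rule sum_rotate3)
    also have "\<dots> = (\<Sum>k\<in>UNIV. \<Sum>l\<in>UNIV. \<Sum>i\<in>UNIV. \<Sum>j\<in>UNIV. E $ k $ l * sc \<mu> i j l * sc \<mu> i j k)"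
      by (intro sum.cong refl sum_rotate3)
    finally show ?thesis by (simp add: sum_distrib_left sum_distrib_right mult_ac)
  qed
  have "inner_V (gl_act E \<mu>) \<mu> =
    ((\<Sum>i\<in>UNIV. \<Sum>j\<in>UNIV. \<Sum>k\<in>UNIV. \<Sum>l\<in>UNIV. E $ k $ l * sc \<mu> i j l * sc \<mu> i j k)
     - (\<Sum>i\<in>UNIV. \<Sum>j\<in>UNIV. \<Sum>k\<in>UNIV. \<Sum>l\<in>UNIV. E $ l $ i * sc \<mu> l j k * sc \<mu> i j k)
     - (\<Sum>i\<in>UNIV. \<Sum>j\<in>UNIV. \<Sum>k\<in>UNIV. \<Sum>l\<in>UNIV. E $ l $ j * sc \<mu> i l k * sc \<mu> i j k)) / 2"
    unfolding inner_V_sc gl by (simp add: left_diff_distrib sum_subtractf sum_distrib_right)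
  also have "\<dots> = momentM \<mu> \<bullet> E"
    unfolding t u v momentM_def
    by (simp add: inner_vec_def left_diff_distrib sum_subtractf sum_divide_distrib[symmetric] diff_divide_distrib)
  finally show ?thesis .
qed

lemma momentM_sym: "transpose (momentM \<mu>) = momentM \<mu>"
  by (simp add: transpose_def momentM_def vec_eq_iff mult.commute)

lemma trace_inner: "trace (M ** transpose E) = M \<bullet> E" for M E :: "real^'n^'n"
  by (simp add: trace_def matrix_matrix_mult_def transpose_def inner_vec_def)

lemma moment_eq:
  assumes "\<mu> \<in> V"
  shows "moment \<mu> = (1 / nV \<mu>) *\<^sub>R momentM \<mu>"
  unfolding moment_def
proof (rule the1_equality[OF moment_ex1[OF V_D(1)[OF assms]]])
  have "(1 / nV \<mu>) *\<^sub>R momentM \<mu> \<in> sym_ops"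
    using momentM_sym[of \<mu>] by (simp add: sym_ops_def transpose_scalar)
  moreover have "trace ((1 / nV \<mu>) *\<^sub>R momentM \<mu> ** transpose E) = inner_V (gl_act E \<mu>) \<mu> / nV \<mu>" for E
    unfolding trace_inner momentM_pair[OF assms] by simp
  ultimately show "(1 / nV \<mu>) *\<^sub>R momentM \<mu> \<in> sym_ops \<and> (\<forall>E\<in>sym_ops.
      trace ((1 / nV \<mu>) *\<^sub>R momentM \<mu> ** transpose E) = inner_V (gl_act E \<mu>) \<mu> / nV \<mu>)"
    by blast
qed

subsection \<open>The action of invertible operators\<close>

lemma GL_act_V:
  assumes "\<mu> \<in> V"
  shows "GL_act h \<mu> \<in> V"
  using V_D(1,2)[OF assms] unfolding V_def GL_act_def
  by (auto simp: bilinear_def bilinear_ladd bilinear_radd bilinear_lmul bilinear_rmul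
      matrix_vector_right_distrib matrix_vector_mult_scaleR intro!: linearI)

lemma GL_act_mult:
  assumes "invertible g" "invertible h"
  shows "GL_act (g ** h) \<mu> = GL_act g (GL_act h \<mu>)"
  unfolding GL_act_def by (simp add: matrix_inv_mult[OF assms] matrix_vector_mul_assoc)

lemma matrix_inv_1: "matrix_inv (mat 1 :: real^'n^'n) = mat 1"
  by (rule matrix_inv_unique) simp

lemma GL_act_1 [simp]: "GL_act (mat 1) \<mu> = \<mu>"
  by (simp add: GL_act_def matrix_inv_1)

lemma GL_act_inv: "invertible h \<Longrightarrow> GL_act (matrix_inv h) (GL_act h \<mu>) = \<mu>"
  by (simp add: GL_act_mult[symmetric] invertible_matrix_inv matrix_inv)

lemma GL_act_eq_0:
  assumes "invertible h" "GL_act h \<mu> = (\<lambda>x y. 0)"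
  shows "\<mu> = (\<lambda>x y. 0)"
proof -
  have "\<mu> = GL_act (matrix_inv h) (\<lambda>x y. 0)" using GL_act_inv[OF assms(1), of \<mu>] assms(2) by simp
  then show ?thesis by (simp add: GL_act_def)
qed

lemma sc_GL_act:
  assumes "\<mu> \<in> V"
  shows "sc (GL_act h \<mu>) i j k = (\<Sum>c\<in>UNIV. h $ k $ c *
    (\<Sum>a\<in>UNIV. \<Sum>b\<in>UNIV. matrix_inv h $ a $ i * matrix_inv h $ b $ j * sc \<mu> a b c))"
proof -
  have "(matrix_inv h *v axis i 1) $ a = matrix_inv h $ a $ i" for i a
    by (simp add: matrix_vector_mult_basis column_def)
  then have "\<mu> (matrix_inv h *v axis i 1) (matrix_inv h *v axis j 1) $ c =
      (\<Sum>a\<in>UNIV. \<Sum>b\<in>UNIV. matrix_inv h $ a $ i * matrix_inv h $ b $ j * sc \<mu> a b c)" for c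
    by (simp only: V_expand[OF assms])
  moreover have "(h *v w) $ k = (\<Sum>c\<in>UNIV. h $ k $ c * w $ c)" for w
    by (simp add: matrix_vector_mult_def)
  ultimately show ?thesis unfolding sc_def[of "GL_act h \<mu>"] by (simp only: GL_act_def)
qed

lemma sc_GL_act_orthogonal:
  assumes "\<mu> \<in> V" "orthogonal_matrix q"
  shows "sc (GL_act q \<mu>) i j k = (\<Sum>c\<in>UNIV. q $ k $ c *
    (\<Sum>a\<in>UNIV. \<Sum>b\<in>UNIV. q $ i $ a * q $ j $ b * sc \<mu> a b c))"
  by (simp add: sc_GL_act[OF assms(1)] orthogonal_inv[OF assms(2)] transpose_def)

lemma diag_axis: "diag x *v axis i 1 = x $ i *\<^sub>R axis i 1"
  by (simp add: vec_eq_iff diag_vec_nth axis_def)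

lemma sc_GL_act_diag:
  assumes "\<mu> \<in> V" "\<And>i. a $ i > 0"
  shows "sc (GL_act (diag a) \<mu>) i j k = a $ k / (a $ i * a $ j) * sc \<mu> i j k"
proof -
  have "matrix_inv (diag a) = diag (\<chi> i. inverse (a $ i))"
    using assms(2) by (intro invertible_diag(2)) (metis less_irrefl)
  moreover have "linear (\<lambda>x. \<mu> x y)" "linear (\<mu> x)" for x y using V_D(1)[OF assms(1)] by (auto simp: bilinear_def)
  ultimately show ?thesis
    by (simp add: sc_def GL_act_def diag_axis diag_vec_nth linear_scale[of "\<lambda>x. \<mu> x _"] linear_scale[of "\<mu> _"]
        field_simps)
qed

definition ediag :: "real^'n \<Rightarrow> real^'n^'n" where
  "ediag x = diag (\<chi> i. exp (x $ i))"

lemma sc_ediag: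
  assumes "\<mu> \<in> V"
  shows "sc (GL_act (ediag x) \<mu>) i j k = exp (wt x i j k) * sc \<mu> i j k"
  unfolding ediag_def by (subst sc_GL_act_diag[OF assms]) (simp_all add: wt_def exp_diff)

lemma nV_ediag:
  assumes "\<mu> \<in> V"
  shows "nV (GL_act (ediag x) \<mu>) =
    (\<Sum>i\<in>UNIV. \<Sum>j\<in>UNIV. \<Sum>k\<in>UNIV. exp (2 * wt x i j k) * (sc \<mu> i j k)\<^sup>2) / 2"
proof -
  have "exp (wt x i j k) * sc \<mu> i j k * (exp (wt x i j k) * sc \<mu> i j k)
    = exp (2 * wt x i j k) * (sc \<mu> i j k)\<^sup>2" for i j k
  proof -
    have "exp (2 * wt x i j k) = exp (wt x i j k) * exp (wt x i j k)" by (simp flip: exp_add)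
    then show ?thesis by (simp add: power2_eq_square)
  qed
  then show ?thesis by (simp add: inner_V_sc sc_ediag[OF assms])
qed

lemma ediag_mult_ediag: "ediag x ** ediag y = ediag (x + y)"
  by (simp add: ediag_def diag_mult exp_add vec_eq_iff diag_nth)

lemma transpose_ediag: "transpose (ediag x) = ediag x"
  by (simp add: ediag_def transpose_diag)

lemma ediag_G_torus: "t \<subseteq> Dg \<Longrightarrow> ediag x \<in> G_torus t"
  unfolding ediag_def by (rule diag_G_torus) auto

lemma chi_ediag: "chi D (ediag x) = (\<Sum>i\<in>UNIV. D $ i $ i * x $ i)"
  unfolding ediag_def by (subst chi_diag) auto

lemma momentM_diag:
  assumes "\<mu> \<in> V"
  shows "(\<Sum>i\<in>UNIV. x $ i * momentM \<mu> $ i $ i) =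
    (\<Sum>i\<in>UNIV. \<Sum>j\<in>UNIV. \<Sum>k\<in>UNIV. wt x i j k * (sc \<mu> i j k)\<^sup>2) / 2"
proof -
  have "linear (\<lambda>x. \<mu> x y)" "linear (\<mu> x)" for x y using V_D(1)[OF assms] by (auto simp: bilinear_def)
  then have "sc (gl_act (diag x) \<mu>) i j k = wt x i j k * sc \<mu> i j k" for i j k
    by (simp add: sc_def gl_act_def diag_vec_nth wt_def diag_axis linear_scale[of "\<lambda>x. \<mu> x _"]
        linear_scale[of "\<mu> _"] algebra_simps)
  then have "inner_V (gl_act (diag x) \<mu>) \<mu> =
      (\<Sum>i\<in>UNIV. \<Sum>j\<in>UNIV. \<Sum>k\<in>UNIV. wt x i j k * (sc \<mu> i j k)\<^sup>2) / 2"
    by (simp add: inner_V_sc power2_eq_square mult.assoc)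
  moreover have "momentM \<mu> \<bullet> diag x = (\<Sum>i\<in>UNIV. x $ i * momentM \<mu> $ i $ i)"
    by (simp add: inner_vec_def diag_nth if_distrib[of "\<lambda>x. _ * x"] mult.commute cong: if_cong)
  ultimately show ?thesis using momentM_pair[OF assms, of "diag x"] by simp
qed

text \<open>The sum-of-squares form in which the moment map occurs in the Ricci curvature.\<close>

lemma momentM_quadratic:
  assumes "\<mu> \<in> V"
  shows "y \<bullet> (momentM \<mu> *v y) = (\<Sum>i\<in>UNIV. \<Sum>j\<in>UNIV. (\<mu> (axis i 1) (axis j 1) \<bullet> y)\<^sup>2) / 2
    - (\<Sum>j\<in>UNIV. \<mu> (axis j 1) y \<bullet> \<mu> (axis j 1) y)"
proof -
  have e1: "\<mu> (axis i 1) (axis j 1) \<bullet> y = (\<Sum>a\<in>UNIV. y $ a * sc \<mu> i j a)" for i j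
    by (simp add: inner_vec_def sc_def mult.commute)
  have e2: "\<mu> (axis j 1) y $ k = - (\<Sum>a\<in>UNIV. y $ a * sc \<mu> a j k)" for j k
  proof -
    have "\<mu> y (axis j 1) $ k = (\<Sum>a\<in>UNIV. y $ a * sc \<mu> a j k)"
      by (subst V_expand[OF assms])
        (simp add: axis_def if_distrib[of "\<lambda>x. x * _"] if_distrib[of "\<lambda>x. _ * x"] cong: if_cong)
    then show ?thesis using V_D(3)[OF assms, of "axis j 1" y] by simp
  qed
  have sq: "(\<Sum>a\<in>UNIV. y $ a * f a) * (\<Sum>a\<in>UNIV. y $ a * f a)
      = (\<Sum>a\<in>UNIV. \<Sum>b\<in>UNIV. y $ a * y $ b * (f a * f b))" for f :: "'a \<Rightarrow> real"
    by (simp add: sum_product mult_ac)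
  have "(\<Sum>i\<in>UNIV. \<Sum>j\<in>UNIV. (\<mu> (axis i 1) (axis j 1) \<bullet> y)\<^sup>2)
      = (\<Sum>a\<in>UNIV. \<Sum>b\<in>UNIV. y $ a * y $ b * (\<Sum>i\<in>UNIV. \<Sum>j\<in>UNIV. sc \<mu> i j a * sc \<mu> i j b))"
    unfolding e1 power2_eq_square sq
    by (subst sum_rotate4) (simp add: sum_distrib_left)
  moreover have "(\<Sum>j\<in>UNIV. \<mu> (axis j 1) y \<bullet> \<mu> (axis j 1) y)
      = (\<Sum>a\<in>UNIV. \<Sum>b\<in>UNIV. y $ a * y $ b * (\<Sum>j\<in>UNIV. \<Sum>k\<in>UNIV. sc \<mu> a j k * sc \<mu> b j k))"
  proof -
    have "\<mu> (axis j 1) y \<bullet> \<mu> (axis j 1) y =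
        (\<Sum>k\<in>UNIV. \<Sum>a\<in>UNIV. \<Sum>b\<in>UNIV. y $ a * y $ b * (sc \<mu> a j k * sc \<mu> b j k))" for j
      unfolding inner_vec_def e2 by (simp add: sq)
    then show ?thesis by (simp only: sum_distrib_left) (rule sum_rotate4)
  qed
  moreover have "y \<bullet> (momentM \<mu> *v y) = (\<Sum>a\<in>UNIV. \<Sum>b\<in>UNIV. y $ a * y $ b * momentM \<mu> $ a $ b)"
    by (simp add: inner_vec_def matrix_vector_mult_def sum_distrib_left mult_ac)
  moreover have "y $ a * y $ b * momentM \<mu> $ a $ b =
      y $ a * y $ b * (\<Sum>i\<in>UNIV. \<Sum>j\<in>UNIV. sc \<mu> i j a * sc \<mu> i j b) / 2
      - y $ a * y $ b * (\<Sum>j\<in>UNIV. \<Sum>k\<in>UNIV. sc \<mu> a j k * sc \<mu> b j k)" for a b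
    by (simp add: momentM_def right_diff_distrib)
  ultimately show ?thesis
    by (simp only: sum_subtractf sum_divide_distrib[symmetric])
qed

subsection \<open>Equivariance\<close>

text \<open>The expansion in the new frame collapses through
  \<open>transpose k ** k = mat 1\<close>. Applied to one argument slot after the other, this makes
  \<open>inner_V\<close> invariant under orthogonal operators.\<close>

lemma frame_sum:
  fixes B :: "real^'n \<Rightarrow> real^'n \<Rightarrow> real"
  assumes B: "bilinear B" and k: "orthogonal_matrix k"
  shows "(\<Sum>i\<in>UNIV. B (transpose k *v axis i 1) (transpose k *v axis i 1)) = (\<Sum>i\<in>UNIV. B (axis i 1) (axis i 1))"
proof -
  have "(\<Sum>i\<in>UNIV. B (transpose k *v axis i 1) (transpose k *v axis i 1))
     = (\<Sum>i\<in>UNIV. \<Sum>a\<in>UNIV. \<Sum>b\<in>UNIV. (k $ i $ a * k $ i $ b) * B (axis a 1) (axis b 1))"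
    by (subst bilinear_expand[OF B]) (simp add: matrix_vector_mult_basis column_def transpose_def)
  also have "\<dots> = (\<Sum>a\<in>UNIV. \<Sum>b\<in>UNIV. \<Sum>i\<in>UNIV. (k $ i $ a * k $ i $ b) * B (axis a 1) (axis b 1))"
    by (rule sum_rotate3[symmetric])
  also have "\<dots> = (\<Sum>a\<in>UNIV. \<Sum>b\<in>UNIV. (transpose k ** k) $ a $ b * B (axis a 1) (axis b 1))"
    by (simp add: matrix_matrix_mult_def transpose_def sum_distrib_right)
  also have "\<dots> = (\<Sum>i\<in>UNIV. B (axis i 1) (axis i 1))"
    using orthogonal_inv(3)[OF k] by (simp add: mat_def if_distrib[of "\<lambda>x. x * _"] cong: if_cong)
  finally show ?thesis .
qed

lemma orthogonal_inner: "orthogonal_matrix k \<Longrightarrow> (k *v x) \<bullet> (k *v y) = x \<bullet> y" for k :: "real^'n^'n"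
  by (metis dot_lmul_matrix matrix_vector_mul_assoc matrix_vector_mul_lid orthogonal_inv(3)
      transpose_matrix_vector transpose_transpose)

lemma bilinear_inner_compose:
  fixes f :: "'a::real_vector \<Rightarrow> 'c::real_inner" and g :: "'b::real_vector \<Rightarrow> 'c"
  assumes "linear f" "linear g"
  shows "bilinear (\<lambda>x y. f x \<bullet> g y)"
  unfolding bilinear_def
  by (auto intro!: linearI simp: linear_add[OF assms(1)] linear_add[OF assms(2)] linear_scale[OF assms(1)]
      linear_scale[OF assms(2)] inner_add_left inner_add_right)

lemma inner_V_orthogonal:
  assumes \<mu>: "bilinear \<mu>" and \<nu>: "bilinear \<nu>" and k: "orthogonal_matrix k"
  shows "inner_V (GL_act k \<mu>) (GL_act k \<nu>) = inner_V \<mu> \<nu>"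
proof -
  have l: "linear (\<lambda>x. \<mu> x y)" "linear (\<mu> x)" "linear (\<lambda>x. \<nu> x y)" "linear (\<nu> x)" for x y
    using \<mu> \<nu> by (auto simp: bilinear_def)
  let ?e = "\<lambda>i. transpose k *v axis i 1"
  have "(\<Sum>i\<in>UNIV. \<Sum>j\<in>UNIV. \<mu> (?e i) (?e j) \<bullet> \<nu> (?e i) (?e j))
     = (\<Sum>i\<in>UNIV. \<Sum>j\<in>UNIV. \<mu> (?e i) (axis j 1) \<bullet> \<nu> (?e i) (axis j 1))"
    by (intro sum.cong refl frame_sum bilinear_inner_compose l k)
  also have "\<dots> = (\<Sum>j\<in>UNIV. \<Sum>i\<in>UNIV. \<mu> (?e i) (axis j 1) \<bullet> \<nu> (?e i) (axis j 1))"
    by (rule sum.swap)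
  also have "\<dots> = (\<Sum>j\<in>UNIV. \<Sum>i\<in>UNIV. \<mu> (axis i 1) (axis j 1) \<bullet> \<nu> (axis i 1) (axis j 1))"
    by (intro sum.cong refl frame_sum[of "\<lambda>x y. \<mu> x (axis _ 1) \<bullet> \<nu> y (axis _ 1)"] bilinear_inner_compose l k)
  also have "\<dots> = (\<Sum>i\<in>UNIV. \<Sum>j\<in>UNIV. \<mu> (axis i 1) (axis j 1) \<bullet> \<nu> (axis i 1) (axis j 1))"
    by (rule sum.swap)
  finally show ?thesis
    by (simp add: inner_V_frame GL_act_def orthogonal_inv[OF k] orthogonal_inner[OF k])
qed

lemma gl_act_GL_act:
  assumes "invertible k"
  shows "gl_act E (GL_act k \<mu>) = GL_act k (gl_act (matrix_inv k ** E ** k) \<mu>)"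
proof -
  have 1: "k ** (matrix_inv k ** E ** k) = E ** k" "matrix_inv k ** E ** k ** matrix_inv k = matrix_inv k ** E"
    by (metis matrix_inv[OF assms] matrix_mul_assoc matrix_mul_lid matrix_mul_rid)+
  show ?thesis
    by (intro ext) (simp add: gl_act_def GL_act_def matrix_vector_mult_diff_distrib matrix_vector_mul_assoc 1)
qed

lemma gl_act_bilinear: "bilinear \<mu> \<Longrightarrow> bilinear (gl_act E \<mu>)"
  unfolding gl_act_def
  by (subst bilinear_def) (auto intro!: linearI simp: bilinear_ladd bilinear_radd bilinear_lmul bilinear_rmul
      matrix_vector_right_distrib matrix_vector_mult_scaleR algebra_simps)

lemma inner_conj: "M \<bullet> (transpose k ** E ** k) = (k ** M ** transpose k) \<bullet> E" for k :: "real^'n^'n"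
proof -
  have "M \<bullet> (transpose k ** E ** k) = trace ((M ** transpose k ** transpose E) ** k)"
    by (simp add: trace_inner[symmetric] matrix_transpose_mul matrix_mul_assoc)
  also have "\<dots> = trace (k ** (M ** transpose k ** transpose E))" by (rule trace_mul_sym)
  also have "\<dots> = (k ** M ** transpose k) \<bullet> E" by (simp add: trace_inner[symmetric] matrix_mul_assoc)
  finally show ?thesis .
qed

text \<open>Both sides have the same inner product with every \<open>E\<close>, because the action
  of \<open>E\<close> can be moved through \<open>GL_act k\<close> and \<open>inner_V\<close> is
  invariant.\<close>

lemma momentM_orthogonal:
  assumes V: "\<mu> \<in> V" and k: "orthogonal_matrix k"
  shows "momentM (GL_act k \<mu>) = k ** momentM \<mu> ** transpose k"
proof -
  have "momentM (GL_act k \<mu>) \<bullet> E = (k ** momentM \<mu> ** transpose k) \<bullet> E" for E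
  proof -
    have "momentM (GL_act k \<mu>) \<bullet> E = inner_V (GL_act k (gl_act (transpose k ** E ** k) \<mu>)) (GL_act k \<mu>)"
      using gl_act_GL_act[OF orthogonal_inv(2)[OF k], of E \<mu>] orthogonal_inv(1)[OF k]
      by (simp add: momentM_pair[OF GL_act_V[OF V], symmetric])
    also have "\<dots> = momentM \<mu> \<bullet> (transpose k ** E ** k)"
      using V_D(1)[OF V] by (simp add: inner_V_orthogonal k gl_act_bilinear momentM_pair[OF V])
    finally show ?thesis by (simp add: inner_conj)
  qed
  then show ?thesis by (metis vector_eq_rdot)
qed

lemma nV_orthogonal: "\<mu> \<in> V \<Longrightarrow> orthogonal_matrix k \<Longrightarrow> nV (GL_act k \<mu>) = nV \<mu>"
  by (simp add: inner_V_orthogonal V_D(1))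

lemma Der_GL_act:
  assumes "D \<in> Der b" "invertible h" "h ** D = D ** h"
  shows "D \<in> Der (GL_act h b)"
proof -
  have hD: "matrix_inv h ** D = D ** matrix_inv h"
    using commutes_inv[of h "{D}"] assms(2,3) by (auto simp: commutes_def)
  have *: "h *v (D *v x) = D *v (h *v x)" "D *v (matrix_inv h *v x) = matrix_inv h *v (D *v x)" for x
    by (simp_all add: matrix_vector_mul_assoc hD assms(3))
  have "D *v b x y = b (D *v x) y + b x (D *v y)" for x y using assms(1) by (auto simp: Der_def)
  then show ?thesis
    by (simp add: Der_def GL_act_def *(1)[symmetric] *(2)[symmetric] matrix_vector_right_distrib[symmetric])
qed

text \<open>The defect of the derivation rule for a diagonal operator multiplies each structure
  constant by its weight. Being a derivation thus depends only on the support of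
  \<open>\<mu>\<close>, which is why torus elements remain derivations of weight parts and of
  limits.\<close>

lemma Der_sc:
  assumes "\<mu> \<in> V" "D \<in> Dg"
  shows "D \<in> Der \<mu> \<longleftrightarrow> (\<forall>i j k. sc \<mu> i j k \<noteq> 0 \<longrightarrow> D $ k $ k = D $ i $ i + D $ j $ j)"
proof -
  define x where "x = (\<chi> i. D $ i $ i)"
  have D: "D = diag x" using Dg_eq_diag[OF assms(2)] by (simp add: x_def)
  have l: "linear (\<lambda>x. \<mu> x y)" "linear (\<mu> x)" for x y using V_D(1)[OF assms(1)] by (auto simp: bilinear_def)
  have "D \<in> Der \<mu> \<longleftrightarrow> (\<forall>i j k. (x $ k - x $ i - x $ j) * sc \<mu> i j k = 0)"
  proof
    assume "D \<in> Der \<mu>"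
    then have "D *v \<mu> (axis i 1) (axis j 1) = \<mu> (D *v axis i 1) (axis j 1) + \<mu> (axis i 1) (D *v axis j 1)" for i j
      by (auto simp: Der_def)
    then have "(D *v \<mu> (axis i 1) (axis j 1)) $ k = (\<mu> (D *v axis i 1) (axis j 1) + \<mu> (axis i 1) (D *v axis j 1)) $ k" for i j k
      by simp
    then show "\<forall>i j k. (x $ k - x $ i - x $ j) * sc \<mu> i j k = 0"
      unfolding D diag_axis by (simp add: linear_scale[OF l(1)] linear_scale[OF l(2)] diag_vec_nth sc_def algebra_simps)
  next
    assume *: "\<forall>i j k. (x $ k - x $ i - x $ j) * sc \<mu> i j k = 0"
    have "(D *v \<mu> u v) $ k = \<mu> (D *v u) v $ k + \<mu> u (D *v v) $ k" for u v k
    proof -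
      have "x $ k * (u $ i * v $ j * sc \<mu> i j k) =
          x $ i * u $ i * v $ j * sc \<mu> i j k + u $ i * (x $ j * v $ j) * sc \<mu> i j k" for i j
      proof -
        have "(x $ k - x $ i - x $ j) * sc \<mu> i j k = 0" using * by blast
        then have "u $ i * v $ j * ((x $ k - x $ i - x $ j) * sc \<mu> i j k) = 0" by simp
        then show ?thesis by (simp add: algebra_simps)
      qed
      then show ?thesis
        by (simp add: D diag_vec_nth V_expand[OF assms(1)] sum_distrib_left sum.distrib[symmetric])
    qed
    then show "D \<in> Der \<mu>" by (auto simp: Der_def vec_eq_iff)
  qed
  moreover have "((x $ k - x $ i - x $ j) * sc \<mu> i j k = 0) \<longleftrightarrow>
      (sc \<mu> i j k \<noteq> 0 \<longrightarrow> D $ k $ k = D $ i $ i + D $ j $ j)" for i j k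
    by (auto simp: x_def)
  ultimately show ?thesis by simp
qed

text \<open>On the support of \<open>\<mu>\<close>, the value of \<open>D\<close> at one index is
  determined by the values at the other two. If \<open>D\<close> differs at \<open>a\<close> and
  \<open>b\<close>, every product in the entry \<open>(a, b)\<close> therefore has a vanishing
  factor.\<close>

lemma momentM_commutes:
  assumes "\<mu> \<in> V" "t \<subseteq> Dg" "t \<subseteq> Der \<mu>"
  shows "commutes (momentM \<mu>) t"
  unfolding commutes_nth[OF assms(2)]
proof (intro ballI allI impI)
  fix D a b assume D: "D \<in> t" and nz: "momentM \<mu> $ a $ b \<noteq> 0"
  have w: "D $ k $ k = D $ i $ i + D $ j $ j" if "sc \<mu> i j k \<noteq> 0" for i j k
    using D assms Der_sc[OF assms(1), of D] that by blast
  show "D $ a $ a = D $ b $ b"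
  proof (rule ccontr)
    assume ne: "D $ a $ a \<noteq> D $ b $ b"
    have z: "sc \<mu> i j a * sc \<mu> i j b = 0" "sc \<mu> a j k * sc \<mu> b j k = 0" for i j k
      using w[of i j a] w[of i j b] w[of a j k] w[of b j k] ne by (smt (verit) mult_eq_0_iff)+
    show False using nz by (simp only: momentM_def vec_lambda_beta z) simp
  qed
qed

subsection \<open>Minimization along rays\<close>

text \<open>Were a sublevel set unbounded, its normalized directions would accumulate at some
  \<open>(v, p)\<close>. The bound at the far point of each segment from the origin holds on the
  whole segment by \<open>conv\<close>, and in the limit on the whole ray through \<open>v\<close>,
  against \<open>ray\<close>. The compact parameter \<open>q\<close> carries the orthogonal factor
  of the group.\<close>

lemma ray_minimum:
  fixes f :: "'a::euclidean_space \<Rightarrow> 'b::metric_space \<Rightarrow> real"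
  assumes K: "compact K" "K \<noteq> {}"
    and cont: "continuous_on (UNIV \<times> K) (\<lambda>z. f (fst z) (snd z))"
    and conv: "\<And>x q r. q \<in> K \<Longrightarrow> 0 \<le> r \<Longrightarrow> r \<le> 1 \<Longrightarrow> f (r *\<^sub>R x) q \<le> max (f 0 q) (f x q)"
    and ray: "\<And>v q C. q \<in> K \<Longrightarrow> v \<noteq> 0 \<Longrightarrow> \<exists>r\<ge>0. f (r *\<^sub>R v) q > C"
  obtains x q where "q \<in> K" "\<And>y p. p \<in> K \<Longrightarrow> f x q \<le> f y p"
proof -
  have c0: "continuous_on K (\<lambda>q. f 0 q)"
  proof -
    have "continuous_on K (\<lambda>q. (0::'a, q))" by (intro continuous_intros)
    from continuous_on_compose2[OF cont this] show ?thesis by (simp add: image_subset_iff)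
  qed
  obtain q1 where q1: "q1 \<in> K" "\<And>q. q \<in> K \<Longrightarrow> f 0 q \<le> f 0 q1"
    using continuous_attains_sup[OF K c0] by blast
  \<comment> \<open>\<open>C\<close> bounds \<open>f\<close> at the origin for every parameter, so
    on the sublevel set of \<open>C\<close> the maximum in \<open>conv\<close> is at most
    \<open>C\<close>.\<close>
  define C where "C = f 0 q1"
  have "\<exists>R. \<forall>x q. q \<in> K \<longrightarrow> f x q \<le> C \<longrightarrow> norm x \<le> R"
  proof (rule ccontr)
    assume "\<nexists>R. \<forall>x q. q \<in> K \<longrightarrow> f x q \<le> C \<longrightarrow> norm x \<le> R"
    then have "\<forall>n::nat. \<exists>x q. q \<in> K \<and> f x q \<le> C \<and> norm x > real n"
      by (meson not_le)
    then obtain x q where xq: "\<And>n::nat. q n \<in> K" "\<And>n. f (x n) (q n) \<le> C" "\<And>n. norm (x n) > real n"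
      by metis
    define z where "z n = (x n /\<^sub>R norm (x n), q n)" for n
    have nz: "norm (x n) > 0" for n using xq(3)[of n] by (metis le_less_trans of_nat_0_le_iff)
    have "compact (sphere (0::'a) 1 \<times> K)" by (intro compact_Times K compact_sphere)
    moreover have "z n \<in> sphere 0 1 \<times> K" for n
      using xq(1) nz[of n] by (simp add: z_def)
    ultimately obtain l s where l: "l \<in> sphere 0 1 \<times> K" and s: "strict_mono (s :: nat \<Rightarrow> nat)" "(z \<circ> s) \<longlonglongrightarrow> l"
      unfolding compact_def by metis
    obtain v p where vp: "l = (v, p)" "p \<in> K" "norm v = 1" using l by auto
    have lim: "(\<lambda>n. fst (z (s n))) \<longlonglongrightarrow> v" "(\<lambda>n. snd (z (s n))) \<longlonglongrightarrow> p"
      using tendsto_fst[OF s(2)] tendsto_snd[OF s(2)] vp by (auto simp: o_def)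
    have "f (r *\<^sub>R v) p \<le> C" if r: "r \<ge> 0" for r
    proof (rule tendsto_upperbound)
      have "(\<lambda>n. (r *\<^sub>R fst (z (s n)), snd (z (s n)))) \<longlonglongrightarrow> (r *\<^sub>R v, p)"
        by (intro tendsto_intros lim)
      then show "(\<lambda>n. f (r *\<^sub>R fst (z (s n))) (snd (z (s n)))) \<longlonglongrightarrow> f (r *\<^sub>R v) p"
        using continuous_on_tendsto_compose[OF cont, of "\<lambda>n. (r *\<^sub>R fst (z (s n)), snd (z (s n)))" "(r *\<^sub>R v, p)"]
          vp(2) xq(1) by (simp add: z_def)
      have "f (r *\<^sub>R fst (z (s n))) (snd (z (s n))) \<le> C" if n: "n \<ge> nat \<lceil>r\<rceil>" for n
      proof -
        have "real (s n) \<ge> r" using seq_suble[OF s(1), of n] n by linarith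
        then have "r / norm (x (s n)) \<le> 1" using xq(3)[of "s n"] nz[of "s n"] by (simp add: field_simps)
        then have "f ((r / norm (x (s n))) *\<^sub>R x (s n)) (q (s n)) \<le> max (f 0 (q (s n))) (f (x (s n)) (q (s n)))"
          using r nz[of "s n"] by (intro conv xq(1)) auto
        also have "\<dots> \<le> C" using q1(2)[OF xq(1)] xq(2) by (simp add: C_def)
        finally show ?thesis by (simp add: z_def divide_inverse)
      qed
      then show "\<forall>\<^sub>F n in sequentially. f (r *\<^sub>R fst (z (s n))) (snd (z (s n))) \<le> C"
        by (rule eventually_sequentiallyI)
    qed simp
    moreover have "v \<noteq> 0" using vp(3) by auto
    ultimately show False using ray[OF vp(2), of v C] by (metis not_le)
  qed
  then obtain R where R: "\<And>x q. q \<in> K \<Longrightarrow> f x q \<le> C \<Longrightarrow> norm x \<le> R" by blast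
  have cR: "compact (cball (0::'a) \<bar>R\<bar> \<times> K)" by (intro compact_Times K compact_cball)
  have "continuous_on (cball 0 \<bar>R\<bar> \<times> K) (\<lambda>z. f (fst z) (snd z))"
    using cont by (rule continuous_on_subset) auto
  then obtain z where z: "z \<in> cball 0 \<bar>R\<bar> \<times> K"
      "\<And>y. y \<in> cball 0 \<bar>R\<bar> \<times> K \<Longrightarrow> f (fst z) (snd z) \<le> f (fst y) (snd y)"
    using continuous_attains_inf[OF cR, of "\<lambda>z. f (fst z) (snd z)"] K(2) by fastforce
  have "f (fst z) (snd z) \<le> f y p" if p: "p \<in> K" for y p
  proof (cases "f y p \<le> C")
    case True
    then show ?thesis using R[OF p True] p z(2)[of "(y, p)"] by auto
  next
    case False
    have "f (fst z) (snd z) \<le> C" using z(2)[of "(0, q1)"] q1(1) by (simp add: C_def)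
    then show ?thesis using False by simp
  qed
  then show ?thesis using that[of "snd z" "fst z"] z(1) by force
qed

lemma exp_segment: "0 \<le> r \<Longrightarrow> r \<le> 1 \<Longrightarrow> exp (r * u) \<le> (1 - r) + r * exp (u::real)"
  using convex_onD[OF exp_convex, of r 0 u] by simp

lemma exp_dominates:
  assumes "c > 0" "w > (0::real)"
  shows "\<exists>r\<ge>0. c * exp (r * w) - r * d > C"
proof -
  have "filterlim (\<lambda>r. c * exp (r * w) - r * d) at_top at_top"
    using assms by real_asymp
  then show ?thesis
    unfolding filterlim_at_top_dense eventually_at_top_linorder by (metis linear)
qed

subsection \<open>A numerical criterion for the moment inequality\<close>

text \<open>The directions in which \<open>ediag (r v)\<close> and its action on
  \<open>\<mu>\<close> both stay bounded as \<open>r\<close> grows: the sign condition on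
  \<open>v\<close> comes from the term \<open>h \<bullet> h\<close>, the weight condition from the
  norm of the bracket.\<close>

definition adm :: "(real^'n \<Rightarrow> real^'n \<Rightarrow> real^'n) \<Rightarrow> real^'n \<Rightarrow> bool" where
  "adm \<mu> v \<longleftrightarrow> (\<forall>i. v $ i \<le> 0) \<and> (\<forall>i j k. sc \<mu> i j k \<noteq> 0 \<longrightarrow> wt v i j k \<le> 0)"

text \<open>Wider than membership in \<open>t\<close>: the identity may be subtracted from
  \<open>D\<close>, and \<open>diag \<beta>\<close> for the optimal direction is also
  covered.\<close>

definition central :: "(real^'n^'n) set \<Rightarrow> real^'n^'n \<Rightarrow> bool" where
  "central t D \<longleftrightarrow> D \<in> Dg \<and> (\<forall>g. commutes g t \<longrightarrow> g ** D = D ** g)"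

definition pairing :: "real^'n^'n \<Rightarrow> real^'n \<Rightarrow> real" where
  "pairing D v = (\<Sum>i\<in>UNIV. D $ i $ i * v $ i)"

lemma wt_scale: "wt (r *\<^sub>R x) i j k = r * wt x i j k"
  by (simp add: wt_def algebra_simps)

lemma continuous_sc_act:
  assumes "\<mu> \<in> V"
  shows "continuous_on (K_torus t) (\<lambda>q. sc (GL_act q \<mu>) i j k)"
proof -
  have "continuous_on (K_torus t) (\<lambda>q. \<Sum>c\<in>UNIV. q $ k $ c *
    (\<Sum>a\<in>UNIV. \<Sum>b\<in>UNIV. q $ i $ a * q $ j $ b * sc \<mu> a b c))"
    by (intro continuous_intros)
  then show ?thesis
    by (rule continuous_on_eq) (simp add: sc_GL_act_orthogonal[OF assms] K_torusD(2))
qed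

lemma diag_mult_row: "(diag a ** g) $ i = a $ i *\<^sub>R g $ i" for g :: "real^'n^'n"
  by (simp add: vec_eq_iff diag_mult_nth)

lemma orthogonal_row: "orthogonal_matrix q \<Longrightarrow> q $ i \<bullet> q $ i = 1" for q :: "real^'n^'n"
  using orthogonal_inv(4)[of q] mult_transpose_nth[of q q i i] by (simp add: mat_def)

lemma ediag_row: "(ediag y ** g) $ j = exp (y $ j) *\<^sub>R g $ j" for g :: "real^'n^'n"
  by (simp add: ediag_def diag_mult_row)

lemma inner_ediag_mult: "(ediag x ** g) \<bullet> (ediag x ** g) = (\<Sum>i\<in>UNIV. exp (2 * x $ i) * (g $ i \<bullet> g $ i))"
  for g :: "real^'n^'n"
proof -
  have "exp (2 * u) = exp u * exp u" for u :: real by (simp flip: exp_add)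
  then show ?thesis by (simp add: inner_vec_def[of "ediag x ** g"] ediag_row mult.assoc)
qed

lemma orthogonal_mult_inner: "orthogonal_matrix k \<Longrightarrow> (k ** g) \<bullet> (k ** h) = g \<bullet> h"
  for k g h :: "real^'n^'n"
proof -
  assume k: "orthogonal_matrix k"
  have "(k ** g) \<bullet> (k ** h) = trace (k ** (g ** transpose h ** transpose k))"
    by (simp add: trace_inner[symmetric] matrix_transpose_mul matrix_mul_assoc)
  also have "\<dots> = trace (g ** transpose h ** transpose k ** k)" by (rule trace_mul_sym)
  also have "\<dots> = trace (g ** transpose h)"
    by (simp add: matrix_mul_assoc[symmetric] orthogonal_inv(3)[OF k])
  finally show ?thesis by (simp add: trace_inner)
qed

lemma svd_ediag:
  fixes g :: "real^'n^'n"
  assumes g: "g \<in> G_torus t" and t: "t \<subseteq> Dg"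
  obtains k x q where "k \<in> K_torus t" "q \<in> K_torus t" "g = k ** (ediag x ** q)"
proof -
  obtain k a q where *: "k \<in> K_torus t" "q \<in> K_torus t" "\<And>i. a $ i > 0" "g = k ** diag a ** q"
    using svd_G_torus[OF g t] by blast
  have "diag a = ediag (\<chi> i. ln (a $ i))"
    using *(3) by (simp add: ediag_def)
  then show ?thesis using that[of k q "\<chi> i. ln (a $ i)"] * by (simp add: matrix_mul_assoc)
qed

lemma centralD:
  assumes "central t D"
  shows "D \<in> Dg" "g \<in> G_torus t \<Longrightarrow> g ** D = D ** g" "g \<in> G_torus t \<Longrightarrow> invertible g"
  using assms by (auto simp: central_def dest: G_torusD)

lemma chi_G_torus:
  assumes "central t D" "g \<in> G_torus t" "h \<in> G_torus t"
  shows "chi D (g ** h) = chi D g + chi D h"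
  using centralD[OF assms(1)] assms(2,3) by (intro chi_mult) auto

lemma chi_K_torus: "central t D \<Longrightarrow> k \<in> K_torus t \<Longrightarrow> chi D k = 0"
  by (intro chi_orthogonal) (auto dest: centralD(1) centralD(2)[OF _ K_torusD(1)] K_torusD(2))

lemma chi_ediag_mult:
  assumes "central t D" "t \<subseteq> Dg" "g \<in> G_torus t"
  shows "chi D (ediag x ** g) = pairing D x + chi D g"
  using chi_G_torus[OF assms(1) ediag_G_torus[OF assms(2)] assms(3), of x]
  by (simp add: chi_ediag pairing_def)

lemma chi_svd:
  assumes "central t D" "t \<subseteq> Dg" "k \<in> K_torus t" "q \<in> K_torus t"
  shows "chi D (k ** (ediag x ** q)) = pairing D x"
proof -
  note kq = K_torusD(1)[OF assms(3)] K_torusD(1)[OF assms(4)]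
  show ?thesis
    using chi_G_torus[OF assms(1) kq(1) G_torus_mult[OF ediag_G_torus[OF assms(2)] kq(2)], of x]
      chi_ediag_mult[OF assms(1,2) kq(2), of x]
    by (simp add: chi_K_torus[OF assms(1,3)] chi_K_torus[OF assms(1,4)])
qed

lemma GL_act_svd:
  assumes "t \<subseteq> Dg" "k \<in> G_torus t" "q \<in> G_torus t"
  shows "GL_act (k ** (ediag x ** q)) b = GL_act k (GL_act (ediag x) (GL_act q b))"
proof -
  have "invertible k" "invertible q" "invertible (ediag x)" "invertible (ediag x ** q)"
    using assms ediag_G_torus[OF assms(1)] G_torusD(1) by (auto intro!: invertible_mult)
  then show ?thesis by (simp add: GL_act_mult)
qed

lemma nV_svd:
  assumes "b \<in> V" "t \<subseteq> Dg" "k \<in> K_torus t" "q \<in> K_torus t"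
  shows "nV (GL_act (k ** (ediag x ** q)) b) = nV (GL_act (ediag x) (GL_act q b))"
  using nV_orthogonal[OF GL_act_V[OF GL_act_V[OF assms(1)]] K_torusD(2)[OF assms(3)]]
  by (simp add: GL_act_svd[OF assms(2) K_torusD(1)[OF assms(3)] K_torusD(1)[OF assms(4)]])

lemma nV_ediag_deriv:
  assumes "\<mu> \<in> V"
  shows "((\<lambda>\<tau>. nV (GL_act (ediag (\<tau> *\<^sub>R y)) \<mu>)) has_real_derivative
    2 * (\<Sum>i\<in>UNIV. y $ i * momentM \<mu> $ i $ i)) (at 0)"
proof -
  have "((\<lambda>\<tau>. nV (GL_act (ediag (\<tau> *\<^sub>R y)) \<mu>)) has_real_derivative
    (\<Sum>i\<in>UNIV. \<Sum>j\<in>UNIV. \<Sum>k\<in>UNIV. 2 * wt y i j k * (sc \<mu> i j k)\<^sup>2) / 2) (at 0)"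
    unfolding nV_ediag[OF assms] wt_scale
    by (auto intro!: derivative_eq_intros DERIV_sum sum.cong)
  moreover have "(\<Sum>i\<in>UNIV. \<Sum>j\<in>UNIV. \<Sum>k\<in>UNIV. 2 * wt y i j k * (sc \<mu> i j k)\<^sup>2) / 2
      = 2 * (\<Sum>i\<in>UNIV. y $ i * momentM \<mu> $ i $ i)"
    unfolding momentM_diag[OF assms] by (simp add: sum_distrib_left mult.assoc)
  ultimately show ?thesis by (simp only: sum_divide_distrib)
qed

lemma inner_ediag_deriv:
  fixes g :: "real^'n^'n"
  shows "((\<lambda>\<tau>. (ediag (\<tau> *\<^sub>R y) ** g) \<bullet> (ediag (\<tau> *\<^sub>R y) ** g)) has_real_derivative
    2 * (\<Sum>i\<in>UNIV. y $ i * (g ** transpose g) $ i $ i)) (at 0)"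
proof -
  have "((\<lambda>\<tau>. \<Sum>i\<in>UNIV. exp (2 * (\<tau> * y $ i)) * (g $ i \<bullet> g $ i)) has_real_derivative
    (\<Sum>i\<in>UNIV. 2 * y $ i * (g $ i \<bullet> g $ i))) (at 0)"
    by (auto intro!: derivative_eq_intros DERIV_sum sum.cong)
  then show ?thesis by (simp add: inner_ediag_mult mult_transpose_nth sum_distrib_left mult.assoc)
qed

lemma sum_axis: "(\<Sum>i\<in>UNIV. axis a (1::real) $ i * f i) = f a"
  by (simp add: axis_def if_distrib[of "\<lambda>x. x * _"] cong: if_cong)

lemma pairing_add: "pairing D (x + y) = pairing D x + pairing D y"
  by (simp add: pairing_def algebra_simps sum.distrib)

lemma pairing_scale: "pairing D (r *\<^sub>R x) = r * pairing D x"
  by (simp add: pairing_def sum_distrib_left mult_ac)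

lemma deriv_zero_of_min:
  fixes \<psi> :: "real \<Rightarrow> real"
  assumes "(\<psi> has_real_derivative l) (at 0)" "\<And>\<tau>. \<psi> 0 \<le> \<psi> \<tau>"
  shows "l = 0"
  using DERIV_local_min[OF assms(1), of 1] assms(2) by simp

text \<open>In the coordinates \<open>g = k ** (ediag x ** q)\<close> the factor \<open>k\<close>
  drops out and \<open>q\<close> runs over a compact set, so \<open>ray_minimum\<close> applies. In
  each direction either some exponential tends to infinity and beats the linear term, or the
  direction is admissible and \<open>H\<close> makes the linear term grow.\<close>

theorem criterion_imp_posdef:
  assumes b: "b \<in> V" and t: "t \<subseteq> Dg" "t \<subseteq> Der b" and D: "central t D"
    and H: "\<And>q v. q \<in> K_torus t \<Longrightarrow> adm (GL_act q b) v \<Longrightarrow> v \<noteq> 0 \<Longrightarrow> pairing D v < 0"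
  obtains h where "h \<in> G_torus t" "posdef (D - momentM (GL_act h b))"
proof -
  define f where "f x q = nV (GL_act (ediag x) (GL_act q b)) / 2 + (\<Sum>i\<in>UNIV. exp (2 * x $ i)) / 2 - pairing D x"
    for x q
  have f: "f x q = (\<Sum>i\<in>UNIV. \<Sum>j\<in>UNIV. \<Sum>k\<in>UNIV. exp (2 * wt x i j k) * (sc (GL_act q b) i j k)\<^sup>2) / 2 / 2
      + (\<Sum>i\<in>UNIV. exp (2 * x $ i)) / 2 - pairing D x" for x q
    by (simp only: f_def nV_ediag[OF GL_act_V[OF b]])
  obtain x0 q0 where x0: "q0 \<in> K_torus t" "\<And>y p. p \<in> K_torus t \<Longrightarrow> f x0 q0 \<le> f y p"
  proof (rule ray_minimum[of "K_torus t" f])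
    show "compact (K_torus t)" "K_torus t \<noteq> {}" using compact_K_torus mat1_K_torus by blast+
    have "continuous_on (UNIV \<times> K_torus t) (\<lambda>z. sc (GL_act (snd z) b) i j k)" for i j k
      by (rule continuous_on_compose2[OF continuous_sc_act[OF b]]) (auto intro: continuous_intros)
    then show "continuous_on (UNIV \<times> K_torus t) (\<lambda>z. f (fst z) (snd z))"
      unfolding f pairing_def wt_def by (intro continuous_intros) auto
  next
    fix x q and r :: real assume "q \<in> K_torus t" and r: "0 \<le> r" "r \<le> 1"
    define S where "S = (\<Sum>i\<in>UNIV. \<Sum>j\<in>UNIV. \<Sum>k\<in>UNIV. (sc (GL_act q b) i j k)\<^sup>2)"
    define S' where "S' = (\<Sum>i\<in>UNIV. \<Sum>j\<in>UNIV. \<Sum>k\<in>UNIV. exp (2 * wt x i j k) * (sc (GL_act q b) i j k)\<^sup>2)"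
    define E where "E = (\<Sum>i\<in>(UNIV::'a set). exp (2 * x $ i))"
    have e: "exp (2 * (r * u)) \<le> (1 - r) + r * exp (2 * u)" for u
      using exp_segment[OF r, of "2 * u"] by (simp add: mult_ac)
    have "(\<Sum>i\<in>UNIV. \<Sum>j\<in>UNIV. \<Sum>k\<in>UNIV. exp (2 * wt (r *\<^sub>R x) i j k) * (sc (GL_act q b) i j k)\<^sup>2)
       \<le> (\<Sum>i\<in>UNIV. \<Sum>j\<in>UNIV. \<Sum>k\<in>UNIV. ((1 - r) + r * exp (2 * wt x i j k)) * (sc (GL_act q b) i j k)\<^sup>2)"
      unfolding wt_scale by (intro sum_mono mult_right_mono e) auto
    also have "\<dots> = (1 - r) * S + r * S'"
      by (simp add: S_def S'_def distrib_right sum.distrib sum_distrib_left mult.assoc)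
    finally have 1: "(\<Sum>i\<in>UNIV. \<Sum>j\<in>UNIV. \<Sum>k\<in>UNIV. exp (2 * wt (r *\<^sub>R x) i j k) * (sc (GL_act q b) i j k)\<^sup>2)
       \<le> (1 - r) * S + r * S'" .
    have "(\<Sum>i\<in>UNIV. exp (2 * (r *\<^sub>R x) $ i)) \<le> (\<Sum>i\<in>UNIV. (1 - r) + r * exp (2 * x $ i))"
      using e by (intro sum_mono) simp
    then have 2: "(\<Sum>i\<in>UNIV. exp (2 * (r *\<^sub>R x) $ i)) \<le> (1 - r) * real CARD('a) + r * E"
      by (simp add: E_def sum.distrib sum_distrib_left mult.commute)
    have "f (r *\<^sub>R x) q \<le> ((1 - r) * S + r * S') / 2 / 2 + ((1 - r) * real CARD('a) + r * E) / 2 - r * pairing D x"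
      unfolding f pairing_scale by (intro diff_mono add_mono divide_right_mono 1 2) auto
    also have "\<dots> = (1 - r) * (S / 2 / 2 + real CARD('a) / 2) + r * (S' / 2 / 2 + E / 2 - pairing D x)"
      by (simp add: field_simps)
    also have "\<dots> = (1 - r) * f 0 q + r * f x q"
      unfolding f by (simp add: S_def S'_def E_def wt_def pairing_def)
    also have "\<dots> \<le> (1 - r) * max (f 0 q) (f x q) + r * max (f 0 q) (f x q)"
      using r by (intro add_mono mult_left_mono) auto
    finally show "f (r *\<^sub>R x) q \<le> max (f 0 q) (f x q)" by (simp add: algebra_simps)
  next
    fix v :: "real^'a" and q C assume q: "q \<in> K_torus t" and v: "v \<noteq> 0"
    let ?c = "\<lambda>i j k. (sc (GL_act q b) i j k)\<^sup>2"
    let ?w = "\<lambda>r i j k. exp (2 * wt (r *\<^sub>R v) i j k) * ?c i j k"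
    consider (1) i where "v $ i > 0" | (2) i j k where "sc (GL_act q b) i j k \<noteq> 0" "wt v i j k > 0"
      | (3) "adm (GL_act q b) v"
      unfolding adm_def by (meson not_le)
    then show "\<exists>r\<ge>0. C < f (r *\<^sub>R v) q"
    proof cases
      case 1
      obtain r where r: "r \<ge> 0" "1/2 * exp (r * (2 * v $ i)) - r * pairing D v > C"
        using exp_dominates[of "1/2" "2 * v $ i"] 1 by auto
      have "exp (2 * (r *\<^sub>R v) $ i) \<le> (\<Sum>i\<in>UNIV. exp (2 * (r *\<^sub>R v) $ i))"
        by (rule member_le_sum) auto
      moreover have "0 \<le> (\<Sum>i\<in>UNIV. \<Sum>j\<in>UNIV. \<Sum>k\<in>UNIV. ?w r i j k)" by (intro sum_nonneg) auto
      ultimately have "1/2 * exp (r * (2 * v $ i)) - r * pairing D v \<le> f (r *\<^sub>R v) q"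
        unfolding f pairing_scale by (simp add: mult_ac)
      then show ?thesis using r by force
    next
      case 2
      obtain r where r: "r \<ge> 0" "?c i j k / 4 * exp (r * (2 * wt v i j k)) - r * pairing D v > C"
        using exp_dominates[of "?c i j k / 4" "2 * wt v i j k"] 2 by auto
      have "?w r i j k \<le> (\<Sum>k\<in>UNIV. ?w r i j k)" by (rule member_le_sum) auto
      also have "\<dots> \<le> (\<Sum>j\<in>UNIV. \<Sum>k\<in>UNIV. ?w r i j k)"
        by (rule member_le_sum[of j UNIV "\<lambda>j. \<Sum>k\<in>UNIV. ?w r i j k"]) (auto intro!: sum_nonneg)
      also have "\<dots> \<le> (\<Sum>i\<in>UNIV. \<Sum>j\<in>UNIV. \<Sum>k\<in>UNIV. ?w r i j k)"
        by (rule member_le_sum[of i UNIV "\<lambda>i. \<Sum>j\<in>UNIV. \<Sum>k\<in>UNIV. ?w r i j k"]) (auto intro!: sum_nonneg)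
      finally have "?w r i j k \<le> (\<Sum>i\<in>UNIV. \<Sum>j\<in>UNIV. \<Sum>k\<in>UNIV. ?w r i j k)" .
      moreover have "0 \<le> (\<Sum>i\<in>UNIV. exp (2 * (r *\<^sub>R v) $ i))" by (intro sum_nonneg) auto
      ultimately have "?c i j k / 4 * exp (r * (2 * wt v i j k)) - r * pairing D v \<le> f (r *\<^sub>R v) q"
        unfolding f pairing_scale by (simp add: mult_ac wt_scale)
      then show ?thesis using r by force
    next
      case 3
      \<comment> \<open>Makes the linear term equal to \<open>\<bar>C\<bar> + 1\<close>; the
        remaining terms are nonnegative.\<close>
      define r where "r = (\<bar>C\<bar> + 1) / - pairing D v"
      have neg: "pairing D v < 0" by (rule H[OF q 3 v])
      then have "r \<ge> 0" "r * pairing D v = - (\<bar>C\<bar> + 1)" by (simp_all add: r_def divide_nonneg_neg)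
      moreover have "0 \<le> (\<Sum>i\<in>UNIV. \<Sum>j\<in>UNIV. \<Sum>k\<in>UNIV. ?w r i j k)" by (intro sum_nonneg) auto
      moreover have "0 \<le> (\<Sum>i\<in>UNIV. exp (2 * (r *\<^sub>R v) $ i))" by (intro sum_nonneg) auto
      ultimately have "C < f (r *\<^sub>R v) q" unfolding f pairing_scale by simp
      then show ?thesis using \<open>r \<ge> 0\<close> by blast
    qed
  qed blast
  define Phi where "Phi g = nV (GL_act g b) / 2 + (g \<bullet> g) / 2 - chi D g" for g
  have Phi_f: "Phi (k ** (ediag x ** q)) = f x q" if "k \<in> K_torus t" "q \<in> K_torus t" for k x q
    using K_torusD(2)[OF that(1)] K_torusD(2)[OF that(2)] that
    by (simp add: Phi_def f_def nV_svd[OF b t(1)] chi_svd[OF D t(1)] orthogonal_mult_inner inner_ediag_mult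
        orthogonal_row)
  define g0 where "g0 = ediag x0 ** q0"
  have g0: "g0 \<in> G_torus t"
    unfolding g0_def using x0(1) K_torusD(1) G_torus_mult ediag_G_torus[OF t(1)] by blast
  have DM: "t \<subseteq> Der (GL_act g b)" if "g \<in> G_torus t" for g
    using t(2) G_torusD[OF that] Der_GL_act by (fastforce simp: commutes_def)
  have g0T: "commutes (g0 ** transpose g0) t"
    using G_torusD(2)[OF g0] commutes_transpose[OF t(1)] commutes_mult by blast
  \<comment> \<open>Only derivatives in diagonal directions will be computed. Rotating the minimizer
    so that \<open>S\<close> becomes diagonal turns these diagonal equations into the full matrix
    equation; the rotated point is still a minimizer because \<open>Phi\<close> is invariant under
    \<open>K_torus t\<close> from the left.\<close>
  define S where "S = momentM (GL_act g0 b) + g0 ** transpose g0"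
  have "commutes S t"
    using momentM_commutes[OF GL_act_V[OF b] t(1) DM[OF g0]] g0T
    by (auto simp: S_def commutes_def matrix_mult_add_diff)
  moreover have "transpose S = S"
    by (simp add: S_def transpose_add_diff momentM_sym matrix_transpose_mul)
  ultimately obtain k where k: "k \<in> K_torus t" "k ** S ** transpose k \<in> Dg"
    using diagonalization[OF _ _ t(1)] by blast
  define g1 where "g1 = k ** g0"
  have g1: "g1 \<in> G_torus t" unfolding g1_def using k(1) g0 K_torusD(1) G_torus_mult by blast
  define M1 where "M1 = momentM (GL_act g1 b)"
  define N1 where "N1 = g1 ** transpose g1"
  have "M1 = k ** momentM (GL_act g0 b) ** transpose k"
    using K_torusD(2,3)[OF k(1)] G_torusD(1)[OF g0]
    by (simp add: M1_def g1_def GL_act_mult momentM_orthogonal[OF GL_act_V[OF b]])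
  then have S1: "M1 + N1 = k ** S ** transpose k"
    by (simp add: S_def N1_def g1_def matrix_transpose_mul matrix_mul_assoc matrix_mult_add_diff)
  have min: "Phi g1 \<le> Phi g" if g: "g \<in> G_torus t" for g
  proof -
    obtain k' x q where *: "k' \<in> K_torus t" "q \<in> K_torus t" "g = k' ** (ediag x ** q)"
      using svd_ediag[OF g t(1)] by blast
    have "Phi g1 = f x0 q0" unfolding g1_def g0_def by (rule Phi_f[OF k(1) x0(1)])
    then show ?thesis using * Phi_f x0(2) by simp
  qed
  have "M1 $ i $ i + N1 $ i $ i = D $ i $ i" for i
  proof -
    let ?y = "axis i (1::real)"
    define \<psi> where "\<psi> \<tau> = nV (GL_act (ediag (\<tau> *\<^sub>R ?y)) (GL_act g1 b)) / 2
       + ((ediag (\<tau> *\<^sub>R ?y) ** g1) \<bullet> (ediag (\<tau> *\<^sub>R ?y) ** g1)) / 2 - (\<tau> * D $ i $ i + chi D g1)" for \<tau>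
    have pa: "pairing D ?y = D $ i $ i" using sum_axis[of i "\<lambda>i. D $ i $ i"] by (simp add: pairing_def mult.commute)
    have psi: "\<psi> \<tau> = Phi (ediag (\<tau> *\<^sub>R ?y) ** g1)" for \<tau>
      using G_torusD(1)[OF g1] G_torusD(1)[OF ediag_G_torus[OF t(1)]]
      by (simp add: \<psi>_def Phi_def GL_act_mult chi_ediag_mult[OF D t(1) g1] pairing_scale pa)
    have "(\<psi> has_real_derivative 2 * M1 $ i $ i / 2 + 2 * N1 $ i $ i / 2 - D $ i $ i) (at 0)"
      unfolding \<psi>_def
      using nV_ediag_deriv[OF GL_act_V[OF b], of ?y g1] inner_ediag_deriv[of ?y g1]
      unfolding sum_axis M1_def[symmetric] N1_def[symmetric]
      by (auto intro!: derivative_eq_intros)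
    moreover have "\<psi> 0 \<le> \<psi> \<tau>" for \<tau>
    proof -
      have "ediag 0 = (mat 1 :: real^'a^'a)" by (simp add: ediag_def flip: diag_1)
      then have "\<psi> 0 = Phi g1" by (simp add: psi)
      then show ?thesis unfolding psi by (simp add: min G_torus_mult ediag_G_torus t(1) g1)
    qed
    ultimately have "2 * M1 $ i $ i / 2 + 2 * N1 $ i $ i / 2 - D $ i $ i = 0"
      by (rule deriv_zero_of_min)
    then show ?thesis by simp
  qed
  moreover have "M1 + N1 \<in> Dg" using k(2) by (simp only: S1)
  ultimately have "(M1 + N1) $ i $ j = D $ i $ j" for i j
    using centralD(1)[OF D] by (cases "i = j") (auto simp: Dg_def)
  then have "M1 + N1 = D" by (simp add: vec_eq_iff)
  then have "D - momentM (GL_act g1 b) = g1 ** transpose g1" by (auto simp: M1_def N1_def)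
  then have "posdef (D - momentM (GL_act g1 b))" using posdef_gram G_torusD(1)[OF g1] by simp
  then show ?thesis using that g1 by blast
qed

section \<open>Stability of positive definiteness and necessity of the inequalities\<close>

lemma matvec_norm_le: "norm (E *v x) \<le> norm E * norm x" for E :: "real^'n^'m"
proof -
  have "norm (E *v x) \<le> L2_set (\<lambda>i. norm (E $ i) * norm x) UNIV"
    unfolding norm_vec_def[of "E *v x"]
    by (intro L2_set_mono) (auto simp: matrix_vector_mul_component Cauchy_Schwarz_ineq2)
  also have "\<dots> = norm E * norm x"
    by (simp add: norm_vec_def[of E] L2_set_left_distrib)
  finally show ?thesis .
qed

lemma posdef_bound:
  fixes A :: "real^'n^'n"
  assumes "posdef A"
  obtains e where "e > 0" "\<And>x. x \<bullet> (A *v x) \<ge> e * (x \<bullet> x)"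
proof -
  have cont: "continuous_on (sphere 0 1) (\<lambda>x. x \<bullet> (A *v x))"
    by (intro continuous_intros linear_continuous_on) (simp add: matrix_vector_mul_bounded_linear)
  have "axis undefined 1 \<in> sphere (0::real^'n) 1" by simp
  then have ne: "sphere (0::real^'n) 1 \<noteq> {}" by blast
  obtain u where u: "u \<in> sphere (0::real^'n) 1"
      "\<And>x. x \<in> sphere 0 1 \<Longrightarrow> u \<bullet> (A *v u) \<le> x \<bullet> (A *v x)"
    using continuous_attains_inf[OF compact_sphere ne cont] by blast
  have "u \<noteq> 0" using u(1) by auto
  then have "u \<bullet> (A *v u) > 0" using assms by (auto simp: posdef_def)
  moreover have "x \<bullet> (A *v x) \<ge> (u \<bullet> (A *v u)) * (x \<bullet> x)" for x
  proof (cases "x = 0")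
    case False
    let ?y = "x /\<^sub>R norm x"
    have "x \<bullet> (A *v x) = (norm x)\<^sup>2 * (?y \<bullet> (A *v ?y))"
      using False by (simp add: matrix_vector_mult_scaleR power2_eq_square field_simps)
    moreover have "u \<bullet> (A *v u) \<le> ?y \<bullet> (A *v ?y)" using False by (intro u(2)) simp
    ultimately show ?thesis by (simp add: power2_norm_eq_inner mult.commute mult_left_mono)
  qed auto
  ultimately show ?thesis using that by blast
qed

lemma posdef_perturb:
  fixes A :: "real^'n^'n"
  assumes "posdef A"
  obtains e where "e > 0" "\<And>B. transpose B = B \<Longrightarrow> norm (B - A) < e \<Longrightarrow> posdef B"
proof -
  obtain e where e: "e > 0" "\<And>x. x \<bullet> (A *v x) \<ge> e * (x \<bullet> x)" using posdef_bound[OF assms] by blast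
  have "posdef B" if B: "transpose B = B" "norm (B - A) < e" for B
    unfolding posdef_def
  proof (intro conjI B(1) allI impI)
    fix x :: "real^'n" assume x: "x \<noteq> 0"
    have "\<bar>x \<bullet> ((B - A) *v x)\<bar> \<le> norm x * (norm (B - A) * norm x)"
      using Cauchy_Schwarz_ineq2[of x "(B - A) *v x"] mult_left_mono[OF matvec_norm_le[of "B - A" x], of "norm x"]
      by simp
    also have "\<dots> = norm (B - A) * (x \<bullet> x)" by (simp add: dot_square_norm power2_eq_square)
    also have "\<dots> < e * (x \<bullet> x)" using B(2) x by (intro mult_strict_right_mono) auto
    finally have "x \<bullet> ((B - A) *v x) > - (e * (x \<bullet> x))" by linarith
    then show "x \<bullet> (B *v x) > 0"
      using e(2)[of x] by (simp add: matrix_vector_mult_diff_rdistrib inner_diff_right)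
  qed
  then show ?thesis using that e(1) by blast
qed

lemma inner_conj_ediag:
  "(ediag x ** q ** P) \<bullet> (ediag x ** q) = (\<Sum>i\<in>UNIV. exp (2 * x $ i) * (q ** P ** transpose q) $ i $ i)"
  for q P :: "real^'n^'n"
proof -
  have "(ediag x ** q ** P) \<bullet> (ediag x ** q) = trace (ediag x ** (q ** P ** transpose q) ** ediag x)"
    by (simp add: trace_inner[symmetric] matrix_transpose_mul matrix_mul_assoc transpose_ediag)
  also have "\<dots> = (\<Sum>i\<in>UNIV. exp (x $ i) * (q ** P ** transpose q) $ i $ i * exp (x $ i))"
    by (simp add: trace_def ediag_def diag_mult_nth)
  also have "\<dots> = (\<Sum>i\<in>UNIV. exp (2 * x $ i) * (q ** P ** transpose q) $ i $ i)"
    by (intro sum.cong refl) (simp add: mult_exp_exp[symmetric] exp_double power2_eq_square)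
  finally show ?thesis .
qed

lemma central_conj:
  "central t D \<Longrightarrow> q \<in> K_torus t \<Longrightarrow> q ** D ** transpose q = D"
  using centralD(2)[of t D q] K_torusD(1,7) by (metis matrix_mul_assoc matrix_mul_rid)

lemma conj_trace: "orthogonal_matrix k \<Longrightarrow> trace (k ** A ** transpose k) = trace A" for k A :: "real^'n^'n"
  by (metis matrix_mul_assoc matrix_mul_lid orthogonal_inv(3) trace_mul_sym)

text \<open>Write \<open>D = s M + P\<close>. The function \<open>J\<close> is convex along the rays
  \<open>ediag x\<close> and critical at the identity, so \<open>J0\<close> is its minimum. Along
  the ray \<open>ediag (r v)\<close> starting at \<open>q\<close> times the inverse of
  \<open>h\<close>, admissibility keeps the first two terms bounded, so a positive
  \<open>pairing D v\<close> would send \<open>J\<close> to minus infinity.\<close>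

lemma criterion_nonstrict:
  assumes b: "b \<in> V" and t: "t \<subseteq> Dg" and D: "central t D" and h: "h \<in> G_torus t" and s: "s \<ge> 0"
    and P: "posdef (D - s *\<^sub>R momentM (GL_act h b))"
    and q: "q \<in> K_torus t" and v: "adm (GL_act q b) v"
  shows "pairing D v \<le> 0"
proof -
  define \<mu> where "\<mu> = GL_act h b"
  define M where "M = momentM \<mu>"
  define P where "P = D - s *\<^sub>R M"
  have \<mu>: "\<mu> \<in> V" by (simp add: \<mu>_def GL_act_V b)
  have Ppos: "posdef P" using P by (simp add: P_def M_def \<mu>_def)
  \<comment> \<open>The quadratic term is weighted by \<open>P\<close> so that the gradient at the
    identity is \<open>s M + P - D = 0\<close>.\<close>
  define J where "J g = s / 2 * nV (GL_act g \<mu>) + ((g ** P) \<bullet> g) / 2 - chi D g" for g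
  define J0 where "J0 = s / 2 * nV \<mu> + trace P / 2"
  have J0: "J0 \<le> J g" if g: "g \<in> G_torus t" for g
  proof -
    obtain k x p where kxp: "k \<in> K_torus t" "p \<in> K_torus t" "g = k ** (ediag x ** p)"
      using svd_ediag[OF g t] by blast
    note k = K_torusD(1,2)[OF kxp(1)] and p = K_torusD(1,2)[OF kxp(2)]
    define P' where "P' = p ** P ** transpose p"
    define \<mu>' where "\<mu>' = GL_act p \<mu>"
    have V': "\<mu>' \<in> V" by (simp add: \<mu>'_def GL_act_V \<mu>)
    have P': "P' $ i $ i = D $ i $ i - s * momentM \<mu>' $ i $ i" for i
    proof -
      have "P' = D - s *\<^sub>R momentM \<mu>'"
        using central_conj[OF D kxp(2)]
        by (simp add: P'_def P_def \<mu>'_def momentM_orthogonal[OF \<mu> p(2)] M_def matrix_mult_add_diff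
            matrix_scalar_ac scalar_matrix_assoc)
      then show ?thesis by simp
    qed
    \<comment> \<open>Every exponential is bounded below by its tangent at zero; the same is done
      for the term in \<open>P\<close> further on.\<close>
    have "nV \<mu>' + 2 * (\<Sum>i\<in>UNIV. x $ i * momentM \<mu>' $ i $ i)
        = (\<Sum>i\<in>UNIV. \<Sum>j\<in>UNIV. \<Sum>k\<in>UNIV. (1 + 2 * wt x i j k) * (sc \<mu>' i j k)\<^sup>2) / 2"
      unfolding momentM_diag[OF V'] inner_V_sc
      by (simp add: distrib_right sum.distrib sum_distrib_left add_divide_distrib power2_eq_square mult.assoc)
    also have "\<dots> \<le> nV (GL_act (ediag x) \<mu>')"
      unfolding nV_ediag[OF V']
      by (intro divide_right_mono sum_mono mult_right_mono exp_ge_add_one_self) auto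
    also have "\<dots> = nV (GL_act g \<mu>)"
      unfolding kxp(3) \<mu>'_def by (rule nV_svd[OF \<mu> t kxp(1,2), symmetric])
    finally have 1: "nV \<mu> + 2 * (\<Sum>i\<in>UNIV. x $ i * momentM \<mu>' $ i $ i) \<le> nV (GL_act g \<mu>)"
      by (simp add: \<mu>'_def nV_orthogonal \<mu> p(2))
    have P'0: "P' $ i $ i > 0" for i
      unfolding P'_def using posdef_nth[OF posdef_conj[OF Ppos]] K_torusD(3)[OF kxp(2)] by blast
    have "trace P + 2 * (\<Sum>i\<in>UNIV. x $ i * P' $ i $ i) = (\<Sum>i\<in>UNIV. (1 + 2 * x $ i) * P' $ i $ i)"
      using conj_trace[OF p(2), of P]
      by (simp add: P'_def trace_def distrib_right sum.distrib sum_distrib_left mult.assoc)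
    also have "\<dots> \<le> (\<Sum>i\<in>UNIV. exp (2 * x $ i) * P' $ i $ i)"
      using P'0 by (intro sum_mono mult_right_mono exp_ge_add_one_self) (auto intro: less_imp_le)
    also have "\<dots> = (g ** P) \<bullet> g"
    proof -
      have "(g ** P) \<bullet> g = (k ** (ediag x ** p ** P)) \<bullet> (k ** (ediag x ** p))"
        by (simp add: kxp(3) matrix_mul_assoc)
      then show ?thesis by (simp only: orthogonal_mult_inner[OF k(2)] inner_conj_ediag P'_def)
    qed
    finally have 2: "trace P + 2 * (\<Sum>i\<in>UNIV. x $ i * P' $ i $ i) \<le> (g ** P) \<bullet> g" .
    \<comment> \<open>The two first-order terms add up to the character, since conjugation by
      \<open>p\<close> fixes \<open>D = s M + P\<close>. They cancel in \<open>J g\<close>.\<close>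
    have 3: "s * (\<Sum>i\<in>UNIV. x $ i * momentM \<mu>' $ i $ i) + (\<Sum>i\<in>UNIV. x $ i * P' $ i $ i) = chi D g"
      unfolding kxp(3) chi_svd[OF D t kxp(1,2)] pairing_def
      by (simp add: P' sum_distrib_left sum.distrib[symmetric] algebra_simps)
    have "s / 2 * (nV \<mu> + 2 * (\<Sum>i\<in>UNIV. x $ i * momentM \<mu>' $ i $ i)) \<le> s / 2 * nV (GL_act g \<mu>)"
      using 1 s by (intro mult_left_mono) auto
    then show ?thesis using 2 3 unfolding J0_def J_def by (simp add: algebra_simps)
  qed
  \<comment> \<open>Moves the base point from \<open>GL_act h b\<close> back to
    \<open>GL_act q b\<close>, where \<open>v\<close> is admissible.\<close>
  define g1 where "g1 = q ** matrix_inv h"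
  have g1: "g1 \<in> G_torus t" unfolding g1_def using K_torusD(1)[OF q] G_torus_inv[OF h] G_torus_mult by blast
  define R where "R = g1 ** P ** transpose g1"
  have R0: "R $ i $ i \<ge> 0" for i
    unfolding R_def using posdef_nth[OF posdef_conj[OF Ppos G_torusD(1)[OF g1]]] by (auto intro: less_imp_le)
  define C where "C = s / 2 * nV b + (\<Sum>i\<in>UNIV. R $ i $ i) / 2 - chi D g1 - J0"
  have bound: "r * pairing D v \<le> C" if r: "r \<ge> 0" for r
  proof -
    let ?e = "ediag (r *\<^sub>R v)"
    have e: "?e ** g1 \<in> G_torus t" using ediag_G_torus[OF t] g1 G_torus_mult by blast
    have "GL_act (?e ** g1) \<mu> = GL_act ?e (GL_act q b)"
    proof -
      have "GL_act (?e ** g1) \<mu> = GL_act ?e (GL_act g1 \<mu>)"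
        using G_torusD(1)[OF g1] G_torusD(1)[OF ediag_G_torus[OF t]] by (simp add: GL_act_mult)
      also have "GL_act g1 \<mu> = GL_act q (GL_act (matrix_inv h) \<mu>)"
        unfolding g1_def using K_torusD(3)[OF q] G_torusD(1)[OF G_torus_inv[OF h]] by (simp add: GL_act_mult)
      finally show ?thesis by (simp add: \<mu>_def GL_act_inv G_torusD(1)[OF h])
    qed
    moreover have "nV (GL_act ?e (GL_act q b)) \<le> nV (GL_act q b)"
    proof -
      have "exp (2 * wt (r *\<^sub>R v) i j k) * (sc (GL_act q b) i j k)\<^sup>2 \<le> (sc (GL_act q b) i j k)\<^sup>2" for i j k
      proof (cases "sc (GL_act q b) i j k = 0")
        case False
        then have "wt v i j k \<le> 0" using v by (auto simp: adm_def)
        then have "exp (2 * wt (r *\<^sub>R v) i j k) \<le> 1" using r by (simp add: wt_scale mult_nonneg_nonpos)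
        then show ?thesis by (simp add: mult_left_le_one_le)
      qed simp
      then show ?thesis
        unfolding nV_ediag[OF GL_act_V[OF b]]
        by (simp add: inner_V_sc power2_eq_square sum_mono divide_right_mono)
    qed
    ultimately have 1: "nV (GL_act (?e ** g1) \<mu>) \<le> nV b"
      by (simp add: nV_orthogonal b K_torusD(2)[OF q])
    have "exp (2 * (r *\<^sub>R v) $ i) * R $ i $ i \<le> R $ i $ i" for i
    proof -
      have "exp (2 * (r *\<^sub>R v) $ i) \<le> 1" using r v by (simp add: adm_def mult_nonneg_nonpos)
      then show ?thesis using R0[of i] by (simp add: mult_left_le_one_le)
    qed
    then have 2: "(?e ** g1 ** P) \<bullet> (?e ** g1) \<le> (\<Sum>i\<in>UNIV. R $ i $ i)"
      unfolding inner_conj_ediag R_def[symmetric] by (rule sum_mono)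
    have "J0 \<le> s / 2 * nV b + (\<Sum>i\<in>UNIV. R $ i $ i) / 2 - (r * pairing D v + chi D g1)"
      using J0[OF e] 2 mult_left_mono[OF 1, of "s / 2"] s
      unfolding J_def chi_ediag_mult[OF D t g1] pairing_scale by simp
    then show ?thesis by (simp add: C_def)
  qed
  show ?thesis
  proof (rule ccontr)
    assume "\<not> pairing D v \<le> 0"
    then have "(\<bar>C\<bar> + 1) / pairing D v * pairing D v = \<bar>C\<bar> + 1" "(\<bar>C\<bar> + 1) / pairing D v \<ge> 0" by auto
    then show False using bound[of "(\<bar>C\<bar> + 1) / pairing D v"] by simp
  qed
qed

lemma central_shift:
  assumes "central t D"
  shows "central t (D - e *\<^sub>R mat 1)"
  unfolding central_def
proof (intro conjI allI impI)
  show "D - e *\<^sub>R mat 1 \<in> Dg"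
    using centralD(1)[OF assms] by (auto simp: Dg_def mat_def)
  fix g assume "commutes g t"
  then have "g ** D = D ** g" using assms by (auto simp: central_def)
  then show "g ** (D - e *\<^sub>R mat 1) = (D - e *\<^sub>R mat 1) ** g"
    by (simp add: matrix_mult_add_diff matrix_scalar_ac scalar_matrix_assoc[symmetric])
qed

text \<open>Positive definiteness survives replacing \<open>D\<close> by \<open>D - d I\<close> for
  small \<open>d > 0\<close>, and the weak inequality for the shifted operator is strict for
  \<open>D\<close>, because the entries of an admissible nonzero \<open>v\<close> have negative
  sum.\<close>

theorem posdef_imp_criterion:
  assumes b: "b \<in> V" and t: "t \<subseteq> Dg" and D: "central t D" and h: "h \<in> G_torus t" and s: "s \<ge> 0"
    and P: "posdef (D - s *\<^sub>R momentM (GL_act h b))"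
    and q: "q \<in> K_torus t" and v: "adm (GL_act q b) v" "v \<noteq> 0"
  shows "pairing D v < 0"
proof -
  let ?P = "D - s *\<^sub>R momentM (GL_act h b)" and ?I = "mat 1 :: real^'a^'a"
  obtain e where e: "e > 0" "\<And>B. transpose B = B \<Longrightarrow> norm (B - ?P) < e \<Longrightarrow> posdef B"
    using posdef_perturb[OF P] by blast
  define N where "N = norm ?I + 1"
  define d where "d = e / (2 * N)"
  have n0: "N > 0" unfolding N_def using norm_ge_zero[of ?I] by linarith
  have d: "d > 0" "d * norm ?I < e"
  proof -
    show "d > 0" using e(1) n0 by (simp add: d_def)
    have "d * N = e / 2" using n0 by (simp add: d_def)
    then have "d * norm ?I + d = e / 2" by (simp add: N_def algebra_simps)
    then show "d * norm ?I < e" using \<open>d > 0\<close> e(1) by simp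
  qed
  have "posdef (?P - d *\<^sub>R ?I)"
  proof (rule e(2))
    have "transpose ?P = ?P" using P by (simp add: posdef_def)
    then show "transpose (?P - d *\<^sub>R ?I) = ?P - d *\<^sub>R ?I"
      by (simp add: transpose_add_diff transpose_scalar)
  qed (use d in simp)
  then have "posdef ((D - d *\<^sub>R ?I) - s *\<^sub>R momentM (GL_act h b))" by (simp add: algebra_simps)
  then have "pairing (D - d *\<^sub>R ?I) v \<le> 0"
    using criterion_nonstrict[OF b t central_shift[OF D] h s _ q v(1)] by blast
  moreover have "pairing (D - d *\<^sub>R ?I) v = pairing D v - d * (\<Sum>i\<in>UNIV. v $ i)"
    by (simp add: pairing_def mat_def left_diff_distrib sum_subtractf sum_distrib_left)
  moreover have "(\<Sum>i\<in>UNIV. v $ i) < 0"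
  proof -
    have n: "\<And>i. v $ i \<le> 0" using v(1) by (auto simp: adm_def)
    obtain i where i: "v $ i \<noteq> 0" using v(2) by (auto simp: vec_eq_iff)
    have "(\<Sum>i\<in>UNIV. v $ i) < (\<Sum>i\<in>(UNIV::'a set). 0)"
      by (rule sum_strict_mono_ex1) (use n i in \<open>auto simp: less_le\<close>)
    then show ?thesis by simp
  qed
  ultimately show ?thesis using d(1) mult_pos_neg by (smt (verit))
qed

subsection \<open>The cone as the solution set of finitely many strict linear inequalities\<close>

text \<open>The moment map of an orbit point commutes with \<open>t\<close>, so an element of
  \<open>K_torus t\<close> diagonalizes it; by equivariance the result is the moment map of another
  orbit point.\<close>

lemma momentM_rotate:
  assumes b: "b \<in> V" and t: "t \<subseteq> Dg" "t \<subseteq> Der b" and h: "h \<in> G_torus t"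
  obtains k where "k \<in> K_torus t" "momentM (GL_act (k ** h) b) \<in> Dg"
    "momentM (GL_act (k ** h) b) = k ** momentM (GL_act h b) ** transpose k"
proof -
  have "t \<subseteq> Der (GL_act h b)"
    using t(2) G_torusD[OF h] Der_GL_act by (fastforce simp: commutes_def)
  then have "commutes (momentM (GL_act h b)) t" by (intro momentM_commutes GL_act_V b t)
  then obtain k where k: "k \<in> K_torus t" "k ** momentM (GL_act h b) ** transpose k \<in> Dg"
    using diagonalization[OF momentM_sym _ t(1)] by blast
  have "momentM (GL_act (k ** h) b) = k ** momentM (GL_act h b) ** transpose k"
    using K_torusD(2,3)[OF k(1)] G_torusD(1)[OF h]
    by (simp add: GL_act_mult momentM_orthogonal[OF GL_act_V[OF b]])
  then show ?thesis using that k by simp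
qed

lemma structure_momentM:
  "momentM \<mu> = (\<chi> a b. (\<Sum>i\<in>UNIV. \<Sum>j\<in>UNIV. structure_constants \<mu> $ i $ j $ a * structure_constants \<mu> $ i $ j $ b) / 2
     - (\<Sum>j\<in>UNIV. \<Sum>k\<in>UNIV. structure_constants \<mu> $ a $ j $ k * structure_constants \<mu> $ b $ j $ k))"
  by (simp add: momentM_def structure_constants_nth)

lemma posdef_Dg: "B \<in> Dg_pos \<Longrightarrow> posdef B"
proof -
  assume "B \<in> Dg_pos"
  then have B: "B \<in> Dg" "\<And>i. B $ i $ i > 0" by (auto simp: Dg_pos_def)
  define c where "c = (\<chi> i. B $ i $ i)"
  have Bc: "B = diag c" unfolding c_def by (rule Dg_eq_diag[OF B(1)])
  have c: "c $ i > 0" for i by (simp add: c_def B(2))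
  have "x \<bullet> (B *v x) > 0" if x: "x \<noteq> 0" for x
  proof -
    obtain i where i: "x $ i \<noteq> 0" using x by (auto simp: vec_eq_iff)
    have "x \<bullet> (B *v x) = (\<Sum>i\<in>UNIV. c $ i * (x $ i)\<^sup>2)"
      by (simp add: Bc inner_vec_def diag_vec_nth power2_eq_square mult_ac)
    also have "\<dots> > 0"
      by (rule sum_pos2[of UNIV i]) (use c i in \<open>simp_all add: less_imp_le\<close>)
    finally show ?thesis .
  qed
  then show ?thesis by (simp add: posdef_def Bc transpose_diag)
qed

text \<open>From left to right, a limit of the orbit is replaced by a nearby orbit point because
  positive definiteness is open. From right to left, a rotation commuting with \<open>D\<close>
  makes the moment map diagonal, and a positive definite diagonal matrix has positive entries. The
  squared norm of the bracket is absorbed into \<open>s\<close>.\<close>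

theorem cone_C_iff:
  assumes b: "b \<in> V" and t: "t \<subseteq> Dg" "t \<subseteq> Der b"
  shows "D \<in> cone_C b t \<longleftrightarrow> D \<in> t \<and> trace D > 0 \<and> b \<noteq> (\<lambda>x y. 0) \<and>
    (\<exists>h\<in>G_torus t. \<exists>s>0. posdef (D - s *\<^sub>R momentM (GL_act h b)))"
proof
  assume "D \<in> cone_C b t"
  then obtain s \<mu> where D: "D \<in> t" "trace D > 0" and s: "s > 0"
    and \<mu>: "\<mu> \<in> closure_V ((\<lambda>h. GL_act h b) ` G_torus t)" "\<mu> \<noteq> (\<lambda>x y. 0)"
    and B: "D - s *\<^sub>R moment \<mu> \<in> Dg_pos"
    by (auto simp: cone_C_def)
  have V: "\<mu> \<in> V" and cl: "structure_constants \<mu> \<in> closure (structure_constants ` (\<lambda>h. GL_act h b) ` G_torus t)"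
    using \<mu>(1) by (auto simp: closure_V_def)
  define s' where "s' = s / nV \<mu>"
  have s': "s' > 0" using s nV_pos[OF V \<mu>(2)] by (simp add: s'_def)
  have pd: "posdef (D - s' *\<^sub>R momentM \<mu>)"
    using posdef_Dg[OF B] by (simp add: moment_eq[OF V] s'_def)
  obtain T where T: "\<And>n::nat. T n \<in> structure_constants ` (\<lambda>h. GL_act h b) ` G_torus t" "T \<longlonglongrightarrow> structure_constants \<mu>"
    using cl closure_sequential by blast
  then have "\<forall>n. \<exists>h. h \<in> G_torus t \<and> T n = structure_constants (GL_act h b)" by auto
  then obtain h where h: "\<And>n. h n \<in> G_torus t" "\<And>n. T n = structure_constants (GL_act (h n) b)" by metis
  have "(\<lambda>n. momentM (GL_act (h n) b)) \<longlonglongrightarrow> momentM \<mu>"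
    unfolding structure_momentM h(2)[symmetric]
    by (intro tendsto_vec_lambda tendsto_intros T(2)) auto
  then have lim: "(\<lambda>n. D - s' *\<^sub>R momentM (GL_act (h n) b)) \<longlonglongrightarrow> D - s' *\<^sub>R momentM \<mu>"
    by (intro tendsto_intros)
  obtain e where e: "e > 0" "\<And>B. transpose B = B \<Longrightarrow> norm (B - (D - s' *\<^sub>R momentM \<mu>)) < e \<Longrightarrow> posdef B"
    using posdef_perturb[OF pd] by blast
  obtain n where n: "norm (D - s' *\<^sub>R momentM (GL_act (h n) b) - (D - s' *\<^sub>R momentM \<mu>)) < e"
    using LIMSEQ_D[OF lim e(1)] by blast
  have "transpose (D - s' *\<^sub>R momentM (GL_act (h n) b)) = D - s' *\<^sub>R momentM (GL_act (h n) b)"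
  proof -
    have "transpose D = D" using Dg_eq_diag[of D] transpose_diag D(1) t(1) by (metis subsetD)
    then show ?thesis by (simp add: transpose_add_diff transpose_scalar momentM_sym)
  qed
  then have "posdef (D - s' *\<^sub>R momentM (GL_act (h n) b))" using e(2) n by blast
  \<comment> \<open>The orbit of the zero bracket is a point, whose closure contains no admissible
    \<open>\<mu>\<close>.\<close>
  moreover have "b \<noteq> (\<lambda>x y. 0)"
  proof
    assume "b = (\<lambda>x y. 0)"
    then have "T n = 0" for n by (simp add: h(2) structure_constants_def GL_act_def vec_eq_iff)
    then have "T = (\<lambda>n. 0)" by blast
    then have "(\<lambda>n. 0) \<longlonglongrightarrow> structure_constants \<mu>" using T(2) by simp
    then have "structure_constants \<mu> = 0" using LIMSEQ_unique[of "\<lambda>n. 0" "structure_constants \<mu>" 0] by simp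
    then have "sc \<mu> i j k = 0" for i j k using structure_constants_nth[of \<mu> i j k] by simp
    then show False using \<mu>(2) V_eqI[OF V V_0] by (simp add: sc_def)
  qed
  ultimately show "D \<in> t \<and> trace D > 0 \<and> b \<noteq> (\<lambda>x y. 0) \<and>
    (\<exists>h\<in>G_torus t. \<exists>s>0. posdef (D - s *\<^sub>R momentM (GL_act h b)))" using D s' h(1) by blast
next
  assume "D \<in> t \<and> trace D > 0 \<and> b \<noteq> (\<lambda>x y. 0) \<and>
    (\<exists>h\<in>G_torus t. \<exists>s>0. posdef (D - s *\<^sub>R momentM (GL_act h b)))"
  then obtain h s where D: "D \<in> t" "trace D > 0" and b0: "b \<noteq> (\<lambda>x y. 0)" and h: "h \<in> G_torus t" and s: "s > 0"
    and pd: "posdef (D - s *\<^sub>R momentM (GL_act h b))" by blast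
  obtain k where k: "k \<in> K_torus t" "momentM (GL_act (k ** h) b) \<in> Dg"
    "momentM (GL_act (k ** h) b) = k ** momentM (GL_act h b) ** transpose k"
    using momentM_rotate[OF b t h] by blast
  let ?\<mu> = "GL_act (k ** h) b"
  have kh: "k ** h \<in> G_torus t" using K_torusD(1)[OF k(1)] h G_torus_mult by blast
  have V: "?\<mu> \<in> V" by (rule GL_act_V[OF b])
  have n0: "?\<mu> \<noteq> (\<lambda>x y. 0)" using GL_act_eq_0[OF G_torusD(1)[OF kh]] b0 by blast
  have "k ** D ** transpose k = D"
  proof -
    have "k ** D = D ** k" using K_torusD(4)[OF k(1)] D(1) by (auto simp: commutes_def)
    then have "k ** D ** transpose k = D ** (k ** transpose k)" by (simp add: matrix_mul_assoc)
    then show ?thesis by (simp add: K_torusD(7)[OF k(1)])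
  qed
  then have "k ** (D - s *\<^sub>R momentM (GL_act h b)) ** transpose k = D - s *\<^sub>R momentM ?\<mu>"
    by (simp add: k(3) matrix_mult_add_diff matrix_scalar_ac scalar_matrix_assoc)
  then have pd': "posdef (D - s *\<^sub>R momentM ?\<mu>)"
    using posdef_conj[OF pd K_torusD(3)[OF k(1)]] by simp
  have DDg: "D \<in> Dg" using D(1) t(1) by blast
  have B: "D - s *\<^sub>R momentM ?\<mu> \<in> Dg_pos"
    using posdef_nth[OF pd'] DDg k(2) by (auto simp: Dg_pos_def Dg_def)
  define s' where "s' = s * nV ?\<mu>"
  have s': "s' > 0" "s' *\<^sub>R moment ?\<mu> = s *\<^sub>R momentM ?\<mu>"
    using s nV_pos[OF V n0] by (simp_all add: s'_def moment_eq[OF V])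
  have "?\<mu> \<in> closure_V ((\<lambda>h. GL_act h b) ` G_torus t)"
    using kh V closure_subset by (fastforce simp: closure_V_def)
  then have mem: "s *\<^sub>R momentM ?\<mu> \<in> {s *\<^sub>R moment \<mu> | s \<mu>. s > 0 \<and>
       \<mu> \<in> closure_V ((\<lambda>h. GL_act h b) ` G_torus t) - {\<lambda>x y. 0}} \<inter> Dg"
    using s' n0 k(2) by (auto simp: Dg_def intro!: exI[of _ s'] exI[of _ ?\<mu>])
  then show "D \<in> cone_C b t"
    unfolding cone_C_def
    by (intro IntI CollectI exI[of _ "s *\<^sub>R momentM ?\<mu>"] exI[of _ "D - s *\<^sub>R momentM ?\<mu>"] conjI mem B D) simp
qed

text \<open>The relation is a parameter so that one finite set of vectors serves both the strict
  inequalities of the cone and the weak ones of its closed counterpart.\<close>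

definition criterion :: "(real^'n \<Rightarrow> real^'n \<Rightarrow> real^'n) \<Rightarrow> (real^'n^'n) set \<Rightarrow> (real \<Rightarrow> real \<Rightarrow> bool) \<Rightarrow> real^'n^'n \<Rightarrow> bool" where
  "criterion b t rel D \<longleftrightarrow> (\<forall>q\<in>K_torus t. \<forall>v. adm (GL_act q b) v \<longrightarrow> v \<noteq> 0 \<longrightarrow> rel (pairing D v) 0)"

lemma linear_pairing: "linear (pairing D)"
  by (intro linearI) (simp_all add: pairing_add pairing_scale)

text \<open>All coordinates are nonpositive and sum to -1, so the l1-norm is 1 and this polyhedron
  is bounded.\<close>

lemma adm_polytope:
  fixes S :: "('n::finite \<times> 'n \<times> 'n) set"
  obtains F :: "(real^'n) set" where "finite F"
    "convex hull F = {v. (\<forall>i. v $ i \<le> 0) \<and> (\<forall>(i,j,k)\<in>S. wt v i j k \<le> 0) \<and> (\<Sum>i\<in>UNIV. v $ i) = -1}"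
proof -
  let ?Q = "{v. (\<forall>i. v $ i \<le> 0) \<and> (\<forall>(i,j,k)\<in>S. wt v i j k \<le> 0) \<and> (\<Sum>i\<in>UNIV. v $ i) = -1} :: (real^'n) set"
  let ?H1 = "\<Inter>i. {v :: real^'n. axis i 1 \<bullet> v \<le> 0}"
  let ?H2 = "\<Inter>s\<in>S. {v :: real^'n. (case s of (i,j,k) \<Rightarrow> axis k 1 - axis i 1 - axis j 1) \<bullet> v \<le> 0}"
  let ?H3 = "{v :: real^'n. (\<chi> i. 1) \<bullet> v = -1}"
  have "polyhedron ?H1" "polyhedron ?H2" "polyhedron ?H3"
    by (auto intro!: polyhedron_Inter polyhedron_halfspace_le polyhedron_hyperplane)
  moreover have "?Q = ?H1 \<inter> ?H2 \<inter> ?H3"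
  proof -
    have "wt v i j k = (axis k 1 - axis i 1 - axis j 1) \<bullet> v" for v :: "real^'n" and i j k
      by (simp add: inner_axis' inner_diff_left wt_def)
    then show ?thesis
      by (auto simp: inner_axis' inner_vec_def[of "\<chi> i. 1"] case_prod_beta)
  qed
  ultimately have "polyhedron ?Q" by (simp add: polyhedron_Int)
  moreover have "bounded ?Q"
  proof (rule bounded_subset)
    show "?Q \<subseteq> cball 0 1"
    proof
      fix v assume v: "v \<in> ?Q"
      have "norm v \<le> (\<Sum>i\<in>UNIV. \<bar>v $ i\<bar>)" by (rule norm_le_l1_cart)
      also have "\<dots> = (\<Sum>i\<in>UNIV. - v $ i)" using v by (intro sum.cong) auto
      also have "\<dots> = - (\<Sum>i\<in>UNIV. v $ i)" by (rule sum_negf)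
      finally show "v \<in> cball 0 1" using v by simp
    qed
  qed simp
  ultimately have "polytope ?Q" by (simp add: polytope_eq_bounded_polyhedron)
  then obtain F where "finite F" "?Q = convex hull F" unfolding polytope_def by blast
  then show ?thesis using that[of F] by simp
qed

text \<open>Admissibility for \<open>q\<close> depends only on the support of
  \<open>GL_act q b\<close>, and there are finitely many supports. For each, the admissible vectors
  of sum -1 are the hull of finitely many points. Convexity of the half-line described by
  \<open>rel\<close> passes from these points to the hull, and scaling reaches every admissible
  vector.\<close>

lemma criterion_finite:
  fixes b :: "real^'n \<Rightarrow> real^'n \<Rightarrow> real^'n"
  obtains F :: "(real^'n) set" where "finite F"
    "\<And>D. criterion b t (<) D \<longleftrightarrow> (\<forall>v\<in>F. pairing D v < 0)"
    "\<And>D. criterion b t (\<le>) D \<longleftrightarrow> (\<forall>v\<in>F. pairing D v \<le> 0)"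
proof -
  define Q where "Q S = {v :: real^'n. (\<forall>i. v $ i \<le> 0) \<and> (\<forall>(i,j,k)\<in>S. wt v i j k \<le> 0) \<and> (\<Sum>i\<in>UNIV. v $ i) = -1}" for S
  have "\<exists>F. finite F \<and> convex hull F = Q S" for S
    unfolding Q_def by (rule adm_polytope[of S]) blast
  then obtain G where G: "\<And>S. finite (G S)" "\<And>S. convex hull (G S) = Q S" by metis
  define supp where "supp q = {(i,j,k). sc (GL_act q b) i j k \<noteq> 0}" for q
  define F where "F = (\<Union>S\<in>supp ` K_torus t. G S)"
  have finF: "finite F" unfolding F_def using G(1) by (meson finite_UN finite finite_subset subset_UNIV)
  have Qadm: "v \<in> Q (supp q) \<longleftrightarrow> adm (GL_act q b) v \<and> (\<Sum>i\<in>UNIV. v $ i) = -1" for q v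
    by (auto simp: Q_def supp_def adm_def)
  have iff: "criterion b t rel D \<longleftrightarrow> (\<forall>v\<in>F. rel (pairing D v) 0)"
    if conv: "convex {x. rel x 0}" and scale: "\<And>r x. r > 0 \<Longrightarrow> rel (r * x) 0 \<Longrightarrow> rel x 0"
    for rel and D :: "real^'n^'n"
  proof
    assume c: "criterion b t rel D"
    show "\<forall>v\<in>F. rel (pairing D v) 0"
    proof
      fix v assume "v \<in> F"
      then obtain q where q: "q \<in> K_torus t" "v \<in> G (supp q)" by (auto simp: F_def)
      then have "v \<in> Q (supp q)" using G(2)[of "supp q"] hull_subset[of "G (supp q)" convex] by auto
      then have "adm (GL_act q b) v" "(\<Sum>i\<in>UNIV. v $ i) = -1" using Qadm by auto
      moreover from this have "v \<noteq> 0" by auto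
      ultimately show "rel (pairing D v) 0" using c q by (auto simp: criterion_def)
    qed
  next
    assume F: "\<forall>v\<in>F. rel (pairing D v) 0"
    show "criterion b t rel D"
      unfolding criterion_def
    proof (intro ballI allI impI)
      fix q v assume q: "q \<in> K_torus t" and v: "adm (GL_act q b) v" "v \<noteq> 0"
      have n: "v $ i \<le> 0" for i using v(1) by (auto simp: adm_def)
      obtain i where i: "v $ i \<noteq> 0" using v(2) by (auto simp: vec_eq_iff)
      have "(\<Sum>i\<in>UNIV. v $ i) < (\<Sum>i\<in>(UNIV::'n set). 0)"
        by (rule sum_strict_mono_ex1) (use n i in \<open>auto simp: less_le\<close>)
      then have s: "(\<Sum>i\<in>UNIV. v $ i) < 0" by simp
      define r where "r = - inverse (\<Sum>i\<in>UNIV. v $ i)"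
      have r: "r > 0" using s by (simp add: r_def)
      have "adm (GL_act q b) (r *\<^sub>R v)"
        using v(1) r by (auto simp: adm_def wt_scale mult_nonneg_nonpos)
      moreover have "(\<Sum>i\<in>UNIV. (r *\<^sub>R v) $ i) = -1"
      proof -
        have "(\<Sum>i\<in>UNIV. (r *\<^sub>R v) $ i) = r * (\<Sum>i\<in>UNIV. v $ i)" by (simp add: sum_distrib_left)
        then show ?thesis using s by (simp add: r_def)
      qed
      ultimately have "r *\<^sub>R v \<in> convex hull (G (supp q))" using Qadm G(2) by blast
      moreover have "convex hull (G (supp q)) \<subseteq> pairing D -` {x. rel x 0}"
      proof (rule hull_minimal)
        show "G (supp q) \<subseteq> pairing D -` {x. rel x 0}" using F q by (auto simp: F_def)
        show "convex (pairing D -` {x. rel x 0})" by (intro convex_linear_vimage linear_pairing conv)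
      qed
      ultimately have "rel (r * pairing D v) 0" by (auto simp: pairing_scale)
      then show "rel (pairing D v) 0" using scale r by blast
    qed
  qed
  have "convex {x :: real. x < 0}" "convex {x :: real. x \<le> 0}"
    using convex_real_interval(2,4)[of 0] by (simp_all add: lessThan_def atMost_def)
  then show ?thesis
    using that[OF finF] iff[of "(<)"] iff[of "(\<le>)"]
    by (simp add: mult_less_0_iff mult_le_0_iff)
qed

lemma torus_central:
  "t \<subseteq> Dg \<Longrightarrow> D \<in> t \<Longrightarrow> central t D"
  by (auto simp: central_def commutes_def)

lemma cone_C_criterion:
  assumes b: "b \<in> V" "b \<noteq> (\<lambda>x y. 0)" and t: "t \<subseteq> Dg" "t \<subseteq> Der b"
  shows "cone_C b t = {D \<in> t. trace D > 0 \<and> criterion b t (<) D}"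
proof -
  have "(\<exists>h\<in>G_torus t. \<exists>s>0. posdef (D - s *\<^sub>R momentM (GL_act h b))) \<longleftrightarrow> criterion b t (<) D"
    if D: "D \<in> t" for D
  proof
    assume "\<exists>h\<in>G_torus t. \<exists>s>0. posdef (D - s *\<^sub>R momentM (GL_act h b))"
    then show "criterion b t (<) D"
      using posdef_imp_criterion[OF b(1) t(1) torus_central[OF t(1) D]]
      unfolding criterion_def by (meson less_imp_le)
  next
    assume "criterion b t (<) D"
    then obtain h where "h \<in> G_torus t" "posdef (D - momentM (GL_act h b))"
      using criterion_imp_posdef[OF b(1) t torus_central[OF t(1) D]] unfolding criterion_def by metis
    then show "\<exists>h\<in>G_torus t. \<exists>s>0. posdef (D - s *\<^sub>R momentM (GL_act h b))"
      by (intro bexI[of _ h] exI[of _ 1]) auto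
  qed
  then show ?thesis using cone_C_iff[OF b(1) t] b(2) by blast
qed

subsection \<open>Nilpotency\<close>

definition iter_span :: "('a::real_vector \<Rightarrow> 'a \<Rightarrow> 'a) \<Rightarrow> nat \<Rightarrow> 'a set" where
  "iter_span b k = span {foldr b xs y | xs y. length xs = k}"

text \<open>With \<open>iter_span\<close> this describes the lower central series through nested
  brackets. For fixed \<open>k\<close> it is a family of identities in \<open>b\<close>, which pass
  to conjugate brackets and to limits with the same \<open>k\<close>.\<close>

definition nilp :: "nat \<Rightarrow> ('a::real_vector \<Rightarrow> 'a \<Rightarrow> 'a) \<Rightarrow> bool" where
  "nilp k b \<longleftrightarrow> (\<forall>xs y. length xs = k \<longrightarrow> foldr b xs y = 0)"

definition jacobi :: "('a::real_vector \<Rightarrow> 'a \<Rightarrow> 'a) \<Rightarrow> bool" where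
  "jacobi b \<longleftrightarrow> (\<forall>x y z. b x (b y z) + b y (b z x) + b z (b x y) = 0)"

lemma lie_bracket_V: "lie_bracket b \<longleftrightarrow> b \<in> V \<and> jacobi b"
  by (auto simp: lie_bracket_def V_def jacobi_def)

lemma foldr_lower_central: "foldr b xs y \<in> lower_central b (length xs)"
  by (induction xs) (auto intro!: span_base)

lemma nilpotent_nilp: "nilpotent_bracket b \<Longrightarrow> \<exists>k. nilp k b"
  unfolding nilpotent_bracket_def nilp_def using foldr_lower_central by (metis singletonD)

lemma iter_span:
  shows "subspace (iter_span b k)" "iter_span b 0 = UNIV" "iter_span b (Suc k) \<subseteq> iter_span b k"
    and "nilp k b \<Longrightarrow> iter_span b k = {0}"
proof -
  show "subspace (iter_span b k)" by (simp add: iter_span_def)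
  have "{foldr b xs y | xs y. length xs = 0} = UNIV" by auto
  then show "iter_span b 0 = UNIV" by (simp add: iter_span_def)
  show "iter_span b (Suc k) \<subseteq> iter_span b k"
    unfolding iter_span_def
  proof (rule span_mono, clarify)
    fix xs :: "'a list" and y assume "length xs = Suc k"
    then obtain ys z where "xs = ys @ [z]" "length ys = k" by (metis length_Suc_conv_rev)
    then have "foldr b xs y = foldr b ys (b z y)" by simp
    then show "\<exists>xs' y'. foldr b xs y = foldr b xs' y' \<and> length xs' = k" using \<open>length ys = k\<close> by blast
  qed
  show "iter_span b k = {0}" if "nilp k b"
  proof -
    have "{foldr b xs y | xs y. length xs = k} \<subseteq> {0}" using that by (auto simp: nilp_def)
    then have "iter_span b k \<subseteq> span {0}" unfolding iter_span_def by (rule span_mono)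
    then show ?thesis using span_zero by (auto simp: iter_span_def)
  qed
qed

lemma span_linear_into:
  assumes "linear f" "\<And>x. x \<in> S \<Longrightarrow> f x \<in> span T" "x \<in> span S"
  shows "f x \<in> span T"
proof -
  have "f ` span S = span (f ` S)" by (rule span_linear_image[OF assms(1), symmetric])
  also have "\<dots> \<subseteq> span T" using assms(2) by (intro span_minimal) auto
  finally show ?thesis using assms(3) by blast
qed

lemma bracket_iter_span:
  assumes "bilinear b" "y \<in> iter_span b k"
  shows "b x y \<in> iter_span b (Suc k)"
  unfolding iter_span_def
proof (rule span_linear_into[of "b x" "{foldr b xs y | xs y. length xs = k}"])
  show "linear (b x)" using assms(1) by (simp add: bilinear_def)
  fix z assume "z \<in> {foldr b xs y | xs y. length xs = k}"
  then obtain xs y where "z = foldr b xs y" "length xs = k" by blast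
  then have "b x z = foldr b (x # xs) y" "length (x # xs) = Suc k" by auto
  then show "b x z \<in> span {foldr b xs y | xs y. length xs = Suc k}" by (intro span_base) blast
qed (use assms(2) in \<open>simp add: iter_span_def\<close>)

lemma Der_iter_span:
  assumes b: "bilinear b" and D: "D \<in> Der b" and y: "y \<in> iter_span b k"
  shows "D *v y \<in> iter_span b k"
proof -
  have *: "D *v foldr b xs y \<in> iter_span b (length xs)" for xs y
  proof (induction xs)
    case (Cons x xs)
    have "D *v foldr b (x # xs) y = b (D *v x) (foldr b xs y) + b x (D *v foldr b xs y)"
      using D by (simp add: Der_def)
    moreover have "foldr b xs y \<in> iter_span b (length xs)"
      unfolding iter_span_def by (intro span_base) blast
    ultimately show ?case
      using subspace_add[OF iter_span(1) bracket_iter_span[OF b] bracket_iter_span[OF b Cons]] by simp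
  qed (simp add: iter_span(2))
  show ?thesis
    using y span_linear_into[of "(*v) D" "{foldr b xs y | xs y. length xs = k}" "{foldr b xs y | xs y. length xs = k}" y] *
    unfolding iter_span_def by auto
qed

lemma orthogonal_projection:
  fixes C :: "(real^'n) set"
  assumes "subspace C"
  obtains P :: "real^'n^'n" where "transpose P = P" "\<And>x. P *v x \<in> C" "\<And>x. x \<in> C \<Longrightarrow> P *v x = x"
proof -
  obtain B where B: "B \<subseteq> C" "pairwise orthogonal B" "\<And>x. x \<in> B \<Longrightarrow> norm x = 1"
      "independent B" "card B = dim C" "span B = C"
    using orthonormal_basis_subspace[OF assms] by metis
  have fin: "finite B" using B(4) independent_bound by blast
  define p where "p x = (\<Sum>u\<in>B. (x \<bullet> u) *\<^sub>R u)" for x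
  have lin: "linear p" unfolding p_def
    by (intro linearI) (auto simp: inner_left_distrib scaleR_left_distrib sum.distrib scaleR_sum_right)
  have P: "matrix p *v x = p x" for x by (rule matrix_works[OF lin[folded linear_matrix_vector_mul_eq]])
  have sym: "p x \<bullet> y = x \<bullet> p y" for x y
    by (simp add: p_def inner_sum_left inner_sum_right inner_commute mult.commute)
  have id: "p u = u" if "u \<in> B" for u
  proof -
    have "(u \<bullet> v) *\<^sub>R v = (if v = u then u else 0)" if v: "v \<in> B" for v
      using B(2) B(3)[OF \<open>u \<in> B\<close>] v \<open>u \<in> B\<close> by (auto simp: pairwise_def orthogonal_def norm_eq_1)
    then show ?thesis unfolding p_def using fin that by (simp add: sum.delta)
  qed
  show ?thesis
  proof (rule that)
    have "(matrix p) $ i $ j = (matrix p) $ j $ i" for i j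
    proof -
      have "(matrix p) $ i $ j = axis i 1 \<bullet> p (axis j 1)" by (simp add: matrix_def inner_axis')
      also have "\<dots> = axis j 1 \<bullet> p (axis i 1)" by (metis sym inner_commute)
      finally show ?thesis by (simp add: matrix_def inner_axis')
    qed
    then show "transpose (matrix p) = matrix p" by (simp add: transpose_def vec_eq_iff)
    show "matrix p *v x \<in> C" for x
      unfolding P p_def using B(1) assms by (intro subspace_sum subspace_scale) auto
    show "matrix p *v x = x" if "x \<in> C" for x
    proof -
      have "x \<in> span B" using that B(6) by simp
      then show ?thesis unfolding P
        by (induction rule: span_induct_alt) (auto simp: linear_0[OF lin] linear_add[OF lin] linear_scale[OF lin] id)
    qed
  qed
qed

text \<open>
  With \<open>P\<^sub>j\<close> the projection onto \<open>C j\<close> one has \<open>A P\<^sub>j = P\<^sub>j\<^sub>+\<^sub>1 A P\<^sub>j\<close>, so the traces of \<open>A P\<^sub>j\<close> agree for all \<open>j\<close>.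
\<close>
lemma trace_nilpotent:
  fixes A :: "real^'n^'n" and C :: "nat \<Rightarrow> (real^'n) set"
  assumes sub: "\<And>j. subspace (C j)" and C0: "C 0 = UNIV" and Ck: "C k = {0}"
    and dec: "\<And>j. C (Suc j) \<subseteq> C j" and A: "\<And>j x. x \<in> C j \<Longrightarrow> A *v x \<in> C (Suc j)"
  shows "trace A = 0"
proof -
  have "\<exists>P :: real^'n^'n. (\<forall>x. P *v x \<in> C j) \<and> (\<forall>x\<in>C j. P *v x = x)" for j
    using orthogonal_projection[OF sub[of j]] by metis
  then obtain P :: "nat \<Rightarrow> real^'n^'n" where P: "\<And>j x. P j *v x \<in> C j" "\<And>j x. x \<in> C j \<Longrightarrow> P j *v x = x"
    by metis
  have "trace (A ** P j) = trace (A ** P (Suc j))" for j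
  proof -
    have "A ** P j = P (Suc j) ** (A ** P j)"
      by (subst matrix_eq) (simp add: matrix_vector_mul_assoc[symmetric] P A)
    then have "trace (A ** P j) = trace (P (Suc j) ** (A ** P j))" by simp
    also have "\<dots> = trace (A ** P j ** P (Suc j))" by (rule trace_mul_sym)
    also have "A ** P j ** P (Suc j) = A ** P (Suc j)"
    proof -
      have "P j *v (P (Suc j) *v x) = P (Suc j) *v x" for x
        by (rule P(2)) (use P(1)[of "Suc j" x] dec in blast)
      then show ?thesis by (subst matrix_eq) (simp add: matrix_vector_mul_assoc[symmetric])
    qed
    finally show ?thesis .
  qed
  then have "trace (A ** P 0) = trace (A ** P j)" for j by (induction j) auto
  then have "trace (A ** P 0) = trace (A ** P k)" .
  moreover have "P 0 = mat 1" by (subst matrix_eq) (simp add: P(2) C0)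
  moreover have "P k = 0" using P(1)[of k] by (subst matrix_eq) (auto simp: Ck)
  then have "trace (A ** P k) = 0" by (simp add: trace_def matrix_matrix_mult_def)
  ultimately show ?thesis by simp
qed

definition ad :: "(real^'n \<Rightarrow> real^'n \<Rightarrow> real^'n) \<Rightarrow> real^'n \<Rightarrow> real^'n^'n" where
  "ad b x = matrix (b x)"

lemma ad_works: "bilinear b \<Longrightarrow> ad b x *v y = b x y"
  unfolding ad_def by (rule matrix_works) (simp add: bilinear_def linear_matrix_vector_mul_eq)

lemma ad_nth: "ad b (axis i 1) $ k $ j = sc b i j k"
  by (simp add: ad_def matrix_def sc_def)

text \<open>\<open>ad b x\<close> shifts the series \<open>iter_span\<close> by one step and
  \<open>D\<close> preserves each step, so the product is nilpotent.\<close>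

lemma trace_Der_ad:
  assumes "bilinear b" "nilp k b" "D \<in> Der b"
  shows "trace (D ** ad b x) = 0"
proof (rule trace_nilpotent[OF iter_span(1) iter_span(2) iter_span(4)[OF assms(2)] iter_span(3)])
  show "(D ** ad b x) *v y \<in> iter_span b (Suc j)" if "y \<in> iter_span b j" for j y
    using Der_iter_span[OF assms(1,3) bracket_iter_span[OF assms(1) that]]
    by (simp add: matrix_vector_mul_assoc[symmetric] ad_works[OF assms(1)])
qed

lemma trace_ad:
  assumes "bilinear b" "nilp k b"
  shows "trace (ad b x) = 0"
proof (rule trace_nilpotent[OF iter_span(1) iter_span(2) iter_span(4)[OF assms(2)] iter_span(3)])
  show "ad b x *v y \<in> iter_span b (Suc j)" if "y \<in> iter_span b j" for j y
    using bracket_iter_span[OF assms(1) that] by (simp add: ad_works[OF assms(1)])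
qed

lemma ad_Der:
  assumes "b \<in> V" "jacobi b"
  shows "ad b x \<in> Der b"
proof -
  have "b x (b y z) = b (b x y) z + b y (b x z)" for y z
  proof -
    have "b x (b y z) + b y (b z x) + b z (b x y) = 0" using assms(2) by (auto simp: jacobi_def)
    moreover have "b z (b x y) = - b (b x y) z" "b y (b z x) = - b y (b x z)"
      using V_D(3)[OF assms(1)] V_D(3)[OF assms(1), of z x] bilinear_rneg[OF V_D(1)[OF assms(1)]] by metis+
    ultimately show ?thesis by (simp add: algebra_simps)
  qed
  then show ?thesis by (simp add: Der_def ad_works V_D(1)[OF assms(1)])
qed

text \<open>A basis adapted to the lower central series diagonalizes the sum of the orthogonal projections onto its terms.\<close>
lemma nilpotent_flag:
  assumes b: "b \<in> V" "nilp k b" and t: "t \<subseteq> Dg" "t \<subseteq> Der b"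
  obtains q \<xi> where "q \<in> K_torus t" "\<And>i j k. sc (GL_act q b) i j k \<noteq> 0 \<Longrightarrow> wt \<xi> i j k \<ge> 1"
proof -
  let ?C = "iter_span b"
  note bl = V_D(1)[OF b(1)]
  have "\<exists>P :: real^'a^'a. transpose P = P \<and> (\<forall>x. P *v x \<in> ?C j) \<and> (\<forall>x\<in>?C j. P *v x = x)" for j
    using orthogonal_projection[OF iter_span(1)[of b j]] by metis
  then obtain P :: "nat \<Rightarrow> real^'a^'a" where P: "\<And>j. transpose (P j) = P j"
    "\<And>j x. P j *v x \<in> ?C j" "\<And>j x. x \<in> ?C j \<Longrightarrow> P j *v x = x"
    by metis
  have dec: "?C j \<subseteq> ?C i" if "i \<le> j" for i j
    using that by (induction rule: dec_induct) (use iter_span(3) in blast)+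
  have Pcomm: "commutes (P j) t" for j
    unfolding commutes_def
  proof
    fix D assume D: "D \<in> t"
    have DT: "transpose D = D" using Dg_eq_diag[of D] transpose_diag D t(1) by (metis subsetD)
    have DP: "D ** P j = P j ** D ** P j"
      using Der_iter_span[OF bl _ P(2)] D t(2) P(3)
      by (subst matrix_eq) (auto simp: matrix_vector_mul_assoc[symmetric])
    then have "transpose (D ** P j) = transpose (P j ** D ** P j)" by simp
    \<comment> \<open>\<open>D\<close> preserves the range of the projection; transposing
      \<open>D P = P D P\<close> with both operators symmetric gives commutation.\<close>
    then have "P j ** D = P j ** D ** P j"
      by (simp add: matrix_transpose_mul DT P(1) matrix_mul_assoc)
    then show "P j ** D = D ** P j" using DP by simp
  qed
  define S where "S = (\<Sum>l\<in>{1..k}. P l)"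
  have "P l $ i $ j = P l $ j $ i" for l i j by (metis P(1) transpose_def vec_lambda_beta)
  then have ST: "transpose S = S"
    unfolding S_def vec_eq_iff transpose_def by simp
  have Sv: "S *v x = (\<Sum>l\<in>{1..k}. P l *v x)" for x
  proof -
    have "(\<Sum>l\<in>A. P l) *v x = (\<Sum>l\<in>A. P l *v x)" if "finite A" for A
      using that by (induction A) (auto simp: matrix_vector_mult_add_rdistrib)
    then show ?thesis by (simp add: S_def)
  qed
  have Scomm: "commutes S t"
    unfolding commutes_nth[OF t(1)]
  proof (intro ballI allI impI)
    fix D i j assume D: "D \<in> t" and nz: "S $ i $ j \<noteq> 0"
    have "S $ i $ j = (\<Sum>l\<in>{1..k}. P l $ i $ j)" by (simp add: S_def)
    then obtain l where "P l $ i $ j \<noteq> 0" using nz by (metis sum.neutral)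
    then show "D $ i $ i = D $ j $ j" using Pcomm D unfolding commutes_nth[OF t(1)] by blast
  qed
  obtain q where q: "q \<in> K_torus t" "q ** S ** transpose q \<in> Dg"
    using diagonalization[OF ST Scomm t(1)] by blast
  define s where "s = (\<chi> i. (q ** S ** transpose q) $ i $ i)"
  have qS: "q ** S ** transpose q = diag s" unfolding s_def by (rule Dg_eq_diag[OF q(2)])
  define u where "u i = transpose q *v axis i 1" for i
  have u0: "u i \<noteq> 0" for i
  proof
    assume "u i = 0"
    then have "q *v u i = 0" by simp
    moreover have "q *v u i = axis i 1"
      by (simp only: u_def matrix_vector_mul_assoc K_torusD(7)[OF q(1)] matrix_vector_mul_lid)
    ultimately show False by simp
  qed
  have Su: "S *v u i = s $ i *\<^sub>R u i" for i
  proof -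
    have "S ** transpose q = transpose q ** (q ** S ** transpose q)"
      using K_torusD(6)[OF q(1)] by (simp add: matrix_mul_assoc)
    then have "S *v u i = (transpose q ** diag s) *v axis i 1"
      by (simp only: u_def matrix_vector_mul_assoc qS)
    then show ?thesis
      by (simp only: matrix_vector_mul_assoc[symmetric] diag_axis matrix_vector_mult_scaleR u_def)
  qed
  \<comment> \<open>Let \<open>m\<close> be the last index whose step contains \<open>u i\<close>.
    The projections up to \<open>m\<close> fix \<open>u i\<close>, so \<open>S\<close> maps it to
    \<open>m u\<close> plus an element of the next step; since \<open>u i\<close> is an eigenvector
    outside that step, the eigenvalue is \<open>m\<close> and the extra element vanishes.\<close>
  have level: "\<exists>m<k. u i \<in> ?C m \<and> s $ i = real m \<and> (\<forall>y\<in>?C (Suc m). u i \<bullet> y = 0)" for i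
  proof -
    have "\<exists>m. u i \<in> ?C m \<and> u i \<notin> ?C (Suc m) \<and> m < k"
    proof -
      have "u i \<in> ?C 0" by (simp add: iter_span(2))
      moreover have "u i \<notin> ?C k" using iter_span(4)[OF b(2)] u0 by auto
      ultimately show ?thesis
        using ex_least_nat_less[of "\<lambda>m. u i \<notin> ?C m" k] by auto
    qed
    then obtain m where m: "u i \<in> ?C m" "u i \<notin> ?C (Suc m)" "m < k" by blast
    have split: "S *v u i = real m *\<^sub>R u i + (\<Sum>l\<in>{Suc m..k}. P l *v u i)"
    proof -
      have "{1..k} = {1..m} \<union> {Suc m..k}" "{1..m} \<inter> {Suc m..k} = {}" using m(3) by auto
      then have "S *v u i = (\<Sum>l\<in>{1..m}. P l *v u i) + (\<Sum>l\<in>{Suc m..k}. P l *v u i)"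
        unfolding Sv by (simp add: sum.union_disjoint)
      also have "(\<Sum>l\<in>{1..m}. P l *v u i) = (\<Sum>l\<in>{1..m}. u i)"
        by (intro sum.cong refl P(3)) (use m(1) dec in auto)
      finally show ?thesis by (simp add: scaleR_conv_of_real sum_constant_scaleR)
    qed
    have "(\<Sum>l\<in>{Suc m..k}. P l *v u i) \<in> ?C (Suc m)"
      by (intro subspace_sum iter_span(1)) (meson P(2) dec subsetD atLeastAtMost_iff)
    moreover have "(\<Sum>l\<in>{Suc m..k}. P l *v u i) = (s $ i - real m) *\<^sub>R u i"
      using split Su[of i] by (simp add: algebra_simps)
    ultimately have sm: "s $ i = real m"
      using m(2) subspace_scale[OF iter_span(1), of "(s $ i - real m) *\<^sub>R u i" b "Suc m" "inverse (s $ i - real m)"]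
      by (cases "s $ i = real m") auto
    then have 0: "(\<Sum>l\<in>{Suc m..k}. P l *v u i) = 0" using split Su[of i] by simp
    \<comment> \<open>For a symmetric projection the pairing with \<open>u i\<close> is a square, so
      the vanishing sum forces each projection of \<open>u i\<close> to vanish.\<close>
    have PP: "u i \<bullet> (P l *v u i) = (P l *v u i) \<bullet> (P l *v u i)" for l
    proof -
      have "(P l *v u i) \<bullet> (P l *v u i) = u i \<bullet> (P l *v (P l *v u i))"
        by (metis P(1) dot_lmul_matrix transpose_matrix_vector)
      then show ?thesis using P(2,3) by simp
    qed
    have "(\<Sum>l\<in>{Suc m..k}. (P l *v u i) \<bullet> (P l *v u i)) = u i \<bullet> (\<Sum>l\<in>{Suc m..k}. P l *v u i)"
      by (simp add: inner_sum_right PP)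
    then have "\<forall>l\<in>{Suc m..k}. (P l *v u i) \<bullet> (P l *v u i) = 0"
      using 0 by (subst sum_nonneg_eq_0_iff[symmetric]) auto
    then have Pu: "P (Suc m) *v u i = 0" using m(3) by auto
    have "u i \<bullet> y = 0" if "y \<in> ?C (Suc m)" for y
    proof -
      have "u i \<bullet> y = u i \<bullet> (P (Suc m) *v y)" using P(3)[OF that] by simp
      also have "\<dots> = (P (Suc m) *v u i) \<bullet> y" by (metis P(1) dot_lmul_matrix transpose_matrix_vector)
      finally show ?thesis using Pu by simp
    qed
    then show ?thesis using m sm by blast
  qed
  obtain m where m: "\<And>i. m i < k" "\<And>i. u i \<in> ?C (m i)" "\<And>i. s $ i = real (m i)"
    "\<And>i y. y \<in> ?C (Suc (m i)) \<Longrightarrow> u i \<bullet> y = 0"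
    using level by metis
  \<comment> \<open>Base 3 suffices: if \<open>m l\<close> exceeds \<open>m i\<close> and
    \<open>m j\<close>, then \<open>3 ^ m l\<close> is at least 3/2 of the sum of the other two
    powers, and half of that sum is at least 1.\<close>
  define \<xi> :: "real^'a" where "\<xi> = (\<chi> i. 3 ^ m i)"
  have scq: "sc (GL_act q b) i j l = u l \<bullet> b (u i) (u j)" for i j l
  proof -
    have "sc (GL_act q b) i j l = axis l 1 \<bullet> (q *v b (u i) (u j))"
      by (simp add: sc_def GL_act_def u_def K_torusD(5)[OF q(1)] inner_axis')
    also have "\<dots> = u l \<bullet> b (u i) (u j)" by (simp add: u_def dot_lmul_matrix[symmetric])
    finally show ?thesis .
  qed
  have step: "m l \<ge> Suc (m j)" if nz: "u l \<bullet> b (u i) (u j) \<noteq> 0" for i j l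
  proof (rule ccontr)
    assume "\<not> m l \<ge> Suc (m j)"
    then have "?C (Suc (m j)) \<subseteq> ?C (Suc (m l))" by (intro dec) simp
    then have "b (u i) (u j) \<in> ?C (Suc (m l))" using bracket_iter_span[OF bl m(2)] by blast
    then show False using m(4) nz by blast
  qed
  have "wt \<xi> i j l \<ge> 1" if "sc (GL_act q b) i j l \<noteq> 0" for i j l
  proof -
    have nz: "u l \<bullet> b (u i) (u j) \<noteq> 0" using that scq by simp
    then have "u l \<bullet> b (u j) (u i) \<noteq> 0" using V_D(3)[OF b(1), of "u i" "u j"] by simp
    then have ge: "m l \<ge> Suc (m j)" "m l \<ge> Suc (m i)" using step nz by blast+
    have "(3::real) ^ m l \<ge> 3 ^ Suc (m j)" "(3::real) ^ m l \<ge> 3 ^ Suc (m i)"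
      "(1::real) \<le> 3 ^ m i" "(1::real) \<le> 3 ^ m j"
      using power_increasing[OF ge(1), of "3::real"] power_increasing[OF ge(2), of "3::real"] by simp_all
    then show ?thesis unfolding wt_def \<xi>_def vec_lambda_beta power_Suc by linarith
  qed
  then show ?thesis using that q(1) by blast
qed

subsection \<open>Positivity of the derivation of a nilsoliton\<close>

lemma transpose_sum_shift:
  fixes B :: "real^'n \<Rightarrow> real^'n \<Rightarrow> real"
  assumes "bilinear B"
  shows "(\<Sum>i\<in>UNIV. B (A *v axis i 1) (axis i 1)) = (\<Sum>i\<in>UNIV. B (axis i 1) (transpose A *v axis i 1))"
proof -
  have l: "linear (\<lambda>x. B x y)" "linear (B x)" for x y using assms by (auto simp: bilinear_def)
  have col: "(E *v axis i 1) $ a = E $ a $ i" for E :: "real^'n^'n" and i a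
    by (simp add: matrix_vector_mult_basis column_def)
  have "(\<Sum>i\<in>UNIV. B (A *v axis i 1) (axis i 1)) = (\<Sum>i\<in>UNIV. \<Sum>a\<in>UNIV. A $ a $ i * B (axis a 1) (axis i 1))"
  proof (intro sum.cong refl)
    fix i
    show "B (A *v axis i 1) (axis i 1) = (\<Sum>a\<in>UNIV. A $ a $ i * B (axis a 1) (axis i 1))"
      by (subst vec_expand[of "A *v axis i 1"]) (simp only: linear_sum[OF l(1)] linear_scale[OF l(1)] col real_scaleR_def)
  qed
  also have "\<dots> = (\<Sum>a\<in>UNIV. \<Sum>i\<in>UNIV. A $ a $ i * B (axis a 1) (axis i 1))" by (rule sum.swap)
  also have "\<dots> = (\<Sum>a\<in>UNIV. B (axis a 1) (transpose A *v axis a 1))"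
  proof (intro sum.cong refl)
    fix a
    show "(\<Sum>i\<in>UNIV. A $ a $ i * B (axis a 1) (axis i 1)) = B (axis a 1) (transpose A *v axis a 1)"
      by (subst vec_expand[of "transpose A *v axis a 1"])
        (simp only: linear_sum[OF l(2)] linear_scale[OF l(2)] col real_scaleR_def transpose_def vec_lambda_beta)
  qed
  finally show ?thesis .
qed

lemma gl_act_adjoint:
  fixes \<mu> \<nu> :: "real^'n \<Rightarrow> real^'n \<Rightarrow> real^'n"
  assumes \<mu>: "bilinear \<mu>" and \<nu>: "bilinear \<nu>"
  shows "inner_V (gl_act A \<mu>) \<nu> = inner_V \<mu> (gl_act (transpose A) \<nu>)"
proof -
  let ?e = "\<lambda>i. axis i 1 :: real^'n"
  have l: "linear (\<lambda>x. \<mu> x y)" "linear (\<mu> x)" "linear (\<lambda>x. \<nu> x y)" "linear (\<nu> x)" for x y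
    using \<mu> \<nu> by (auto simp: bilinear_def)
  have 1: "(A *v x) \<bullet> y = x \<bullet> (transpose A *v y)" for x y :: "real^'n"
    by (metis dot_lmul_matrix inner_commute transpose_matrix_vector transpose_transpose)
  have 3: "(\<Sum>j\<in>UNIV. \<mu> (?e i) (A *v ?e j) \<bullet> \<nu> (?e i) (?e j)) = (\<Sum>j\<in>UNIV. \<mu> (?e i) (?e j) \<bullet> \<nu> (?e i) (transpose A *v ?e j))" for i
    using transpose_sum_shift[OF bilinear_inner_compose[OF l(2) l(4)]] by blast
  have 2: "(\<Sum>i\<in>UNIV. \<Sum>j\<in>UNIV. \<mu> (A *v ?e i) (?e j) \<bullet> \<nu> (?e i) (?e j)) = (\<Sum>i\<in>UNIV. \<Sum>j\<in>UNIV. \<mu> (?e i) (?e j) \<bullet> \<nu> (transpose A *v ?e i) (?e j))"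
  proof -
    have "(\<Sum>i\<in>UNIV. \<mu> (A *v ?e i) (?e j) \<bullet> \<nu> (?e i) (?e j)) = (\<Sum>i\<in>UNIV. \<mu> (?e i) (?e j) \<bullet> \<nu> (transpose A *v ?e i) (?e j))" for j
      using transpose_sum_shift[OF bilinear_inner_compose[OF l(1) l(3)]] by blast
    then show ?thesis by (subst (1 2) sum.swap) simp
  qed
  show ?thesis
    unfolding inner_V_frame gl_act_def
    by (simp add: inner_diff_left inner_diff_right sum_subtractf 1 2 3)
qed

lemma gl_act_Der: "A \<in> Der \<mu> \<longleftrightarrow> gl_act A \<mu> = (\<lambda>x y. 0)"
  by (auto simp: Der_def gl_act_def fun_eq_iff algebra_simps)

lemma gl_act_commutator:
  assumes "bilinear \<mu>"
  shows "gl_act (A ** B - B ** A) \<mu> x y = gl_act A (gl_act B \<mu>) x y - gl_act B (gl_act A \<mu>) x y"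
  by (simp add: gl_act_def matrix_vector_mult_diff_rdistrib matrix_vector_mult_diff_distrib
      matrix_vector_mul_assoc bilinear_lsub[OF assms] bilinear_rsub[OF assms] algebra_simps)

lemma gl_act_V:
  assumes "\<mu> \<in> V"
  shows "gl_act A \<mu> \<in> V"
proof -
  have "gl_act A \<mu> x x = 0" for x
    using V_D(3)[OF assms, of "A *v x" x] by (simp add: gl_act_def V_D(2)[OF assms])
  then show ?thesis using gl_act_bilinear[OF V_D(1)[OF assms], of A] by (simp add: V_def)
qed

text \<open>Pair the moment map with the commutator of \<open>A = ad e_i\<close> and its transpose.
  Since \<open>A\<close> annihilates \<open>\<mu>\<close>, the result is the squared norm of the
  transpose acting on \<open>\<mu>\<close>; since \<open>diag \<phi>\<close> is a derivation, it is
  also \<open>c * \<phi> $ i\<close> times the squared norm of \<open>A\<close>. If it were not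
  positive, the transpose would be a derivation, and \<open>trace_Der_ad\<close> would force
  \<open>A = 0\<close>. For \<open>A = 0\<close> the diagonal entry of the moment map is nonnegative
  and \<open>\<phi> $ i \<ge> 1\<close>.\<close>

theorem soliton_positive:
  fixes \<phi> :: "real^'n"
  assumes V: "\<mu> \<in> V" and jac: "jacobi \<mu>" and nil: "nilp k \<mu>"
    and der: "\<And>i j l. sc \<mu> i j l \<noteq> 0 \<Longrightarrow> wt \<phi> i j l = 0"
    and M: "momentM \<mu> = c *\<^sub>R (diag \<phi> - mat 1)" and c: "c > 0"
  shows "\<phi> $ i > 0"
proof -
  define A where "A = ad \<mu> (axis i 1)"
  note bl = V_D(1)[OF V]
  have Mii: "momentM \<mu> $ i $ i = c * (\<phi> $ i - 1)" by (simp add: M diag_nth mat_def)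
  show ?thesis
  proof (cases "A = 0")
    case True
    then have "sc \<mu> i j l = 0" for j l using ad_nth[of \<mu> i l j] by (simp add: A_def)
    then have "momentM \<mu> $ i $ i \<ge> 0" by (simp add: momentM_def sum_nonneg)
    then have "\<phi> $ i - 1 \<ge> 0" using Mii c by (simp add: zero_le_mult_iff)
    then show ?thesis by simp
  next
    case False
    have AD: "A \<in> Der \<mu>" unfolding A_def by (rule ad_Der[OF V jac])
    let ?E = "A ** transpose A - transpose A ** A"
    have g0: "gl_act A \<mu> = (\<lambda>x y. 0)" using AD gl_act_Der by blast
    have "gl_act ?E \<mu> = gl_act A (gl_act (transpose A) \<mu>)"
      by (intro ext) (simp add: gl_act_commutator[OF bl] g0, simp add: gl_act_def)
    then have "momentM \<mu> \<bullet> ?E = nV (gl_act (transpose A) \<mu>)"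
      unfolding momentM_pair[OF V, symmetric]
      by (simp add: gl_act_adjoint[OF gl_act_bilinear[OF bl] bl])
    moreover have "momentM \<mu> \<bullet> ?E = c * \<phi> $ i * (A \<bullet> A)"
    proof -
      have w: "\<phi> $ l * (A $ l $ j)\<^sup>2 - \<phi> $ j * (A $ l $ j)\<^sup>2 = \<phi> $ i * (A $ l $ j)\<^sup>2" for l j
      proof (cases "A $ l $ j = 0")
        case False
        then have "wt \<phi> i j l = 0" using der ad_nth[of \<mu> i l j] by (simp add: A_def)
        then have "\<phi> $ l = \<phi> $ i + \<phi> $ j" by (simp add: wt_def)
        then show ?thesis by (simp add: algebra_simps)
      qed simp
      have AA: "(A ** transpose A) $ l $ l = (\<Sum>j\<in>UNIV. (A $ l $ j)\<^sup>2)"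
        "(transpose A ** A) $ l $ l = (\<Sum>j\<in>UNIV. (A $ j $ l)\<^sup>2)" for l
        by (simp_all add: matrix_matrix_mult_def transpose_def power2_eq_square)
      have "diag \<phi> \<bullet> ?E = (\<Sum>l\<in>UNIV. \<phi> $ l * ?E $ l $ l)"
        by (simp add: inner_vec_def diag_nth if_distrib[of "\<lambda>x. x * _"] cong: if_cong)
      also have "\<dots> = (\<Sum>l\<in>UNIV. \<Sum>j\<in>UNIV. \<phi> $ l * (A $ l $ j)\<^sup>2) - (\<Sum>l\<in>UNIV. \<Sum>j\<in>UNIV. \<phi> $ l * (A $ j $ l)\<^sup>2)"
        by (simp add: AA right_diff_distrib sum_subtractf sum_distrib_left)
      also have "(\<Sum>l\<in>UNIV. \<Sum>j\<in>UNIV. \<phi> $ l * (A $ j $ l)\<^sup>2) = (\<Sum>l\<in>UNIV. \<Sum>j\<in>UNIV. \<phi> $ j * (A $ l $ j)\<^sup>2)"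
        by (rule sum.swap)
      also have "(\<Sum>l\<in>UNIV. \<Sum>j\<in>UNIV. \<phi> $ l * (A $ l $ j)\<^sup>2) - \<dots> = (\<Sum>l\<in>UNIV. \<Sum>j\<in>UNIV. \<phi> $ i * (A $ l $ j)\<^sup>2)"
        by (simp add: sum_subtractf[symmetric] w)
      also have "\<dots> = \<phi> $ i * (A \<bullet> A)"
        by (simp add: inner_vec_def power2_eq_square sum_distrib_left)
      finally have 1: "diag \<phi> \<bullet> ?E = \<phi> $ i * (A \<bullet> A)" .
      \<comment> \<open>The identity part of the soliton equation drops out, because a commutator
        has trace zero.\<close>
      have "mat 1 \<bullet> ?E = trace ?E"
        using trace_inner[of "mat 1" "transpose ?E"]
        by (simp add: trace_def inner_vec_def mat_def if_distrib[of "\<lambda>x. x * _"] cong: if_cong)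
      also have "\<dots> = trace (A ** transpose A) - trace (transpose A ** A)" by (simp add: trace_def sum_subtractf)
      also have "\<dots> = 0" by (simp add: trace_mul_sym[of A])
      finally show ?thesis by (simp add: M inner_diff_left 1)
    qed
    ultimately have eq: "c * \<phi> $ i * (A \<bullet> A) = nV (gl_act (transpose A) \<mu>)" by simp
    have AA0: "A \<bullet> A > 0" using False by simp
    show ?thesis
    proof (rule ccontr)
      assume "\<not> \<phi> $ i > 0"
      then have "c * \<phi> $ i * (A \<bullet> A) \<le> 0" using c AA0 by (simp add: mult_le_0_iff)
      then have "nV (gl_act (transpose A) \<mu>) = 0" using eq nV_ge_0[of "gl_act (transpose A) \<mu>"] by simp
      then have "transpose A \<in> Der \<mu>" using nV_eq_0[OF gl_act_V[OF V]] gl_act_Der by blast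
      then have "trace (transpose A ** A) = 0" unfolding A_def by (rule trace_Der_ad[OF bl nil])
      moreover have "trace (transpose A ** A) = A \<bullet> A"
        by (metis trace_inner trace_mul_sym)
      ultimately show False using AA0 by simp
    qed
  qed
qed

subsection \<open>Limits of nilpotent brackets\<close>

definition nilLie :: "nat \<Rightarrow> (real^'n \<Rightarrow> real^'n \<Rightarrow> real^'n) \<Rightarrow> bool" where
  "nilLie k \<mu> \<longleftrightarrow> \<mu> \<in> V \<and> jacobi \<mu> \<and> nilp k \<mu>"

definition of_structure :: "real^'n^'n^'n \<Rightarrow> real^'n \<Rightarrow> real^'n \<Rightarrow> real^'n" where
  "of_structure T x y = (\<Sum>i\<in>UNIV. \<Sum>j\<in>UNIV. (x $ i * y $ j) *\<^sub>R T $ i $ j)"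

lemma of_structure_constants: "bilinear \<mu> \<Longrightarrow> \<mu> = of_structure (structure_constants \<mu>)"
  by (intro ext) (simp add: of_structure_def structure_constants_def, rule bilinear_expand)

lemma sc_of_structure: "sc (of_structure T) i j k = T $ i $ j $ k"
proof -
  have "(axis i 1 $ a * axis j 1 $ b) * T $ a $ b $ k = (if b = j then if a = i then T $ a $ j $ k else 0 else 0)"
    for a b by (simp add: axis_def)
  then show ?thesis by (simp add: sc_def of_structure_def)
qed

lemma of_structure_V:
  assumes "\<And>i j. T $ i $ j = - T $ j $ i"
  shows "of_structure T \<in> V"
proof -
  have "bilinear (of_structure T)"
    unfolding bilinear_def of_structure_def
    by (auto intro!: linearI simp: distrib_left distrib_right scaleR_add_left sum.distrib scaleR_sum_right mult_ac)
  moreover have "of_structure T x x = 0" for x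
  proof -
    have "of_structure T x x = (\<Sum>i\<in>UNIV. \<Sum>j\<in>UNIV. - ((x $ j * x $ i) *\<^sub>R T $ j $ i))"
      unfolding of_structure_def by (intro sum.cong refl) (subst assms, simp add: mult.commute)
    also have "\<dots> = - (\<Sum>i\<in>UNIV. \<Sum>j\<in>UNIV. (x $ j * x $ i) *\<^sub>R T $ j $ i)" by (simp add: sum_negf)
    also have "(\<Sum>i\<in>UNIV. \<Sum>j\<in>UNIV. (x $ j * x $ i) *\<^sub>R T $ j $ i) = of_structure T x x"
      unfolding of_structure_def by (rule sum.swap)
    finally show ?thesis by (simp add: vec_eq_iff)
  qed
  ultimately show ?thesis by (simp add: V_def)
qed

lemma LIMSEQ_zero:
  fixes L :: "'a::real_normed_vector"
  assumes "X \<longlonglongrightarrow> L" "\<And>n. X n = 0"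
  shows "L = 0"
proof -
  have "X = (\<lambda>n. 0)" using assms(2) by (rule ext)
  then show ?thesis using assms(1) LIMSEQ_unique[OF tendsto_const[of 0]] by metis
qed

text \<open>Antisymmetry, the Jacobi identity and the vanishing of nested brackets of length
  \<open>k\<close> are all identities that are continuous in the structure constants.\<close>

lemma nilLie_limit:
  assumes nl: "\<And>n. nilLie k (\<nu> n)" and lim: "(\<lambda>n. structure_constants (\<nu> n)) \<longlonglongrightarrow> T"
  obtains \<mu> where "nilLie k \<mu>" "structure_constants \<mu> = T"
proof -
  have nV: "\<nu> n \<in> V" for n using nl by (auto simp: nilLie_def)
  have nus: "\<nu> n = of_structure (structure_constants (\<nu> n))" for n
    by (rule of_structure_constants[OF V_D(1)[OF nV]])
  have pt: "(\<lambda>n. \<nu> n (x n) (y n)) \<longlonglongrightarrow> of_structure T x' y'" if "x \<longlonglongrightarrow> x'" "y \<longlonglongrightarrow> y'" for x y x' y'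
    by (subst nus) (unfold of_structure_def, intro tendsto_intros that lim)
  have "T $ i $ j = - T $ j $ i" for i j
  proof (rule LIMSEQ_unique)
    show "(\<lambda>n. structure_constants (\<nu> n) $ i $ j) \<longlonglongrightarrow> T $ i $ j" by (intro tendsto_intros lim)
    have "structure_constants (\<nu> n) $ i $ j = - structure_constants (\<nu> n) $ j $ i" for n
      using V_D(3)[OF nV, of n "axis i 1" "axis j 1"] by (simp add: structure_constants_def)
    then have eq: "(\<lambda>n. structure_constants (\<nu> n) $ i $ j) = (\<lambda>n. - structure_constants (\<nu> n) $ j $ i)"
      by (rule ext)
    show "(\<lambda>n. structure_constants (\<nu> n) $ i $ j) \<longlonglongrightarrow> - T $ j $ i"
      unfolding eq by (intro tendsto_intros lim)
  qed
  then have "of_structure T \<in> V" by (rule of_structure_V)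
  moreover have "jacobi (of_structure T)"
    unfolding jacobi_def
  proof (intro allI)
    fix x y z
    have "(\<lambda>n. \<nu> n x (\<nu> n y z) + \<nu> n y (\<nu> n z x) + \<nu> n z (\<nu> n x y)) \<longlonglongrightarrow>
      of_structure T x (of_structure T y z) + of_structure T y (of_structure T z x) + of_structure T z (of_structure T x y)"
      by (intro tendsto_add pt tendsto_const)
    moreover have "\<nu> n x (\<nu> n y z) + \<nu> n y (\<nu> n z x) + \<nu> n z (\<nu> n x y) = 0" for n
      using nl by (auto simp: nilLie_def jacobi_def)
    ultimately show "of_structure T x (of_structure T y z) + of_structure T y (of_structure T z x) + of_structure T z (of_structure T x y) = 0"
      by (rule LIMSEQ_zero)
  qed
  moreover have "nilp k (of_structure T)"
    unfolding nilp_def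
  proof (intro allI impI)
    fix xs :: "(real^'a) list" and y assume len: "length xs = k"
    have "(\<lambda>n. foldr (\<nu> n) xs y) \<longlonglongrightarrow> foldr (of_structure T) xs y"
      by (induction xs) (auto intro!: pt tendsto_const)
    moreover have "foldr (\<nu> n) xs y = 0" for n using nl len by (auto simp: nilLie_def nilp_def)
    ultimately show "foldr (of_structure T) xs y = 0" by (rule LIMSEQ_zero)
  qed
  moreover have "structure_constants (of_structure T) = T"
    by (simp add: vec_eq_iff structure_constants_nth sc_of_structure)
  ultimately show ?thesis using that by (auto simp: nilLie_def)
qed

lemma nilLie_GL_act:
  assumes "nilLie k \<mu>" "invertible h"
  shows "nilLie k (GL_act h \<mu>)"
proof -
  have inv: "matrix_inv h *v (h *v x) = x" for x
    by (simp add: matrix_vector_mul_assoc matrix_inv assms(2))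
  have V: "\<mu> \<in> V" and jac: "\<And>x y z. \<mu> x (\<mu> y z) + \<mu> y (\<mu> z x) + \<mu> z (\<mu> x y) = 0" and nil: "nilp k \<mu>"
    using assms(1) by (auto simp: nilLie_def jacobi_def)
  have "jacobi (GL_act h \<mu>)"
    by (simp add: jacobi_def GL_act_def inv matrix_vector_right_distrib[symmetric] jac)
  moreover have "foldr (GL_act h \<mu>) xs y = h *v foldr \<mu> (map ((*v) (matrix_inv h)) xs) (matrix_inv h *v y)" for xs y
    by (induction xs) (simp_all add: GL_act_def inv matrix_vector_mul_assoc matrix_inv assms(2))
  then have "nilp k (GL_act h \<mu>)" using nil by (simp add: nilp_def)
  ultimately show ?thesis using GL_act_V[OF V] by (simp add: nilLie_def)
qed

subsection \<open>The optimal filtration\<close>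

lemma K_torus_mono: "s \<subseteq> t \<Longrightarrow> K_torus t \<subseteq> K_torus s"
proof -
  assume st: "s \<subseteq> t"
  then have "{h. invertible h \<and> commutes h t} \<subseteq> {h. invertible h \<and> commutes h s}"
    by (auto simp: commutes_def)
  from connected_component_mono[OF this, of "mat 1"] show ?thesis
    unfolding K_torus_def invertible_eq by blast
qed

text \<open>A pair \<open>(q, \<xi>)\<close> encodes a one-parameter subgroup contracting
  \<open>b\<close> to zero, normalized to rate at least one. The shortest \<open>\<xi>\<close> is
  the optimal one in the sense of Kempf.\<close>

definition destab :: "(real^'n \<Rightarrow> real^'n \<Rightarrow> real^'n) \<Rightarrow> (real^'n^'n) set \<Rightarrow> real^'n^'n \<Rightarrow> real^'n \<Rightarrow> bool" where
  "destab b t q \<xi> \<longleftrightarrow> q \<in> K_torus t \<and> (\<forall>i j k. sc (GL_act q b) i j k \<noteq> 0 \<longrightarrow> wt \<xi> i j k \<ge> 1)"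

text \<open>The support varies with \<open>q\<close>, so closedness of the condition is not visible
  from its definition. Multiplying each structure constant by its deficit
  \<open>max 0 (1 - wt)\<close> expresses it as the zero set of a continuous function, and bounding
  the length by that of \<open>\<xi>0\<close> makes the set compact.\<close>

lemma destab_minimum:
  assumes b: "b \<in> V" and ex: "destab b t q0 \<xi>0"
  obtains q \<xi> where "destab b t q \<xi>" "\<And>q' \<xi>'. destab b t q' \<xi>' \<Longrightarrow> \<xi> \<bullet> \<xi> \<le> \<xi>' \<bullet> \<xi>'"
proof -
  define g where "g z = (\<Sum>i\<in>UNIV. \<Sum>j\<in>UNIV. \<Sum>k\<in>UNIV. (sc (GL_act (fst z) b) i j k * max 0 (1 - wt (snd z) i j k))\<^sup>2)" for z
  let ?C = "K_torus t \<times> cball (0::real^'a) (norm \<xi>0)"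
  have m: "s * max 0 (1 - w) = 0 \<longleftrightarrow> (s \<noteq> 0 \<longrightarrow> w \<ge> 1)" for s w :: real
    by (auto simp: max_def)
  have g0: "g (q, \<xi>) = 0 \<longleftrightarrow> destab b t q \<xi>" if "q \<in> K_torus t" for q \<xi>
    using that unfolding destab_def m[symmetric] by (simp add: g_def sum_nonneg_eq_0_iff sum_nonneg)
  have "continuous_on ?C (\<lambda>z. sc (GL_act (fst z) b) i j k)" for i j k
    by (rule continuous_on_compose2[OF continuous_sc_act[OF b]]) (auto intro: continuous_intros)
  then have contg: "continuous_on ?C g"
    unfolding g_def wt_def by (intro continuous_intros)
  have cC: "compact ?C" by (intro compact_Times compact_K_torus compact_cball)
  have "closedin (top_of_set ?C) {z \<in> ?C. g z = 0}"
    by (rule continuous_closedin_preimage_constant[OF contg])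
  then have cS: "compact {z \<in> ?C. g z = 0}" by (rule closedin_compact[OF cC])
  have mem: "(q0, \<xi>0) \<in> {z \<in> ?C. g z = 0}" using ex g0 by (auto simp: destab_def)
  have "continuous_on {z \<in> ?C. g z = 0} (\<lambda>z. snd z \<bullet> snd z)" by (intro continuous_intros)
  then obtain z where z: "z \<in> {z \<in> ?C. g z = 0}" "\<And>y. y \<in> {z \<in> ?C. g z = 0} \<Longrightarrow> snd z \<bullet> snd z \<le> snd y \<bullet> snd y"
    using continuous_attains_inf[OF cS] mem by blast
  have "destab b t (fst z) (snd z)" using z(1) g0[of "fst z" "snd z"] by auto
  moreover have "snd z \<bullet> snd z \<le> \<xi>' \<bullet> \<xi>'" if d: "destab b t q' \<xi>'" for q' \<xi>'
  proof (cases "norm \<xi>' \<le> norm \<xi>0")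
    case True
    then have "(q', \<xi>') \<in> {z \<in> ?C. g z = 0}" using d g0 by (auto simp: destab_def)
    then show ?thesis using z(2) by fastforce
  next
    case False
    have "snd z \<bullet> snd z \<le> \<xi>0 \<bullet> \<xi>0" using z(2)[OF mem] by simp
    also have "\<dots> \<le> \<xi>' \<bullet> \<xi>'" using False by (simp add: norm_eq_sqrt_inner)
    finally show ?thesis .
  qed
  ultimately show ?thesis using that by blast
qed

lemma wt_add: "wt (x + y) i j k = wt x i j k + wt y i j k"
  by (simp add: wt_def)

lemma K_torus_GL_act_mult:
  "g \<in> K_torus t \<Longrightarrow> q \<in> K_torus t' \<Longrightarrow> GL_act (g ** q) b = GL_act g (GL_act q b)"
  by (simp add: GL_act_mult K_torusD(3))

text \<open>This is Hoelder's inequality. Dividing by the values \<open>exp L0\<close> and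
  \<open>exp L1\<close> at the two ends reduces it to convexity of the exponential in each
  term.\<close>

lemma log_sum_exp_segment:
  fixes c w :: "'a \<Rightarrow> real"
  assumes A: "finite A" and c: "\<And>a. a \<in> A \<Longrightarrow> c a \<ge> 0" and pos: "(\<Sum>a\<in>A. c a) > 0" and r: "0 \<le> r" "r \<le> 1"
  shows "ln (\<Sum>a\<in>A. c a * exp (r * w a)) \<le> (1 - r) * ln (\<Sum>a\<in>A. c a) + r * ln (\<Sum>a\<in>A. c a * exp (w a))"
proof -
  have gt: "(\<Sum>a\<in>A. c a * exp (u * w a)) > 0" for u
  proof -
    obtain a where a: "a \<in> A" "c a > 0" using pos c by (metis less_eq_real_def not_less sum_nonpos)
    then show ?thesis using A c by (intro sum_pos2[of A a]) auto
  qed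
  define L0 where "L0 = ln (\<Sum>a\<in>A. c a)"
  define L1 where "L1 = ln (\<Sum>a\<in>A. c a * exp (w a))"
  have e0: "exp L0 = (\<Sum>a\<in>A. c a)" using pos by (simp add: L0_def)
  have e1: "exp L1 = (\<Sum>a\<in>A. c a * exp (w a))" using gt[of 1] by (simp add: L1_def)
  have "(\<Sum>a\<in>A. c a * exp (r * w a)) \<le> exp ((1 - r) * L0 + r * L1)"
  proof -
    have "c a * exp (r * w a) \<le> exp ((1 - r) * L0 + r * L1) * ((1 - r) * (c a * exp (- L0)) + r * (c a * exp (w a - L1)))"
      if "a \<in> A" for a
    proof -
      have "exp (r * (w a - L1 + L0)) \<le> (1 - r) + r * exp (w a - L1 + L0)" by (rule exp_segment[OF r])
      then have "exp (r * (w a - L1 + L0)) * exp (- L0) \<le> ((1 - r) + r * exp (w a - L1 + L0)) * exp (- L0)"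
        by (rule mult_right_mono) simp
      also have "\<dots> = (1 - r) * exp (- L0) + r * exp (w a - L1)"
        by (simp add: distrib_right mult.assoc flip: exp_add)
      finally have "exp ((1 - r) * L0 + r * L1) * (exp (r * (w a - L1 + L0)) * exp (- L0))
          \<le> exp ((1 - r) * L0 + r * L1) * ((1 - r) * exp (- L0) + r * exp (w a - L1))"
        by (rule mult_left_mono) simp
      moreover have "exp ((1 - r) * L0 + r * L1) * (exp (r * (w a - L1 + L0)) * exp (- L0)) = exp (r * w a)"
        by (simp add: algebra_simps flip: exp_add)
      ultimately have "c a * exp (r * w a) \<le> c a * (exp ((1 - r) * L0 + r * L1) * ((1 - r) * exp (- L0) + r * exp (w a - L1)))"
        using c[OF that] by (intro mult_left_mono) auto
      then show ?thesis by (simp add: algebra_simps)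
    qed
    then have "(\<Sum>a\<in>A. c a * exp (r * w a)) \<le>
        (\<Sum>a\<in>A. exp ((1 - r) * L0 + r * L1) * ((1 - r) * (c a * exp (- L0)) + r * (c a * exp (w a - L1))))"
      by (rule sum_mono)
    also have "\<dots> = exp ((1 - r) * L0 + r * L1) *
        ((1 - r) * (\<Sum>a\<in>A. c a * exp (- L0)) + r * (\<Sum>a\<in>A. c a * exp (w a - L1)))"
      by (simp only: sum_distrib_left[symmetric] sum.distrib)
    also have "(\<Sum>a\<in>A. c a * exp (- L0)) = exp L0 * exp (- L0)"
      by (simp only: e0 sum_distrib_right)
    also have "(\<Sum>a\<in>A. c a * exp (w a - L1)) = exp L1 * exp (- L1)"
      by (simp only: e1 sum_distrib_right mult.assoc mult_exp_exp diff_conv_add_uminus)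
    finally have "(\<Sum>a\<in>A. c a * exp (r * w a)) \<le> exp ((1 - r) * L0 + r * L1) *
        ((1 - r) * (exp L0 * exp (- L0)) + r * (exp L1 * exp (- L1)))" .
    moreover have "exp L0 * exp (- L0) = 1" "exp L1 * exp (- L1) = 1" by (simp_all add: exp_minus)
    ultimately show ?thesis by simp
  qed
  then have "ln (\<Sum>a\<in>A. c a * exp (r * w a)) \<le> (1 - r) * L0 + r * L1"
    using gt[of r] by (metis exp_le_cancel_iff exp_ln)
  then show ?thesis by (simp add: L0_def L1_def)
qed

lemma scaled_square_min:
  fixes x y :: "'a::real_inner"
  assumes "\<And>\<tau>. x \<bullet> x \<le> (x + \<tau> *\<^sub>R y) \<bullet> (x + \<tau> *\<^sub>R y)"
  shows "x \<bullet> y = 0"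
proof -
  define \<psi> where "\<psi> \<tau> = x \<bullet> x + 2 * \<tau> * (x \<bullet> y) + \<tau>\<^sup>2 * (y \<bullet> y)" for \<tau>
  have e: "\<psi> \<tau> = (x + \<tau> *\<^sub>R y) \<bullet> (x + \<tau> *\<^sub>R y)" for \<tau>
    by (simp add: \<psi>_def inner_add_left inner_add_right inner_commute power2_eq_square)
  have "(\<psi> has_real_derivative 2 * (x \<bullet> y)) (at 0)"
    unfolding \<psi>_def by (auto intro!: derivative_eq_intros)
  moreover have "\<psi> 0 \<le> \<psi> \<tau>" for \<tau> using assms[of \<tau>] by (simp add: e)
  ultimately have "2 * (x \<bullet> y) = 0" by (rule deriv_zero_of_min)
  then show ?thesis by simp
qed

text \<open>A torus element has weight zero on the support, so adding its multiples to
  \<open>\<xi>\<close> keeps the pair destabilizing; a shortest \<open>\<xi>\<close> is then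
  orthogonal to it.\<close>

lemma destab_optimal_orthogonal:
  assumes b: "b \<in> V" and t: "t \<subseteq> Dg" "t \<subseteq> Der b" and opt: "destab b t q \<xi>"
    "\<And>q' \<xi>'. destab b t q' \<xi>' \<Longrightarrow> \<xi> \<bullet> \<xi> \<le> \<xi>' \<bullet> \<xi>'" and D: "D \<in> t"
  shows "pairing D \<xi> = 0"
proof -
  define d where "d = (\<chi> i. D $ i $ i)"
  have q: "q \<in> K_torus t" using opt(1) by (simp add: destab_def)
  have "D \<in> Der (GL_act q b)"
    using Der_GL_act[of D b q] t(2) D K_torusD(3,4)[OF q] by (auto simp: commutes_def)
  then have "wt d i j k = 0" if "sc (GL_act q b) i j k \<noteq> 0" for i j k
    using Der_sc[OF GL_act_V[OF b]] t(1) D that by (auto simp: d_def wt_def)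
  then have "destab b t q (\<xi> + \<tau> *\<^sub>R d)" for \<tau>
    using opt(1) by (auto simp: destab_def wt_add wt_scale)
  then have "\<xi> \<bullet> d = 0" by (intro scaled_square_min opt(2))
  then show ?thesis by (simp add: pairing_def d_def inner_vec_def mult.commute)
qed

text \<open>If all weights on the support are at least one, this is the limit of \<open>b\<close>
  under the one-parameter subgroup of \<open>- (\<xi> + 1)\<close>, where 1 is the vector of
  ones.\<close>

definition weight_part :: "real^'n \<Rightarrow> (real^'n \<Rightarrow> real^'n \<Rightarrow> real^'n) \<Rightarrow> real^'n \<Rightarrow> real^'n \<Rightarrow> real^'n" where
  "weight_part \<xi> b = of_structure (\<chi> i j k. if wt \<xi> i j k = 1 then sc b i j k else 0)"

lemma sc_weight_part: "sc (weight_part \<xi> b) i j k = (if wt \<xi> i j k = 1 then sc b i j k else 0)"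
  by (simp add: weight_part_def sc_of_structure)

lemma weight_part_V:
  assumes "b \<in> V"
  shows "weight_part \<xi> b \<in> V"
  unfolding weight_part_def
proof (rule of_structure_V)
  have w: "wt \<xi> i j k = wt \<xi> j i k" for i j k by (simp add: wt_def)
  have e: "(if wt \<xi> i j k = 1 then sc b i j k else 0) = - (if wt \<xi> j i k = 1 then sc b j i k else 0)" for i j k
    unfolding w[of i j k] using sc_antisym[OF assms, of j i k] by simp
  show "(\<chi> i j k. if wt \<xi> i j k = 1 then sc b i j k else 0) $ i $ j =
      - (\<chi> i j k. if wt \<xi> i j k = 1 then sc b i j k else 0) $ j $ i" for i j
    unfolding vec_eq_iff vector_uminus_component vec_lambda_beta by (intro allI e)
qed

text \<open>\<open>q\<close> commutes with \<open>diag \<xi>\<close>, so its nonzero entries join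
  indices with equal values of \<open>\<xi>\<close>. Every contribution to a structure constant then
  has the same weight, and the grading by \<open>wt \<xi>\<close> is preserved.\<close>

lemma sc_weight_part_act:
  assumes b: "b \<in> V" and q: "q \<in> K_torus (insert (diag \<xi>) t)" and t: "t \<subseteq> Dg"
    and ge: "\<And>i j k. sc b i j k \<noteq> 0 \<Longrightarrow> wt \<xi> i j k \<ge> 1"
  shows "sc (GL_act q (weight_part \<xi> b)) i j k = (if wt \<xi> i j k = 1 then sc (GL_act q b) i j k else 0)"
    and "sc (GL_act q b) i j k \<noteq> 0 \<Longrightarrow> wt \<xi> i j k \<ge> 1"
proof -
  have qe: "\<xi> $ i = \<xi> $ a" if "q $ i $ a \<noteq> 0" for i a
    using K_torusD(4)[OF q] that t by (auto simp: commutes_nth diag_nth)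
  have w: "wt \<xi> a c e = wt \<xi> i j k" if "q $ k $ e \<noteq> 0" "q $ i $ a \<noteq> 0" "q $ j $ c \<noteq> 0" for a c e
    using qe that by (simp add: wt_def)
  have *: "sc (GL_act q \<mu>) i j k = (\<Sum>e\<in>UNIV. \<Sum>a\<in>UNIV. \<Sum>c\<in>UNIV. q $ k $ e * (q $ i $ a * q $ j $ c * sc \<mu> a c e))"
    if "\<mu> \<in> V" for \<mu>
    by (simp add: sc_GL_act_orthogonal[OF that K_torusD(2)[OF q]] sum_distrib_left)
  have "q $ k $ e * (q $ i $ a * q $ j $ c * sc (weight_part \<xi> b) a c e) =
      (if wt \<xi> i j k = 1 then q $ k $ e * (q $ i $ a * q $ j $ c * sc b a c e) else 0)" for a c e
    using w[of e a c]
    by (cases "q $ k $ e = 0 \<or> q $ i $ a = 0 \<or> q $ j $ c = 0") (auto simp: sc_weight_part)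
  then show "sc (GL_act q (weight_part \<xi> b)) i j k = (if wt \<xi> i j k = 1 then sc (GL_act q b) i j k else 0)"
    unfolding *[OF b] *[OF weight_part_V[OF b]] by simp
  show "wt \<xi> i j k \<ge> 1" if nz: "sc (GL_act q b) i j k \<noteq> 0"
  proof (rule ccontr)
    assume "\<not> wt \<xi> i j k \<ge> 1"
    then have z: "q $ k $ e * (q $ i $ a * q $ j $ c * sc b a c e) = 0" for a c e
      using w[of e a c] ge[of a c e]
      by (cases "q $ k $ e = 0 \<or> q $ i $ a = 0 \<or> q $ j $ c = 0") auto
    show False using nz unfolding *[OF b] z by simp
  qed
qed

text \<open>Optimality of \<open>\<xi>\<close> yields the growth condition needed to approximate a
  soliton with \<open>\<beta>\<close>. If it failed for \<open>v\<close>, a move of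
  \<open>\<xi>\<close> orthogonal to itself would raise all weights to first order while its length
  grows only to second order; after rescaling, a shorter destabilizing vector would result.\<close>

lemma destab_optimal_weight:
  assumes b: "b \<in> V" "b \<noteq> (\<lambda>x y. 0)" and t: "t \<subseteq> Dg" and opt: "destab b t q \<xi>"
    "\<And>q' \<xi>'. destab b t q' \<xi>' \<Longrightarrow> \<xi> \<bullet> \<xi> \<le> \<xi>' \<bullet> \<xi>'"
  defines "b0 \<equiv> weight_part \<xi> (GL_act q b)" and "\<beta> \<equiv> (1 / (\<xi> \<bullet> \<xi>)) *\<^sub>R \<xi>"
  assumes q': "q' \<in> K_torus (insert (diag \<xi>) t)"
  shows "\<exists>i j k. sc (GL_act q' b0) i j k \<noteq> 0 \<and> wt v i j k \<ge> v \<bullet> \<beta>"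
    and "\<xi> \<noteq> 0"
proof -
  let ?b1 = "GL_act q b"
  have q: "q \<in> K_torus t" using opt(1) by (simp add: destab_def)
  have V1: "?b1 \<in> V" by (rule GL_act_V[OF b(1)])
  have ge1: "wt \<xi> i j k \<ge> 1" if "sc ?b1 i j k \<noteq> 0" for i j k using opt(1) that by (auto simp: destab_def)
  have "?b1 \<noteq> (\<lambda>x y. 0)" using GL_act_eq_0[OF K_torusD(3)[OF q]] b(2) by blast
  then obtain i j k where "sc ?b1 i j k \<noteq> 0" using V_eqI[OF V1 V_0] by (auto simp: sc_def)
  then show \<xi>0: "\<xi> \<noteq> 0" using ge1[of i j k] by (auto simp: wt_def)
  then have n: "\<xi> \<bullet> \<xi> > 0" by simp
  note act = sc_weight_part_act[OF V1 q' t ge1]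
  show "\<exists>i j k. sc (GL_act q' b0) i j k \<noteq> 0 \<and> wt v i j k \<ge> v \<bullet> \<beta>"
  proof (rule ccontr)
    assume "\<not> ?thesis"
    then have less: "wt v i j k < v \<bullet> \<beta>" if "sc (GL_act q' b0) i j k \<noteq> 0" for i j k
      using that by (meson not_le)
    \<comment> \<open>The multiple of \<open>\<xi>\<close> makes \<open>v'\<close> orthogonal to
      \<open>\<xi>\<close> and its weights positive wherever the weight of \<open>\<xi>\<close> is
      one.\<close>
    define v' where "v' = (v \<bullet> \<beta>) *\<^sub>R \<xi> - v"
    have vx: "\<xi> \<bullet> v' = 0" using n by (simp add: v'_def \<beta>_def inner_diff_right inner_commute)
    have wv': "wt v' i j k = (v \<bullet> \<beta>) * wt \<xi> i j k - wt v i j k" for i j k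
      by (simp add: v'_def wt_def algebra_simps)
    define S where "S = {(i,j,k). sc (GL_act q' ?b1) i j k \<noteq> 0}"
    define S0 where "S0 = {(i,j,k). sc (GL_act q' b0) i j k \<noteq> 0}"
    have S0: "wt \<xi> i j k = 1 \<and> wt v' i j k > 0" if "(i,j,k) \<in> S0" for i j k
      using that act(1)[of i j k] less[of i j k] by (auto simp: S0_def b0_def wv' split: if_splits)
    \<comment> \<open>A uniform gain on the weight-one part; the inserted 1 keeps the minimum over a
      nonempty set.\<close>
    define \<omega> where "\<omega> = Min (insert 1 ((\<lambda>(i,j,k). wt v' i j k) ` S0))"
    have \<omega>: "\<omega> > 0" "\<And>i j k. (i,j,k) \<in> S0 \<Longrightarrow> \<omega> \<le> wt v' i j k"
    proof -
      show "\<omega> > 0" unfolding \<omega>_def using S0 by (subst Min_gr_iff) auto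
      show "\<omega> \<le> wt v' i j k" if "(i,j,k) \<in> S0" for i j k
        unfolding \<omega>_def using that by (intro Min_le) force+
    qed
    have "\<forall>\<^sub>F e in at_right 0. \<forall>s\<in>S. case s of (i,j,k) \<Rightarrow> wt (\<xi> + e *\<^sub>R v') i j k \<ge> 1 + e * \<omega>"
    proof (rule eventually_ball_finite)
      show "finite S" by simp
      show "\<forall>s\<in>S. \<forall>\<^sub>F e in at_right 0. case s of (i,j,k) \<Rightarrow> wt (\<xi> + e *\<^sub>R v') i j k \<ge> 1 + e * \<omega>"
      proof (clarify)
        fix i j k assume s: "(i,j,k) \<in> S"
        show "\<forall>\<^sub>F e in at_right 0. 1 + e * \<omega> \<le> wt (\<xi> + e *\<^sub>R v') i j k"
        proof (cases "wt \<xi> i j k = 1")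
          case True
          then have "(i,j,k) \<in> S0" using s act(1)[of i j k] by (simp add: S_def S0_def b0_def)
          then have "\<omega> \<le> wt v' i j k" by (rule \<omega>(2))
          then show ?thesis
            unfolding wt_add wt_scale True eventually_at_right_field
            by (intro exI[of _ 1]) (simp add: mult_left_mono)
        next
          case False
          \<comment> \<open>Indices of weight above one have slack, which absorbs any first-order
            loss for small \<open>e\<close>.\<close>
          then have gt: "wt \<xi> i j k - 1 > 0" using act(2)[of i j k] s by (simp add: S_def)
          have "((\<lambda>e. e * (\<omega> - wt v' i j k)) \<longlongrightarrow> 0 * (\<omega> - wt v' i j k)) (at_right 0)"
            by (intro tendsto_intros)
          from order_tendstoD(2)[OF this] gt
          have "\<forall>\<^sub>F e in at_right 0. e * (\<omega> - wt v' i j k) < wt \<xi> i j k - 1" by simp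
          then show ?thesis by eventually_elim (simp add: wt_add wt_scale algebra_simps)
        qed
      qed
    qed
    \<comment> \<open>The second-order growth of the squared length must stay below the first-order
      gain from rescaling.\<close>
    moreover have "\<forall>\<^sub>F e in at_right 0. e * (v' \<bullet> v') < 2 * \<omega> * (\<xi> \<bullet> \<xi>)"
    proof -
      have "((\<lambda>e. e * (v' \<bullet> v')) \<longlongrightarrow> 0 * (v' \<bullet> v')) (at_right 0)" by (intro tendsto_intros)
      from order_tendstoD(2)[OF this] show ?thesis using n \<omega>(1) by simp
    qed
    moreover have "\<forall>\<^sub>F e in at_right 0. e > (0::real)" by (rule eventually_at_right_less)
    ultimately have "\<forall>\<^sub>F e in at_right 0. (\<forall>s\<in>S. case s of (i,j,k) \<Rightarrow> wt (\<xi> + e *\<^sub>R v') i j k \<ge> 1 + e * \<omega>)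
        \<and> e * (v' \<bullet> v') < 2 * \<omega> * (\<xi> \<bullet> \<xi>) \<and> e > 0"
      by eventually_elim auto
    then obtain e where e: "\<forall>s\<in>S. case s of (i,j,k) \<Rightarrow> wt (\<xi> + e *\<^sub>R v') i j k \<ge> 1 + e * \<omega>"
        "e * (v' \<bullet> v') < 2 * \<omega> * (\<xi> \<bullet> \<xi>)" "e > 0"
      using eventually_happens[of _ "at_right (0::real)"] by auto
    \<comment> \<open>Brings the least weight back to one.\<close>
    define c where "c = 1 / (1 + e * \<omega>)"
    have eo: "1 + e * \<omega> > 0" using e(3) \<omega>(1) by (simp add: add_pos_pos)
    have "destab b t (q' ** q) (c *\<^sub>R (\<xi> + e *\<^sub>R v'))"
      unfolding destab_def
    proof (intro conjI allI impI)
      have q't: "q' \<in> K_torus t" using q' K_torus_mono[of t "insert (diag \<xi>) t"] by blast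
      show "q' ** q \<in> K_torus t" by (rule K_torus_mult[OF q't q])
      fix i j k assume "sc (GL_act (q' ** q) b) i j k \<noteq> 0"
      then have "(i,j,k) \<in> S" using K_torus_GL_act_mult[OF q' q] by (simp add: S_def)
      then have "wt (\<xi> + e *\<^sub>R v') i j k \<ge> 1 + e * \<omega>" using e(1) by auto
      then show "1 \<le> wt (c *\<^sub>R (\<xi> + e *\<^sub>R v')) i j k"
        unfolding wt_scale c_def using eo by (simp add: field_simps)
    qed
    note le = opt(2)[OF this]
    have "v' \<bullet> \<xi> = 0" using vx by (simp only: inner_commute)
    then have sq: "(\<xi> + e *\<^sub>R v') \<bullet> (\<xi> + e *\<^sub>R v') = \<xi> \<bullet> \<xi> + e * e * (v' \<bullet> v')"
      using vx by (simp add: inner_add_left inner_add_right)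
    define m where "m = 1 + e * \<omega>"
    have mc: "m * m * (c * c * R) = R" for R using eo by (simp add: m_def c_def)
    have "\<xi> \<bullet> \<xi> \<le> c * c * (\<xi> \<bullet> \<xi> + e * e * (v' \<bullet> v'))"
      using le by (simp only: inner_scaleR_left inner_scaleR_right sq mult.assoc)
    then have "m * m * (\<xi> \<bullet> \<xi>) \<le> m * m * (c * c * (\<xi> \<bullet> \<xi> + e * e * (v' \<bullet> v')))"
      by (rule mult_left_mono) simp
    then have "(1 + e * \<omega>) * (1 + e * \<omega>) * (\<xi> \<bullet> \<xi>) \<le> \<xi> \<bullet> \<xi> + e * e * (v' \<bullet> v')"
      unfolding mc by (simp only: m_def)
    then have "2 * e * \<omega> * (\<xi> \<bullet> \<xi>) + (e * \<omega>) * (e * \<omega>) * (\<xi> \<bullet> \<xi>) \<le> e * (e * (v' \<bullet> v'))"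
      by (simp add: algebra_simps)
    moreover have "(e * \<omega>) * (e * \<omega>) * (\<xi> \<bullet> \<xi>) \<ge> 0" using n by simp
    moreover have "e * (e * (v' \<bullet> v')) < e * (2 * \<omega> * (\<xi> \<bullet> \<xi>))" using e(2,3) by (intro mult_strict_left_mono)
    ultimately show False by (simp add: algebra_simps)
  qed
qed

text \<open>Adding the vector of ones to \<open>\<xi>\<close> lowers every weight by one, so along
  the subgroup generated by the negative of \<open>\<phi>\<close> the weight-one constants stay
  fixed and the others on the support decay. The weight part is thus a limit of conjugates of
  \<open>b\<close>.\<close>

lemma nilLie_weight_part:
  assumes nl: "nilLie k b" and ge: "\<And>i j k. sc b i j k \<noteq> 0 \<Longrightarrow> wt \<xi> i j k \<ge> 1"
  shows "nilLie k (weight_part \<xi> b)"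
proof -
  have V: "b \<in> V" using nl by (simp add: nilLie_def)
  define \<phi> where "\<phi> = \<xi> + (\<chi> i. 1)"
  have w\<phi>: "wt \<phi> i j k = wt \<xi> i j k - 1" for i j k by (simp add: \<phi>_def wt_def)
  define \<nu> where "\<nu> n = GL_act (ediag ((- real n) *\<^sub>R \<phi>)) b" for n
  define T where "T = (\<chi> i j k. if wt \<xi> i j k = 1 then sc b i j k else 0)"
  have inv: "invertible (ediag x)" for x :: "real^'a"
    using G_torusD(1)[OF ediag_G_torus[of "{}"]] by simp
  have sc\<nu>: "sc (\<nu> n) i j l = exp (- real n * wt \<phi> i j l) * sc b i j l" for n i j l
    unfolding \<nu>_def sc_ediag[OF V] wt_scale by simp
  have "(\<lambda>n. structure_constants (\<nu> n)) \<longlonglongrightarrow> T"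
  proof (intro vec_tendstoI)
    fix i j l
    have "(\<lambda>n. exp (- real n * wt \<phi> i j l) * sc b i j l) \<longlonglongrightarrow> T $ i $ j $ l"
    proof (cases "wt \<xi> i j l = 1 \<or> sc b i j l = 0")
      case True
      then show ?thesis by (auto simp: T_def w\<phi>)
    next
      case False
      then have "wt \<phi> i j l > 0" using ge[of i j l] by (simp add: w\<phi>)
      then have "(\<lambda>n. exp (- real n * wt \<phi> i j l)) \<longlonglongrightarrow> 0" by real_asymp
      then have "(\<lambda>n. exp (- real n * wt \<phi> i j l) * sc b i j l) \<longlonglongrightarrow> 0 * sc b i j l" by (intro tendsto_intros)
      then show ?thesis using False by (simp add: T_def)
    qed
    then show "(\<lambda>n. structure_constants (\<nu> n) $ i $ j $ l) \<longlonglongrightarrow> T $ i $ j $ l"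
      by (simp add: structure_constants_nth sc\<nu>)
  qed
  moreover have "nilLie k (\<nu> n)" for n unfolding \<nu>_def by (rule nilLie_GL_act[OF nl inv])
  ultimately obtain \<mu> where \<mu>: "nilLie k \<mu>" "structure_constants \<mu> = T" using nilLie_limit by blast
  have "\<mu> = weight_part \<xi> b"
    using of_structure_constants[of \<mu>] \<mu> V_D(1)[of \<mu>] by (simp add: nilLie_def weight_part_def T_def)
  then show ?thesis using \<mu>(1) by simp
qed

section \<open>Approximate nilsolitons and their limits\<close>

definition costar :: "real^'n^'n \<Rightarrow> real^'n^'n" where
  "costar g = transpose (matrix_inv g)"

lemma costar_mult: "invertible g \<Longrightarrow> invertible h \<Longrightarrow> costar (g ** h) = costar g ** costar h"
  by (simp add: costar_def matrix_inv_mult matrix_transpose_mul)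

lemma costar_orthogonal: "orthogonal_matrix k \<Longrightarrow> costar k = k"
  by (simp add: costar_def orthogonal_inv)

lemma invertible_ediag: "invertible (ediag x)"
  using G_torusD(1)[OF ediag_G_torus[of "{}"]] by simp

lemma costar_ediag: "costar (ediag x) = ediag (- x)"
proof -
  have "ediag x ** ediag (- x) = mat 1" by (simp add: ediag_mult_ediag) (simp add: ediag_def flip: diag_1)
  from matrix_inv_unique(1)[OF this] show ?thesis by (simp add: costar_def transpose_ediag)
qed

text \<open>
  The term with \<open>e\<close> makes the function proper; its gradient has norm at most \<open>e\<close>, so the minimizers are
  approximate solutions of \<open>moment \<mu> = diag \<beta>\<close>.
\<close>
theorem approximate_soliton:
  assumes b: "b \<in> V" and t: "t \<subseteq> Dg" "t \<subseteq> Der b" and cen: "central t (diag \<beta>)"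
    and H: "\<And>q v. q \<in> K_torus t \<Longrightarrow> \<exists>i j k. sc (GL_act q b) i j k \<noteq> 0 \<and> wt v i j k \<ge> v \<bullet> \<beta>"
    and e: "e > 0"
  obtains g where "g \<in> G_torus t" "nV (GL_act g b) > 0"
    "\<And>i j. \<bar>momentM (GL_act g b) $ i $ j / nV (GL_act g b) - diag \<beta> $ i $ j\<bar> \<le> e"
proof -
  have pos: "nV (GL_act g b) > 0" if "invertible g" for g
  proof -
    have "b \<noteq> (\<lambda>x y. 0)"
    proof
      assume b0: "b = (\<lambda>x y. 0)"
      obtain i j k where "sc (GL_act (mat 1) b) i j k \<noteq> 0" using H[OF mat1_K_torus, of 0] by blast
      then show False by (simp add: b0 sc_def)
    qed
    then show ?thesis using GL_act_eq_0[OF that] nV_pos[OF GL_act_V[OF b]] by blast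
  qed
  define E where "E x = (\<Sum>i\<in>UNIV. exp (2 * x $ i)) + (\<Sum>i\<in>UNIV. exp (2 * (- x) $ i))" for x :: "real^'a"
  \<comment> \<open>The logarithm is taken because its gradient is the moment map normalized by
    \<open>nV\<close>.\<close>
  define f where "f x q = ln (nV (GL_act (ediag x) (GL_act q b))) / 2 + e / 2 * ln (E x) - \<beta> \<bullet> x" for x q
  have E0: "E x > 0" for x unfolding E_def by (intro add_pos_pos sum_pos) auto
  have N0: "nV (GL_act (ediag x) (GL_act q b)) > 0" if "q \<in> K_torus t" for x q
    using pos[OF invertible_mult[OF invertible_ediag K_torusD(3)[OF that]]]
    by (simp add: GL_act_mult[OF invertible_ediag K_torusD(3)[OF that]])
  have N: "nV (GL_act (ediag x) (GL_act q b)) =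
      (\<Sum>s\<in>UNIV. (case s of (i,j,k) \<Rightarrow> (sc (GL_act q b) i j k)\<^sup>2 / 2) * exp (case s of (i,j,k) \<Rightarrow> 2 * wt x i j k))" for x q
    unfolding nV_ediag[OF GL_act_V[OF b]]
    by (simp add: sum.cartesian_product UNIV_Times_UNIV sum_divide_distrib case_prod_beta mult.commute)
  have EE: "E x = (\<Sum>s\<in>UNIV. 1 * exp (case s of (i,True) \<Rightarrow> 2 * x $ i | (i,False) \<Rightarrow> 2 * (- x) $ i))" for x
  proof -
    have "(\<Sum>s\<in>UNIV. exp (case s of (i,True) \<Rightarrow> 2 * x $ i | (i,False) \<Rightarrow> 2 * (- x) $ i))
      = (\<Sum>i\<in>UNIV. \<Sum>c\<in>UNIV. exp (case c of True \<Rightarrow> 2 * x $ i | False \<Rightarrow> 2 * (- x) $ i))"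
      unfolding sum.cartesian_product UNIV_Times_UNIV
      by (intro sum.cong refl) (auto split: prod.splits bool.splits)
    then show ?thesis by (simp add: E_def UNIV_bool sum.distrib add.commute)
  qed
  obtain x0 q0 where x0: "q0 \<in> K_torus t" "\<And>y p. p \<in> K_torus t \<Longrightarrow> f x0 q0 \<le> f y p"
  proof (rule ray_minimum[of "K_torus t" f])
    show "compact (K_torus t)" "K_torus t \<noteq> {}" using compact_K_torus mat1_K_torus by blast+
    have c1: "continuous_on (UNIV \<times> K_torus t) (\<lambda>z. sc (GL_act (snd z) b) i j k)" for i j k
      by (rule continuous_on_compose2[OF continuous_sc_act[OF b]]) (auto intro: continuous_intros)
    have "continuous_on (UNIV \<times> K_torus t) (\<lambda>z. nV (GL_act (ediag (fst z)) (GL_act (snd z) b)))"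
      unfolding nV_ediag[OF GL_act_V[OF b]] wt_def by (intro continuous_intros c1) auto
    moreover have "continuous_on (UNIV \<times> K_torus t) (\<lambda>z. E (fst z))"
      unfolding E_def by (intro continuous_intros)
    ultimately show "continuous_on (UNIV \<times> K_torus t) (\<lambda>z. f (fst z) (snd z))"
      unfolding f_def using N0 E0
      by (intro continuous_intros) (auto simp: less_imp_neq[THEN not_sym])
  next
    fix x q and r :: real assume q: "q \<in> K_torus t" and r: "0 \<le> r" "r \<le> 1"
    have 1: "ln (nV (GL_act (ediag (r *\<^sub>R x)) (GL_act q b))) \<le>
        (1 - r) * ln (nV (GL_act (ediag 0) (GL_act q b))) + r * ln (nV (GL_act (ediag x) (GL_act q b)))"
    proof -
      let ?c = "\<lambda>s. case s of (i,j,k) \<Rightarrow> (sc (GL_act q b) i j k)\<^sup>2 / 2" and ?w = "\<lambda>s. case s of (i,j,k) \<Rightarrow> 2 * wt x i j k"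
      have 0: "nV (GL_act (ediag 0) (GL_act q b)) = (\<Sum>s\<in>UNIV. ?c s)"
        unfolding N by (simp add: wt_def case_prod_beta)
      have r': "nV (GL_act (ediag (r *\<^sub>R x)) (GL_act q b)) = (\<Sum>s\<in>UNIV. ?c s * exp (r * ?w s))"
        unfolding N by (simp add: wt_scale case_prod_beta mult_ac)
      show ?thesis
        unfolding 0 r' N[of x q]
      proof (rule log_sum_exp_segment[OF _ _ _ r])
        show "(\<Sum>s\<in>UNIV. ?c s) > 0" using N0[OF q, of 0] unfolding 0 .
      qed (auto split: prod.splits)
    qed
    have 2: "ln (E (r *\<^sub>R x)) \<le> (1 - r) * ln (E 0) + r * ln (E x)"
    proof -
      let ?w = "\<lambda>s. case s of (i,True) \<Rightarrow> 2 * x $ i | (i,False) \<Rightarrow> 2 * (- x) $ i"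
      have 0: "E 0 = (\<Sum>s\<in>(UNIV::('a\<times>bool) set). 1)"
        unfolding EE by (intro sum.cong refl) (auto split: bool.splits prod.splits)
      have r': "E (r *\<^sub>R x) = (\<Sum>s\<in>UNIV. 1 * exp (r * ?w s))"
        unfolding EE by (intro sum.cong refl) (auto split: bool.splits prod.splits simp: mult_ac)
      show ?thesis
        unfolding 0 r' EE[of x]
      proof (rule log_sum_exp_segment[OF _ _ _ r])
        show "(\<Sum>s\<in>(UNIV::('a\<times>bool) set). (1::real)) > 0" using E0[of 0] unfolding 0 .
      qed auto
    qed
    have "f (r *\<^sub>R x) q \<le> ((1 - r) * ln (nV (GL_act (ediag 0) (GL_act q b))) + r * ln (nV (GL_act (ediag x) (GL_act q b)))) / 2
        + e / 2 * ((1 - r) * ln (E 0) + r * ln (E x)) - r * (\<beta> \<bullet> x)"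
      unfolding f_def inner_scaleR_right using e r
      by (intro diff_mono add_mono divide_right_mono mult_left_mono 1 2) auto
    also have "\<dots> = (1 - r) * f 0 q + r * f x q"
      by (simp add: f_def field_simps)
    also have "\<dots> \<le> (1 - r) * max (f 0 q) (f x q) + r * max (f 0 q) (f x q)"
      using r by (intro add_mono mult_left_mono) auto
    finally show "f (r *\<^sub>R x) q \<le> max (f 0 q) (f x q)" by (simp add: algebra_simps)
  next
    fix v :: "real^'a" and q C assume q: "q \<in> K_torus t" and v: "v \<noteq> 0"
    \<comment> \<open>By \<open>H\<close> one exponential makes up for the linear term in
      \<open>\<beta>\<close>, so these two together are bounded below on the ray and the term with
      \<open>e\<close> decides.\<close>
    obtain i j k where ijk: "sc (GL_act q b) i j k \<noteq> 0" "wt v i j k \<ge> v \<bullet> \<beta>" using H[OF q] by blast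
    obtain l where l: "v $ l \<noteq> 0" using v by (auto simp: vec_eq_iff)
    define c where "c = (sc (GL_act q b) i j k)\<^sup>2 / 2"
    have c: "c > 0" using ijk(1) by (simp add: c_def)
    have lower: "f (r *\<^sub>R v) q \<ge> ln c / 2 + e * (r * \<bar>v $ l\<bar>)" if r: "r \<ge> 0" for r
    proof -
      have "c * exp (2 * wt (r *\<^sub>R v) i j k) \<le> nV (GL_act (ediag (r *\<^sub>R v)) (GL_act q b))"
        unfolding N c_def
        using member_le_sum[of "(i,j,k)" UNIV "\<lambda>s. (case s of (i,j,k) \<Rightarrow> (sc (GL_act q b) i j k)\<^sup>2 / 2) * exp (case s of (i,j,k) \<Rightarrow> 2 * wt (r *\<^sub>R v) i j k)"]
        by (simp add: case_prod_beta)
      then have "ln (c * exp (2 * wt (r *\<^sub>R v) i j k)) \<le> ln (nV (GL_act (ediag (r *\<^sub>R v)) (GL_act q b)))"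
        using c N0[OF q] by (subst ln_le_cancel_iff) auto
      then have 1: "ln c + 2 * r * wt v i j k \<le> ln (nV (GL_act (ediag (r *\<^sub>R v)) (GL_act q b)))"
        using c by (simp add: ln_mult wt_scale mult.assoc)
      have "exp (2 * (r * \<bar>v $ l\<bar>)) \<le> E (r *\<^sub>R v)"
      proof -
        have "exp (2 * (r *\<^sub>R v) $ l) \<le> (\<Sum>i\<in>UNIV. exp (2 * (r *\<^sub>R v) $ i))" by (rule member_le_sum) auto
        moreover have "exp (2 * (- (r *\<^sub>R v)) $ l) \<le> (\<Sum>i\<in>UNIV. exp (2 * (- (r *\<^sub>R v)) $ i))" by (rule member_le_sum) auto
        moreover have "0 \<le> (\<Sum>i\<in>UNIV. exp (2 * (r *\<^sub>R v) $ i))" "0 \<le> (\<Sum>i\<in>UNIV. exp (2 * (- (r *\<^sub>R v)) $ i))"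
          by (intro sum_nonneg, simp)+
        ultimately have "exp (2 * (r *\<^sub>R v) $ l) \<le> E (r *\<^sub>R v)" "exp (2 * (- (r *\<^sub>R v)) $ l) \<le> E (r *\<^sub>R v)"
          unfolding E_def by linarith+
        then show ?thesis by (cases "v $ l \<ge> 0") auto
      qed
      then have "ln (exp (2 * (r * \<bar>v $ l\<bar>))) \<le> ln (E (r *\<^sub>R v))" using E0 by (subst ln_le_cancel_iff) auto
      then have 2: "e * (r * \<bar>v $ l\<bar>) \<le> e / 2 * ln (E (r *\<^sub>R v))" using e by simp
      have "r * (v \<bullet> \<beta>) \<le> r * wt v i j k" using ijk(2) r by (rule mult_left_mono)
      then show ?thesis using 1 2 by (simp add: f_def inner_commute)
    qed
    define r where "r = (\<bar>C - ln c / 2\<bar> + 1) / (e * \<bar>v $ l\<bar>)"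
    have "r \<ge> 0" "e * (r * \<bar>v $ l\<bar>) = \<bar>C - ln c / 2\<bar> + 1" using e l by (simp_all add: r_def)
    then show "\<exists>r\<ge>0. C < f (r *\<^sub>R v) q" using lower[of r] by (intro exI[of _ r]) linarith
  qed blast
  \<comment> \<open>The inverse transpose is included so that \<open>W\<close> grows when
    \<open>g\<close> tends to zero as well as to infinity; in the coordinates of
    \<open>svd_ediag\<close> it becomes \<open>E\<close>.\<close>
  define W where "W g = g \<bullet> g + costar g \<bullet> costar g" for g :: "real^'a^'a"
  define Phi where "Phi g = ln (nV (GL_act g b)) / 2 + e / 2 * ln (W g) - chi (diag \<beta>) g" for g
  have pair: "pairing (diag \<beta>) x = \<beta> \<bullet> x" for x by (simp add: pairing_def diag_nth inner_vec_def)
  have Phi_f: "Phi (k ** (ediag x ** q)) = f x q" if kq: "k \<in> K_torus t" "q \<in> K_torus t" for k x q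
  proof -
    note k = K_torusD(2,3)[OF kq(1)] and q = K_torusD(2,3)[OF kq(2)]
    have "costar (k ** (ediag x ** q)) = k ** (ediag (- x) ** q)"
      by (simp add: costar_mult[OF k(2) invertible_mult[OF invertible_ediag q(2)]]
          costar_mult[OF invertible_ediag q(2)] costar_orthogonal[OF k(1)] costar_orthogonal[OF q(1)] costar_ediag)
    then have "W (k ** (ediag x ** q)) = E x"
      by (simp add: W_def E_def orthogonal_mult_inner[OF k(1)] inner_ediag_mult orthogonal_row[OF q(1)])
    then show ?thesis
      by (simp add: Phi_def f_def nV_svd[OF b t(1) kq] chi_svd[OF cen t(1) kq] pair)
  qed
  define g0 where "g0 = ediag x0 ** q0"
  have g0: "g0 \<in> G_torus t"
    unfolding g0_def using x0(1) K_torusD(1) G_torus_mult ediag_G_torus[OF t(1)] by blast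
  have DM: "t \<subseteq> Der (GL_act g b)" if "g \<in> G_torus t" for g
    using t(2) G_torusD[OF that] Der_GL_act by (fastforce simp: commutes_def)
  have gram: "commutes (g ** transpose g) t" if "commutes g t" for g
    using that commutes_transpose[OF t(1)] commutes_mult by blast
  have cs0: "commutes (costar g0) t"
    unfolding costar_def using commutes_transpose[OF t(1)] commutes_inv G_torusD[OF g0] by blast
  let ?M = "\<lambda>g. (1 / nV (GL_act g b)) *\<^sub>R momentM (GL_act g b)"
  let ?R = "\<lambda>g. (e / W g) *\<^sub>R (g ** transpose g - costar g ** transpose (costar g))"
  define S where "S = ?M g0 + ?R g0"
  have "commutes S t"
    using momentM_commutes[OF GL_act_V[OF b] t(1) DM[OF g0]] gram[OF G_torusD(2)[OF g0]] gram[OF cs0]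
    by (auto simp: S_def commutes_def matrix_mult_add_diff scalar_matrix_assoc[symmetric] matrix_scalar_ac scaleR_diff_right)
  moreover have "transpose S = S"
    by (simp add: S_def transpose_add_diff transpose_scalar momentM_sym matrix_transpose_mul)
  ultimately obtain k where k: "k \<in> K_torus t" "k ** S ** transpose k \<in> Dg"
    using diagonalization[OF _ _ t(1)] by blast
  note kD = K_torusD(2,3)[OF k(1)]
  define g1 where "g1 = k ** g0"
  have g1: "g1 \<in> G_torus t" unfolding g1_def using k(1) g0 K_torusD(1) G_torus_mult by blast
  have i1: "invertible g1" by (rule G_torusD(1)[OF g1])
  have cs1: "costar g1 = k ** costar g0"
    unfolding g1_def by (simp add: costar_mult[OF kD(2) G_torusD(1)[OF g0]] costar_orthogonal[OF kD(1)])
  have W1: "W g1 = W g0" unfolding W_def cs1 unfolding g1_def by (simp add: orthogonal_mult_inner[OF kD(1)])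
  have nV1: "nV (GL_act g1 b) = nV (GL_act g0 b)"
    unfolding g1_def by (simp add: GL_act_mult[OF kD(2) G_torusD(1)[OF g0]] nV_orthogonal[OF GL_act_V[OF b] kD(1)])
  have "momentM (GL_act g1 b) = k ** momentM (GL_act g0 b) ** transpose k"
    by (simp add: g1_def GL_act_mult[OF kD(2) G_torusD(1)[OF g0]] momentM_orthogonal[OF GL_act_V[OF b] kD(1)])
  then have S1: "?M g1 + ?R g1 = k ** S ** transpose k"
    unfolding S_def W1 nV1 cs1 unfolding g1_def
    by (simp add: matrix_transpose_mul matrix_mul_assoc matrix_mult_add_diff scalar_matrix_assoc[symmetric] matrix_scalar_ac scaleR_diff_right)
  have W0: "W g1 > 0"
  proof -
    have "g1 \<bullet> g1 > 0"
    proof -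
      have "g1 \<noteq> 0"
      proof
        assume "g1 = 0"
        then have "mat 1 = (0 :: real^'a^'a)" using matrix_inv(1)[OF i1] by simp
        then have "(mat 1 :: real^'a^'a) $ undefined $ undefined = 0" by simp
        then show False by (simp add: mat_def)
      qed
      then show ?thesis by simp
    qed
    then show ?thesis by (simp add: W_def add_pos_nonneg)
  qed
  have min: "Phi g1 \<le> Phi g" if g: "g \<in> G_torus t" for g
  proof -
    obtain k' x q where *: "k' \<in> K_torus t" "q \<in> K_torus t" "g = k' ** (ediag x ** q)"
      using svd_ediag[OF g t(1)] by blast
    have "Phi g1 = f x0 q0" unfolding g1_def g0_def by (rule Phi_f[OF k(1) x0(1)])
    then show ?thesis using * Phi_f x0(2) by simp
  qed
  have "(?M g1 + ?R g1) $ i $ i = \<beta> $ i" for i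
  proof -
    let ?y = "axis i (1::real)"
    define n where "n \<tau> = nV (GL_act (ediag (\<tau> *\<^sub>R ?y)) (GL_act g1 b))" for \<tau>
    define u where "u \<tau> = (ediag (\<tau> *\<^sub>R ?y) ** g1) \<bullet> (ediag (\<tau> *\<^sub>R ?y) ** g1)" for \<tau>
    define w where "w \<tau> = (ediag (\<tau> *\<^sub>R (- ?y)) ** costar g1) \<bullet> (ediag (\<tau> *\<^sub>R (- ?y)) ** costar g1)" for \<tau>
    define \<psi> where "\<psi> \<tau> = ln (n \<tau>) / 2 + e / 2 * ln (u \<tau> + w \<tau>) - (\<tau> * \<beta> $ i + chi (diag \<beta>) g1)" for \<tau>
    have pa: "\<beta> \<bullet> ?y = \<beta> $ i" by (simp add: inner_axis)
    have psi: "\<psi> \<tau> = Phi (ediag (\<tau> *\<^sub>R ?y) ** g1)" for \<tau>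
    proof -
      have "costar (ediag (\<tau> *\<^sub>R ?y) ** g1) = ediag (\<tau> *\<^sub>R (- ?y)) ** costar g1"
        by (simp add: costar_mult[OF invertible_ediag i1] costar_ediag)
      moreover have "pairing (diag \<beta>) (\<tau> *\<^sub>R ?y) = \<tau> * \<beta> $ i" by (simp add: pairing_scale pair pa)
      ultimately show ?thesis
        by (simp add: \<psi>_def Phi_def W_def n_def u_def w_def GL_act_mult[OF invertible_ediag i1]
            chi_ediag_mult[OF cen t(1) g1])
    qed
    have ed0: "ediag 0 = (mat 1 :: real^'a^'a)" by (simp add: ediag_def flip: diag_1)
    have n0: "n 0 = nV (GL_act g1 b)" and uw0: "u 0 + w 0 = W g1"
      by (simp_all add: n_def u_def w_def ed0 W_def)
    have dn: "(n has_real_derivative 2 * momentM (GL_act g1 b) $ i $ i) (at 0)"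
      using nV_ediag_deriv[OF GL_act_V[OF b], of ?y g1] unfolding n_def sum_axis .
    have du: "(u has_real_derivative 2 * (g1 ** transpose g1) $ i $ i) (at 0)"
      using inner_ediag_deriv[of ?y g1] unfolding u_def sum_axis .
    have dw: "(w has_real_derivative - (2 * (costar g1 ** transpose (costar g1)) $ i $ i)) (at 0)"
    proof -
      have "(\<Sum>a\<in>UNIV. (- ?y) $ a * h a) = - h i" for h :: "'a \<Rightarrow> real"
        using sum_axis[of i h] by (simp add: sum_negf)
      then show ?thesis using inner_ediag_deriv[of "- ?y" "costar g1"] unfolding w_def by simp
    qed
    have "(\<psi> has_real_derivative (2 * momentM (GL_act g1 b) $ i $ i / nV (GL_act g1 b)) / 2
      + e / 2 * ((2 * (g1 ** transpose g1) $ i $ i - 2 * (costar g1 ** transpose (costar g1)) $ i $ i) / W g1) - \<beta> $ i) (at 0)"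
      unfolding \<psi>_def
      by (rule derivative_eq_intros dn du dw | simp add: n0 uw0 W0 pos[OF i1] | simp add: mult_ac)+
    moreover have "\<psi> 0 \<le> \<psi> \<tau>" for \<tau>
    proof -
      have "\<psi> 0 = Phi g1" by (simp add: psi ed0)
      then show ?thesis unfolding psi by (simp add: min G_torus_mult ediag_G_torus t(1) g1)
    qed
    ultimately have "(2 * momentM (GL_act g1 b) $ i $ i / nV (GL_act g1 b)) / 2
      + e / 2 * ((2 * (g1 ** transpose g1) $ i $ i - 2 * (costar g1 ** transpose (costar g1)) $ i $ i) / W g1) - \<beta> $ i = 0"
      by (rule deriv_zero_of_min)
    moreover have "(?R g1) $ i $ i = e / 2 * ((2 * (g1 ** transpose g1) $ i $ i - 2 * (costar g1 ** transpose (costar g1)) $ i $ i) / W g1)"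
    proof -
      have "e / W g1 * (x - y) = e / 2 * ((2 * x - 2 * y) / W g1)" for x y
        using W0 by (simp add: field_simps)
      then show ?thesis by (simp only: vector_scaleR_component vector_minus_component real_scaleR_def)
    qed
    moreover have "(?M g1) $ i $ i = 2 * momentM (GL_act g1 b) $ i $ i / nV (GL_act g1 b) / 2" by simp
    ultimately show ?thesis unfolding vector_add_component by linarith
  qed
  moreover have "?M g1 + ?R g1 \<in> Dg" using k(2) by (simp only: S1)
  ultimately have eq: "(?M g1 + ?R g1) $ i $ j = diag \<beta> $ i $ j" for i j
    by (cases "i = j") (auto simp: Dg_def diag_nth)
  have "\<bar>momentM (GL_act g1 b) $ i $ j / nV (GL_act g1 b) - diag \<beta> $ i $ j\<bar> \<le> e" for i j
  proof -
    \<comment> \<open>Entries of a Gram matrix are inner products of rows, so \<open>W\<close>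
      dominates both Gram matrices and the perturbation is at most \<open>e\<close>.\<close>
    have gr: "\<bar>(h ** transpose h) $ i $ j\<bar> \<le> h \<bullet> h" for h :: "real^'a^'a"
    proof -
      have "\<bar>h $ i \<bullet> h $ j\<bar> \<le> norm (h $ i) * norm (h $ j)" by (rule Cauchy_Schwarz_ineq2)
      also have "\<dots> \<le> norm h * norm h" by (intro mult_mono Finite_Cartesian_Product.norm_nth_le) auto
      finally show ?thesis by (simp add: mult_transpose_nth dot_square_norm power2_eq_square)
    qed
    have "\<bar>(g1 ** transpose g1) $ i $ j - (costar g1 ** transpose (costar g1)) $ i $ j\<bar> \<le> W g1"
      using gr[of g1] gr[of "costar g1"] unfolding W_def by linarith
    moreover have "\<bar>e / W g1 * x\<bar> \<le> e" if "\<bar>x\<bar> \<le> W g1" for x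
    proof -
      have "\<bar>e / W g1 * x\<bar> = e / W g1 * \<bar>x\<bar>" using e W0 by (simp add: abs_mult)
      also have "\<dots> \<le> e / W g1 * W g1" using e W0 that by (intro mult_left_mono) auto
      finally show ?thesis using W0 by simp
    qed
    ultimately have "\<bar>(?R g1) $ i $ j\<bar> \<le> e"
      by (simp only: vector_scaleR_component vector_minus_component real_scaleR_def)
    moreover have "(?M g1) $ i $ j + (?R g1) $ i $ j = diag \<beta> $ i $ j" using eq[of i j] by simp
    moreover have "(?M g1) $ i $ j = momentM (GL_act g1 b) $ i $ j / nV (GL_act g1 b)" by simp
    ultimately show ?thesis by linarith
  qed
  then show ?thesis using that g1 pos[OF i1] by blast
qed

lemma scalar_ediag:
  assumes "\<mu> \<in> V"
  shows "sc (GL_act (ediag (\<chi> i. - s)) \<mu>) i j k = exp s * sc \<mu> i j k"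
  by (simp add: sc_ediag[OF assms] wt_def)

lemma nV_momentM_scale:
  assumes "\<And>i j k. sc \<nu> i j k = r * sc \<mu> i j k"
  shows "nV \<nu> = r\<^sup>2 * nV \<mu>" "momentM \<nu> = r\<^sup>2 *\<^sub>R momentM \<mu>"
proof -
  have *: "r * x * (r * y) = r\<^sup>2 * (x * y)" for x y by (simp add: power2_eq_square)
  show "nV \<nu> = r\<^sup>2 * nV \<mu>"
    unfolding inner_V_sc assms * by (simp add: sum_distrib_left)
  show "momentM \<nu> = r\<^sup>2 *\<^sub>R momentM \<mu>"
    unfolding momentM_def assms * by (simp add: vec_eq_iff sum_distrib_left[symmetric] right_diff_distrib)
qed

text \<open>Approximate solutions for \<open>e = 1 / (n + 1)\<close> are rescaled by scalars to norm
  one and a convergent subsequence is taken. The moment equation passes to the limit by continuity,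
  which avoids any closedness of the orbit.\<close>

theorem soliton_limit:
  assumes nl: "nilLie k b" and t: "t \<subseteq> Dg" "t \<subseteq> Der b" and cen: "central t (diag \<beta>)"
    and H: "\<And>q v. q \<in> K_torus t \<Longrightarrow> \<exists>i j k. sc (GL_act q b) i j k \<noteq> 0 \<and> wt v i j k \<ge> v \<bullet> \<beta>"
  obtains \<mu> where "nilLie k \<mu>" "t \<subseteq> Der \<mu>" "momentM \<mu> = diag \<beta>"
proof -
  have b: "b \<in> V" using nl by (simp add: nilLie_def)
  have "\<exists>g\<in>G_torus t. nV (GL_act g b) = 1 \<and> (\<forall>i j. \<bar>momentM (GL_act g b) $ i $ j - diag \<beta> $ i $ j\<bar> \<le> e)"
    if e: "e > 0" for e :: real
  proof -
    obtain g where g: "g \<in> G_torus t" "nV (GL_act g b) > 0"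
      "\<And>i j. \<bar>momentM (GL_act g b) $ i $ j / nV (GL_act g b) - diag \<beta> $ i $ j\<bar> \<le> e"
      using approximate_soliton[OF b t cen H e] by blast
    define n where "n = nV (GL_act g b)"
    \<comment> \<open>\<open>ediag\<close> of the constant vector \<open>- s\<close> multiplies
      brackets by \<open>exp s\<close>, and the square of this must be \<open>1 / n\<close>.\<close>
    define s where "s = - (ln n / 2)"
    have es: "(exp s)\<^sup>2 = 1 / n"
    proof -
      have "(exp s)\<^sup>2 = exp (- ln n)" by (simp add: s_def power2_eq_square flip: exp_add)
      then show ?thesis using g(2) by (simp add: exp_minus n_def divide_inverse)
    qed
    let ?h = "ediag (\<chi> i. - s) ** g"
    have h: "?h \<in> G_torus t" using g(1) ediag_G_torus[OF t(1)] G_torus_mult by blast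
    have "GL_act ?h b = GL_act (ediag (\<chi> i. - s)) (GL_act g b)"
      by (rule GL_act_mult[OF invertible_ediag G_torusD(1)[OF g(1)]])
    then have sc: "sc (GL_act ?h b) i j l = exp s * sc (GL_act g b) i j l" for i j l
      by (simp add: scalar_ediag GL_act_V[OF b])
    have "nV (GL_act ?h b) = 1" using g(2) by (simp add: nV_momentM_scale(1)[OF sc] es n_def)
    moreover have "momentM (GL_act ?h b) $ i $ j = momentM (GL_act g b) $ i $ j / nV (GL_act g b)" for i j
      by (simp add: nV_momentM_scale(2)[OF sc] es n_def)
    ultimately show ?thesis using g(3) h by auto
  qed
  then have "\<exists>g\<in>G_torus t. nV (GL_act g b) = 1 \<and> (\<forall>i j. \<bar>momentM (GL_act g b) $ i $ j - diag \<beta> $ i $ j\<bar> \<le> 1 / Suc n)"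
    for n by simp
  then obtain g where g: "\<And>n. g n \<in> G_torus t" "\<And>n. nV (GL_act (g n) b) = 1"
    "\<And>n i j. \<bar>momentM (GL_act (g n) b) $ i $ j - diag \<beta> $ i $ j\<bar> \<le> 1 / Suc n" by metis
  define T where "T n = structure_constants (GL_act (g n) b)" for n
  have nVT: "nV \<mu> = (structure_constants \<mu> \<bullet> structure_constants \<mu>) / 2" for \<mu> :: "real^'a \<Rightarrow> real^'a \<Rightarrow> real^'a"
    by (simp add: inner_V_def structure_constants_def inner_vec_def)
  have "T n \<in> cball 0 2" for n
  proof -
    have "T n \<bullet> T n = 2" using g(2)[of n] by (simp add: nVT T_def)
    then have "(norm (T n))\<^sup>2 \<le> 2\<^sup>2" by (simp add: dot_square_norm)
    then have "norm (T n) \<le> 2" by (rule power2_le_imp_le) simp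
    then show ?thesis by simp
  qed
  then obtain L r where r: "strict_mono (r :: nat \<Rightarrow> nat)" and lim: "(T \<circ> r) \<longlonglongrightarrow> L"
    using compact_cball[of "0 :: real^'a^'a^'a" 2] unfolding compact_def by metis
  define \<nu> where "\<nu> n = GL_act (g (r n)) b" for n
  have lim': "(\<lambda>n. structure_constants (\<nu> n)) \<longlonglongrightarrow> L" using lim by (simp add: T_def \<nu>_def o_def)
  have nl\<nu>: "nilLie k (\<nu> n)" for n unfolding \<nu>_def by (rule nilLie_GL_act[OF nl G_torusD(1)[OF g(1)]])
  obtain \<mu> where \<mu>: "nilLie k \<mu>" "structure_constants \<mu> = L" using nilLie_limit[OF nl\<nu> lim'] by blast
  have V: "\<mu> \<in> V" using \<mu>(1) by (simp add: nilLie_def)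
  have "t \<subseteq> Der \<mu>"
  proof
    fix D assume D: "D \<in> t"
    have DD: "D \<in> Dg" using D t(1) by blast
    have "D $ l $ l = D $ i $ i + D $ j $ j" if nz: "sc \<mu> i j l \<noteq> 0" for i j l
    proof -
      \<comment> \<open>A nonzero constant of the limit is nonzero along the sequence, so the
        support can only shrink in the limit.\<close>
      have "(\<lambda>n. sc (\<nu> n) i j l) \<longlonglongrightarrow> sc \<mu> i j l"
        unfolding structure_constants_nth[symmetric] \<mu>(2) by (intro tendsto_intros lim')
      then have "\<forall>\<^sub>F n in sequentially. sc (\<nu> n) i j l \<noteq> 0" using nz by (rule tendsto_imp_eventually_ne)
      then obtain n where n: "sc (\<nu> n) i j l \<noteq> 0" by (auto simp: eventually_sequentially)
      have "D \<in> Der (\<nu> n)"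
        unfolding \<nu>_def using Der_GL_act[of D b] D t(2) G_torusD[OF g(1)] by (auto simp: commutes_def)
      moreover have "\<nu> n \<in> V" using nl\<nu> by (simp add: nilLie_def)
      ultimately show ?thesis using Der_sc[OF _ DD] n by blast
    qed
    then show "D \<in> Der \<mu>" using Der_sc[OF V DD] by blast
  qed
  moreover have "momentM \<mu> = diag \<beta>"
  proof -
    have "momentM \<mu> $ i $ j = diag \<beta> $ i $ j" for i j
    proof (rule LIMSEQ_unique)
      have "(\<lambda>n. momentM (\<nu> n)) \<longlonglongrightarrow> momentM \<mu>"
        unfolding structure_momentM \<mu>(2) by (intro tendsto_vec_lambda tendsto_intros lim') auto
      then show "(\<lambda>n. momentM (\<nu> n) $ i $ j) \<longlonglongrightarrow> momentM \<mu> $ i $ j" by (intro tendsto_intros)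
      have "(\<lambda>n. momentM (\<nu> n) $ i $ j - diag \<beta> $ i $ j) \<longlonglongrightarrow> 0"
      proof (rule Lim_null_comparison)
        show "\<forall>\<^sub>F n in sequentially. norm (momentM (\<nu> n) $ i $ j - diag \<beta> $ i $ j) \<le> 1 / Suc n"
        proof (rule always_eventually, rule allI)
          fix n
          have "n \<le> r n" by (rule seq_suble[OF r])
          then have "1 / real (Suc (r n)) \<le> 1 / real (Suc n)" by (intro divide_left_mono) auto
          then show "norm (momentM (\<nu> n) $ i $ j - diag \<beta> $ i $ j) \<le> 1 / Suc n"
            using g(3)[of "r n" i j] by (simp add: \<nu>_def)
        qed
        show "(\<lambda>n. 1 / real (Suc n)) \<longlonglongrightarrow> 0" by real_asymp
      qed
      then have "(\<lambda>n. momentM (\<nu> n) $ i $ j - diag \<beta> $ i $ j + diag \<beta> $ i $ j) \<longlonglongrightarrow> 0 + diag \<beta> $ i $ j"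
        by (intro tendsto_add tendsto_const)
      then show "(\<lambda>n. momentM (\<nu> n) $ i $ j) \<longlonglongrightarrow> diag \<beta> $ i $ j" by simp
    qed
    then show ?thesis by (simp add: vec_eq_iff)
  qed
  ultimately show ?thesis using that \<mu>(1) by blast
qed

text \<open>With \<open>\<phi> = \<xi> + 1\<close> for the optimal \<open>\<xi>\<close>, the weight
  part has \<open>diag \<phi>\<close> as a derivation and degenerates to a bracket whose moment map
  is \<open>diag \<beta>\<close>, a positive multiple of \<open>diag \<phi> - mat 1\<close>. This is
  the soliton equation, so \<open>\<phi>\<close> is positive. Orthogonality of \<open>\<xi>\<close>
  to the torus leaves only the vector of ones in the pairing, hence the trace.\<close>

theorem positive_filtration:
  assumes nl: "nilLie k b" and b0: "b \<noteq> (\<lambda>x y. 0)" and t: "t \<subseteq> Dg" "t \<subseteq> Der b"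
  obtains q \<phi> where "q \<in> K_torus t" "\<And>i. \<phi> $ i > 0" "\<And>i j k. sc (GL_act q b) i j k \<noteq> 0 \<Longrightarrow> wt \<phi> i j k \<ge> 0"
    "\<And>D. D \<in> t \<Longrightarrow> pairing D \<phi> = trace D"
proof -
  have b: "b \<in> V" and nil: "nilp k b" using nl by (auto simp: nilLie_def)
  obtain q1 \<xi>1 where "q1 \<in> K_torus t" "\<And>i j k. sc (GL_act q1 b) i j k \<noteq> 0 \<Longrightarrow> wt \<xi>1 i j k \<ge> 1"
    using nilpotent_flag[OF b nil t] by blast
  then have "destab b t q1 \<xi>1" by (simp add: destab_def)
  then obtain q \<xi> where opt: "destab b t q \<xi>" "\<And>q' \<xi>'. destab b t q' \<xi>' \<Longrightarrow> \<xi> \<bullet> \<xi> \<le> \<xi>' \<bullet> \<xi>'"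
    using destab_minimum[OF b] by blast
  have q: "q \<in> K_torus t" and ge: "\<And>i j k. sc (GL_act q b) i j k \<noteq> 0 \<Longrightarrow> wt \<xi> i j k \<ge> 1"
    using opt(1) by (auto simp: destab_def)
  note q' = K_torusD(3,4)[OF q]
  define \<phi> where "\<phi> = \<xi> + (\<chi> i. 1)"
  have w\<phi>: "wt \<phi> i j l = wt \<xi> i j l - 1" for i j l by (simp add: \<phi>_def wt_def)
  define \<beta> where "\<beta> = (1 / (\<xi> \<bullet> \<xi>)) *\<^sub>R \<xi>"
  have \<xi>0: "\<xi> \<noteq> 0" by (rule destab_optimal_weight(2)[OF b b0 t(1) opt mat1_K_torus])
  define \<nu> where "\<nu> = weight_part \<xi> (GL_act q b)"
  have nl\<nu>: "nilLie k \<nu>"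
    unfolding \<nu>_def by (rule nilLie_weight_part[OF nilLie_GL_act[OF nl q'(1)] ge])
  have V\<nu>: "\<nu> \<in> V" and Vq: "GL_act q b \<in> V" using nl\<nu> GL_act_V[OF b] by (auto simp: nilLie_def)
  \<comment> \<open>Enlarging the torus keeps the minimization inside the centralizer of the
    grading: \<open>diag \<beta>\<close> becomes central, and \<open>diag \<phi>\<close> remains a
    derivation in the limit.\<close>
  let ?t = "insert (diag \<phi>) t"
  have tDg: "?t \<subseteq> Dg" using t(1) by simp
  have comm: "commutes g (insert (diag \<phi>) t) \<longleftrightarrow> commutes g (insert (diag \<xi>) t)" for g
    using t(1) by (simp add: commutes_nth diag_nth \<phi>_def)
  then have KK: "K_torus ?t = K_torus (insert (diag \<xi>) t)"
    by (simp add: K_torus_def invertible_eq)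
  have tDer: "?t \<subseteq> Der \<nu>"
  proof -
    have "D \<in> Der \<nu>" if D: "D \<in> t" for D
    proof -
      have DD: "D \<in> Dg" using D t(1) by blast
      have "D \<in> Der (GL_act q b)" using Der_GL_act[of D b q] D t(2) q' by (auto simp: commutes_def)
      then show ?thesis using Der_sc[OF Vq DD] Der_sc[OF V\<nu> DD] by (auto simp: \<nu>_def sc_weight_part split: if_splits)
    qed
    moreover have "diag \<phi> \<in> Der \<nu>"
    proof -
      have "\<phi> $ l = \<phi> $ i + \<phi> $ j" if "sc \<nu> i j l \<noteq> 0" for i j l
        using that w\<phi>[of i j l] by (auto simp: \<nu>_def sc_weight_part wt_def split: if_splits)
      then show ?thesis using Der_sc[OF V\<nu> diag_Dg] by (auto simp: diag_nth)
    qed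
    ultimately show ?thesis by blast
  qed
  have cen: "central ?t (diag \<beta>)"
  proof -
    have "g ** diag \<beta> = diag \<beta> ** g" if "commutes g ?t" for g
      using that tDg \<xi>0 by (auto simp: commutes_nth commute_Dg_iff diag_nth \<beta>_def \<phi>_def)
    then show ?thesis by (simp add: central_def)
  qed
  have H: "\<exists>i j l. sc (GL_act p \<nu>) i j l \<noteq> 0 \<and> wt v i j l \<ge> v \<bullet> \<beta>" if "p \<in> K_torus ?t" for p v
    unfolding \<nu>_def \<beta>_def
    by (rule destab_optimal_weight(1)[OF b b0 t(1) opt(1)]) (use opt(2) that KK in auto)
  obtain \<mu> where \<mu>: "nilLie k \<mu>" "?t \<subseteq> Der \<mu>" "momentM \<mu> = diag \<beta>"
    using soliton_limit[OF nl\<nu> tDg tDer cen H] by blast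
  have "\<phi> $ i > 0" for i
  proof (rule soliton_positive[of \<mu> k \<phi> "1 / (\<xi> \<bullet> \<xi>)"])
    show "\<mu> \<in> V" "jacobi \<mu>" "nilp k \<mu>" using \<mu>(1) by (auto simp: nilLie_def)
    then show "wt \<phi> i j l = 0" if "sc \<mu> i j l \<noteq> 0" for i j l
      using Der_sc[of \<mu> "diag \<phi>"] \<mu>(2) that by (auto simp: wt_def diag_nth)
    show "momentM \<mu> = (1 / (\<xi> \<bullet> \<xi>)) *\<^sub>R (diag \<phi> - mat 1)"
      unfolding \<mu>(3) by (simp add: vec_eq_iff diag_nth \<beta>_def \<phi>_def mat_def)
    show "1 / (\<xi> \<bullet> \<xi>) > 0" using \<xi>0 by simp
  qed
  moreover have "wt \<phi> i j l \<ge> 0" if "sc (GL_act q b) i j l \<noteq> 0" for i j l using ge[OF that] by (simp add: w\<phi>)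
  moreover have "pairing D \<phi> = trace D" if "D \<in> t" for D
    using destab_optimal_orthogonal[OF b t opt that] by (simp add: \<phi>_def pairing_add) (simp add: pairing_def trace_def)
  ultimately show ?thesis using that q by blast
qed

text \<open>Test the weak inequalities on \<open>v = e d - \<phi>\<close>, where \<open>d\<close> is
  the diagonal of \<open>D\<close> and \<open>\<phi>\<close> the positive vector of
  \<open>positive_filtration\<close>. For small \<open>e\<close> it has negative entries, and its
  weights are nonpositive because \<open>d\<close> has weight zero on the support. Its pairing with
  \<open>D\<close> is \<open>e (d \<bullet> d) - trace D\<close>, which forces
  \<open>d = 0\<close>.\<close>

theorem criterion_trace_0:
  assumes nl: "nilLie k b" and b0: "b \<noteq> (\<lambda>x y. 0)" and t: "t \<subseteq> Dg" "t \<subseteq> Der b"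
    and D: "D \<in> t" "trace D = 0" and c: "criterion b t (\<le>) D"
  shows "D = 0"
proof -
  obtain q \<phi> where q: "q \<in> K_torus t" "\<And>i. \<phi> $ i > 0" "\<And>i j k. sc (GL_act q b) i j k \<noteq> 0 \<Longrightarrow> wt \<phi> i j k \<ge> 0"
    "pairing D \<phi> = trace D"
    using positive_filtration[OF nl b0 t] D(1) by metis
  define d where "d = (\<chi> i. D $ i $ i)"
  have Dd: "D = diag d" unfolding d_def by (rule Dg_eq_diag) (use D t in blast)
  have "D \<in> Der (GL_act q b)"
    using Der_GL_act[of D b q] t(2) D K_torusD(3,4)[OF q(1)] by (auto simp: commutes_def)
  moreover have "GL_act q b \<in> V" using nl GL_act_V by (auto simp: nilLie_def)
  ultimately have wd: "wt d i j l = 0" if "sc (GL_act q b) i j l \<noteq> 0" for i j l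
    using Der_sc[of "GL_act q b" D] t(1) D(1) that by (auto simp: d_def wt_def)
  have "\<forall>\<^sub>F e in at_right (0::real). \<forall>i\<in>UNIV. \<phi> $ i - e * d $ i > 0"
  proof (rule eventually_ball_finite, simp, rule ballI)
    fix i
    have "((\<lambda>e. \<phi> $ i - e * d $ i) \<longlongrightarrow> \<phi> $ i - 0 * d $ i) (at_right 0)" by (intro tendsto_intros)
    from order_tendstoD(1)[OF this, of 0] show "\<forall>\<^sub>F e in at_right 0. \<phi> $ i - e * d $ i > 0" using q(2)[of i] by simp
  qed
  moreover have "\<forall>\<^sub>F e in at_right 0. e > (0::real)" by (rule eventually_at_right_less)
  ultimately have "\<forall>\<^sub>F e in at_right (0::real). (\<forall>i\<in>UNIV. \<phi> $ i - e * d $ i > 0) \<and> e > 0" by eventually_elim auto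
  then obtain e where e: "\<And>i. \<phi> $ i - e * d $ i > 0" "e > 0"
    using eventually_happens[of _ "at_right (0::real)"] by auto
  define v where "v = e *\<^sub>R d - \<phi>"
  have vn: "v $ i < 0" for i using e(1)[of i] by (simp add: v_def)
  have "v \<noteq> 0" using vn[of undefined] by auto
  moreover have "adm (GL_act q b) v"
  proof -
    have "wt v i j l = e * wt d i j l - wt \<phi> i j l" for i j l by (simp add: v_def wt_def algebra_simps)
    then show ?thesis using vn q(3) wd by (auto simp: adm_def less_imp_le)
  qed
  ultimately have "pairing D v \<le> 0" using c q(1) by (auto simp: criterion_def)
  moreover have "pairing D v = e * (d \<bullet> d)"
  proof -
    have "pairing D v = e * pairing D d - pairing D \<phi>"
      by (simp add: v_def pairing_def right_diff_distrib sum_subtractf sum_distrib_left mult_ac)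
    moreover have "pairing D d = d \<bullet> d" by (simp add: pairing_def d_def inner_vec_def)
    ultimately show ?thesis using q(4) D(2) by simp
  qed
  ultimately have "d \<bullet> d \<le> 0" using e(2) by (simp add: mult_le_0_iff)
  then have "d = 0" by (metis inner_gt_zero_iff not_less)
  then show ?thesis by (simp add: Dd diag_def vec_eq_iff)
qed

subsection \<open>Transporting the Ricci curvature along isometries\<close>

lemma levi_civita_eqI:
  assumes "bilinear b" "inner_product_on_space g"
    "\<And>Z. 2 * g W Z = g (b X Y) Z - g (b Y Z) X + g (b Z X) Y"
  shows "levi_civita b g X Y = W"
  unfolding levi_civita_def by (rule the1_equality[OF levi_civita_ex1[OF assms(1,2)]]) (use assms(3) in blast)

lemma levi_civita_koszul:
  assumes "bilinear b" "inner_product_on_space g"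
  shows "2 * g (levi_civita b g X Y) Z = g (b X Y) Z - g (b Y Z) X + g (b Z X) Y"
  using theI'[OF levi_civita_ex1[OF assms]] unfolding levi_civita_def by blast

lemma inner_product_inner: "inner_product_on_space ((\<bullet>) :: 'a::euclidean_space \<Rightarrow> _)"
  by (simp add: inner_product_on_space_def inner_commute bilinear_conv_bounded_bilinear bounded_bilinear_inner)

lemma sum_trace_swap:
  fixes P Q :: "'a::euclidean_space \<Rightarrow> 'a"
  assumes "linear P" "linear Q"
  shows "(\<Sum>e\<in>Basis. P (Q e) \<bullet> e) = (\<Sum>e\<in>Basis. Q (P e) \<bullet> e)"
proof -
  have *: "F (G e) \<bullet> e = (\<Sum>f\<in>Basis. (G e \<bullet> f) * (F f \<bullet> e))" if "linear F" for F G :: "'a \<Rightarrow> 'a" and e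
  proof -
    have "F (G e) = F (\<Sum>f\<in>Basis. (G e \<bullet> f) *\<^sub>R f)" by (simp add: euclidean_representation)
    also have "\<dots> = (\<Sum>f\<in>Basis. (G e \<bullet> f) *\<^sub>R F f)"
      by (simp only: linear_sum[OF that] linear_scale[OF that])
    finally show ?thesis by (simp add: inner_sum_left)
  qed
  have "(\<Sum>e\<in>Basis. P (Q e) \<bullet> e) = (\<Sum>e\<in>Basis. \<Sum>f\<in>Basis. (Q e \<bullet> f) * (P f \<bullet> e))"
    by (simp only: *[OF assms(1)])
  also have "\<dots> = (\<Sum>f\<in>Basis. \<Sum>e\<in>Basis. (P f \<bullet> e) * (Q e \<bullet> f))"
    by (subst sum.swap) (simp add: mult.commute)
  also have "\<dots> = (\<Sum>e\<in>Basis. Q (P e) \<bullet> e)" by (simp only: *[OF assms(2)])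
  finally show ?thesis .
qed

text \<open>The connection is determined by bracket and inner product, so \<open>T\<close>
  intertwines the curvatures. The trace in \<open>ricci\<close> uses a fixed basis that
  \<open>T\<close> does not preserve; linearity of the curvature in its first argument allows
  \<open>T'\<close> to be moved cyclically.\<close>

lemma ricci_transport:
  fixes b b' :: "'a::euclidean_space \<Rightarrow> 'a \<Rightarrow> 'a"
  assumes b: "bilinear b" "bilinear b'" and g: "inner_product_on_space g"
    and T: "linear T" "linear T'" "\<And>x. T (T' x) = x" "\<And>x. T' (T x) = x"
    and iso: "\<And>x y. g x y = T x \<bullet> T y" and hom: "\<And>x y. b' (T x) (T y) = T (b x y)"
    and lin: "\<And>Y. linear (\<lambda>X. riemann b' (\<bullet>) X Y Y)"
  shows "ricci b g X X = ricci b' (\<bullet>) (T X) (T X)"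
proof -
  have lc: "levi_civita b' (\<bullet>) (T x) (T y) = T (levi_civita b g x y)" for x y
  proof (rule levi_civita_eqI[OF b(2) inner_product_inner])
    fix Z
    show "2 * (T (levi_civita b g x y) \<bullet> Z) = b' (T x) (T y) \<bullet> Z - b' (T y) Z \<bullet> T x + b' Z (T x) \<bullet> T y"
      using levi_civita_koszul[OF b(1) g, of x y "T' Z"] hom[of y "T' Z"] hom[of "T' Z" x]
      by (simp add: iso T(3) hom)
  qed
  have "riemann b' (\<bullet>) (T x) (T y) (T z) = T (riemann b g x y z)" for x y z
    by (simp add: riemann_def lc hom linear_diff[OF T(1)])
  then have R: "riemann b g e X X = T' (riemann b' (\<bullet>) (T e) (T X) (T X))" for e by (simp add: T(4))
  have "ricci b g X X = (\<Sum>e\<in>Basis. T' (riemann b' (\<bullet>) (T e) (T X) (T X)) \<bullet> e)"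
    by (simp add: ricci_def R)
  also have "\<dots> = (\<Sum>e\<in>Basis. riemann b' (\<bullet>) (T (T' e)) (T X) (T X) \<bullet> e)"
    by (rule sum_trace_swap[OF T(2), of "\<lambda>e. riemann b' (\<bullet>) (T e) (T X) (T X)"])
      (rule linear_compose[OF T(1) lin, unfolded o_def])
  finally show ?thesis by (simp add: ricci_def T(3))
qed

subsection \<open>The Ricci curvature of a one-dimensional extension\<close>

lemma sum_Basis_vec: "(\<Sum>e\<in>Basis. f e) = (\<Sum>i\<in>UNIV. f (axis i (1::real)))" for f :: "real^'n \<Rightarrow> 'b::comm_monoid_add"
proof -
  have B: "(Basis :: (real^'n) set) = (\<lambda>i. axis i 1) ` UNIV" by (auto simp: Basis_vec_def)
  have inj: "inj (\<lambda>i::'n. axis i (1::real))" by (auto simp: inj_on_def axis_eq_axis)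
  show ?thesis unfolding B sum.reindex[OF inj] o_def ..
qed

lemma sum_Basis_real_vec:
  "(\<Sum>e\<in>Basis. f e) = f (1, 0) + (\<Sum>i\<in>UNIV. f (0, axis i 1))" for f :: "real \<times> (real^'n) \<Rightarrow> real"
proof -
  have "inj_on (\<lambda>u. (0::real, u::real^'n)) Basis" by (auto intro!: inj_onI)
  then have "(\<Sum>e\<in>Basis. f e) = f (1, 0) + (\<Sum>e\<in>Basis. f (0, e))"
    unfolding Basis_prod_def by (subst sum.union_disjoint) (auto simp: sum.reindex o_def)
  then show ?thesis by (simp only: sum_Basis_vec)
qed

definition lcn :: "(real^'n \<Rightarrow> real^'n \<Rightarrow> real^'n) \<Rightarrow> real^'n \<Rightarrow> real^'n \<Rightarrow> real^'n" where
  "lcn \<mu> x y = (\<chi> k. (\<mu> x y $ k - \<mu> y (axis k 1) \<bullet> x + \<mu> (axis k 1) x \<bullet> y) / 2)"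

text \<open>The connection of the extension for symmetric \<open>D\<close>. The covariant derivative
  along \<open>f\<close> vanishes, and \<open>D\<close> is the second fundamental form of the
  nilpotent factor up to sign.\<close>

definition lcs :: "(real^'n \<Rightarrow> real^'n \<Rightarrow> real^'n) \<Rightarrow> real^'n^'n \<Rightarrow> real \<times> (real^'n) \<Rightarrow> real \<times> (real^'n) \<Rightarrow> real \<times> (real^'n)" where
  "lcs \<mu> D X Y = ((D *v snd X) \<bullet> snd Y, lcn \<mu> (snd X) (snd Y) - fst Y *\<^sub>R (D *v snd X))"

lemma lcn_koszul:
  assumes "bilinear \<mu>"
  shows "2 * (lcn \<mu> x y \<bullet> z) = \<mu> x y \<bullet> z - \<mu> y z \<bullet> x + \<mu> z x \<bullet> y"
proof -
  have l: "linear (\<mu> y)" "linear (\<lambda>z. \<mu> z x)" using assms by (auto simp: bilinear_def)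
  have 1: "\<mu> y z \<bullet> x = (\<Sum>k\<in>UNIV. z $ k * (\<mu> y (axis k 1) \<bullet> x))"
    by (subst vec_expand[of z]) (simp only: linear_sum[OF l(1)] linear_scale[OF l(1)] inner_sum_left inner_scaleR_left)
  have 2: "\<mu> z x \<bullet> y = (\<Sum>k\<in>UNIV. z $ k * (\<mu> (axis k 1) x \<bullet> y))"
    by (subst vec_expand[of z]) (simp only: linear_sum[OF l(2)] linear_scale[OF l(2)] inner_sum_left inner_scaleR_left)
  have "2 * (lcn \<mu> x y \<bullet> z) = (\<Sum>k\<in>UNIV. z $ k * \<mu> x y $ k - z $ k * (\<mu> y (axis k 1) \<bullet> x) + z $ k * (\<mu> (axis k 1) x \<bullet> y))"
    unfolding inner_vec_def[of "lcn \<mu> x y"] sum_distrib_left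
  proof (intro sum.cong refl)
    fix k
    have "lcn \<mu> x y $ k * 2 = \<mu> x y $ k - \<mu> y (axis k 1) \<bullet> x + \<mu> (axis k 1) x \<bullet> y" by (simp add: lcn_def)
    then show "2 * (lcn \<mu> x y $ k \<bullet> z $ k) =
        z $ k * \<mu> x y $ k - z $ k * (\<mu> y (axis k 1) \<bullet> x) + z $ k * (\<mu> (axis k 1) x \<bullet> y)"
      unfolding inner_real_def by algebra
  qed
  also have "\<dots> = \<mu> x y \<bullet> z - \<mu> y z \<bullet> x + \<mu> z x \<bullet> y"
    unfolding 1 2 by (simp add: sum.distrib sum_subtractf inner_vec_def mult.commute)
  finally show ?thesis .
qed

lemma lcn_bilinear:
  assumes "bilinear \<mu>"
  shows "bilinear (lcn \<mu>)"
  unfolding bilinear_def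
  by (auto intro!: linearI simp: lcn_def vec_eq_iff bilinear_ladd[OF assms] bilinear_radd[OF assms]
      bilinear_lmul[OF assms] bilinear_rmul[OF assms] inner_add_left inner_add_right algebra_simps add_divide_distrib diff_divide_distrib)

lemma lcn_props:
  assumes V: "\<mu> \<in> V"
  shows "lcn \<mu> x y \<bullet> z = - (lcn \<mu> x z \<bullet> y)" "lcn \<mu> x y - lcn \<mu> y x = \<mu> x y"
proof -
  note k = lcn_koszul[OF V_D(1)[OF V]]
  have n: "\<mu> a c \<bullet> d = - (\<mu> c a \<bullet> d)" for a c d by (subst V_D(3)[OF V]) simp
  show "lcn \<mu> x y \<bullet> z = - (lcn \<mu> x z \<bullet> y)"
    using k[of x y z] k[of x z y] n[of y z x] n[of z x y] n[of x y z] by linarith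
  have "(lcn \<mu> x y - lcn \<mu> y x) \<bullet> z = \<mu> x y \<bullet> z" for z
    using k[of x y z] k[of y x z] n[of y z x] n[of z x y] n[of y x z] by (simp add: inner_diff_left)
  then show "lcn \<mu> x y - lcn \<mu> y x = \<mu> x y" by (metis vector_eq_rdot)
qed

lemma sym_inner: "transpose D = D \<Longrightarrow> (D *v x) \<bullet> y = x \<bullet> (D *v y)" for D :: "real^'n^'n"
  by (metis dot_lmul_matrix transpose_matrix_vector)

lemma bilinear_semidirect:
  assumes "bilinear \<mu>"
  shows "bilinear (semidirect_bracket \<mu> D)"
  unfolding bilinear_def semidirect_bracket_def
  by (auto intro!: linearI simp: bilinear_ladd[OF assms] bilinear_radd[OF assms]
      bilinear_lmul[OF assms] bilinear_rmul[OF assms] matrix_vector_right_distrib matrix_vector_mult_scaleR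
      algebra_simps split: prod.splits)

lemma levi_civita_semidirect:
  assumes V: "\<mu> \<in> V" and D: "transpose D = D"
  shows "levi_civita (semidirect_bracket \<mu> D) (\<bullet>) = lcs \<mu> D"
proof (intro ext levi_civita_eqI bilinear_semidirect inner_product_inner V_D(1)[OF V])
  fix X Y Z :: "real \<times> (real^'a)"
  obtain a x c y d z where e: "X = (a, x)" "Y = (c, y)" "Z = (d, z)" by (metis surj_pair)
  have s: "(D *v y) \<bullet> z = (D *v z) \<bullet> y" "(D *v z) \<bullet> x = (D *v x) \<bullet> z" "(D *v y) \<bullet> x = (D *v x) \<bullet> y"
    using sym_inner[OF D] inner_commute by metis+
  show "2 * (lcs \<mu> D X Y \<bullet> Z) = semidirect_bracket \<mu> D X Y \<bullet> Z - semidirect_bracket \<mu> D Y Z \<bullet> X + semidirect_bracket \<mu> D Z X \<bullet> Y"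
    using lcn_koszul[OF V_D(1)[OF V], of x y z]
    by (simp add: e lcs_def semidirect_bracket_def inner_add_left inner_diff_left s algebra_simps)
qed

lemma lcs_bilinear:
  assumes "bilinear \<mu>"
  shows "bilinear (lcs \<mu> D)"
  using lcn_bilinear[OF assms]
  unfolding bilinear_def[of "lcs \<mu> D"]
  by (auto intro!: linearI simp: lcs_def bilinear_ladd bilinear_radd bilinear_lmul bilinear_rmul
      matrix_vector_right_distrib matrix_vector_mult_scaleR inner_add_left inner_add_right algebra_simps)

lemma trace_axis: "trace A = (\<Sum>i\<in>UNIV. (A *v axis i 1) \<bullet> axis i 1)" for A :: "real^'n^'n"
  by (simp add: trace_def inner_axis matrix_vector_mult_basis column_def)

text \<open>The terms linear in \<open>a\<close> are traces that vanish by nilpotency or by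
  skew-symmetry. The squared length of \<open>D y\<close> from the \<open>f\<close> direction
  cancels \<open>S5\<close>. In terms of \<open>z\<close> and \<open>s\<close> the mixed sums cancel
  between \<open>S6\<close> and \<open>S7\<close>, and the remaining squares are half of
  \<open>momentM_quadratic\<close>.\<close>

theorem ricci_semidirect:
  assumes nl: "nilLie k \<mu>" and D: "transpose D = D" "D \<in> Der \<mu>"
  shows "ricci (semidirect_bracket \<mu> D) (\<bullet>) (a, y) (a, y) =
    - a\<^sup>2 * trace (D ** D) - trace D * ((D *v y) \<bullet> y) + (y \<bullet> (momentM \<mu> *v y)) / 2"
    and "linear (\<lambda>X. riemann (semidirect_bracket \<mu> D) (\<bullet>) X Y Y)"
proof -
  have V: "\<mu> \<in> V" and jac: "jacobi \<mu>" and nil: "nilp k \<mu>" using nl by (auto simp: nilLie_def)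
  note bl = V_D(1)[OF V]
  let ?U = "lcn \<mu>" and ?e = "\<lambda>i. axis i 1 :: real^'a"
  note Ub = lcn_bilinear[OF bl]
  have Ul: "linear (?U x)" "linear (\<lambda>x. ?U x z)" for x z using Ub by (auto simp: bilinear_def)
  have ml: "linear (\<mu> x)" "linear (\<lambda>x. \<mu> x z)" for x z using bl by (auto simp: bilinear_def)
  have Dl: "linear ((*v) D)" by simp
  have U0: "?U 0 z = 0" "?U z 0 = 0" for z using bilinear_lzero[OF Ub] bilinear_rzero[OF Ub] by auto
  have m0: "\<mu> 0 z = 0" for z using bilinear_lzero[OF bl] by auto
  note skew = lcn_props(1)[OF V] and tors = lcn_props(2)[OF V]
  note lc = levi_civita_semidirect[OF V D(1)]
  have lcb: "bilinear (lcs \<mu> D)" by (rule lcs_bilinear[OF bl])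
  have ll: "linear (lcs \<mu> D x)" "linear (\<lambda>x. lcs \<mu> D x z)" for x z using lcb unfolding bilinear_def by blast+
  have sl: "linear (\<lambda>x. semidirect_bracket \<mu> D x z)" for z
    using bilinear_semidirect[OF bl, of D] unfolding bilinear_def by blast
  show "linear (\<lambda>X. riemann (semidirect_bracket \<mu> D) (\<bullet>) X Y Y)"
    unfolding riemann_def lc
    by (intro linear_compose_sub ll(2) linear_compose[OF ll(2) ll(1), unfolded o_def] linear_compose[OF sl ll(2), unfolded o_def])
  have swap: "(\<Sum>i\<in>UNIV. P (Q (?e i)) \<bullet> ?e i) = (\<Sum>i\<in>UNIV. Q (P (?e i)) \<bullet> ?e i)"
    if "linear P" "linear Q" for P Q :: "real^'a \<Rightarrow> real^'a"
    using sum_trace_swap[OF that] by (simp add: sum_Basis_vec)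
  have neg: "\<mu> u w = - \<mu> w u" for u w by (rule V_D(3)[OF V])
  have tr_ad: "(\<Sum>i\<in>UNIV. \<mu> z (?e i) \<bullet> ?e i) = 0" for z
    using trace_ad[OF bl nil, of z] by (simp add: trace_axis ad_works[OF bl])
  have tr_Dad: "(\<Sum>i\<in>UNIV. (E *v \<mu> z (?e i)) \<bullet> ?e i) = 0" if "E \<in> Der \<mu>" for E z
    using trace_Der_ad[OF bl nil that, of z] by (simp only: trace_axis matrix_vector_mul_assoc[symmetric] ad_works[OF bl])
  \<comment> \<open>The Killing form of a nilpotent algebra vanishes; here \<open>ad y\<close> plays
    the role of the derivation in \<open>trace_Der_ad\<close>.\<close>
  have tr_adad: "(\<Sum>i\<in>UNIV. \<mu> (\<mu> (?e i) y) y \<bullet> ?e i) = 0"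
  proof -
    have "\<mu> (\<mu> (?e i) y) y = \<mu> y (\<mu> y (?e i))" for i
      by (metis neg bilinear_lneg[OF bl] minus_minus)
    then show ?thesis using tr_Dad[OF ad_Der[OF V jac, of y], of y] by (simp add: ad_works[OF bl])
  qed
  have S1: "(\<Sum>i\<in>UNIV. ?U (?e i) z \<bullet> ?e i) = 0" for z
  proof -
    have "?U (?e i) z \<bullet> ?e i = - (\<mu> z (?e i) \<bullet> ?e i)" for i
      using lcn_koszul[OF bl, of "?e i" "?e i" z] skew[of "?e i" z "?e i"] V_D(2)[OF V] neg[of "?e i" z] by simp
    then show ?thesis using tr_ad[of z] by (simp add: sum_negf)
  qed
  \<comment> \<open>\<open>?U y\<close> is skew and \<open>D\<close> symmetric, so the trace of
    their product is its own negative.\<close>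
  have S2: "(\<Sum>i\<in>UNIV. ?U y (D *v ?e i) \<bullet> ?e i) = 0"
  proof -
    have "(\<Sum>i\<in>UNIV. ?U y (D *v ?e i) \<bullet> ?e i) = (\<Sum>i\<in>UNIV. - ((D *v ?U y (?e i)) \<bullet> ?e i))"
      by (intro sum.cong refl) (simp add: skew[of y "D *v _"] sym_inner[OF D(1)])
    also have "\<dots> = - (\<Sum>i\<in>UNIV. ?U y (D *v ?e i) \<bullet> ?e i)"
      by (simp add: sum_negf swap[OF Dl Ul(1)])
    finally show ?thesis by simp
  qed
  have S3: "(\<Sum>i\<in>UNIV. ?U (D *v ?e i) y \<bullet> ?e i) = 0"
  proof -
    have "?U (D *v ?e i) y = ?U y (D *v ?e i) - \<mu> y (D *v ?e i)" for i
      using tors[of y "D *v ?e i"] by (simp add: algebra_simps)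
    then have "(\<Sum>i\<in>UNIV. ?U (D *v ?e i) y \<bullet> ?e i) = - (\<Sum>i\<in>UNIV. \<mu> y (D *v ?e i) \<bullet> ?e i)"
      by (simp add: inner_diff_left sum_subtractf S2)
    then show ?thesis using swap[OF ml(1) Dl, of y] tr_Dad[OF D(2), of y] by simp
  qed
  have S4: "(\<Sum>i\<in>UNIV. (D *v \<mu> (?e i) y) \<bullet> ?e i) = 0"
  proof -
    have "(D *v \<mu> (?e i) y) \<bullet> ?e i = - ((D *v \<mu> y (?e i)) \<bullet> ?e i)" for i
      by (subst neg) (simp add: linear_neg[OF Dl])
    then show ?thesis using tr_Dad[OF D(2), of y] by (simp add: sum_negf)
  qed
  have S5: "(\<Sum>i\<in>UNIV. ((D *v ?e i) \<bullet> y) * ((D *v y) \<bullet> ?e i)) = (D *v y) \<bullet> (D *v y)"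
  proof -
    have "(D *v ?e i) \<bullet> y = (D *v y) $ i" for i by (simp add: sym_inner[OF D(1)] inner_axis')
    then show ?thesis by (simp add: inner_axis inner_vec_def[of "D *v y"])
  qed
  define z where "z i j = \<mu> (?e i) y $ j" for i j
  define s where "s i j = \<mu> (?e i) (?e j) \<bullet> y" for i j
  have zs: "(\<Sum>i\<in>UNIV. \<mu> (?e i) (\<mu> (?e i) y) \<bullet> y) = (\<Sum>i\<in>UNIV. \<Sum>j\<in>UNIV. z i j * s i j)"
  proof (intro sum.cong refl)
    fix i
    show "\<mu> (?e i) (\<mu> (?e i) y) \<bullet> y = (\<Sum>j\<in>UNIV. z i j * s i j)"
      by (subst vec_expand[of "\<mu> (?e i) y"])
        (simp only: linear_sum[OF ml(1)] linear_scale[OF ml(1)] inner_sum_left inner_scaleR_left z_def s_def)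
  qed
  have S6: "(\<Sum>i\<in>UNIV. ?U (\<mu> (?e i) y) y \<bullet> ?e i) = ((\<Sum>i\<in>UNIV. \<Sum>j\<in>UNIV. (z i j)\<^sup>2) + (\<Sum>i\<in>UNIV. \<Sum>j\<in>UNIV. z i j * s i j)) / 2"
  proof -
    have "?U (\<mu> (?e i) y) y \<bullet> ?e i = (\<mu> (\<mu> (?e i) y) y \<bullet> ?e i + \<mu> (?e i) y \<bullet> \<mu> (?e i) y + \<mu> (?e i) (\<mu> (?e i) y) \<bullet> y) / 2" for i
      using lcn_koszul[OF bl, of "\<mu> (?e i) y" y "?e i"] neg[of y "?e i"] by simp
    then have "(\<Sum>i\<in>UNIV. ?U (\<mu> (?e i) y) y \<bullet> ?e i) = ((\<Sum>i\<in>UNIV. \<mu> (\<mu> (?e i) y) y \<bullet> ?e i)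
        + (\<Sum>i\<in>UNIV. \<mu> (?e i) y \<bullet> \<mu> (?e i) y) + (\<Sum>i\<in>UNIV. \<mu> (?e i) (\<mu> (?e i) y) \<bullet> y)) / 2"
      by (simp only: sum_divide_distrib[symmetric] sum.distrib)
    then show ?thesis
      by (simp only: tr_adad zs) (simp add: inner_vec_def z_def power2_eq_square)
  qed
  have S7: "(\<Sum>i\<in>UNIV. ?U y (?U (?e i) y) \<bullet> ?e i) = - ((\<Sum>i\<in>UNIV. \<Sum>j\<in>UNIV. (s i j)\<^sup>2) / 4 + (\<Sum>i\<in>UNIV. \<Sum>j\<in>UNIV. z i j * s i j) / 2)"
  proof -
    have p: "?U (?e i) y $ j = (z i j + z j i - s i j) / 2" for i j
    proof -
      have "2 * (?U (?e i) y \<bullet> ?e j) = \<mu> (?e i) y \<bullet> ?e j - \<mu> y (?e j) \<bullet> ?e i + \<mu> (?e j) (?e i) \<bullet> y"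
        by (rule lcn_koszul[OF bl])
      also have "\<mu> y (?e j) \<bullet> ?e i = - z j i" by (subst neg) (simp add: z_def inner_axis)
      also have "\<mu> (?e j) (?e i) \<bullet> y = - s i j" by (subst neg) (simp add: s_def)
      finally show ?thesis by (simp add: z_def inner_axis)
    qed
    have "?U y (?U (?e i) y) \<bullet> ?e i = (\<Sum>j\<in>UNIV. - (((z j i)\<^sup>2 - (z i j)\<^sup>2 - 2 * (z j i * s i j) + (s i j)\<^sup>2) / 4))" for i
    proof -
      have q0: "?U y (?e i) = ?U (?e i) y - \<mu> (?e i) y" using tors[of "?e i" y] by (simp add: algebra_simps)
      have "?U y (?e i) $ j = (z i j + z j i - s i j) / 2 - z i j" for j
        unfolding q0 vector_minus_component p by (simp add: z_def)
      then have q: "?U y (?e i) $ j = (z j i - z i j - s i j) / 2" for j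
        by (simp add: field_simps)
      have "?U y (?U (?e i) y) \<bullet> ?e i = - (?U y (?e i) \<bullet> ?U (?e i) y)" by (rule skew)
      also have "\<dots> = (\<Sum>j\<in>UNIV. - (((z j i - z i j - s i j) / 2) * ((z i j + z j i - s i j) / 2)))"
        by (simp add: inner_vec_def p q sum_negf)
      also have "\<dots> = (\<Sum>j\<in>UNIV. - (((z j i)\<^sup>2 - (z i j)\<^sup>2 - 2 * (z j i * s i j) + (s i j)\<^sup>2) / 4))"
        by (intro sum.cong refl) (simp add: field_simps power2_eq_square)
      finally show ?thesis .
    qed
    then have f1: "(\<Sum>i\<in>UNIV. ?U y (?U (?e i) y) \<bullet> ?e i) =
        - (((\<Sum>i\<in>UNIV. \<Sum>j\<in>UNIV. (z j i)\<^sup>2) - (\<Sum>i\<in>UNIV. \<Sum>j\<in>UNIV. (z i j)\<^sup>2)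
          - 2 * (\<Sum>i\<in>UNIV. \<Sum>j\<in>UNIV. z j i * s i j) + (\<Sum>i\<in>UNIV. \<Sum>j\<in>UNIV. (s i j)\<^sup>2)) / 4)"
      by (simp only: sum_negf sum_divide_distrib[symmetric] sum.distrib sum_subtractf sum_distrib_left[symmetric])
    have f2: "(\<Sum>i\<in>UNIV. \<Sum>j\<in>UNIV. (z j i)\<^sup>2) = (\<Sum>i\<in>UNIV. \<Sum>j\<in>UNIV. (z i j)\<^sup>2)" by (rule sum.swap)
    have f3: "(\<Sum>i\<in>UNIV. \<Sum>j\<in>UNIV. z j i * s i j) = - (\<Sum>i\<in>UNIV. \<Sum>j\<in>UNIV. z i j * s i j)"
    proof -
      have "s i j = - s j i" for i j unfolding s_def by (subst neg) simp
      then have "z j i * s i j = - (z j i * s j i)" for i j by (metis mult_minus_right)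
      then have "(\<Sum>i\<in>UNIV. \<Sum>j\<in>UNIV. z j i * s i j) = - (\<Sum>i\<in>UNIV. \<Sum>j\<in>UNIV. z j i * s j i)" by (simp only: sum_negf)
      also have "(\<Sum>i\<in>UNIV. \<Sum>j\<in>UNIV. z j i * s j i) = (\<Sum>i\<in>UNIV. \<Sum>j\<in>UNIV. z i j * s i j)" by (rule sum.swap)
      finally show ?thesis .
    qed
    have "- ((A - B - 2 * C + S) / 4) = - (S / 4 + E / 2)" if "A = B" "C = - E" for A B C S E :: real
      using that by (simp add: field_simps)
    from trans[OF f1 this[OF f2 f3]] show ?thesis .
  qed
  have quad: "y \<bullet> (momentM \<mu> *v y) = (\<Sum>i\<in>UNIV. \<Sum>j\<in>UNIV. (s i j)\<^sup>2) / 2 - (\<Sum>i\<in>UNIV. \<Sum>j\<in>UNIV. (z i j)\<^sup>2)"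
    unfolding momentM_quadratic[OF V] by (simp add: s_def z_def inner_vec_def power2_eq_square)
  let ?Y = "(a, y)" and ?b = "semidirect_bracket \<mu> D"
  let ?z = "?U y y - a *\<^sub>R (D *v y)"
  have YY: "lcs \<mu> D ?Y ?Y = ((D *v y) \<bullet> y, ?z)" by (simp add: lcs_def)
  have f: "riemann ?b (\<bullet>) (1, 0) ?Y ?Y \<bullet> (1, 0) = - ((D *v y) \<bullet> (D *v y))"
    unfolding riemann_def lc
    by (simp add: lcs_def semidirect_bracket_def U0 m0 sym_inner[OF D(1)])
  have e: "riemann ?b (\<bullet>) (0, ?e i) ?Y ?Y \<bullet> (0, ?e i) =
      ?U (?e i) ?z \<bullet> ?e i - ((D *v y) \<bullet> y) * ((D *v ?e i) \<bullet> ?e i)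
      - ?U y (?U (?e i) y) \<bullet> ?e i + a * (?U y (D *v ?e i) \<bullet> ?e i) + ((D *v ?e i) \<bullet> y) * ((D *v y) \<bullet> ?e i)
      + a * (?U (D *v ?e i) y \<bullet> ?e i) - ?U (\<mu> (?e i) y) y \<bullet> ?e i
      - a\<^sup>2 * ((D *v (D *v ?e i)) \<bullet> ?e i) + a * ((D *v \<mu> (?e i) y) \<bullet> ?e i)" for i
  proof -
    have 1: "lcs \<mu> D (0, ?e i) ?Y = ((D *v ?e i) \<bullet> y, ?U (?e i) y - a *\<^sub>R (D *v ?e i))" by (simp add: lcs_def)
    have 2: "?b (0, ?e i) ?Y = (0, \<mu> (?e i) y - a *\<^sub>R (D *v ?e i))" by (simp add: semidirect_bracket_def)
    have 3: "?U y (?U (?e i) y - a *\<^sub>R (D *v ?e i)) = ?U y (?U (?e i) y) - a *\<^sub>R ?U y (D *v ?e i)"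
      by (simp only: linear_diff[OF Ul(1)] linear_scale[OF Ul(1)])
    have 4: "?U (\<mu> (?e i) y - a *\<^sub>R (D *v ?e i)) y = ?U (\<mu> (?e i) y) y - a *\<^sub>R ?U (D *v ?e i) y"
      by (simp only: linear_diff[OF Ul(2)] linear_scale[OF Ul(2)])
    have 5: "D *v (\<mu> (?e i) y - a *\<^sub>R (D *v ?e i)) = D *v \<mu> (?e i) y - a *\<^sub>R (D *v (D *v ?e i))"
      by (simp only: linear_diff[OF Dl] linear_scale[OF Dl])
    show ?thesis
      unfolding riemann_def lc YY 1 2 unfolding lcs_def fst_conv snd_conv 3 4 5
      by (simp only: inner_Pair fst_diff snd_diff inner_diff_left inner_scaleR_left fst_conv snd_conv inner_zero_right
          inner_add_left diff_Pair) (simp add: power2_eq_square algebra_simps)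
  qed
  have "ricci ?b (\<bullet>) ?Y ?Y = riemann ?b (\<bullet>) (1, 0) ?Y ?Y \<bullet> (1, 0) + (\<Sum>i\<in>UNIV. riemann ?b (\<bullet>) (0, ?e i) ?Y ?Y \<bullet> (0, ?e i))"
    unfolding ricci_def sum_Basis_real_vec ..
  also have "(\<Sum>i\<in>UNIV. riemann ?b (\<bullet>) (0, ?e i) ?Y ?Y \<bullet> (0, ?e i)) =
      (\<Sum>i\<in>UNIV. ?U (?e i) ?z \<bullet> ?e i) - ((D *v y) \<bullet> y) * (\<Sum>i\<in>UNIV. (D *v ?e i) \<bullet> ?e i)
      - (\<Sum>i\<in>UNIV. ?U y (?U (?e i) y) \<bullet> ?e i) + a * (\<Sum>i\<in>UNIV. ?U y (D *v ?e i) \<bullet> ?e i)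
      + (\<Sum>i\<in>UNIV. ((D *v ?e i) \<bullet> y) * ((D *v y) \<bullet> ?e i))
      + a * (\<Sum>i\<in>UNIV. ?U (D *v ?e i) y \<bullet> ?e i) - (\<Sum>i\<in>UNIV. ?U (\<mu> (?e i) y) y \<bullet> ?e i)
      - a\<^sup>2 * (\<Sum>i\<in>UNIV. (D *v (D *v ?e i)) \<bullet> ?e i) + a * (\<Sum>i\<in>UNIV. (D *v \<mu> (?e i) y) \<bullet> ?e i)"
    unfolding e by (simp only: sum.distrib sum_subtractf sum_distrib_left)
  also have "(\<Sum>i\<in>UNIV. (D *v (D *v ?e i)) \<bullet> ?e i) = trace (D ** D)"
    by (simp only: trace_axis matrix_vector_mul_assoc)
  also have "(\<Sum>i\<in>UNIV. (D *v ?e i) \<bullet> ?e i) = trace D" by (simp only: trace_axis)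
  finally show "ricci ?b (\<bullet>) ?Y ?Y = - a\<^sup>2 * trace (D ** D) - trace D * ((D *v y) \<bullet> y) + (y \<bullet> (momentM \<mu> *v y)) / 2"
    unfolding f S1 S2 S3 S4 S5 S6 S7 quad by (simp add: algebra_simps add_divide_distrib diff_divide_distrib)
qed

subsection \<open>Strongly Ricci negative derivations\<close>

lemma Der_conj:
  assumes "D \<in> Der b" "invertible h"
  shows "h ** D ** matrix_inv h \<in> Der (GL_act h b)"
proof -
  have inv: "matrix_inv h *v (h *v x) = x" for x
    by (simp add: matrix_vector_mul_assoc matrix_inv assms(2))
  have "D *v b x y = b (D *v x) y + b x (D *v y)" for x y using assms(1) by (auto simp: Der_def)
  then show ?thesis
    by (simp add: Der_def GL_act_def matrix_vector_mul_assoc[symmetric] inv matrix_vector_right_distrib)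
qed

lemma Der_scale: "bilinear b \<Longrightarrow> D \<in> Der b \<Longrightarrow> r *\<^sub>R D \<in> Der b"
  by (simp add: Der_def scaleR_matrix_vector_assoc[symmetric] bilinear_lmul bilinear_rmul scaleR_add_right)

lemma trace_conj: "invertible h \<Longrightarrow> trace (h ** D ** matrix_inv h) = trace D" for h D :: "real^'n^'n"
  by (metis matrix_inv(2) matrix_mul_assoc matrix_mul_lid trace_mul_sym)

lemma trace_scale: "trace (r *\<^sub>R A) = r * trace A" for A :: "real^'n^'n"
  by (simp add: trace_def sum_distrib_left)

text \<open>The map \<open>T (a, x) = (\<gamma> a, h x)\<close> carries \<open>g\<close> to the
  standard inner product and the algebra to the extension of \<open>GL_act h b\<close> by
  \<open>D1 / \<gamma>\<close>. The factors of \<open>\<gamma>\<close> cancel in the first term and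
  accumulate in the second.\<close>

lemma ricci_extension:
  assumes nl: "nilLie k b" and D: "D \<in> Der b" and h: "invertible h" and \<gamma>: "\<gamma> > 0"
    and sym: "transpose (h ** D ** matrix_inv h) = h ** D ** matrix_inv h"
    and g: "inner_product_on_space g" and gf: "\<And>a x c y. g (a, x) (c, y) = \<gamma>\<^sup>2 * a * c + (h *v x) \<bullet> (h *v y)"
  defines "D1 \<equiv> h ** D ** matrix_inv h"
  shows "ricci (semidirect_bracket b D) g (a, x) (a, x) = - a\<^sup>2 * trace (D1 ** D1)
    - trace D / \<gamma>\<^sup>2 * ((D1 *v (h *v x)) \<bullet> (h *v x)) + ((h *v x) \<bullet> (momentM (GL_act h b) *v (h *v x))) / 2"
proof -
  have b: "b \<in> V" using nl by (simp add: nilLie_def)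
  define D' where "D' = (1 / \<gamma>) *\<^sub>R D1"
  define T where "T X = (\<gamma> * fst X, h *v snd X)" for X :: "real \<times> (real^'a)"
  define T' where "T' X = (fst X / \<gamma>, matrix_inv h *v snd X)" for X :: "real \<times> (real^'a)"
  let ?\<mu> = "GL_act h b"
  have nl\<mu>: "nilLie k ?\<mu>" by (rule nilLie_GL_act[OF nl h])
  have \<mu>: "bilinear ?\<mu>" using nl\<mu> V_D(1) by (auto simp: nilLie_def)
  have symD: "transpose D' = D'" using sym by (simp add: D'_def D1_def transpose_scalar)
  have DerD: "D' \<in> Der ?\<mu>" unfolding D'_def D1_def by (intro Der_scale \<mu> Der_conj D h)
  have inv: "matrix_inv h *v (h *v x) = x" "h *v (matrix_inv h *v x) = x" for x
    by (simp_all add: matrix_vector_mul_assoc matrix_inv h)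
  have D'h: "\<gamma> *\<^sub>R (D' *v (h *v x)) = h *v (D *v x)" for x
    using \<gamma> by (simp add: D'_def D1_def scaleR_matrix_vector_assoc[symmetric] matrix_vector_mul_assoc[symmetric] inv)
  note R = ricci_semidirect[OF nl\<mu> symD DerD]
  have "ricci (semidirect_bracket b D) g (a, x) (a, x) = ricci (semidirect_bracket ?\<mu> D') (\<bullet>) (T (a, x)) (T (a, x))"
  proof (rule ricci_transport[where T' = T'])
    show "bilinear (semidirect_bracket b D)" "bilinear (semidirect_bracket ?\<mu> D')"
      using bilinear_semidirect V_D(1)[OF b] \<mu> by blast+
    show "linear T" "linear T'" unfolding T_def T'_def
      by (auto intro!: linearI simp: matrix_vector_right_distrib matrix_vector_mult_scaleR distrib_left add_divide_distrib)
    show "T (T' X) = X" "T' (T X) = X" for X using \<gamma> by (simp_all add: T_def T'_def inv)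
    show "g X Y = T X \<bullet> T Y" for X Y
      using gf[of "fst X" "snd X" "fst Y" "snd Y"] by (simp add: T_def inner_prod_def power2_eq_square mult_ac)
    show "semidirect_bracket ?\<mu> D' (T X) (T Y) = T (semidirect_bracket b D X Y)" for X Y
    proof -
      have "(\<gamma> * u) *\<^sub>R (D' *v (h *v x)) = u *\<^sub>R (h *v (D *v x))" for u x
        using D'h[of x] by (metis mult.commute scaleR_scaleR)
      then show ?thesis
        by (simp add: semidirect_bracket_def T_def GL_act_def inv split_beta matrix_vector_right_distrib
            matrix_vector_mult_diff_distrib matrix_vector_mult_scaleR)
    qed
  qed (use g R(2) in auto)
  also have "\<dots> = - (\<gamma> * a)\<^sup>2 * trace (D' ** D') - trace D' * ((D' *v (h *v x)) \<bullet> (h *v x))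
      + ((h *v x) \<bullet> (momentM ?\<mu> *v (h *v x))) / 2"
    unfolding T_def fst_conv snd_conv by (rule R(1))
  also have "trace (D' ** D') = trace (D1 ** D1) / \<gamma>\<^sup>2"
    by (simp add: D'_def scalar_matrix_assoc[symmetric] matrix_scalar_ac trace_scale power2_eq_square)
  also have "trace D' = trace D / \<gamma>" by (simp add: D'_def D1_def trace_scale trace_conj[OF h])
  also have "(D' *v (h *v x)) \<bullet> (h *v x) = ((D1 *v (h *v x)) \<bullet> (h *v x)) / \<gamma>"
    by (simp add: D'_def scaleR_matrix_vector_assoc[symmetric])
  finally show ?thesis using \<gamma> by (simp add: power2_eq_square field_simps)
qed

text \<open>The formula has no mixed term in \<open>a\<close> and \<open>x\<close>. Along
  \<open>f\<close> it is always negative, since a symmetric operator of nonzero trace has a square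
  of positive trace; on the nilpotent factor it is a negative multiple of the displayed operator,
  evaluated at \<open>h x\<close>.\<close>

lemma ricci_negative_extension:
  assumes nl: "nilLie k b" and D: "D \<in> Der b" "trace D > 0" and h: "invertible h" and \<gamma>: "\<gamma> > 0"
    and sym: "transpose (h ** D ** matrix_inv h) = h ** D ** matrix_inv h"
    and g: "inner_product_on_space g" and gf: "\<And>a x c y. g (a, x) (c, y) = \<gamma>\<^sup>2 * a * c + (h *v x) \<bullet> (h *v y)"
  shows "ricci_negative (semidirect_bracket b D) g \<longleftrightarrow>
    posdef (h ** D ** matrix_inv h - (\<gamma>\<^sup>2 / (2 * trace D)) *\<^sub>R momentM (GL_act h b))"
proof -
  let ?D = "h ** D ** matrix_inv h" and ?M = "momentM (GL_act h b)" and ?r = "\<gamma>\<^sup>2 / (2 * trace D)"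
  note R = ricci_extension[OF nl D(1) h \<gamma> sym g gf]
  have q: "- (trace D / \<gamma>\<^sup>2 * ((?D *v u) \<bullet> u)) + (u \<bullet> (?M *v u)) / 2
      = - (trace D / \<gamma>\<^sup>2) * (u \<bullet> ((?D - ?r *\<^sub>R ?M) *v u))" for u
    using \<gamma> D(2)
    by (simp add: matrix_vector_mult_diff_rdistrib scaleR_matrix_vector_assoc[symmetric] inner_diff_right
        inner_commute[of u "?D *v u"] right_diff_distrib)
  have c: "trace D / \<gamma>\<^sup>2 > 0" using D(2) \<gamma> by simp
  have R': "ricci (semidirect_bracket b D) g (a, x) (a, x) = - a\<^sup>2 * trace (?D ** ?D)
    - (trace D / \<gamma>\<^sup>2) * ((h *v x) \<bullet> ((?D - ?r *\<^sub>R ?M) *v (h *v x)))" for a x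
    unfolding R using q[of "h *v x"] by simp
  have tr: "trace (?D ** ?D) > 0"
  proof -
    have "trace (?D ** ?D) = ?D \<bullet> ?D" using trace_inner[of ?D ?D] sym by simp
    moreover have "?D \<noteq> 0"
    proof
      assume "?D = 0"
      then have "trace D = 0" using trace_conj[OF h, of D] by (simp add: trace_def)
      then show False using D(2) by simp
    qed
    ultimately show ?thesis by simp
  qed
  have symP: "transpose (?D - ?r *\<^sub>R ?M) = ?D - ?r *\<^sub>R ?M"
    using sym by (simp add: transpose_add_diff transpose_scalar momentM_sym)
  show ?thesis
  proof
    assume neg: "ricci_negative (semidirect_bracket b D) g"
    have "u \<bullet> ((?D - ?r *\<^sub>R ?M) *v u) > 0" if u: "u \<noteq> 0" for u
    proof -
      define x where "x = matrix_inv h *v u"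
      have hx: "h *v x = u" by (simp add: x_def matrix_vector_mul_assoc matrix_inv h)
      then have "x \<noteq> 0" using u by auto
      then have "ricci (semidirect_bracket b D) g (0, x) (0, x) < 0" using neg unfolding ricci_negative_def by (auto simp: zero_prod_def simp del: split_paired_All)
      moreover have "- 0\<^sup>2 * T - q < 0 \<Longrightarrow> q > 0" for T q :: real by simp
      ultimately have "(trace D / \<gamma>\<^sup>2) * (u \<bullet> ((?D - ?r *\<^sub>R ?M) *v u)) > 0" unfolding R' hx by blast
      then show ?thesis using c by (rule zero_less_mult_pos)
    qed
    then show "posdef (?D - ?r *\<^sub>R ?M)" using symP by (simp add: posdef_def)
  next
    assume pd: "posdef (?D - ?r *\<^sub>R ?M)"
    show "ricci_negative (semidirect_bracket b D) g"
      unfolding ricci_negative_def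
    proof (intro allI impI)
      fix X :: "real \<times> (real^'a)" assume X: "X \<noteq> 0"
      obtain a x where aX: "X = (a, x)" by (metis surj_pair)
      let ?P = "(h *v x) \<bullet> ((?D - ?r *\<^sub>R ?M) *v (h *v x))"
      have hx: "h *v x = 0 \<Longrightarrow> x = 0"
        using matrix_inv(2)[OF h] by (metis matrix_vector_mul_assoc matrix_vector_mul_lid matrix_vector_mult_0_right)
      have a0: "a\<^sup>2 * trace (?D ** ?D) \<ge> 0" using tr by simp
      show "ricci (semidirect_bracket b D) g X X < 0"
      proof (cases "x = 0")
        case True
        then have "a \<noteq> 0" using X aX by (simp add: zero_prod_def)
        then have "a\<^sup>2 * trace (?D ** ?D) > 0" using tr by simp
        then show ?thesis unfolding aX R' using True by simp
      next
        case False
        then have "?P > 0" using pd hx by (auto simp: posdef_def)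
        then have "(trace D / \<gamma>\<^sup>2) * ?P > 0" using c by (rule mult_pos_pos[rotated])
        then show ?thesis unfolding aX R' using a0 by simp
      qed
    qed
  qed
qed

text \<open>Diagonalization with the empty torus followed by square roots of the
  eigenvalues.\<close>

lemma gram_factor:
  fixes G :: "real^'n^'n"
  assumes "posdef G"
  obtains h :: "real^'n^'n" where "invertible h" "\<And>x y. x \<bullet> (G *v y) = (h *v x) \<bullet> (h *v y)"
proof -
  have "transpose G = G" using assms by (simp add: posdef_def)
  then obtain k where k: "k \<in> K_torus {}" "k ** G ** transpose k \<in> Dg"
    using diagonalization[of G "{}"] by (auto simp: commutes_def)
  note kD = K_torusD[OF k(1)]
  define c where "c = (\<chi> i. (k ** G ** transpose k) $ i $ i)"
  have kG: "k ** G ** transpose k = diag c" unfolding c_def by (rule Dg_eq_diag[OF k(2)])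
  have c0: "c $ i > 0" for i
    unfolding c_def using posdef_nth[OF posdef_conj[OF assms kD(3)]] by simp
  define a where "a = (\<chi> i. sqrt (c $ i))"
  have aa: "diag a ** diag a = diag c" using c0 by (simp add: diag_mult a_def vec_eq_iff diag_nth less_imp_le)
  define h where "h = diag a ** k"
  have ia: "invertible (diag a)" using c0 by (intro invertible_diag(1)) (simp add: a_def less_imp_neq[THEN not_sym])
  have "transpose h ** h = transpose k ** (diag a ** diag a) ** k"
    by (simp add: h_def matrix_transpose_mul transpose_diag matrix_mul_assoc)
  also have "\<dots> = (transpose k ** k) ** G ** (transpose k ** k)"
    unfolding aa kG[symmetric] by (simp only: matrix_mul_assoc)
  finally have hh: "transpose h ** h = G" by (simp add: kD(6))
  have "x \<bullet> (G *v y) = (h *v x) \<bullet> (h *v y)" for x y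
  proof -
    have "x \<bullet> (G *v y) = x \<bullet> (transpose h *v (h *v y))" by (simp only: hh[symmetric] matrix_vector_mul_assoc)
    also have "\<dots> = (h *v x) \<bullet> (h *v y)" by (metis dot_lmul_matrix inner_commute transpose_matrix_vector)
    finally show ?thesis .
  qed
  then show ?thesis using that[of h] ia kD(3) by (simp add: h_def invertible_mult)
qed

text \<open>An inner product with \<open>f\<close> orthogonal to the nilpotent factor is given by
  the length \<open>\<gamma>\<close> of \<open>f\<close> and a Gram factor \<open>h\<close>.
  Symmetry of \<open>D\<close> for it means that the conjugate of \<open>D\<close> by
  \<open>h\<close> is symmetric, and \<open>\<gamma>\<close> enters only through
  \<open>s\<close>.\<close>

lemma Der_srn_iff:
  fixes D :: "real^'n^'n"
  assumes nl: "nilLie k b" and D: "D \<in> Der b" "trace D > 0"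
  shows "D \<in> Der_srn b \<longleftrightarrow> (\<exists>(h::real^'n^'n) s. invertible h \<and> s > 0 \<and>
    transpose (h ** D ** matrix_inv h) = h ** D ** matrix_inv h \<and>
    posdef (h ** D ** matrix_inv h - s *\<^sub>R momentM (GL_act h b)))"
proof
  assume "D \<in> Der_srn b"
  then obtain g where g: "inner_product_on_space g" "\<And>x. g (1, 0) (0, x) = 0"
    "\<And>x y. g (0, D *v x) (0, y) = g (0, x) (0, D *v y)" "ricci_negative (semidirect_bracket b D) g"
    by (auto simp: Der_srn_def)
  have gb: "bilinear g" and gs: "\<And>x y. g x y = g y x" and gp: "\<And>x. x \<noteq> 0 \<Longrightarrow> g x x > 0"
    using g(1) by (auto simp: inner_product_on_space_def)
  have B: "bilinear (\<lambda>x y. g (0, x) (0, y))"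
  proof -
    have l: "linear (\<lambda>x. (0::real, x::real^'n))" by (intro linearI) auto
    show ?thesis
      using linear_compose[OF l, unfolded o_def] gb unfolding bilinear_def by blast
  qed
  define G where "G = (\<chi> i j. g (0, axis i 1) (0, axis j 1))"
  have G: "g (0, x) (0, y) = x \<bullet> (G *v y)" for x y
  proof -
    have "g (0, x) (0, y) = (\<Sum>i\<in>UNIV. \<Sum>j\<in>UNIV. x $ i * y $ j * G $ i $ j)"
      using bilinear_expand[OF B, of x y] by (simp add: G_def)
    also have "\<dots> = x \<bullet> (G *v y)"
      by (simp add: inner_vec_def matrix_vector_mult_def sum_distrib_left mult_ac)
    finally show ?thesis .
  qed
  have "posdef G"
    unfolding posdef_def
  proof (intro conjI allI impI)
    show "transpose G = G" by (simp add: transpose_def G_def vec_eq_iff gs)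
    show "x \<bullet> (G *v x) > 0" if "x \<noteq> 0" for x using gp[of "(0, x)"] that by (simp add: G zero_prod_def)
  qed
  then obtain h :: "real^'n^'n" where h: "invertible h" "\<And>x y. x \<bullet> (G *v y) = (h *v x) \<bullet> (h *v y)" using gram_factor by blast
  define \<gamma> where "\<gamma> = sqrt (g (1, 0) (1, 0))"
  have g1: "g (1, 0) (1, 0) > 0" by (rule gp) (simp add: zero_prod_def)
  have \<gamma>: "\<gamma> > 0" "\<gamma>\<^sup>2 = g (1, 0) (1, 0)" using g1 by (simp_all add: \<gamma>_def)
  have gf: "g (a, x) (c, y) = \<gamma>\<^sup>2 * a * c + (h *v x) \<bullet> (h *v y)" for a x c y
  proof -
    have "(a, x) = a *\<^sub>R (1, 0) + (0, x)" "(c, y) = c *\<^sub>R (1, 0) + (0, y)" by simp_all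
    then have "g (a, x) (c, y) = a * (c * g (1,0) (1,0)) + a * g (1,0) (0,y) + (c * g (0,x) (1,0) + g (0,x) (0,y))"
      by (simp only: bilinear_ladd[OF gb] bilinear_radd[OF gb] bilinear_lmul[OF gb] bilinear_rmul[OF gb])
        (simp add: distrib_left)
    then show ?thesis using g(2) gs[of "(0, x)" "(1, 0)"] by (simp add: G h(2) \<gamma>(2) mult_ac)
  qed
  have sym: "transpose (h ** D ** matrix_inv h) = h ** D ** matrix_inv h"
  proof -
    let ?D = "h ** D ** matrix_inv h"
    have "(?D *v u) \<bullet> w = u \<bullet> (?D *v w)" for u w
    proof -
      have iv: "h *v (matrix_inv h *v u) = u" for u by (simp add: matrix_vector_mul_assoc matrix_inv(1)[OF h(1)])
      have "g (0, D *v (matrix_inv h *v u)) (0, matrix_inv h *v w) = g (0, matrix_inv h *v u) (0, D *v (matrix_inv h *v w))"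
        by (rule g(3))
      then show ?thesis by (simp add: G h(2) iv matrix_vector_mul_assoc[symmetric])
    qed
    then have "transpose ?D *v w = ?D *v w" for w
      by (metis dot_lmul_matrix inner_commute transpose_matrix_vector vector_eq_rdot)
    then show ?thesis by (subst matrix_eq) blast
  qed
  have "posdef (h ** D ** matrix_inv h - (\<gamma>\<^sup>2 / (2 * trace D)) *\<^sub>R momentM (GL_act h b))"
    using g(4) ricci_negative_extension[OF nl D h(1) \<gamma>(1) sym g(1) gf] by blast
  then show "\<exists>(h::real^'n^'n) s. invertible h \<and> s > 0 \<and> transpose (h ** D ** matrix_inv h) = h ** D ** matrix_inv h \<and>
    posdef (h ** D ** matrix_inv h - s *\<^sub>R momentM (GL_act h b))"
    using h(1) sym \<gamma>(1) D(2) by (intro exI[of _ h] exI[of _ "\<gamma>\<^sup>2 / (2 * trace D)"]) auto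
next
  assume "\<exists>(h::real^'n^'n) s. invertible h \<and> s > 0 \<and> transpose (h ** D ** matrix_inv h) = h ** D ** matrix_inv h \<and>
    posdef (h ** D ** matrix_inv h - s *\<^sub>R momentM (GL_act h b))"
  then obtain h :: "real^'n^'n" and s where h: "invertible h" and s: "s > 0" and sym: "transpose (h ** D ** matrix_inv h) = h ** D ** matrix_inv h"
    and pd: "posdef (h ** D ** matrix_inv h - s *\<^sub>R momentM (GL_act h b))" by blast
  \<comment> \<open>The length of \<open>f\<close> is free and is chosen to make the coefficient of
    the moment map equal to \<open>s\<close>.\<close>
  define \<gamma> where "\<gamma> = sqrt (2 * trace D * s)"
  have \<gamma>: "\<gamma> > 0" "\<gamma>\<^sup>2 / (2 * trace D) = s" using D(2) s by (simp_all add: \<gamma>_def)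
  define g where "g X Y = \<gamma>\<^sup>2 * fst X * fst Y + (h *v snd X) \<bullet> (h *v snd Y)" for X Y :: "real \<times> (real^'n)"
  have gf: "g (a, x) (c, y) = \<gamma>\<^sup>2 * a * c + (h *v x) \<bullet> (h *v y)" for a x c y by (simp add: g_def)
  have "inner_product_on_space g"
    unfolding inner_product_on_space_def
  proof (intro conjI allI impI)
    show "bilinear g" unfolding bilinear_def g_def
      by (auto intro!: linearI simp: matrix_vector_right_distrib matrix_vector_mult_scaleR inner_add_left inner_add_right algebra_simps)
    show "g X Y = g Y X" for X Y by (simp add: g_def inner_commute mult_ac)
    fix X :: "real \<times> (real^'n)" assume X: "X \<noteq> 0"
    obtain a x where aX: "X = (a, x)" by (metis surj_pair)
    have hx: "h *v x = 0 \<Longrightarrow> x = 0"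
      using matrix_inv(2)[OF h] by (metis matrix_vector_mul_assoc matrix_vector_mul_lid matrix_vector_mult_0_right)
    have e: "g X X = (\<gamma> * a)\<^sup>2 + (h *v x) \<bullet> (h *v x)" by (simp add: aX g_def power2_eq_square mult_ac)
    show "g X X > 0"
    proof (cases "x = 0")
      case True
      then have "a \<noteq> 0" using X aX by (simp add: zero_prod_def)
      then show ?thesis unfolding e using \<gamma>(1) True by simp
    next
      case False
      then have "(h *v x) \<bullet> (h *v x) > 0" using hx by auto
      then show ?thesis unfolding e by (simp add: add_nonneg_pos)
    qed
  qed
  moreover from this have "ricci_negative (semidirect_bracket b D) g"
    using ricci_negative_extension[OF nl D h \<gamma>(1) sym _ gf] pd \<gamma>(2) by auto
  moreover have "g (0, D *v x) (0, y) = g (0, x) (0, D *v y)" for x y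
  proof -
    let ?D = "h ** D ** matrix_inv h"
    have iv: "h *v (D *v x) = ?D *v (h *v x)" for x
    proof -
      have "?D *v (h *v x) = h *v (D *v ((matrix_inv h ** h) *v x))" by (simp only: matrix_vector_mul_assoc matrix_mul_assoc)
      then show ?thesis by (simp add: matrix_inv h)
    qed
    show ?thesis by (simp add: gf iv sym_inner[OF sym])
  qed
  ultimately show "D \<in> Der_srn b" using D gf by (auto simp: Der_srn_def intro!: exI[of _ g])
qed

subsection \<open>Slices of constant trace\<close>

lemma pairing_inner: "pairing D v = diag v \<bullet> D"
proof -
  have "(if i = j then v $ i else 0) * D $ i $ j = (if i = j then v $ i * D $ i $ i else 0)" for i j by simp
  then show ?thesis by (simp add: pairing_def inner_vec_def diag_nth mult.commute[of "D $ _ $ _" "v $ _"])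
qed

lemma trace_mat_inner: "trace D = mat 1 \<bullet> D"
  by (simp add: trace_def inner_vec_def mat_def if_distrib[of "\<lambda>x. x * _"] cong: if_cong)

text \<open>\<open>P\<close> is the slice with weak inequalities. A point \<open>z\<close>
  satisfying all of them strictly shows that none degenerates to an equation on \<open>P\<close>, so
  the strict slice is the relative interior. If there is no such point, the empty polytope
  serves.\<close>

lemma slice_polytope:
  fixes t :: "(real^'n^'n) set"
  assumes t: "subspace t" and F: "finite F"
    and zero: "\<And>D. D \<in> t \<Longrightarrow> trace D = 0 \<Longrightarrow> \<forall>v\<in>F. pairing D v \<le> 0 \<Longrightarrow> D = 0"
  shows "\<exists>P. polytope P \<and> {D \<in> t. trace D = c \<and> (\<forall>v\<in>F. pairing D v < 0)} = rel_interior P"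
proof (cases "{D \<in> t. trace D = c \<and> (\<forall>v\<in>F. pairing D v < 0)} = {}")
  case True
  then show ?thesis by (metis polytope_empty rel_interior_empty)
next
  case False
  then obtain z where z: "z \<in> t" "trace z = c" "\<forall>v\<in>F. pairing z v < 0" by blast
  define P where "P = {D \<in> t. trace D = c \<and> (\<forall>v\<in>F. pairing D v \<le> 0)}"
  have P_eq: "P = t \<inter> {D. mat 1 \<bullet> D = c} \<inter> (\<Inter>v\<in>F. {D. diag v \<bullet> D \<le> 0})"
    by (auto simp: P_def trace_mat_inner pairing_inner)
  have poly: "polyhedron P"
    unfolding P_eq
    using F by (intro polyhedron_Int polyhedron_Inter polyhedron_hyperplane affine_imp_polyhedron[OF subspace_imp_affine[OF t]])
      (auto intro: polyhedron_halfspace_le)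
  have zP: "z \<in> P" using z by (auto simp: P_def intro: less_imp_le)
  have "bounded P"
  proof -
    let ?S = "t \<inter> sphere 0 1 \<inter> (\<Inter>v\<in>F. {D. diag v \<bullet> D \<le> 0})"
    have "closed (t \<inter> (\<Inter>v\<in>F. {D. diag v \<bullet> D \<le> 0}))"
      by (intro closed_Int closed_INT ballI closed_halfspace_le closed_subspace t)
    then have cS: "compact ?S"
      using compact_Int_closed[OF compact_sphere, of "t \<inter> (\<Inter>v\<in>F. {D. diag v \<bullet> D \<le> 0})" 0 1]
      by (simp add: Int_ac)
    \<comment> \<open>By \<open>zero\<close> the trace does not vanish on this compact set of unit
      directions; its least absolute value \<open>m\<close> bounds the norm on \<open>P\<close> by
      \<open>\<bar>c\<bar> / m\<close>.\<close>
    have "\<exists>m>0. \<forall>D\<in>?S. m \<le> \<bar>trace D\<bar>"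
    proof (cases "?S = {}")
      case True
      then show ?thesis by (intro exI[of _ 1]) auto
    next
      case False
      have "continuous_on ?S (\<lambda>D. \<bar>trace D\<bar>)" unfolding trace_mat_inner by (intro continuous_intros)
      then obtain D0 where D0: "D0 \<in> ?S" "\<And>D. D \<in> ?S \<Longrightarrow> \<bar>trace D0\<bar> \<le> \<bar>trace D\<bar>"
        using continuous_attains_inf[OF cS False] by (metis (no_types))
      have "trace D0 \<noteq> 0" using zero[of D0] D0(1) by (fastforce simp: pairing_inner)
      then show ?thesis using D0(2) by (intro exI[of _ "\<bar>trace D0\<bar>"]) auto
    qed
    then obtain m where m: "m > 0" "\<And>D. D \<in> ?S \<Longrightarrow> m \<le> \<bar>trace D\<bar>" by blast
    have "norm D \<le> \<bar>c\<bar> / m" if D: "D \<in> P" for D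
    proof (cases "D = 0")
      case False
      have "D /\<^sub>R norm D \<in> ?S"
        using D False subspace_scale[OF t] by (auto simp: P_eq divide_nonpos_pos mult_nonneg_nonpos)
      then have "m \<le> \<bar>trace (D /\<^sub>R norm D)\<bar>" by (rule m(2))
      also have "\<dots> = \<bar>c\<bar> / norm D" using D by (simp add: trace_scale P_def abs_mult divide_inverse mult.commute)
      finally show ?thesis using False m(1) by (simp add: field_simps)
    qed (use m(1) in simp)
    then show ?thesis by (auto simp: bounded_iff)
  qed
  then have "polytope P" using poly by (simp add: polytope_eq_bounded_polyhedron)
  moreover have "{D \<in> t. trace D = c \<and> (\<forall>v\<in>F. pairing D v < 0)} = rel_interior P"
  proof (intro equalityI subsetI)
    fix D assume D: "D \<in> {D \<in> t. trace D = c \<and> (\<forall>v\<in>F. pairing D v < 0)}"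
    let ?T = "\<Inter>v\<in>F. {D. diag v \<bullet> D < 0}"
    have "affine hull P \<subseteq> t \<inter> {D. mat 1 \<bullet> D = c}"
      by (intro hull_minimal affine_Int affine_hyperplane subspace_imp_affine t) (auto simp: P_eq)
    then have "?T \<inter> affine hull P \<subseteq> P" by (auto simp: P_eq intro: less_imp_le)
    moreover have "open ?T" by (intro open_INT F ballI open_halfspace_lt)
    moreover have "D \<in> ?T" "D \<in> P" using D by (auto simp: P_def pairing_inner intro: less_imp_le)
    ultimately show "D \<in> rel_interior P" unfolding mem_rel_interior by blast
  next
    fix D assume D: "D \<in> rel_interior P"
    have DP: "D \<in> P" using D rel_interior_subset by blast
    have "convex P" by (rule polyhedron_imp_convex[OF poly])
    \<comment> \<open>The segment from \<open>z\<close> can be prolonged beyond \<open>D\<close>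
      within \<open>P\<close>. Equality at some \<open>v\<close> would make the prolonged point
      violate the inequality, which is strict at \<open>z\<close>.\<close>
    then obtain e where e: "e > 1" "(1 - e) *\<^sub>R z + e *\<^sub>R D \<in> P"
      using convex_rel_interior_iff[of P D] D zP by blast
    have "pairing D v < 0" if v: "v \<in> F" for v
    proof (rule ccontr)
      assume "\<not> pairing D v < 0"
      then have "diag v \<bullet> D = 0" using DP v by (auto simp: P_def pairing_inner intro: antisym)
      moreover have "diag v \<bullet> ((1 - e) *\<^sub>R z + e *\<^sub>R D) \<le> 0" using e(2) v by (auto simp: P_eq)
      ultimately have "(1 - e) * (diag v \<bullet> z) \<le> 0" by (simp add: inner_add_right)
      moreover have "(1 - e) * (diag v \<bullet> z) > 0" using e(1) z(3) v by (intro mult_neg_neg) (auto simp: pairing_inner)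
      ultimately show False by simp
    qed
    then show "D \<in> {D \<in> t. trace D = c \<and> (\<forall>v\<in>F. pairing D v < 0)}" using DP by (auto simp: P_def)
  qed
  ultimately show ?thesis by blast
qed

subsection \<open>The cone and strongly Ricci negative derivations\<close>

lemma commutes_conj: "invertible g \<Longrightarrow> D \<in> t \<Longrightarrow> commutes g t \<Longrightarrow> g ** D ** matrix_inv g = D"
  by (metis commutes_def matrix_inv(1) matrix_mul_assoc matrix_mul_rid)

lemma transpose_Dg: "D \<in> Dg \<Longrightarrow> transpose D = D"
  by (metis Dg_eq_diag transpose_diag)

lemma cone_C_subset_srn:
  assumes nl: "nilLie k b" and t: "t \<subseteq> Dg" "t \<subseteq> Der b"
  shows "cone_C b t \<subseteq> Der_srn b \<inter> t"
proof
  fix D assume "D \<in> cone_C b t"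
  moreover have b: "b \<in> V" using nl by (simp add: nilLie_def)
  ultimately obtain h s where D: "D \<in> t" "trace D > 0" and h: "h \<in> G_torus t"
    and s: "s > 0" "posdef (D - s *\<^sub>R momentM (GL_act h b))"
    using cone_C_iff[OF b t] by blast
  note hD = G_torusD[OF h]
  have "h ** D ** matrix_inv h = D" by (rule commutes_conj[OF hD(1) D(1) hD(2)])
  moreover have "transpose D = D" using D t transpose_Dg by blast
  ultimately show "D \<in> Der_srn b \<inter> t"
    using Der_srn_iff[OF nl subsetD[OF t(2) D(1)] D(2)] D(1) s hD(1) by (metis IntI)
qed

text \<open>Each basis vector is a weight vector. A nonzero entry of \<open>S\<close> joins indices
  with the same eigenvalue of \<open>D\<close>, and genericity upgrades this to the same weight on
  all of \<open>t\<close>.\<close>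

lemma torus_gen_commutes:
  assumes D: "D \<in> torus_gen t" and t: "t \<subseteq> Dg" and S: "S ** D = D ** S"
  shows "commutes S t"
proof -
  have Dt: "D \<in> t" using D by (simp add: torus_gen_def)
  let ?\<alpha> = "\<lambda>i. \<lambda>E\<in>t. E $ i $ i"
  have w: "?\<alpha> i \<in> weights t" for i
  proof -
    have "E *v axis i 1 = E $ i $ i *\<^sub>R axis i 1" if "E \<in> t" for E
    proof -
      have "E \<in> Dg" using that t by blast
      then show ?thesis unfolding matrix_vector_mult_basis by (auto simp: vec_eq_iff column_def axis_def Dg_def)
    qed
    then show ?thesis by (auto simp: weights_def axis_eq_0_iff intro!: exI[of _ "axis i 1"])
  qed
  have "commutes S {D}" using S by (simp add: commutes_def)
  then have *: "S $ i $ j \<noteq> 0 \<Longrightarrow> D $ i $ i = D $ j $ j" for i j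
    using commutes_nth[of "{D}" S] t Dt by blast
  have "E $ i $ i = E $ j $ j" if "S $ i $ j \<noteq> 0" "E \<in> t" for E i j
  proof -
    have "?\<alpha> i = ?\<alpha> j"
    proof (rule ccontr)
      assume "?\<alpha> i \<noteq> ?\<alpha> j"
      then have "?\<alpha> i D \<noteq> ?\<alpha> j D" using D w[of i] w[of j] unfolding torus_gen_def by blast
      then show False using *[OF that(1)] Dt by simp
    qed
    then have "?\<alpha> i E = ?\<alpha> j E" by (rule fun_cong)
    then show ?thesis using that(2) by simp
  qed
  then show ?thesis using commutes_nth[OF t] by blast
qed

text \<open>\<open>svd\<close> writes \<open>h = k ** g\<close> with \<open>g\<close> in
  \<open>G_torus t\<close>. Since \<open>g\<close> commutes with \<open>D\<close>, the conjugate of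
  \<open>D\<close> by \<open>h\<close> is that by \<open>k\<close>, and undoing the orthogonal
  \<open>k\<close> in the whole inequality replaces \<open>h\<close> by \<open>g\<close>.\<close>

lemma srn_gen_subset_cone_C:
  assumes nl: "nilLie k b" and b0: "b \<noteq> (\<lambda>x y. 0)" and t: "t \<subseteq> Dg" "t \<subseteq> Der b"
  shows "Der_srn b \<inter> t \<inter> torus_gen t \<subseteq> cone_C b t"
proof
  fix D assume D: "D \<in> Der_srn b \<inter> t \<inter> torus_gen t"
  then have Dt: "D \<in> t" "trace D > 0" "D \<in> Der b" by (auto simp: Der_srn_def)
  have b: "b \<in> V" using nl by (simp add: nilLie_def)
  have trD: "transpose D = D" using Dt t transpose_Dg by blast
  obtain h s where h: "invertible h" and s: "s > 0"
    and sym: "transpose (h ** D ** matrix_inv h) = h ** D ** matrix_inv h"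
    and pd: "posdef (h ** D ** matrix_inv h - s *\<^sub>R momentM (GL_act h b))"
    using Der_srn_iff[OF nl Dt(3,2)] D by blast
  let ?S = "h ** D ** matrix_inv h"
  have Sh: "?S ** h = h ** D" by (metis h matrix_inv(2) matrix_mul_assoc matrix_mul_rid)
  \<comment> \<open>The transpose of \<open>Sh\<close>, as both \<open>?S\<close> and
    \<open>D\<close> are symmetric; together they show that \<open>transpose h ** h\<close> commutes
    with \<open>D\<close>.\<close>
  have hS: "transpose h ** ?S = D ** transpose h"
    using arg_cong[OF Sh, of transpose] by (simp only: matrix_transpose_mul[of ?S h] matrix_transpose_mul[of h D] sym trD)
  have "(transpose h ** h) ** D = D ** (transpose h ** h)"
    using Sh hS by (metis matrix_mul_assoc)
  then have "commutes (transpose h ** h) t"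
    using torus_gen_commutes[of D t] D t(1) by blast
  from svd[OF h this t(1)] obtain k a q where
    k: "orthogonal_matrix k" and q: "q \<in> K_torus t" and a: "\<And>i. a $ i > 0" and hk: "h = k ** diag a ** q"
    by blast
  define g where "g = diag a ** q"
  have g: "g \<in> G_torus t" unfolding g_def by (rule G_torus_mult[OF diag_G_torus[OF t(1) a] K_torusD(1)[OF q]])
  note gD = G_torusD[OF g] and ki = orthogonal_inv[OF k]
  have hg: "h = k ** g" by (simp add: hk g_def matrix_mul_assoc)
  have "?S = k ** (g ** D ** matrix_inv g) ** transpose k"
    unfolding hg matrix_inv_mult[OF ki(2) gD(1)] ki(1) by (simp only: matrix_mul_assoc)
  then have S: "?S = k ** D ** transpose k" by (simp only: commutes_conj[OF gD(1) Dt(1) gD(2)])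
  have M: "momentM (GL_act h b) = k ** momentM (GL_act g b) ** transpose k"
    unfolding hg GL_act_mult[OF ki(2) gD(1)] by (rule momentM_orthogonal[OF GL_act_V[OF b] k])
  have "transpose k ** (?S - s *\<^sub>R momentM (GL_act h b)) ** transpose (transpose k) = D - s *\<^sub>R momentM (GL_act g b)"
  proof -
    have e: "transpose k ** (k ** X ** transpose k) ** transpose (transpose k) = X" for X
    proof -
      have "transpose k ** (k ** X ** transpose k) ** transpose (transpose k) = (transpose k ** k) ** X ** (transpose k ** k)"
        by (simp add: matrix_mul_assoc)
      then show ?thesis by (simp add: ki)
    qed
    have "?S - s *\<^sub>R momentM (GL_act h b) = k ** (D - s *\<^sub>R momentM (GL_act g b)) ** transpose k"
      unfolding S M by (simp add: matrix_mult_add_diff matrix_scalar_ac scalar_matrix_assoc)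
    then show ?thesis by (simp only: e)
  qed
  moreover have "invertible (transpose k)" using ki(2) by (simp add: transpose_invertible)
  ultimately have "posdef (D - s *\<^sub>R momentM (GL_act g b))" using posdef_conj[OF pd] by metis
  then show "D \<in> cone_C b t" unfolding cone_C_iff[OF b t]
    using Dt(1,2) b0 s by (intro conjI bexI[OF _ g] exI[of _ s])
qed

section \<open>Invariance under the normalizer and the shape of the cone\<close>

lemma G_torus_conj:
  assumes h: "invertible h" "(\<lambda>D. h ** D ** matrix_inv h) ` t = t" and g: "g \<in> G_torus t"
  shows "h ** g ** matrix_inv h \<in> G_torus t"
proof -
  let ?c = "\<lambda>x. h ** x ** matrix_inv h"
  have mult: "?c x ** ?c y = ?c (x ** y)" for x y
  proof -
    have "?c x ** ?c y = h ** x ** (matrix_inv h ** h) ** y ** matrix_inv h" by (simp only: matrix_mul_assoc)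
    then show ?thesis by (simp add: matrix_inv h(1) matrix_mul_assoc)
  qed
  have "?c ` G_torus t \<subseteq> G_torus t"
  proof (rule G_torus_connected_subset)
    show "connected (?c ` G_torus t)"
      by (intro connected_continuous_image connected_G_torus continuous_intros)
    show "mat 1 \<in> ?c ` G_torus t"
      using mat1_G_torus by (intro image_eqI[of _ _ "mat 1"]) (simp_all add: matrix_inv h(1))
    show "mat 1 \<in> G_torus t" by (rule mat1_G_torus)
    fix x assume "x \<in> ?c ` G_torus t"
    then obtain y where y: "y \<in> G_torus t" "x = ?c y" by blast
    note yD = G_torusD[OF y(1)]
    have "commutes x t" unfolding commutes_def
    proof
      fix D assume "D \<in> t"
      then obtain E where E: "E \<in> t" "D = ?c E" using h(2) by blast
      show "x ** D = D ** x" unfolding y(2) E(2) mult using yD(2) E(1) by (simp add: commutes_def)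
    qed
    moreover have "invertible x" unfolding y(2)
      by (intro invertible_mult h(1) yD(1) invertible_matrix_inv)
    ultimately show "invertible x \<and> commutes x t" by blast
  qed
  then show ?thesis using g by blast
qed

text \<open>An automorphism fixes \<open>b\<close>, so acting by the conjugate of \<open>g\<close>
  is acting by \<open>g\<close> and then by \<open>h\<close>. Orthogonality of \<open>h\<close>
  conjugates the moment map together with \<open>D\<close>.\<close>

lemma cone_C_conj:
  assumes b: "b \<in> V" and t: "t \<subseteq> Dg" "t \<subseteq> Der b"
    and h: "h \<in> AutO b" "(\<lambda>D. h ** D ** matrix_inv h) ` t = t" and D: "D \<in> cone_C b t"
  shows "h ** D ** matrix_inv h \<in> cone_C b t"
proof -
  have inv: "invertible h" and orth: "orthogonal_matrix h" and hb: "\<And>x y. h *v b x y = b (h *v x) (h *v y)"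
    using h(1) by (auto simp: AutO_def Aut_def)
  note oi = orthogonal_inv[OF orth]
  have act: "GL_act h b = b"
    by (simp add: GL_act_def hb matrix_vector_mul_assoc matrix_inv inv)
  have act': "GL_act (matrix_inv h) b = b" using GL_act_inv[OF inv, of b] act by simp
  from D obtain g s where Dt: "D \<in> t" "trace D > 0" and b0: "b \<noteq> (\<lambda>x y. 0)" and g: "g \<in> G_torus t"
    and s: "s > 0" and pd: "posdef (D - s *\<^sub>R momentM (GL_act g b))"
    unfolding cone_C_iff[OF b t] by blast
  note gD = G_torusD[OF g]
  let ?g = "h ** g ** matrix_inv h"
  have g': "?g \<in> G_torus t" by (rule G_torus_conj[OF inv h(2) g])
  have "GL_act ?g b = GL_act h (GL_act g b)"
    by (simp add: GL_act_mult invertible_mult inv gD(1) invertible_matrix_inv act')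
  then have M: "momentM (GL_act ?g b) = h ** momentM (GL_act g b) ** transpose h"
    by (simp add: momentM_orthogonal[OF GL_act_V[OF b] orth])
  have "h ** D ** matrix_inv h - s *\<^sub>R momentM (GL_act ?g b)
      = h ** (D - s *\<^sub>R momentM (GL_act g b)) ** transpose h"
    unfolding M unfolding oi(1) by (simp add: matrix_mult_add_diff matrix_scalar_ac scalar_matrix_assoc)
  then have "posdef (h ** D ** matrix_inv h - s *\<^sub>R momentM (GL_act ?g b))"
    using posdef_conj[OF pd inv] by simp
  moreover have "h ** D ** matrix_inv h \<in> t" using h(2) Dt(1) by blast
  moreover have "trace (h ** D ** matrix_inv h) > 0" using Dt(2) by (simp add: trace_conj inv)
  ultimately show ?thesis unfolding cone_C_iff[OF b t] using b0 s by (intro conjI bexI[OF _ g'] exI[of _ s])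
qed

text \<open>For a nonzero bracket the cone is the torus intersected with finitely many open
  half-spaces. On a slice with \<open>c > 0\<close> the trace condition is automatic, and
  \<open>criterion_trace_0\<close> supplies the hypothesis of \<open>slice_polytope\<close>. For the
  zero bracket the cone is empty.\<close>

lemma cone_C_convex_cone:
  assumes nl: "nilLie k b" and t: "subspace t" "t \<subseteq> Dg" "t \<subseteq> Der b"
  shows "openin (top_of_set t) (cone_C b t)" "convex (cone_C b t)"
    "D \<in> cone_C b t \<Longrightarrow> r > 0 \<Longrightarrow> r *\<^sub>R D \<in> cone_C b t"
    "c > 0 \<Longrightarrow> \<exists>P. polytope P \<and> {D \<in> cone_C b t. trace D = c} = rel_interior P"
proof -
  have b: "b \<in> V" using nl by (simp add: nilLie_def)
  obtain F where F: "finite F" "\<And>D. criterion b t (<) D \<longleftrightarrow> (\<forall>v\<in>F. pairing D v < 0)"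
    "\<And>D. criterion b t (\<le>) D \<longleftrightarrow> (\<forall>v\<in>F. pairing D v \<le> 0)" using criterion_finite by blast
  have "openin (top_of_set t) (cone_C b t) \<and> convex (cone_C b t)
    \<and> (D \<in> cone_C b t \<longrightarrow> r > 0 \<longrightarrow> r *\<^sub>R D \<in> cone_C b t)
    \<and> (c > 0 \<longrightarrow> (\<exists>P. polytope P \<and> {D \<in> cone_C b t. trace D = c} = rel_interior P))"
  proof (cases "b = (\<lambda>x y. 0)")
    case True
    then have "cone_C b t = {}" using cone_C_iff[OF b t(2,3)] by blast
    then show ?thesis using polytope_empty rel_interior_empty by auto
  next
    case False
    have eq: "cone_C b t = {D \<in> t. trace D > 0 \<and> (\<forall>v\<in>F. pairing D v < 0)}"
      unfolding cone_C_criterion[OF b False t(2,3)] F(2) by (rule refl)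
    define U where "U = {D. mat 1 \<bullet> D > 0} \<inter> (\<Inter>v\<in>F. {D. diag v \<bullet> D < 0})"
    have eqU: "cone_C b t = t \<inter> U" by (auto simp: eq U_def trace_mat_inner pairing_inner)
    have "open U" unfolding U_def
      by (intro open_Int open_INT F(1) ballI open_halfspace_lt open_halfspace_gt)
    then have "openin (top_of_set t) (cone_C b t)" unfolding eqU by blast
    moreover have "convex (cone_C b t)" unfolding eqU U_def
      by (intro convex_Int convex_INT convex_halfspace_lt convex_halfspace_gt subspace_imp_convex t(1))
    moreover have "r *\<^sub>R D \<in> cone_C b t" if "D \<in> cone_C b t" "r > 0"
      using that subspace_scale[OF t(1)] by (auto simp: eqU U_def mult_pos_neg)
    moreover have "\<exists>P. polytope P \<and> {D \<in> cone_C b t. trace D = c} = rel_interior P" if c: "c > 0"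
    proof -
      have sl: "{D \<in> cone_C b t. trace D = c} = {D \<in> t. trace D = c \<and> (\<forall>v\<in>F. pairing D v < 0)}"
        using c by (auto simp: eq)
      have "D = 0" if "D \<in> t" "trace D = 0" "\<forall>v\<in>F. pairing D v \<le> 0" for D
        using criterion_trace_0[OF nl False t(2,3) that(1,2)] F(3) that(3) by blast
      then show ?thesis unfolding sl by (rule slice_polytope[OF t(1) F(1)])
    qed
    ultimately show ?thesis by blast
  qed
  then show "openin (top_of_set t) (cone_C b t)" "convex (cone_C b t)"
    "D \<in> cone_C b t \<Longrightarrow> r > 0 \<Longrightarrow> r *\<^sub>R D \<in> cone_C b t"
    "c > 0 \<Longrightarrow> \<exists>P. polytope P \<and> {D \<in> cone_C b t. trace D = c} = rel_interior P"
    by blast+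
qed

subsection \<open>The orthogonal Weyl group\<close>

lemma mat_conj_mult:
  fixes g h D :: "real^'n^'n"
  assumes "invertible g" "invertible h"
  shows "(g ** h) ** D ** matrix_inv (g ** h) = g ** (h ** D ** matrix_inv h) ** matrix_inv g"
  by (simp add: matrix_inv_mult[OF assms] matrix_mul_assoc)

lemma mat_conj_inv:
  fixes h D :: "real^'n^'n"
  assumes "invertible h"
  shows "matrix_inv h ** (h ** D ** matrix_inv h) ** h = D" "h ** (matrix_inv h ** D ** h) ** matrix_inv h = D"
proof -
  have "matrix_inv h ** (h ** D ** matrix_inv h) ** h = (matrix_inv h ** h) ** D ** (matrix_inv h ** h)"
    "h ** (matrix_inv h ** D ** h) ** matrix_inv h = (h ** matrix_inv h) ** D ** (h ** matrix_inv h)"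
    by (simp_all only: matrix_mul_assoc)
  then show "matrix_inv h ** (h ** D ** matrix_inv h) ** h = D" "h ** (matrix_inv h ** D ** h) ** matrix_inv h = D"
    by (simp_all add: matrix_inv assms)
qed

lemma AutO_invertible: "h \<in> AutO b \<Longrightarrow> invertible h"
  by (simp add: AutO_def Aut_def)

lemma AutO_mult: "g \<in> AutO b \<Longrightarrow> h \<in> AutO b \<Longrightarrow> g ** h \<in> AutO b"
  by (simp add: AutO_def Aut_def invertible_mult orthogonal_matrix_mul matrix_vector_mul_assoc[symmetric])

lemma AutO_mat1: "mat 1 \<in> AutO b"
  by (simp add: AutO_def Aut_def orthogonal_matrix_id orthogonal_inv(2))

lemma AutO_inv:
  assumes "h \<in> AutO b"
  shows "matrix_inv h \<in> AutO b"
proof -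
  have h: "invertible h" "orthogonal_matrix h" "\<And>x y. h *v b x y = b (h *v x) (h *v y)"
    using assms by (auto simp: AutO_def Aut_def)
  have inv: "matrix_inv h *v (h *v x) = x" "h *v (matrix_inv h *v x) = x" for x
    by (simp_all add: matrix_vector_mul_assoc matrix_inv h(1))
  have "matrix_inv h *v b x y = b (matrix_inv h *v x) (matrix_inv h *v y)" for x y
    using h(3)[of "matrix_inv h *v x" "matrix_inv h *v y"] inv by metis
  moreover have "orthogonal_matrix (matrix_inv h)"
    using h(2) orthogonal_inv(1)[OF h(2)] by (simp add: orthogonal_matrix_transpose)
  ultimately show ?thesis by (simp add: AutO_def Aut_def invertible_matrix_inv h(1))
qed

lemma group_normalizer: "group (normalizer_AutO b t)"
proof (rule groupI)
  let ?N = "{h \<in> AutO b. (\<lambda>D. h ** D ** matrix_inv h) ` t = t}"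
  have mult: "g ** h \<in> ?N" if "g \<in> ?N" "h \<in> ?N" for g h
  proof -
    have "(\<lambda>D. (g ** h) ** D ** matrix_inv (g ** h)) ` t = (\<lambda>D. g ** D ** matrix_inv g) ` (\<lambda>D. h ** D ** matrix_inv h) ` t"
      unfolding image_image using that by (intro image_cong refl mat_conj_mult) (auto intro: AutO_invertible)
    then show ?thesis using that AutO_mult by auto
  qed
  have inv: "matrix_inv h \<in> ?N" if "h \<in> ?N" for h
  proof -
    have h: "invertible h" using that AutO_invertible by blast
    have "(\<lambda>D. matrix_inv h ** D ** h) ` (\<lambda>D. h ** D ** matrix_inv h) ` t = t"
      by (simp add: image_image mat_conj_inv h)
    then show ?thesis using that AutO_inv by (auto simp: matrix_inv_inv h)
  qed
  show "x \<otimes>\<^bsub>normalizer_AutO b t\<^esub> y \<in> carrier (normalizer_AutO b t)"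
    if "x \<in> carrier (normalizer_AutO b t)" "y \<in> carrier (normalizer_AutO b t)" for x y
    using mult that by (simp add: normalizer_AutO_def)
  show "\<one>\<^bsub>normalizer_AutO b t\<^esub> \<in> carrier (normalizer_AutO b t)"
    by (simp add: normalizer_AutO_def AutO_mat1 matrix_inv_1)
  show "\<exists>y\<in>carrier (normalizer_AutO b t). y \<otimes>\<^bsub>normalizer_AutO b t\<^esub> x = \<one>\<^bsub>normalizer_AutO b t\<^esub>"
    if "x \<in> carrier (normalizer_AutO b t)" for x
  proof
    show "matrix_inv x \<in> carrier (normalizer_AutO b t)" using inv that by (simp add: normalizer_AutO_def)
    show "matrix_inv x \<otimes>\<^bsub>normalizer_AutO b t\<^esub> x = \<one>\<^bsub>normalizer_AutO b t\<^esub>"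
      using that matrix_inv(2)[OF AutO_invertible] by (auto simp: normalizer_AutO_def)
  qed
qed (simp_all add: normalizer_AutO_def matrix_mul_assoc)

lemma normalizer_inv:
  assumes "h \<in> carrier (normalizer_AutO b t)"
  shows "inv\<^bsub>normalizer_AutO b t\<^esub> h = matrix_inv h"
proof -
  interpret N: group "normalizer_AutO b t" by (rule group_normalizer)
  have h: "invertible h" using assms AutO_invertible by (auto simp: normalizer_AutO_def)
  have "h \<otimes>\<^bsub>normalizer_AutO b t\<^esub> inv\<^bsub>normalizer_AutO b t\<^esub> h = \<one>\<^bsub>normalizer_AutO b t\<^esub>"
    using assms by (rule N.r_inv)
  then have "h ** inv\<^bsub>normalizer_AutO b t\<^esub> h = mat 1" by (simp add: normalizer_AutO_def)
  then show ?thesis by (rule matrix_inv_unique(1)[symmetric])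
qed

lemma normal_centralizer: "centralizer_AutO b t \<lhd> normalizer_AutO b t"
proof -
  interpret N: group "normalizer_AutO b t" by (rule group_normalizer)
  have sub: "centralizer_AutO b t \<subseteq> carrier (normalizer_AutO b t)"
    by (auto simp: centralizer_AutO_def normalizer_AutO_def)
  have mult: "g ** h \<in> centralizer_AutO b t" if "g \<in> centralizer_AutO b t" "h \<in> centralizer_AutO b t" for g h
    using that by (auto simp: centralizer_AutO_def AutO_mult mat_conj_mult AutO_invertible)
  have inv: "matrix_inv h \<in> centralizer_AutO b t" if h: "h \<in> centralizer_AutO b t" for h
  proof -
    have i: "invertible h" using h AutO_invertible by (auto simp: centralizer_AutO_def)
    have "matrix_inv h ** D ** h = D" if "D \<in> t" for D
      using h that mat_conj_inv(1)[OF i, of D] by (auto simp: centralizer_AutO_def)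
    then show ?thesis using h AutO_inv by (auto simp: centralizer_AutO_def matrix_inv_inv i)
  qed
  show ?thesis
  proof (rule N.normal_invI)
    show "subgroup (centralizer_AutO b t) (normalizer_AutO b t)"
    proof (rule N.subgroupI[OF sub])
      show "centralizer_AutO b t \<noteq> {}"
        using AutO_mat1 by (force simp: centralizer_AutO_def matrix_inv_1)
      show "inv\<^bsub>normalizer_AutO b t\<^esub> a \<in> centralizer_AutO b t" if "a \<in> centralizer_AutO b t" for a
        using that sub inv by (simp add: normalizer_inv subset_iff)
      show "x \<otimes>\<^bsub>normalizer_AutO b t\<^esub> y \<in> centralizer_AutO b t"
        if "x \<in> centralizer_AutO b t" "y \<in> centralizer_AutO b t" for x y
        using mult[OF that] by (simp add: normalizer_AutO_def)
    qed
    fix x h assume x: "x \<in> carrier (normalizer_AutO b t)" and h: "h \<in> centralizer_AutO b t"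
    have x': "x \<in> AutO b" "(\<lambda>D. x ** D ** matrix_inv x) ` t = t" "invertible x"
      using x AutO_invertible by (auto simp: normalizer_AutO_def)
    have h': "h \<in> AutO b" "\<And>D. D \<in> t \<Longrightarrow> h ** D ** matrix_inv h = D" "invertible h"
      using h AutO_invertible by (auto simp: centralizer_AutO_def)
    have xi: "invertible (matrix_inv x)" using x'(3) by (rule invertible_matrix_inv)
    have "(x ** h ** matrix_inv x) ** D ** matrix_inv (x ** h ** matrix_inv x) = D" if D: "D \<in> t" for D
    proof -
      obtain E where E: "E \<in> t" "D = x ** E ** matrix_inv x" using D x'(2) by blast
      have "matrix_inv x ** D ** matrix_inv (matrix_inv x) = E"
        unfolding E(2) matrix_inv_inv[OF x'(3)] by (rule mat_conj_inv(1)[OF x'(3)])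
      then have "(x ** h ** matrix_inv x) ** D ** matrix_inv (x ** h ** matrix_inv x) = x ** (h ** E ** matrix_inv h) ** matrix_inv x"
        using mat_conj_mult[OF _ xi, of "x ** h" D] mat_conj_mult[OF x'(3) h'(3), of E] invertible_mult[OF x'(3) h'(3)] by simp
      then show ?thesis using h'(2)[OF E(1)] E(2) by simp
    qed
    then have "x ** h ** matrix_inv x \<in> centralizer_AutO b t"
      using AutO_mult[OF AutO_mult[OF x'(1) h'(1)] AutO_inv[OF x'(1)]] by (simp add: centralizer_AutO_def)
    then show "x \<otimes>\<^bsub>normalizer_AutO b t\<^esub> h \<otimes>\<^bsub>normalizer_AutO b t\<^esub> inv\<^bsub>normalizer_AutO b t\<^esub> x \<in> centralizer_AutO b t"
      by (simp add: normalizer_inv[OF x]) (simp add: normalizer_AutO_def)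
  qed
qed

text \<open>The centralizer acts trivially on \<open>E\<close> because \<open>E\<close> lies in
  \<open>t\<close>, so conjugation descends to cosets. The value of the action is stated for every
  representative of a coset.\<close>

lemma W_ort_action:
  fixes E t :: "(real^'n^'n) set"
  assumes E: "E \<subseteq> t"
    and conj: "\<And>h D. h \<in> carrier (normalizer_AutO b t) \<Longrightarrow> D \<in> E \<Longrightarrow> h ** D ** matrix_inv h \<in> E"
  obtains \<phi> where "group_action (W_ort b t) E \<phi>"
    "\<And>w h. w \<in> carrier (W_ort b t) \<Longrightarrow> h \<in> w \<Longrightarrow> h \<in> carrier (normalizer_AutO b t)"
    "\<And>w h D. w \<in> carrier (W_ort b t) \<Longrightarrow> h \<in> w \<Longrightarrow> D \<in> E \<Longrightarrow> \<phi> w D = h ** D ** matrix_inv h"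
proof -
  let ?N = "normalizer_AutO b t" and ?C = "centralizer_AutO b t"
  interpret N: group ?N by (rule group_normalizer)
  interpret C: normal ?C ?N by (rule normal_centralizer)
  define f where "f h = (\<lambda>D\<in>E. h ** D ** matrix_inv h)" for h :: "real^'n^'n"
  have inv: "invertible h" if "h \<in> carrier ?N" for h
    using that AutO_invertible by (auto simp: normalizer_AutO_def)
  have f_mult: "f (g ** h) = compose E (f g) (f h)" if "g \<in> carrier ?N" "h \<in> carrier ?N" for g h
    using conj[OF that(2)] by (auto simp: f_def compose_def mat_conj_mult inv that)
  have fB: "f h \<in> Bij E" if h: "h \<in> carrier ?N" for h
  proof -
    have mi: "matrix_inv h \<in> carrier ?N" using N.inv_closed[OF h] normalizer_inv[OF h] by simp
    have "bij_betw (f h) E E"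
    proof (rule bij_betw_byWitness[where f' = "f (matrix_inv h)"])
      show "\<forall>D\<in>E. f (matrix_inv h) (f h D) = D" "\<forall>D\<in>E. f h (f (matrix_inv h) D) = D"
        using conj[OF h] conj[OF mi] by (simp_all add: f_def matrix_inv_inv inv h mat_conj_inv)
    qed (use conj[OF h] conj[OF mi] in \<open>auto simp: f_def\<close>)
    then show ?thesis by (simp add: Bij_def f_def)
  qed
  have hom: "f \<in> hom ?N (BijGroup E)"
    by (rule homI) (simp_all add: BijGroup_def fB f_mult[symmetric], simp add: normalizer_AutO_def)
  have f_C: "f (c ** h) = f h" if c: "c \<in> ?C" and h: "h \<in> carrier ?N" for c h
  proof -
    have "f c D = D" if "D \<in> E" for D using that c E by (auto simp: f_def centralizer_AutO_def)
    then have "compose E (f c) (f h) = f h" using conj[OF h] by (auto simp: compose_def f_def)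
    then show ?thesis using f_mult[of c h] c h C.subset by auto
  qed
  have "group_hom ?N (BijGroup E) f"
    by (intro group_hom.intro group_hom_axioms.intro N.is_group group_BijGroup hom)
  obtain \<phi> where \<phi>: "\<phi> \<in> hom (?N Mod ?C) (BijGroup E)" "\<And>x. x \<in> carrier ?N \<Longrightarrow> \<phi> (?C #>\<^bsub>?N\<^esub> x) = f x"
  proof (rule FactGroup_universal[OF hom normal_centralizer])
    fix x y assume xy: "x \<in> carrier ?N" "y \<in> carrier ?N" "?C #>\<^bsub>?N\<^esub> x = ?C #>\<^bsub>?N\<^esub> y"
    then have "x \<in> ?C #>\<^bsub>?N\<^esub> y" using N.rcos_self C.subgroup_axioms by blast
    then obtain c where "c \<in> ?C" "x = c ** y" by (auto simp: r_coset_def normalizer_AutO_def)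
    then show "f x = f y" using f_C xy(2) by blast
  qed blast
  have "group_action (W_ort b t) E \<phi>"
    unfolding group_action_def W_ort_def
    by (intro group_hom.intro group_hom_axioms.intro C.factorgroup_is_group group_BijGroup \<phi>(1))
  moreover have "h \<in> carrier ?N \<and> (\<forall>D\<in>E. \<phi> w D = h ** D ** matrix_inv h)"
    if w: "w \<in> carrier (W_ort b t)" and h: "h \<in> w" for w h
  proof -
    obtain x where x: "x \<in> carrier ?N" "w = ?C #>\<^bsub>?N\<^esub> x"
      using w by (auto simp: W_ort_def FactGroup_def RCOSETS_def)
    have hN: "h \<in> carrier ?N" using h x N.r_coset_subset_G C.subset by blast
    obtain c where "c \<in> ?C" "h = c ** x" using h x(2) by (auto simp: r_coset_def normalizer_AutO_def)
    then have "f h = f x" using f_C x(1) by blast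
    then have "\<phi> w = f h" using \<phi>(2)[OF x(1)] x(2) by simp
    then show ?thesis using hN by (simp add: f_def)
  qed
  ultimately show ?thesis using that[of \<phi>] by metis
qed

text \<open>The zero bracket is set apart in the first inclusion: there the cone is empty, whereas
  \<open>t\<close> is all of \<open>Dg\<close> and every positive diagonal operator, generic or not,
  is strongly Ricci negative.\<close>

theorem proposition5p1:
  fixes b :: "real^'n \<Rightarrow> real^'n \<Rightarrow> real^'n"
    and t :: "(real^'n^'n) set"
  assumes "lie_bracket b" and "nilpotent_bracket b"
    and "maximal_torus b t" and "t \<subseteq> Dg"
  shows
    "openin (top_of_set t) (cone_C b t) \<and> convex (cone_C b t) \<and>
     (\<forall>D\<in>cone_C b t. \<forall>r>0. r *\<^sub>R D \<in> cone_C b t) \<and>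
     (b \<noteq> (\<lambda>x y. 0) \<longrightarrow> Der_srn b \<inter> t \<inter> torus_gen t \<subseteq> cone_C b t) \<and>
     cone_C b t \<subseteq> Der_srn b \<inter> t \<and>
     (\<exists>\<phi>. group_action (W_ort b t) (cone_C b t) \<phi> \<and>
        (\<forall>w\<in>carrier (W_ort b t). \<forall>h\<in>w. \<forall>D\<in>cone_C b t. \<phi> w D = h ** D ** matrix_inv h) \<and>
        (\<forall>c>0.
           (\<exists>P. polytope P \<and> {D \<in> cone_C b t. trace D = c} = rel_interior P) \<and>
           (\<forall>w\<in>carrier (W_ort b t).
              \<phi> w ` {D \<in> cone_C b t. trace D = c} = {D \<in> cone_C b t. trace D = c})))"
proof -
  obtain k where nl: "nilLie k b"
    using nilpotent_nilp[OF assms(2)] assms(1) by (auto simp: nilLie_def lie_bracket_V)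
  then have b: "b \<in> V" by (simp add: nilLie_def)
  have t: "subspace t" "t \<subseteq> Der b" using assms(3) by (auto simp: maximal_torus_def torus_def)
  note cc = cone_C_convex_cone[OF nl t(1) assms(4) t(2)]
  have conj: "h ** D ** matrix_inv h \<in> cone_C b t"
    if "h \<in> carrier (normalizer_AutO b t)" "D \<in> cone_C b t" for h D
    using cone_C_conj[OF b assms(4) t(2)] that by (auto simp: normalizer_AutO_def)
  obtain \<phi> where \<phi>: "group_action (W_ort b t) (cone_C b t) \<phi>"
    "\<And>w h. w \<in> carrier (W_ort b t) \<Longrightarrow> h \<in> w \<Longrightarrow> h \<in> carrier (normalizer_AutO b t)"
    "\<And>w h D. w \<in> carrier (W_ort b t) \<Longrightarrow> h \<in> w \<Longrightarrow> D \<in> cone_C b t \<Longrightarrow> \<phi> w D = h ** D ** matrix_inv h"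
  proof (rule W_ort_action)
    show "cone_C b t \<subseteq> t" by (auto simp: cone_C_def)
    fix \<phi> assume *: "group_action (W_ort b t) (cone_C b t) \<phi>"
      "\<And>w h. w \<in> carrier (W_ort b t) \<Longrightarrow> h \<in> w \<Longrightarrow> h \<in> carrier (normalizer_AutO b t)"
      "\<And>w h D. w \<in> carrier (W_ort b t) \<Longrightarrow> h \<in> w \<Longrightarrow> D \<in> cone_C b t \<Longrightarrow> \<phi> w D = h ** D ** matrix_inv h"
    show thesis by (rule that; fact *)
  qed (rule conj)
  have slice: "\<phi> w ` {D \<in> cone_C b t. trace D = c} = {D \<in> cone_C b t. trace D = c}"
    if w: "w \<in> carrier (W_ort b t)" for w c
  proof -
    interpret N: group "normalizer_AutO b t" by (rule group_normalizer)
    interpret C: normal "centralizer_AutO b t" "normalizer_AutO b t" by (rule normal_centralizer)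
    obtain h where h: "h \<in> w"
      using w N.rcos_self C.subgroup_axioms by (fastforce simp: W_ort_def FactGroup_def RCOSETS_def)
    have "invertible h" using \<phi>(2)[OF w h] AutO_invertible by (auto simp: normalizer_AutO_def)
    \<comment> \<open>Conjugation preserves the trace, so each group element maps every slice into
      itself; bijectivity on the cone makes this onto.\<close>
    then have tr: "trace (\<phi> w D) = trace D" if "D \<in> cone_C b t" for D
      using \<phi>(3)[OF w h that] by (simp add: trace_conj)
    have "\<phi> w ` cone_C b t = cone_C b t"
      using group_action.surj_prop[OF \<phi>(1) w] by simp
    then have im: "\<And>D. D \<in> cone_C b t \<Longrightarrow> \<phi> w D \<in> cone_C b t"
      "\<And>D. D \<in> cone_C b t \<Longrightarrow> \<exists>E\<in>cone_C b t. D = \<phi> w E" by blast+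
    show ?thesis
    proof (intro equalityI subsetI)
      fix D assume "D \<in> \<phi> w ` {D \<in> cone_C b t. trace D = c}"
      then show "D \<in> {D \<in> cone_C b t. trace D = c}" using im(1) tr by auto
    next
      fix D assume D: "D \<in> {D \<in> cone_C b t. trace D = c}"
      then obtain E where E: "E \<in> cone_C b t" "D = \<phi> w E" using im(2) by blast
      then have "trace E = c" using D tr by simp
      then show "D \<in> \<phi> w ` {D \<in> cone_C b t. trace D = c}" using E by blast
    qed
  qed
  show ?thesis
  proof (intro conjI exI[of _ \<phi>] allI impI ballI)
    show "openin (top_of_set t) (cone_C b t)" "convex (cone_C b t)" by (fact cc(1), fact cc(2))
    show "r *\<^sub>R D \<in> cone_C b t" if "D \<in> cone_C b t" "r > 0" for D r using that by (rule cc(3))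
    show "Der_srn b \<inter> t \<inter> torus_gen t \<subseteq> cone_C b t" if "b \<noteq> (\<lambda>x y. 0)"
      by (rule srn_gen_subset_cone_C[OF nl that assms(4) t(2)])
    show "cone_C b t \<subseteq> Der_srn b \<inter> t" by (rule cone_C_subset_srn[OF nl assms(4) t(2)])
    show "group_action (W_ort b t) (cone_C b t) \<phi>" by (rule \<phi>(1))
    show "\<phi> w D = h ** D ** matrix_inv h"
      if "w \<in> carrier (W_ort b t)" "h \<in> w" "D \<in> cone_C b t" for w h D using that by (rule \<phi>(3))
    show "\<exists>P. polytope P \<and> {D \<in> cone_C b t. trace D = c} = rel_interior P" if "c > 0" for c
      using that by (rule cc(4))
    show "\<phi> w ` {D \<in> cone_C b t. trace D = c} = {D \<in> cone_C b t. trace D = c}"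
      if "w \<in> carrier (W_ort b t)" for w c using that by (rule slice)
  qed
qed

end
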